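(* Let $f$ be a critically fixed Thurston map and $\Gamma$ be a non-empty completely invariant multicurve. Suppose $\widehat f\colon\widehat{\mathscr S}_\Gamma\to\widehat{\mathscr S}_\Gamma$ is the corresponding map on the small spheres with respect to $\Gamma$. Then the following statements are true: (i) For each curve $\gamma\in\Gamma$ there is exactly one component $\gamma'$ of $f^{-1}(\gamma)$ that is isotopic to $\gamma$ rel. $C(f)$. All other components $\delta'$ of $f^{-1}(\gamma)$ are null-homotopic with $\deg(f|\delta')=1$. (ii) Every small sphere $\widehat S\in\widehat{\mathscr S}_\Gamma$ is fixed under $\widehat f$. Moreover, every point in $Q(\widehat S)$ is fixed under $\widehat f$.
   Context: $S^2$ is an oriented topological 2-sphere. A branched covering map $f\colon S^2\to S^2$ is a continuous surjection that near each $p$, in orientation-preserving charts sending $p$ and $f(p)$ to $0$, has the form $z\mapsto z^{d}$, $d=\deg(f,p)\in\mathbb N$; $C(f)=\{p:\deg(f,p)>1\}$. A critically fixed Thurston map is a branched covering map with $\deg(f)\ge 2$ fixing each of its critical points; then the postcritical set $P(f)=\bigcup_{n\ge1}f^n(C(f))$ equals $C(f)$. Write $P=P(f)$. A Jordan curve $\gamma\subset S^2\setminus P$ is essential if each component of $S^2\setminus\gamma$ contains at least two points of $P$, and null-homotopic if some component contains none. Isotopy rel. $P$ of curves means ambient isotopy of $S^2$ fixing $P$ pointwise. A multicurve is a finite collection of essential Jordan curves in $S^2\setminus P$, pairwise disjoint and pairwise non-isotopic rel. $P$. For a multicurve $\Gamma$, $f^{-1}(\Gamma)$ denotes the set of components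 of $f^{-1}(\bigcup_{\gamma\in\Gamma}\gamma)$ (Jordan curves). $\Gamma$ is completely invariant if each essential curve in $f^{-1}(\Gamma)$ is isotopic rel. $P$ to a curve in $\Gamma$, and each curve in $\Gamma$ is isotopic rel. $P$ to a curve in $f^{-1}(\Gamma)$. For a component $\delta'$ of $f^{-1}(\gamma)$, $\deg(f|\delta')$ is the unsigned degree of the covering $f|\delta'\colon\delta'\to\gamma$. Small spheres. For a finite collection $\Gamma'$ of pairwise disjoint Jordan curves in $S^2\setminus P$, let $\mathscr S_{\Gamma'}$ be the set of components of $S^2\setminus\bigcup_{\gamma\in\Gamma'}\gamma$. For $S\in\mathscr S_{\Gamma'}$ view $S$ as a punctured sphere by collapsing each component of $\partial S$ to a puncture; the small sphere $\widehat S$ is the sphere obtained by filling the punctures, marked by the set $Q(\widehat S)$ consisting of the points of $S\cap P$ and the points corresponding to the components of $\partial S$. $\widehat{\mathscr S}_{\Gamma'}$ is the set of these small spheres. Let $\Gamma$ be completely invariant. For each $S\in\mathscr S_\Gamma$ there is a unique $S'\in\mathscr S_{f^{-1}(\Gamma)}$ such that $S'\setminus P$ is homotopic to $S\setminus P$ in $S^2\setminus P$. Choose a homotopy $H\colon S^2\times[0,1]\to S^2$ rel. $P$ such that $H_t$ is a homeomorphism for $t<1$, $H_0=\mathrm{id}$, and for each $S\in\mathscr S_\Gamma$: $H_1(\overline{S'})=\overline S$; $H_1|S'$ is a homeomorphism onto its image, contained in $S$; and $H_1$ maps each essential boundary component of $S'$ homeomorphically onto the isotopic boundary component of $S$ and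 collapses each non-essential boundary component of $S'$ to a point. The inverse of $H_1|S'\colon S'\to S$ induces, after filling in punctures, a homeomorphism $i^*\colon\widehat S\to\widehat{S'}$ sending marked points to marked points. The image $f(S')$ is an element of $\mathscr S_\Gamma$, and $f|S'$ extends over the punctures to a branched covering map $f_*\colon\widehat{S'}\to\widehat{f(S')}$ respecting marked points. Set $\widehat f:=f_*\circ i^*\colon(\widehat S,Q(\widehat S))\to(\widehat{f(S')},Q(\widehat{f(S')}))$, defined up to isotopy rel. $Q(\widehat S)$. These maps together give $\widehat f\colon\widehat{\mathscr S}_\Gamma\to\widehat{\mathscr S}_\Gamma$ (a map on the disjoint union of the small spheres). $\widehat S$ is fixed under $\widehat f$ means $\widehat f(\widehat S)=\widehat S$. *)

theory Defs
  imports "HOL-Complex_Analysis.Complex_Analysis"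
begin

section \<open>Oriented topological spheres\<close>

type_synonym 'a chart = "'a set \<times> ('a \<Rightarrow> complex)"

definition is_chart :: "'a topology \<Rightarrow> 'a chart \<Rightarrow> bool" where
  "is_chart X c \<longleftrightarrow> (case c of (U, \<phi>) \<Rightarrow>
     openin X U \<and> open (\<phi> ` U) \<and> homeomorphic_map (subtopology X U) (top_of_set (\<phi> ` U)) \<phi>)"

text \<open>For a topological embedding \<open>h\<close> of an open set \<open>W\<close> of the plane, preservation of the orientation
  means that its local degree is \<open>1\<close> everywhere: the image of a small counterclockwise circle around
  \<open>z\<close> winds once counterclockwise around \<open>h z\<close>.\<close>

definition orientation_preserving_on :: "complex set \<Rightarrow> (complex \<Rightarrow> complex) \<Rightarrow> bool" where
  "orientation_preserving_on W h \<longleftrightarrow>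
     (\<forall>z\<in>W. \<forall>r>0. cball z r \<subseteq> W \<longrightarrow> winding_number (h \<circ> circlepath z r) (h z) = 1)"

definition compatible_charts :: "'a chart \<Rightarrow> 'a chart \<Rightarrow> bool" where
  "compatible_charts c c' \<longleftrightarrow> (case (c, c') of ((U, \<phi>), (V, \<psi>)) \<Rightarrow>
     orientation_preserving_on (\<phi> ` (U \<inter> V)) (\<psi> \<circ> inv_into U \<phi>))"

text \<open>An orientation of a surface is given by an atlas with orientation-preserving transition maps.\<close>

definition oriented_atlas :: "'a topology \<Rightarrow> 'a chart set \<Rightarrow> bool" where
  "oriented_atlas X \<A> \<longleftrightarrow>
     (\<forall>c\<in>\<A>. is_chart X c) \<and> \<Union>(fst ` \<A>) = topspace X \<and>
     (\<forall>c\<in>\<A>. \<forall>c'\<in>\<A>. compatible_charts c c')"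

definition oriented_chart :: "'a topology \<Rightarrow> 'a chart set \<Rightarrow> 'a chart \<Rightarrow> bool" where
  "oriented_chart X \<A> c \<longleftrightarrow> is_chart X c \<and> (\<forall>a\<in>\<A>. compatible_charts a c)"

definition oriented_sphere :: "'a topology \<Rightarrow> 'a chart set \<Rightarrow> bool" where
  "oriented_sphere X \<A> \<longleftrightarrow>
     X homeomorphic_space top_of_set (sphere (0::real^3) 1) \<and> oriented_atlas X \<A>"


section \<open>Critically fixed Thurston maps\<close>

definition has_local_degree ::
  "'a topology \<Rightarrow> 'a chart set \<Rightarrow> ('a \<Rightarrow> 'a) \<Rightarrow> 'a \<Rightarrow> nat \<Rightarrow> bool" where
  "has_local_degree X \<A> f p d \<longleftrightarrow> d \<ge> 1 \<and>
     (\<exists>U \<phi> V \<psi>. oriented_chart X \<A> (U, \<phi>) \<and> oriented_chart X \<A> (V, \<psi>) \<and>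
        p \<in> U \<and> \<phi> p = 0 \<and> f p \<in> V \<and> \<psi> (f p) = 0 \<and>
        f ` U \<subseteq> V \<and> (\<forall>x\<in>U. \<psi> (f x) = \<phi> x ^ d))"

definition branched_covering :: "'a topology \<Rightarrow> 'a chart set \<Rightarrow> ('a \<Rightarrow> 'a) \<Rightarrow> bool" where
  "branched_covering X \<A> f \<longleftrightarrow>
     continuous_map X X f \<and> f ` topspace X = topspace X \<and>
     (\<forall>p\<in>topspace X. \<exists>d. has_local_degree X \<A> f p d)"

definition local_degree :: "'a topology \<Rightarrow> 'a chart set \<Rightarrow> ('a \<Rightarrow> 'a) \<Rightarrow> 'a \<Rightarrow> nat" where
  "local_degree X \<A> f p = (THE d. has_local_degree X \<A> f p d)"

text \<open>The degree of a branched covering: the number of preimages of a point, counted with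
  multiplicity, which does not depend on the point.\<close>

definition map_degree :: "'a topology \<Rightarrow> 'a chart set \<Rightarrow> ('a \<Rightarrow> 'a) \<Rightarrow> nat" where
  "map_degree X \<A> f =
     (THE d. \<forall>q\<in>topspace X. (\<Sum>p\<in>{p \<in> topspace X. f p = q}. local_degree X \<A> f p) = d)"

definition critical_points :: "'a topology \<Rightarrow> 'a chart set \<Rightarrow> ('a \<Rightarrow> 'a) \<Rightarrow> 'a set" where
  "critical_points X \<A> f = {p \<in> topspace X. local_degree X \<A> f p > 1}"

definition postcritical_set :: "'a topology \<Rightarrow> 'a chart set \<Rightarrow> ('a \<Rightarrow> 'a) \<Rightarrow> 'a set" where
  "postcritical_set X \<A> f = (\<Union>n\<in>{1..}. (f ^^ n) ` critical_points X \<A> f)"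

definition critically_fixed_Thurston_map ::
  "'a topology \<Rightarrow> 'a chart set \<Rightarrow> ('a \<Rightarrow> 'a) \<Rightarrow> bool" where
  "critically_fixed_Thurston_map X \<A> f \<longleftrightarrow>
     branched_covering X \<A> f \<and> map_degree X \<A> f \<ge> 2 \<and>
     (\<forall>c\<in>critical_points X \<A> f. f c = c)"


section \<open>Curves and multicurves\<close>

definition jordan_curve :: "'a topology \<Rightarrow> 'a set \<Rightarrow> bool" where
  "jordan_curve X \<gamma> \<longleftrightarrow>
     \<gamma> \<subseteq> topspace X \<and> subtopology X \<gamma> homeomorphic_space top_of_set (sphere (0::complex) 1)"

definition complement_components :: "'a topology \<Rightarrow> 'a set \<Rightarrow> 'a set set" where
  "complement_components X K = connected_components_of (subtopology X (topspace X - K))"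

definition essential_curve :: "'a topology \<Rightarrow> 'a set \<Rightarrow> 'a set \<Rightarrow> bool" where
  "essential_curve X P \<gamma> \<longleftrightarrow>
     (\<forall>U\<in>complement_components X \<gamma>. \<exists>a\<in>U \<inter> P. \<exists>b\<in>U \<inter> P. a \<noteq> b)"

definition null_homotopic_curve :: "'a topology \<Rightarrow> 'a set \<Rightarrow> 'a set \<Rightarrow> bool" where
  "null_homotopic_curve X P \<gamma> \<longleftrightarrow> (\<exists>U\<in>complement_components X \<gamma>. U \<inter> P = {})"

definition isotopic_rel :: "'a topology \<Rightarrow> 'a set \<Rightarrow> 'a set \<Rightarrow> 'a set \<Rightarrow> bool" where
  "isotopic_rel X P \<gamma> \<gamma>' \<longleftrightarrow>
     (\<exists>g. homotopic_with (\<lambda>h. homeomorphic_map X X h \<and> (\<forall>p\<in>P. h p = p)) X X id g \<and> g ` \<gamma> = \<gamma>')"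

definition multicurve :: "'a topology \<Rightarrow> 'a set \<Rightarrow> 'a set set \<Rightarrow> bool" where
  "multicurve X P \<Gamma> \<longleftrightarrow>
     finite \<Gamma> \<and>
     (\<forall>\<gamma>\<in>\<Gamma>. jordan_curve X \<gamma> \<and> \<gamma> \<inter> P = {} \<and> essential_curve X P \<gamma>) \<and>
     (\<forall>\<gamma>\<in>\<Gamma>. \<forall>\<gamma>'\<in>\<Gamma>. \<gamma> \<noteq> \<gamma>' \<longrightarrow> \<gamma> \<inter> \<gamma>' = {} \<and> \<not> isotopic_rel X P \<gamma> \<gamma>')"

definition preimage_curves :: "'a topology \<Rightarrow> ('a \<Rightarrow> 'a) \<Rightarrow> 'a set set \<Rightarrow> 'a set set" where
  "preimage_curves X f \<Gamma> = connected_components_of (subtopology X {x \<in> topspace X. f x \<in> \<Union>\<Gamma>})"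

definition completely_invariant ::
  "'a topology \<Rightarrow> 'a set \<Rightarrow> ('a \<Rightarrow> 'a) \<Rightarrow> 'a set set \<Rightarrow> bool" where
  "completely_invariant X P f \<Gamma> \<longleftrightarrow>
     (\<forall>\<delta>\<in>preimage_curves X f \<Gamma>. essential_curve X P \<delta> \<longrightarrow> (\<exists>\<gamma>\<in>\<Gamma>. isotopic_rel X P \<delta> \<gamma>)) \<and>
     (\<forall>\<gamma>\<in>\<Gamma>. \<exists>\<delta>\<in>preimage_curves X f \<Gamma>. isotopic_rel X P \<gamma> \<delta>)"

text \<open>The unsigned degree of a covering \<open>f|\<delta> : \<delta> \<rightarrow> \<gamma>\<close> of Jordan curves, i.e. its number of sheets.\<close>

definition curve_degree :: "('a \<Rightarrow> 'a) \<Rightarrow> 'a set \<Rightarrow> 'a set \<Rightarrow> nat" where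
  "curve_degree f \<delta> \<gamma> = (THE d. \<forall>y\<in>\<gamma>. card {x \<in> \<delta>. f x = y} = d)"


section \<open>Small spheres\<close>

definition boundary_curves :: "'a topology \<Rightarrow> 'a set \<Rightarrow> 'a set set" where
  "boundary_curves X S = connected_components_of (subtopology X (X frontier_of S))"

text \<open>The small sphere of a complementary component \<open>S\<close> is the quotient of the closure of \<open>S\<close>
  in which every boundary component becomes a single point. Its points are the
  equivalence classes: the singletons \<open>{x}\<close> with \<open>x \<in> S\<close>, and the boundary components of \<open>S\<close>.\<close>

definition small_sphere_points :: "'a topology \<Rightarrow> 'a set \<Rightarrow> 'a set set" where
  "small_sphere_points X S = (\<lambda>x. {x}) ` S \<union> boundary_curves X S"

definition small_sphere :: "'a topology \<Rightarrow> 'a set \<Rightarrow> 'a set topology" where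
  "small_sphere X S = topology (\<lambda>\<U>. \<U> \<subseteq> small_sphere_points X S \<and>
                                   openin (subtopology X (X closure_of S)) (\<Union>\<U>))"

lemma Union_small_sphere_points:
  assumes "openin X S"
  shows "\<Union>(small_sphere_points X S) = X closure_of S"
proof -
  have "\<Union>(small_sphere_points X S) = S \<union> X frontier_of S"
    using frontier_of_subset_topspace[of X S]
    by (auto simp: small_sphere_points_def boundary_curves_def Union_connected_components_of)
  also have "\<dots> = X closure_of S"
    using assms by (metis interior_of_eq interior_of_union_frontier_of)
  finally show ?thesis .
qed

lemma disjoint_small_sphere_points:
  assumes "openin X S"
  shows "pairwise disjnt (small_sphere_points X S)"
proof (rule pairwiseI)
  fix A B assume AB: "A \<in> small_sphere_points X S" "B \<in> small_sphere_points X S" "A \<noteq> B"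
  have S: "x \<notin> X frontier_of S" if "x \<in> S" for x
    using assms that by (simp add: frontier_of_openin)
  have sub: "D \<subseteq> X frontier_of S" if "D \<in> boundary_curves X S" for D
    using connected_components_of_subset[OF that[unfolded boundary_curves_def]] by simp
  have disj: "disjnt C D"
    if "C \<in> boundary_curves X S" "D \<in> boundary_curves X S" "C \<noteq> D" for C D
    using pairwise_disjoint_connected_components_of that
    unfolding boundary_curves_def by (rule pairwiseD)
  consider (pp) x y where "A = {x}" "B = {y}"
    | (pc) x where "A = {x}" "x \<in> S" "B \<in> boundary_curves X S"
    | (cp) y where "B = {y}" "y \<in> S" "A \<in> boundary_curves X S"
    | (cc) "A \<in> boundary_curves X S" "B \<in> boundary_curves X S"
    using AB(1,2) unfolding small_sphere_points_def by blast
  then show "disjnt A B"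
  proof cases
    case pp then show ?thesis using AB(3) by simp
  next
    case pc then show ?thesis using S sub[of B] by (auto simp: disjnt_def)
  next
    case cp then show ?thesis using S sub[of A] by (auto simp: disjnt_def)
  next
    case cc then show ?thesis using disj AB(3) by simp
  qed
qed

lemma openin_small_sphere:
  assumes "openin X S"
  shows "openin (small_sphere X S) \<U> \<longleftrightarrow>
           \<U> \<subseteq> small_sphere_points X S \<and> openin (subtopology X (X closure_of S)) (\<Union>\<U>)"
proof -
  let ?ok = "\<lambda>\<U>. \<U> \<subseteq> small_sphere_points X S \<and> openin (subtopology X (X closure_of S)) (\<Union>\<U>)"
  have "istopology ?ok"
    unfolding istopology_def
  proof (intro conjI allI impI)
    fix \<U> \<V> assume \<U>: "?ok \<U>" and \<V>: "?ok \<V>"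
    have "\<Union>(\<U> \<inter> \<V>) = \<Union>\<U> \<inter> \<Union>\<V>"
    proof (intro equalityI subsetI)
      fix x assume "x \<in> \<Union>\<U> \<inter> \<Union>\<V>"
      then obtain A B where AB: "A \<in> \<U>" "B \<in> \<V>" "x \<in> A" "x \<in> B" by blast
      then have "A \<in> small_sphere_points X S" "B \<in> small_sphere_points X S" "\<not> disjnt A B"
        using \<U> \<V> by (auto simp: disjnt_iff)
      then have "A = B"
        using pairwiseD[OF disjoint_small_sphere_points[OF assms]] by blast
      with AB show "x \<in> \<Union>(\<U> \<inter> \<V>)" by blast
    qed blast
    with \<U> \<V> show "openin (subtopology X (X closure_of S)) (\<Union>(\<U> \<inter> \<V>))"
      by (simp add: openin_Int)
    show "\<U> \<inter> \<V> \<subseteq> small_sphere_points X S" using \<U> by blast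
  next
    fix \<K> assume K: "\<forall>K\<in>\<K>. ?ok K"
    show "\<Union>\<K> \<subseteq> small_sphere_points X S" using K by blast
    have eq: "\<Union>(\<Union>\<K>) = \<Union>((\<lambda>K. \<Union>K) ` \<K>)" by blast
    show "openin (subtopology X (X closure_of S)) (\<Union>(\<Union>\<K>))"
      unfolding eq by (rule openin_Union) (use K in blast)
  qed
  then show ?thesis
    by (simp add: small_sphere_def)
qed

lemma topspace_small_sphere:
  assumes "openin X S"
  shows "topspace (small_sphere X S) = small_sphere_points X S"
proof (rule antisym)
  show "topspace (small_sphere X S) \<subseteq> small_sphere_points X S"
    using openin_small_sphere[OF assms] openin_topspace by blast
  have "topspace (subtopology X (X closure_of S)) = X closure_of S"
    by (simp add: closure_of_subset_topspace inf.absorb2)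
  then have "openin (subtopology X (X closure_of S)) (X closure_of S)"
    by (metis openin_topspace)
  then have "openin (small_sphere X S) (small_sphere_points X S)"
    by (simp add: openin_small_sphere[OF assms] Union_small_sphere_points[OF assms])
  then show "small_sphere_points X S \<subseteq> topspace (small_sphere X S)"
    by (rule openin_subset)
qed

definition marked_points :: "'a topology \<Rightarrow> 'a set \<Rightarrow> 'a set \<Rightarrow> 'a set set" where
  "marked_points X P S = (\<lambda>x. {x}) ` (S \<inter> P) \<union> boundary_curves X S"


section \<open>The map on small spheres\<close>

text \<open>Two subsets are homotopic in \<open>Y\<close> if each of them can be moved into the other one by a homotopy
  inside \<open>Y\<close> starting at its inclusion. (They need not be homotopy equivalent in themselves:
  \<open>S' - P\<close> may have more unmarked holes than \<open>S - P\<close>.)\<close>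

definition homotopic_subsets :: "'a topology \<Rightarrow> 'a set \<Rightarrow> 'a set \<Rightarrow> bool" where
  "homotopic_subsets Y A B \<longleftrightarrow>
     (\<exists>u. u ` A \<subseteq> B \<and> homotopic_with (\<lambda>_. True) (subtopology Y A) Y id u) \<and>
     (\<exists>v. v ` B \<subseteq> A \<and> homotopic_with (\<lambda>_. True) (subtopology Y B) Y id v)"

text \<open>The map \<open>lift\<close> sends \<open>S\<close> to \<open>S'\<close>, and \<open>H (x, t)\<close> is the chosen homotopy.\<close>

definition collapsing_homotopy ::
  "'a topology \<Rightarrow> 'a set \<Rightarrow> ('a \<Rightarrow> 'a) \<Rightarrow> 'a set set \<Rightarrow> ('a set \<Rightarrow> 'a set) \<Rightarrow> ('a \<times> real \<Rightarrow> 'a) \<Rightarrow> bool"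
where
  "collapsing_homotopy X P f \<Gamma> lift H \<longleftrightarrow>
     continuous_map (prod_topology X (top_of_set {0..1})) X H \<and>
     (\<forall>p\<in>P. \<forall>t\<in>{0..1}. H (p, t) = p) \<and>
     (\<forall>t\<in>{0..<1}. homeomorphic_map X X (\<lambda>x. H (x, t))) \<and>
     (\<forall>x\<in>topspace X. H (x, 0) = x) \<and>
     (\<forall>S\<in>complement_components X (\<Union>\<Gamma>).
        let S' = lift S; H\<^sub>1 = (\<lambda>x. H (x, 1)) in
        S' \<in> complement_components X (\<Union>(preimage_curves X f \<Gamma>)) \<and>
        homotopic_subsets (subtopology X (topspace X - P)) (S' - P) (S - P) \<and>
        H\<^sub>1 ` (X closure_of S') = X closure_of S \<and>
        H\<^sub>1 ` S' \<subseteq> S \<and>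
        homeomorphic_map (subtopology X S') (subtopology X (H\<^sub>1 ` S')) H\<^sub>1 \<and>
        (\<forall>\<delta>\<in>boundary_curves X S'.
           if essential_curve X P \<delta>
           then \<exists>\<gamma>\<in>boundary_curves X S. isotopic_rel X P \<delta> \<gamma> \<and>
                  homeomorphic_map (subtopology X \<delta>) (subtopology X \<gamma>) H\<^sub>1
           else \<exists>y. H\<^sub>1 ` \<delta> = {y}))"

text \<open>In the next definition, \<open>i\<close> is the extension of the inverse of \<open>H\<^sub>1|S'\<close> and \<open>f_star\<close> that of \<open>f|S'\<close>.
  Since \<open>S'\<close> and \<open>H\<^sub>1 ` S'\<close> are dense in the corresponding small spheres, both are determined by
  continuity once \<open>lift\<close> and \<open>H\<close> are chosen; \<open>F\<close> is a map on small spheres if it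
  arises from some choice of \<open>H\<close>.\<close>

definition map_on_small_spheres ::
  "'a topology \<Rightarrow> 'a set \<Rightarrow> ('a \<Rightarrow> 'a) \<Rightarrow> 'a set set \<Rightarrow> ('a set \<times> 'a set \<Rightarrow> 'a set \<times> 'a set) \<Rightarrow> bool"
where
  "map_on_small_spheres X P f \<Gamma> F \<longleftrightarrow>
     (\<exists>lift H. collapsing_homotopy X P f \<Gamma> lift H \<and>
       (\<forall>S\<in>complement_components X (\<Union>\<Gamma>).
          let S' = lift S in
          \<exists>i f_star. homeomorphic_map (small_sphere X S) (small_sphere X S') i \<and>
                 (\<forall>x\<in>S'. i {H (x, 1)} = {x}) \<and>
                 continuous_map (small_sphere X S') (small_sphere X (f ` S')) f_star \<and>
                 (\<forall>x\<in>S'. f_star {x} = {f x}) \<and>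
                 (\<forall>q\<in>topspace (small_sphere X S). F (S, q) = (f ` S', f_star (i q)))))"

text \<open>The map \<open>F\<close> acts on the disjoint union of the small spheres: the point \<open>q\<close> of the small sphere
  of \<open>S\<close> is the pair \<open>(S, q)\<close>, and the small sphere of \<open>S\<close> is the following subset.\<close>

definition small_sphere_in :: "'a topology \<Rightarrow> 'a set \<Rightarrow> ('a set \<times> 'a set) set" where
  "small_sphere_in X S = Pair S ` topspace (small_sphere X S)"

end

theory Submission
  imports Defs
begin

text \<open>Write \<open>P\<close> for the set of critical points; as they are fixed, \<open>P\<close> is also the postcritical set, and
it is finite. The proof is a counting argument. Two facts drive it.

First, \<open>f\<close> is unbranched off \<open>P\<close>. If \<open>G\<close> is a side of a curve \<open>\<gamma>\<close>, a disc, and a component \<open>V\<close> of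
\<open>f -` G\<close> contains no point of \<open>P\<close>, then \<open>f\<close> maps \<open>V\<close> homeomorphically onto \<open>G\<close>, also at the
boundary, so \<open>V\<close> is itself one side of a single preimage curve, on which \<open>f\<close> is injective
(\<open>disc_pre_component\<close>). Second, every point of \<open>P\<close> is fixed, so a component \<open>V\<close> of \<open>f -` G\<close> satisfies
\<open>V \<inter> P \<subseteq> G \<inter> P\<close>.

Let \<open>\<delta>\<close> be a preimage curve over \<open>\<gamma>\<close>. Near \<open>\<delta>\<close>, the two sides of \<open>\<delta>\<close> are mapped to the two sides
of \<open>\<gamma>\<close>; this matches each side \<open>W\<close> of \<open>\<delta>\<close> with a side \<open>G\<close> of \<open>\<gamma>\<close> (the relation \<open>label\<close>). By the two
facts, a side \<open>W\<close> that contains marked points has a marked point in common with its label \<open>G\<close>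
(\<open>label_common_marked\<close>).

The central step is \<open>no_shrinking_label\<close>: a label never has strictly fewer marked points than the
side it belongs to, in the sense that \<open>G \<inter> P\<close> is not a proper subset of \<open>W \<inter> P\<close> (if \<open>P\<close> is not
contained in \<open>W\<close>). Otherwise invariance of \<open>\<Gamma>\<close> yields a preimage curve \<open>\<delta>'\<close> isotopic to \<open>\<gamma>\<close>. One of
its sides \<open>Y\<close> has the marked points of \<open>G\<close> and lies in \<open>W\<close>, and the component of \<open>f -` G\<close> adjacent to
\<open>\<delta>\<close> must contain \<open>\<delta>'\<close>. Hence \<open>\<delta>'\<close> lies over a curve inside \<open>G\<close>, different from \<open>\<gamma>\<close>, and \<open>Y\<close> is matched
with the inner side of that curve, which has strictly fewer marked points because distinct curves
of \<open>\<Gamma>\<close> are not isotopic. So the situation repeats with fewer marked points, which is impossible.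

It follows that the preimage curve \<open>\<delta>0\<close> isotopic to \<open>\<gamma>\<close> lies over \<open>\<gamma>\<close> itself and that its sides are
matched with the sides of \<open>\<gamma>\<close> having the same marked points (\<open>essential_label\<close>). Any other preimage
curve \<open>\<delta>\<close> over \<open>\<gamma>\<close> lies on one side of \<open>\<delta>0\<close>. The component adjacent to \<open>\<delta>\<close> over the opposite side of
\<open>\<gamma>\<close> lies on that side as well; it contains no marked point, and the first fact shows that \<open>\<delta>\<close> is
null-homotopic and of degree one (\<open>other_component\<close>). This is part (i).

For part (ii), let \<open>S'\<close> be the component that the homotopy \<open>H\<close> turns into \<open>S\<close>. Its essential
boundary curves correspond to those of \<open>S\<close>, and they lie over the corresponding curves by part (i);
counting marked points shows that \<open>S'\<close> and \<open>S\<close> are on matching sides of these curves, whence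
\<open>f(S') = S\<close> (\<open>image_lift\<close>). Continuity then forces the map on small spheres to fix the points that
replace the boundary curves, while the points of \<open>P\<close> in \<open>S\<close> lie in \<open>S'\<close> and are fixed by \<open>H\<close> and by \<open>f\<close>.

The statement that a curve is determined up to isotopy by the marked points on its sides, for
disjoint curves, is \<open>parallel_curves_isotopic\<close>. It rests on the Schoenflies theorem, which is
obtained here from the Riemann mapping theorem: a lemma of Koebe bounds the boundary oscillation
of the Riemann map (\<open>Caratheodory_extension\<close>), and the resulting parametrisations of the two sides
of a Jordan curve are glued (\<open>Schoenflies\<close>).\<close>


section \<open>A lemma of Koebe\<close>

text \<open>The rays \<open>sgn z ^ N = c\<close> cut the punctured plane into sectors of angle \<open>2pi/N\<close>. If \<open>C\<close> misses all of
them, then the midline \<open>h z\<close> of the sector of \<open>z\<close> is continuous and takes finitely many values, so it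
is constant on \<open>C\<close>, and \<open>C\<close> lies in one sector.\<close>

lemma connected_meets_ray:
  fixes C :: "complex set" and c :: complex
  assumes C: "connected C" "0 \<notin> C" "u \<in> C" "v \<in> C"
    and N: "0 < N" and c: "c = 1 \<or> c = -1" and far: "2 * pi / N < dist (sgn u) (sgn v)"
  obtains z where "z \<in> C" "sgn z ^ N = c"
proof (rule ccontr)
  assume "\<not> thesis"
  with that have no: "sgn z ^ N \<noteq> c" if "z \<in> C" for z using \<open>z \<in> C\<close> by blast
  define a where "a = (\<lambda>z. - c * sgn z ^ N)"
  define h where "h = (\<lambda>z. sgn z / exp (Ln (a z) / N))"
  have nz: "z \<noteq> 0" if "z \<in> C" for z using that C by blast
  have na: "norm (a z) = 1" if "z \<in> C" for z
    using nz[OF that] c by (auto simp: a_def norm_mult norm_power norm_sgn)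
  have a0: "a z \<noteq> 0" if "z \<in> C" for z using na[OF that] by auto
  have aneg: "a z \<notin> \<real>\<^sub>\<le>\<^sub>0" if "z \<in> C" for z
  proof
    assume "a z \<in> \<real>\<^sub>\<le>\<^sub>0"
    then obtain t where t: "a z = of_real t" "t \<le> 0"
      by (auto simp: complex_nonpos_Reals_iff complex_eq_iff intro: that)
    with na[OF that] have "t = -1" by simp
    with t have "a z = -1" by simp
    with no[OF that] c show False by (auto simp: a_def minus_equation_iff)
  qed
  have cont: "continuous_on C h"
    unfolding h_def a_def using nz aneg N
    by (intro continuous_intros) (auto simp: a_def)
  have hN: "h z ^ N = - c" if "z \<in> C" for z
  proof -
    have "exp (Ln (a z) / N) ^ N = a z"
      using N a0[OF that] by (simp add: exp_of_nat_mult[symmetric])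
    moreover have "c * c = 1" using c by auto
    moreover have "sgn z ^ N \<noteq> 0" using nz[OF that] by (simp add: sgn_eq_0_iff)
    ultimately show ?thesis
      using c by (auto simp: h_def power_divide a_def)
  qed
  have "finite {w. w ^ N = - c}" using N by (intro finite_nth_roots) auto
  then have "finite (h ` C)" by (rule finite_subset[rotated]) (use hN in auto)
  then have "h constant_on C"
    using continuous_finite_range_constant[OF \<open>connected C\<close> cont] by blast
  then have huv: "h u = h v" using C by (auto simp: constant_on_def)
  have close: "dist (sgn z) (h z) \<le> pi / N" if "z \<in> C" for z
  proof -
    define t where "t = Im (Ln (a z)) / N"
    have "Re (Ln (a z)) = 0" using na[OF that] a0[OF that] by (simp add: Re_Ln)
    then have "Ln (a z) / N = \<i> * of_real t"
      by (simp add: t_def complex_eq_iff Re_divide_of_nat Im_divide_of_nat)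
    then have sh: "sgn z = h z * exp (\<i> * of_real t)" by (simp add: h_def)
    have nh: "norm (h z) = 1"
      using nz[OF that] \<open>Ln (a z) / N = \<i> * of_real t\<close> by (simp add: h_def norm_divide norm_sgn)
    have "dist (sgn z) (h z) = norm (h z * (exp (\<i> * of_real t) - 1))"
      by (simp add: dist_norm sh algebra_simps)
    also have "\<dots> = 2 * \<bar>sin (t / 2)\<bar>" by (simp add: norm_mult nh dist_exp_i_1)
    also have "\<dots> \<le> \<bar>t\<bar>" using abs_sin_x_le_abs_x[of "t/2"] by simp
    also have "\<dots> \<le> pi / N"
      using mpi_less_Im_Ln[OF a0[OF that]] Im_Ln_le_pi[OF a0[OF that]] N
      by (simp add: t_def abs_if divide_right_mono) (simp add: divide_simps)?
    finally show ?thesis .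
  qed
  have "dist (sgn u) (sgn v) \<le> dist (sgn u) (h u) + dist (h u) (sgn v)" by (rule dist_triangle)
  also have "\<dots> \<le> pi / N + pi / N"
    using close[of u] close[of v] C huv by (simp add: dist_commute)
  finally show False using far by simp
qed

text \<open>The product of the conjugates of \<open>f\<close> under the dihedral group of order \<open>2N\<close>. Its modulus is
invariant under the group, hence depends on \<open>z\<close> only through \<open>norm z\<close> and \<open>Re (sgn z ^ N)\<close>; it is
small wherever one of the factors is.\<close>

lemma dihedral_product:
  fixes f :: "complex \<Rightarrow> complex"
  assumes f: "f holomorphic_on ball 0 1" and M: "\<And>z. z \<in> ball 0 1 \<Longrightarrow> norm (f z) \<le> M" and N: "0 < N"
  obtains F where "F holomorphic_on ball 0 1" "norm (F 0) = norm (f 0) ^ (2 * N)"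
    "\<And>z. z \<in> ball 0 1 \<Longrightarrow> norm (F z) \<le> norm (f z) * M ^ (2 * N - 1)"
    "\<And>z w. norm z = norm w \<Longrightarrow> Re (sgn z ^ N) = Re (sgn w ^ N) \<Longrightarrow> norm (F z) = norm (F w)"
proof -
  define R where "R = {u::complex. u ^ N = 1}"
  have finR: "finite R" unfolding R_def using N by (intro finite_nth_roots) auto
  have cardR: "card R = N" unfolding R_def by (rule card_roots_unity_eq[OF N])
  have R1: "1 \<in> R" by (simp add: R_def)
  have nR: "norm u = 1" if "u \<in> R" for u
    using that N power_eq_1_iff[of u N] by (auto simp: R_def)
  define F where "F = (\<lambda>z. (\<Prod>u\<in>R. f (u * z)) * (\<Prod>u\<in>R. cnj (f (cnj (u * z)))))"
  have M0: "0 \<le> M" using M[of 0] norm_ge_zero[of "f 0"] by (meson centre_in_ball order_trans zero_less_one)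
  have hol: "F holomorphic_on ball 0 1"
  proof -
    have 1: "(\<lambda>z. f (u * z)) holomorphic_on ball 0 1" if "u \<in> R" for u
      using holomorphic_on_compose_gen[of "\<lambda>z. u * z" "ball 0 1" f "ball 0 1"] f nR[OF that]
      by (auto simp: o_def norm_mult image_subset_iff intro!: holomorphic_intros)
    have "(cnj \<circ> f \<circ> cnj) holomorphic_on ball 0 1"
    proof (rule holomorphic_on_compose_cnj_cnj)
      have "cnj ` ball 0 1 \<subseteq> ball 0 1" by auto
      then show "f holomorphic_on cnj ` ball 0 1" using f holomorphic_on_subset by blast
    qed simp
    then have 2: "(\<lambda>z. cnj (f (cnj (u * z)))) holomorphic_on ball 0 1" if "u \<in> R" for u
      using holomorphic_on_compose_gen[of "\<lambda>z. u * z" "ball 0 1" "cnj \<circ> f \<circ> cnj" "ball 0 1"] nR[OF that]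
      by (auto simp: o_def norm_mult image_subset_iff intro!: holomorphic_intros)
    show ?thesis unfolding F_def by (intro holomorphic_intros 1 2)
  qed
  have F0: "norm (F 0) = norm (f 0) ^ (2 * N)"
    by (simp add: F_def norm_mult norm_power cardR power_add[symmetric] mult_2)
  have bd: "norm (F z) \<le> norm (f z) * M ^ (2 * N - 1)" if z: "z \<in> ball 0 1" for z
  proof -
    have "(\<Prod>u\<in>R. norm (f (u * z))) = norm (f z) * (\<Prod>u\<in>R-{1}. norm (f (u * z)))"
      using prod.remove[OF finR R1, of "\<lambda>u. norm (f (u * z))"] by simp
    also have "\<dots> \<le> norm (f z) * (\<Prod>u\<in>R-{1}. M)"
      using z nR by (intro mult_left_mono prod_mono) (auto intro!: M simp: norm_mult)
    also have "\<dots> = norm (f z) * M ^ (N - 1)" by (simp add: cardR R1 finR)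
    finally have 1: "(\<Prod>u\<in>R. norm (f (u * z))) \<le> norm (f z) * M ^ (N - 1)" .
    have "(\<Prod>u\<in>R. norm (f (cnj (u * z)))) \<le> (\<Prod>u\<in>R. M)"
      using z nR by (intro prod_mono) (auto intro!: M simp: norm_mult)
    then have 2: "(\<Prod>u\<in>R. norm (f (cnj (u * z)))) \<le> M ^ N" by (simp add: cardR)
    have "norm (F z) = (\<Prod>u\<in>R. norm (f (u * z))) * (\<Prod>u\<in>R. norm (f (cnj (u * z))))"
      by (simp add: F_def norm_mult prod_norm[symmetric])
    also have "\<dots> \<le> (norm (f z) * M ^ (N - 1)) * M ^ N"
      by (intro mult_mono 1 2) (auto intro!: prod_nonneg mult_nonneg_nonneg zero_le_power M0)
    also have "\<dots> = norm (f z) * M ^ (2 * N - 1)"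
      using N by (simp add: power_add[symmetric] mult_2)
    finally show ?thesis .
  qed
  have rot: "F (u * z) = F z" if u: "u \<in> R" for u z
  proof -
    have bij: "bij_betw (\<lambda>v. v * u) R R"
    proof (rule bij_betw_byWitness[where f' = "\<lambda>v. v / u"])
      have "u \<noteq> 0" using nR[OF u] by auto
      then show "\<forall>a\<in>R. a * u / u = a" "\<forall>a\<in>R. a / u * u = a" by auto
      show "(\<lambda>v. v * u) ` R \<subseteq> R" "(\<lambda>v. v / u) ` R \<subseteq> R"
        using u by (auto simp: R_def power_mult_distrib power_divide)
    qed
    show ?thesis
      unfolding F_def
      using prod.reindex_bij_betw[OF bij, of "\<lambda>v. f (v * z)"]
        prod.reindex_bij_betw[OF bij, of "\<lambda>v. cnj (f (cnj (v * z)))"]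
      by (simp add: mult.assoc)
  qed
  have conj: "norm (F (cnj z)) = norm (F z)" for z
  proof -
    have bij: "bij_betw cnj R R"
      by (rule bij_betw_byWitness[where f' = cnj])
         (auto simp: R_def simp flip: complex_cnj_power)
    have "F (cnj z) = cnj (F z)"
      unfolding F_def
      using prod.reindex_bij_betw[OF bij, of "\<lambda>v. f (v * cnj z)"]
        prod.reindex_bij_betw[OF bij, of "\<lambda>v. cnj (f (cnj (v * cnj z)))"]
      by (simp add: mult.commute)
    then show ?thesis by simp
  qed
  have inv: "norm (F z) = norm (F w)" if n: "norm z = norm w" and re: "Re (sgn z ^ N) = Re (sgn w ^ N)" for z w
  proof (cases "z = 0")
    case True then show ?thesis using n by simp
  next
    case False
    then have w0: "w \<noteq> 0" using n by auto
    have *: "norm (F z) = norm (F w')" if w': "norm w' = norm z" "sgn z ^ N = sgn w' ^ N" for w'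
    proof -
      have "w' \<noteq> 0" using w' False by auto
      then have "sgn w' \<noteq> 0" by (simp add: sgn_eq_0_iff)
      have "(sgn z / sgn w') ^ N = 1" using w'(2) \<open>sgn w' \<noteq> 0\<close> by (simp add: power_divide)
      then have "sgn z / sgn w' \<in> R" by (simp add: R_def)
      moreover have "sgn z / sgn w' * w' = z"
        using \<open>w' \<noteq> 0\<close> False w'(1) by (simp add: sgn_eq field_simps)
      ultimately show ?thesis using rot by metis
    qed
    have nn: "norm (sgn z ^ N) = 1" "norm (sgn w ^ N) = 1"
      using False w0 by (simp_all add: norm_power norm_sgn)
    then have "(Im (sgn z ^ N))\<^sup>2 = (Im (sgn w ^ N))\<^sup>2"
      using re by (metis add_left_cancel cmod_power2)
    then consider "sgn z ^ N = sgn w ^ N" | "sgn z ^ N = cnj (sgn w ^ N)"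
      using re by (auto simp: complex_eq_iff power2_eq_iff simp del: complex_cnj_power)
    then show ?thesis
    proof cases
      case 1 then show ?thesis using * n by metis
    next
      case 2
      moreover have "cnj (sgn w ^ N) = sgn (cnj w) ^ N" by (simp add: sgn_eq)
      ultimately show ?thesis using *[of "cnj w"] n conj[of w] by simp
    qed
  qed
  show thesis by (rule that[OF hol F0 bd inv])
qed

text \<open>A bounded holomorphic function that is small on a path whose ends are seen from \<open>0\<close> in different
directions is small at \<open>0\<close>. With \<open>F\<close> from \<open>dihedral_product\<close>, suppose that \<open>\<bar>F\<bar>\<close> at \<open>0\<close> exceeds its
bound \<open>B\<close> on the path. By the maximum principle the component of \<open>{\<bar>F\<bar> > B}\<close> around \<open>0\<close> reaches
beyond the path. In the coordinates \<open>(Re (sgn z ^ N), \<bar>z\<bar>)\<close>, which determine \<open>\<bar>F\<bar>\<close>, a path in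
this component from near \<open>0\<close> outwards runs from the bottom to the top of a rectangle, so it has to
cross the given path, a part of which runs from the left edge to the right edge.\<close>

lemma Koebe_lemma:
  fixes f :: "complex \<Rightarrow> complex"
  assumes f: "f holomorphic_on ball 0 1" and M: "\<And>z. z \<in> ball 0 1 \<Longrightarrow> norm (f z) \<le> M" and N: "0 < N"
    and p: "path p" "path_image p \<subseteq> ball 0 1" and small: "\<And>z. z \<in> path_image p \<Longrightarrow> norm (f z) \<le> e"
    and far: "2 * pi / N < dist (sgn (pathstart p)) (sgn (pathfinish p))"
  shows "norm (f 0) ^ (2 * N) \<le> e * M ^ (2 * N - 1)"
proof (rule ccontr)
  define B where "B = e * M ^ (2 * N - 1)"
  have M0: "0 \<le> M" using M[of 0] norm_ge_zero[of "f 0"] by (meson centre_in_ball order_trans zero_less_one)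
  obtain F where F: "F holomorphic_on ball 0 1" and F0: "norm (F 0) = norm (f 0) ^ (2 * N)"
    and Fbd: "\<And>z. z \<in> ball 0 1 \<Longrightarrow> norm (F z) \<le> norm (f z) * M ^ (2 * N - 1)"
    and Finv: "\<And>z w. norm z = norm w \<Longrightarrow> Re (sgn z ^ N) = Re (sgn w ^ N) \<Longrightarrow> norm (F z) = norm (F w)"
    using dihedral_product[OF f M N] by blast
  assume "\<not> ?thesis"
  then have big: "B < norm (F 0)" by (simp add: B_def F0)
  have onp: "norm (F z) \<le> B" if "z \<in> path_image p" for z
  proof -
    have "norm (F z) \<le> norm (f z) * M ^ (2 * N - 1)" using Fbd p(2) that by blast
    also have "\<dots> \<le> B"
      unfolding B_def using small[OF that] M0 by (intro mult_right_mono) auto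
    finally show ?thesis .
  qed
  have p0: "0 \<notin> path_image p" using onp big by force
  have comp: "compact (path_image p)" "path_image p \<noteq> {}" using p by (auto simp: compact_path_image)
  obtain zm where zm: "zm \<in> path_image p" "\<And>z. z \<in> path_image p \<Longrightarrow> norm zm \<le> norm z"
    using continuous_attains_inf[OF comp, of norm] continuous_on_norm_id by blast
  obtain zM where zM: "zM \<in> path_image p" "\<And>z. z \<in> path_image p \<Longrightarrow> norm z \<le> norm zM"
    using continuous_attains_sup[OF comp, of norm] continuous_on_norm_id by blast
  have "norm zM < 1" using zM(1) p(2) by auto
  then obtain \<rho> where \<rho>: "norm zM < \<rho>" "\<rho> < 1" using dense by blast
  have "0 < norm zm" using zm(1) p0 by (metis zero_less_norm_iff)
  then obtain r where r: "0 < r" "r < norm zm" using dense by blast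
  have rr: "r < \<rho>" using r zm(2)[OF zM(1)] \<rho> by linarith
  define T where "T = {z \<in> ball 0 1. B < norm (F z)}"
  have contF: "continuous_on (ball 0 1) F" using F by (rule holomorphic_on_imp_continuous_on)
  have "open T"
  proof -
    have "open (ball 0 1 \<inter> (\<lambda>z. norm (F z)) -` {B<..})"
      by (rule continuous_open_preimage) (auto intro!: continuous_intros contF)
    then show ?thesis by (simp add: T_def vimage_def Int_def)
  qed
  define C where "C = connected_component_set T 0"
  have C: "open C" "connected C" "C \<subseteq> T" "0 \<in> C"
    using \<open>open T\<close> big by (auto simp: C_def open_connected_component connected_component_subset T_def)
  obtain z1 where z1: "z1 \<in> C" "\<rho> \<le> norm z1"
  proof (rule ccontr)
    assume "\<not> thesis"
    then have Cb: "C \<subseteq> ball 0 \<rho>" using that by force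
    then have cl: "closure C \<subseteq> cball 0 \<rho>"
      by (metis ball_subset_cball closed_cball closure_minimal order_trans)
    then have cl1: "closure C \<subseteq> ball 0 1" using \<rho>(2) by (force simp: subset_iff)
    have "norm (F 0) \<le> B"
    proof (rule maximum_modulus_frontier[of F C])
      show "F holomorphic_on interior C" using F cl1 closure_subset[of C]
        by (meson holomorphic_on_subset interior_subset order_trans)
      show "continuous_on (closure C) F" using contF cl1 continuous_on_subset by blast
      show "bounded C" using Cb bounded_ball bounded_subset by blast
      show "norm (F z) \<le> B" if z: "z \<in> frontier C" for z
      proof (rule ccontr)
        assume "\<not> norm (F z) \<le> B"
        moreover have "z \<in> closure C" "z \<notin> C" using z C(1) by (auto simp: frontier_def interior_open)
        ultimately have "z \<in> T" using cl1 by (auto simp: T_def)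
        let ?D = "connected_component_set T z"
        have "open ?D" "z \<in> ?D" using \<open>open T\<close> \<open>z \<in> T\<close> by (auto simp: open_connected_component)
        then have "?D \<inter> C \<noteq> {}" using \<open>z \<in> closure C\<close>
          by (metis closure_iff_nhds_not_empty Int_commute order_refl)
        then have "?D = C" unfolding C_def by (metis connected_component_overlap)
        then show False using \<open>z \<in> ?D\<close> \<open>z \<notin> C\<close> by blast
      qed
    qed (use C in auto)
    then show False using big by simp
  qed
  obtain z0 where z0: "z0 \<in> C - {0}" "norm z0 < r"
  proof -
    obtain s where s: "s > 0" "ball 0 s \<subseteq> C" using C(1,4) open_contains_ball by blast
    define t where "t = min s r / 2"
    have t: "0 < t" "t < s" "t < r" using s r by (auto simp: t_def)
    show thesis
      by (rule that[of "of_real t"]) (use t s in \<open>auto simp: subset_iff\<close>)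
  qed
  have "z1 \<in> C - {0}" using z1 rr r by auto
  have "path_connected (C - {0})" using C by (intro path_connected_open_delete) auto
  then obtain q where q: "path q" "path_image q \<subseteq> C - {0}" "pathstart q = z0" "pathfinish q = z1"
    using z0 \<open>z1 \<in> C - {0}\<close> unfolding path_connected_def by blast
  define h where "h = (\<lambda>z. Re (sgn z ^ N))"
  have h_le: "\<bar>h z\<bar> \<le> 1" for z
  proof -
    have "norm (sgn z ^ N) \<le> 1" by (simp add: norm_power norm_sgn power_le_one)
    then show ?thesis using abs_Re_le_cmod[of "sgn z ^ N"] by (simp add: h_def)
  qed
  have h_cont: "continuous_on S h" if "0 \<notin> S" for S
    unfolding h_def using that by (intro continuous_intros) auto
  have conn: "connected (path_image p)" using p by (simp add: connected_path_image)
  have se: "pathstart p \<in> path_image p" "pathfinish p \<in> path_image p" by auto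
  obtain a where a: "a \<in> path_image p" "sgn a ^ N = -1"
    by (rule connected_meets_ray[OF conn p0 se N _ far, of "-1"]) auto
  obtain b where b: "b \<in> path_image p" "sgn b ^ N = 1"
    by (rule connected_meets_ray[OF conn p0 se N _ far, of "1"]) auto
  obtain s t where st: "s \<in> {0..1}" "t \<in> {0..1}" "p s = a" "p t = b"
    using a(1) b(1) by (auto simp: path_image_def)
  define p' where "p' = subpath s t p"
  have p': "path p'" "path_image p' \<subseteq> path_image p" "pathstart p' = a" "pathfinish p' = b"
    using st p by (auto simp: p'_def path_image_subpath_subset)
  \<comment> \<open>The coordinates \<open>(Re (sgn z ^ N), norm z)\<close>, with the second one truncated to \<open>[r, \<rho>]\<close> so that both paths stay in the rectangle; on \<open>p\<close> the truncation is inactive.\<close>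
  define \<Phi> where "\<Phi> = (\<lambda>z. (\<chi> i. if i = 1 then h z else max r (min \<rho> (norm z))) :: real^2)"
  have \<Phi>1: "\<Phi> z $ 1 = h z" and \<Phi>2: "\<Phi> z $ 2 = max r (min \<rho> (norm z))" for z by (auto simp: \<Phi>_def)
  have \<Phi>c: "continuous_on S \<Phi>" if "0 \<notin> S" for S
    unfolding \<Phi>_def
  proof (rule continuous_on_vec_lambda)
    show "continuous_on S (\<lambda>z. if i = 1 then h z else max r (min \<rho> (norm z)))" for i :: 2
      by (cases "i = 1") (auto intro!: continuous_intros h_cont that)
  qed
  define lo :: "real^2" where "lo = vector [-1, r]"
  define hi :: "real^2" where "hi = vector [1, \<rho>]"
  have box: "\<Phi> z \<in> cbox lo hi" for z
    using h_le[of z] rr by (auto simp: mem_box_cart forall_2 \<Phi>1 \<Phi>2 lo_def hi_def abs_le_iff)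
  obtain y where y: "y \<in> path_image (\<Phi> \<circ> p')" "y \<in> path_image (\<Phi> \<circ> q)"
  proof (rule fashoda[of "\<Phi> \<circ> p'" "\<Phi> \<circ> q" lo hi])
    show "path (\<Phi> \<circ> p')"
      using p' p0 by (intro path_continuous_image \<Phi>c) auto
    show "path (\<Phi> \<circ> q)"
      using q by (intro path_continuous_image \<Phi>c) auto
    show "path_image (\<Phi> \<circ> p') \<subseteq> cbox lo hi" "path_image (\<Phi> \<circ> q) \<subseteq> cbox lo hi"
      using box by (auto simp: path_image_def)
    show "pathstart (\<Phi> \<circ> p') $ 1 = lo $ 1" "pathfinish (\<Phi> \<circ> p') $ 1 = hi $ 1"
      using a b p' by (auto simp: pathstart_compose pathfinish_compose \<Phi>1 lo_def hi_def h_def)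
    show "pathstart (\<Phi> \<circ> q) $ 2 = lo $ 2" "pathfinish (\<Phi> \<circ> q) $ 2 = hi $ 2"
      using z0 z1 q rr by (auto simp: pathstart_compose pathfinish_compose \<Phi>2 lo_def hi_def)
  qed
  then obtain z w where z: "z \<in> path_image p" "y = \<Phi> z" and w: "w \<in> C" "y = \<Phi> w"
    using p'(2) q(2) unfolding path_image_compose by blast
  have "h z = h w" using z w by (metis \<Phi>1)
  moreover have "norm z = norm w"
  proof -
    have "max r (min \<rho> (norm z)) = max r (min \<rho> (norm w))" using z w by (metis \<Phi>2)
    moreover have "r < norm z" "norm z < \<rho>" using zm(2)[OF z(1)] zM(2)[OF z(1)] r \<rho> by auto
    ultimately show ?thesis by (auto simp: max_def min_def split: if_splits)
  qed
  ultimately have "norm (F z) = norm (F w)" by (intro Finv) (auto simp: h_def)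
  then show False using onp[OF z(1)] w(1) C(3) by (auto simp: T_def)
qed

section \<open>Jordan curves and boundary values of holomorphic functions\<close>

text \<open>The set \<open>B\<close> is the curve without a short open arc about \<open>a\<close>.\<close>

lemma Jordan_curve_cut_at:
  fixes c :: "real \<Rightarrow> complex"
  assumes c: "simple_path c" "pathfinish c = pathstart c" and a: "a \<in> path_image c" and e: "0 < e"
  obtains B where "compact B" "connected B" "B \<subseteq> path_image c" "a \<notin> B" "path_image c - B \<subseteq> ball a e"
proof -
  obtain t where t: "t \<in> {0..1}" "c t = a" using a by (auto simp: path_image_def)
  define g where "g = shiftpath t c"
  have g: "simple_path g" "path_image g = path_image c" "g 0 = a" "g 1 = a"
    using simple_path_shiftpath[OF c(1,2)] path_image_shiftpath[OF t(1) c(2)]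
      pathstart_shiftpath[of t c] pathfinish_shiftpath[of t c] t c
    by (auto simp: g_def pathstart_def pathfinish_def)
  have cg: "continuous_on {0..1} g" using g(1) by (simp add: simple_path_def path_def)
  obtain s0 where s0: "s0 > 0" "\<And>x. x \<in> {0..1} \<Longrightarrow> dist x 0 < s0 \<Longrightarrow> dist (g x) a < e"
    using cg e g(3) unfolding continuous_on_iff by (metis atLeastAtMost_iff order_refl zero_le_one)
  obtain s1 where s1: "s1 > 0" "\<And>x. x \<in> {0..1} \<Longrightarrow> dist x 1 < s1 \<Longrightarrow> dist (g x) a < e"
    using cg e g(4) unfolding continuous_on_iff by (metis atLeastAtMost_iff order_refl zero_le_one)
  define s where "s = min (min s0 s1) 1 / 2"
  have s: "0 < s" "s < s0" "s < s1" "s \<le> 1/2" using s0 s1 by (auto simp: s_def)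
  define B where "B = g ` {s..1-s}"
  have cB: "continuous_on {s..1-s} g" using cg s by (rule_tac continuous_on_subset) auto
  show thesis
  proof
    show "compact B" "connected B"
      unfolding B_def using cB by (auto intro: compact_continuous_image connected_continuous_image)
    have "B \<subseteq> path_image g" unfolding B_def path_image_def using s by (intro image_mono) auto
    then show "B \<subseteq> path_image c" by (simp add: g(2))
    show "a \<notin> B"
    proof
      assume "a \<in> B"
      then obtain x where x: "x \<in> {s..1-s}" "g x = g 0" using g(3) by (auto simp: B_def)
      then have "x = 0 \<or> x = 1"
        using g(1) s unfolding simple_path_def loop_free_def by force
      then show False using x s by auto
    qed
    show "path_image c - B \<subseteq> ball a e"
    proof
      fix y assume y: "y \<in> path_image c - B"
      then have "y \<in> path_image g" by (simp add: g(2))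
      then obtain x where x: "x \<in> {0..1}" "y = g x" unfolding path_image_def by blast
      then have "x < s \<or> x > 1 - s" using y by (force simp: B_def)
      then have "dist x 0 < s0 \<or> dist x 1 < s1" using s x by (auto simp: dist_real_def)
      then show "y \<in> ball a e" using s0(2) s1(2) x by (auto simp: dist_commute)
    qed
  qed
qed

text \<open>Janiszewski's theorem, applied to the curve and to the union of the complement of a disc about \<open>a\<close>
with a subarc that contains all of the curve outside this disc. These two closed sets meet in that
subarc, which is connected.\<close>

lemma Jordan_curve_locally_accessible:
  fixes c :: "real \<Rightarrow> complex"
  assumes c: "simple_path c" "pathfinish c = pathstart c" and a: "a \<in> path_image c" and e: "0 < e"
  obtains d where "0 < d"
    "\<And>z w. \<lbrakk>dist z a < d; dist w a < d; connected_component (- path_image c) z w\<rbrakk>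
       \<Longrightarrow> connected_component (ball a e - path_image c) z w"
proof -
  obtain B where B: "compact B" "connected B" "B \<subseteq> path_image c" "a \<notin> B" "path_image c - B \<subseteq> ball a e"
    using Jordan_curve_cut_at[OF c a e] by blast
  obtain d0 where d0: "d0 > 0" "ball a d0 \<inter> B = {}"
    using B by (metis compact_imp_closed Diff_disjoint Int_commute open_Compl open_contains_ball ComplI disjoint_eq_subset_Compl)
  define d where "d = min d0 e"
  show thesis
  proof
    show "0 < d" using d0 e by (simp add: d_def)
    fix z w assume zw: "dist z a < d" "dist w a < d" and cc: "connected_component (- path_image c) z w"
    have "connected_component (- (path_image c \<union> (B \<union> - ball a e))) z w"
    proof (rule Janiszewski)
      show "compact (path_image c)" using c by (simp add: compact_simple_path_image)
      show "closed (B \<union> - ball a e)" using B by (simp add: compact_imp_closed closed_Un closed_Compl)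
      have "path_image c \<inter> (B \<union> - ball a e) = B" using B by blast
      then show "connected (path_image c \<inter> (B \<union> - ball a e))" using B by simp
      show "connected_component (- (B \<union> - ball a e)) z w"
      proof (rule connected_component_of_subset)
        show "connected_component (ball a d) z w"
          using zw convex_connected[OF convex_ball, of a d]
          by (auto simp: connected_component_def dist_commute intro: exI[of _ "ball a d"])
        show "ball a d \<subseteq> - (B \<union> - ball a e)" using d0 by (auto simp: d_def)
      qed
    qed (rule cc)
    then show "connected_component (ball a e - path_image c) z w"
      by (rule connected_component_of_subset) auto
  qed
qed

text \<open>Every rotation about \<open>z0\<close> is close, on the circle through \<open>e\<close>, to one by a multiple of a fixed small angle.\<close>

lemma rotations_meet_disc:
  fixes z0 e :: complex
  assumes "z0 \<noteq> e" "0 < s"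
  obtains N :: nat where "0 < N" "\<And>x. dist z0 x = dist z0 e \<Longrightarrow> \<exists>k<N. z0 + cis (2 * pi * k / N) * (x - z0) \<in> ball e s"
proof -
  define \<rho> where "\<rho> = dist z0 e"
  have \<rho>: "\<rho> > 0" using assms by (simp add: \<rho>_def)
  obtain N :: nat where N: "2 * pi * \<rho> / s < N" using reals_Archimedean2 by blast
  then have "0 < real N" using \<rho> assms pi_gt_zero
    by (smt (verit, best) divide_nonneg_pos mult_nonneg_nonneg)
  then have N0: "0 < N" by simp
  show thesis
  proof (rule that[OF N0])
    fix x assume x: "dist z0 x = dist z0 e"
    then have x0: "x - z0 \<noteq> 0" using assms by auto
    define q where "q = (e - z0) / (x - z0)"
    have nq: "norm q = 1" using x x0 assms by (simp add: q_def norm_divide dist_norm norm_minus_commute)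
    obtain t where t: "q = cis t" "0 \<le> t" "t < 2 * pi"
      using nq Arg2pi[of q] by (metis Arg2pi_eq cis_conv_exp mult_1 of_real_1)
    define k where "k = nat \<lfloor>t * N / (2 * pi)\<rfloor>"
    have k1: "k \<le> t * N / (2 * pi)" "t * N / (2 * pi) < k + 1"
    proof -
      have "0 \<le> t * N / (2 * pi)" using t by simp
      then show "k \<le> t * N / (2 * pi)" "t * N / (2 * pi) < k + 1"
        unfolding k_def by linarith+
    qed
    have "t * N / (2 * pi) < N" using t N0 by (simp add: field_simps)
    then have kN: "k < N" using k1 by linarith
    have "2 * pi * k / N \<le> t" "t \<le> 2 * pi * (k + 1) / N" using k1 N0 by (simp_all add: field_simps)
    then have d: "0 \<le> t - 2 * pi * k / N" "t - 2 * pi * k / N \<le> 2 * pi / N"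
      by (simp_all add: distrib_left add_divide_distrib)
    have "norm (cis (2 * pi * k / N) - q) = norm (exp (\<i> * of_real (2 * pi * k / N - t)) - 1)"
    proof -
      have "cis (2 * pi * k / N) - q = q * (exp (\<i> * of_real (2 * pi * k / N - t)) - 1)"
        unfolding cis_conv_exp[symmetric] by (simp add: t(1) right_diff_distrib cis_mult)
      then show ?thesis by (simp add: norm_mult nq)
    qed
    also have "\<dots> \<le> \<bar>2 * pi * k / N - t\<bar>"
      unfolding dist_exp_i_1 using abs_sin_x_le_abs_x[of "(2 * pi * k / N - t)/2"] by simp
    also have "\<dots> \<le> 2 * pi / N" using d by linarith
    finally have 1: "norm (cis (2 * pi * k / N) - q) \<le> 2 * pi / N" .
    define w where "w = cis (2 * pi * k / N)"
    have "e = z0 + q * (x - z0)" using x0 by (simp add: q_def)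
    then have "e - (z0 + w * (x - z0)) = - ((w - q) * (x - z0))" by (simp add: algebra_simps)
    then have "dist e (z0 + cis (2 * pi * k / N) * (x - z0)) = norm ((cis (2 * pi * k / N) - q) * (x - z0))"
      by (simp add: dist_norm w_def)
    also have "\<dots> = norm (cis (2 * pi * k / N) - q) * \<rho>"
      using x by (simp add: norm_mult \<rho>_def dist_norm norm_minus_commute)
    also have "\<dots> \<le> 2 * pi / N * \<rho>" using 1 \<rho> by (intro mult_right_mono) auto
    also have "\<dots> < s" using N N0 assms by (simp add: field_simps)
    finally show "\<exists>k<N. z0 + cis (2 * pi * k / N) * (x - z0) \<in> ball e s" using kN by auto
  qed
qed

text \<open>A holomorphic function that vanishes on the part of the boundary near \<open>a\<close> vanishes somewhere inside.
Rotate about a point \<open>z0\<close> of \<open>D\<close> close to \<open>a\<close>, with \<open>e\<close> a point close to \<open>a\<close> outside the closure. The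
product of the rotated functions is defined where all rotated points are in \<open>D\<close>; on the boundary of
this set some factor vanishes, because points on the circle through \<open>e\<close> are moved close to \<open>e\<close> by some
rotation. So the product vanishes at \<open>z0\<close> by the maximum principle.\<close>

lemma holomorphic_zero_on_boundary_piece:
  fixes g :: "complex \<Rightarrow> complex"
  assumes D: "open D" and hol: "g holomorphic_on D" and cont: "continuous_on (closure D) g"
    and r: "0 < r" and a: "a \<in> closure D" "a \<in> closure (- closure D)"
    and zero: "\<And>z. z \<in> frontier D \<Longrightarrow> dist a z < r \<Longrightarrow> g z = 0"
  obtains z where "z \<in> D" "g z = 0"
proof -
  obtain z0 where z0: "z0 \<in> D" "dist z0 a < r / 4" using a(1) r by (meson closure_approachable divide_pos_pos zero_less_numeral)
  obtain e where e: "e \<in> - closure D" "dist e a < r / 4" using a(2) r by (meson closure_approachable divide_pos_pos zero_less_numeral)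
  obtain s where s: "s > 0" "ball e s \<subseteq> - closure D"
    using e by (meson closed_closure open_Compl open_contains_ball)
  have "z0 \<noteq> e" using z0 e closure_subset by auto
  then obtain N :: nat where N: "0 < N" and rot: "\<And>x. dist z0 x = dist z0 e \<Longrightarrow> \<exists>k<N. z0 + cis (2 * pi * k / N) * (x - z0) \<in> ball e s"
    using rotations_meet_disc[OF _ s(1)] by metis
  define R where "R = (\<lambda>k::nat. \<lambda>x. z0 + cis (2 * pi * k / N) * (x - z0))"
  have distR: "dist z0 (R k x) = dist z0 x" for k x
    by (simp add: R_def dist_norm norm_mult norm_minus_commute)
  have contR: "continuous_on S (R k)" and holR: "R k holomorphic_on S" for k S
    unfolding R_def by (intro continuous_intros) (intro holomorphic_intros)
  have R0: "R k z0 = z0" for k by (simp add: R_def)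
  define \<rho> where "\<rho> = dist z0 e"
  have "dist z0 e \<le> dist z0 a + dist e a" by (rule dist_triangle2)
  then have \<rho>: "0 < \<rho>" "\<rho> < r / 2" using \<open>z0 \<noteq> e\<close> z0 e by (auto simp: \<rho>_def)
  define \<Omega> where "\<Omega> = ball z0 \<rho> \<inter> (\<Inter>k<N. R k -` D)"
  have op: "open \<Omega>" unfolding \<Omega>_def
    using D by (intro open_Int open_INT) (auto intro!: open_vimage contR)
  have clR: "R k x \<in> closure D" if "x \<in> closure \<Omega>" "k < N" for k x
  proof -
    have "R k ` closure \<Omega> \<subseteq> closure (R k ` \<Omega>)"
      by (rule image_closure_subset) (use contR closure_subset[of "R k ` \<Omega>"] in auto)
    moreover have "R k ` \<Omega> \<subseteq> D" using that by (auto simp: \<Omega>_def)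
    ultimately show ?thesis using that closure_mono by blast
  qed
  define G where "G = (\<lambda>x. \<Prod>k<N. g (R k x))"
  have "norm (G z0) \<le> 0"
  proof (rule maximum_modulus_frontier[of G \<Omega>])
    have "(\<lambda>x. g (R k x)) holomorphic_on \<Omega>" if "k < N" for k
      using holomorphic_on_compose_gen[of "R k" \<Omega> g D] hol holR that by (auto simp: o_def \<Omega>_def)
    then show "G holomorphic_on interior \<Omega>" unfolding G_def interior_open[OF op]
      by (intro holomorphic_intros) auto
    show "continuous_on (closure \<Omega>) G"
      unfolding G_def using clR by (intro continuous_intros continuous_on_compose2[OF cont contR]) auto
    show "bounded \<Omega>" by (rule bounded_subset[of "ball z0 \<rho>"]) (auto simp: \<Omega>_def)
    show "z0 \<in> \<Omega>" using z0 \<rho> by (auto simp: \<Omega>_def R0)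
    show "norm (G x) \<le> 0" if x: "x \<in> frontier \<Omega>" for x
    proof -
      have xc: "x \<in> closure \<Omega>" "x \<notin> \<Omega>" using x op by (auto simp: frontier_def interior_open)
      have "closure \<Omega> \<subseteq> cball z0 \<rho>" by (rule closure_minimal) (auto simp: \<Omega>_def)
      then have dx: "dist z0 x \<le> \<rho>" using xc by auto
      have "dist z0 x \<noteq> \<rho>"
      proof
        assume "dist z0 x = \<rho>"
        then obtain k where "k < N" "R k x \<in> ball e s" using rot[of x] by (auto simp: \<rho>_def R_def)
        then show False using clR[OF xc(1)] s(2) by blast
      qed
      then obtain k where k: "k < N" "R k x \<notin> D" using xc(2) dx by (auto simp: \<Omega>_def)
      then have "R k x \<in> frontier D" using clR[OF xc(1)] D by (auto simp: frontier_def interior_open)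
      moreover have "dist a (R k x) < r"
        using dist_triangle[of a "R k x" z0] z0(2) dx \<rho> distR[of k x] r by (auto simp: dist_commute)
      ultimately have "g (R k x) = 0" by (rule zero)
      then show ?thesis using k by (auto simp: G_def)
    qed
  qed
  then have "g z0 ^ N = 0" by (simp add: G_def R0)
  then show thesis using z0 that by simp
qed

section \<open>Boundary extension of the Riemann map\<close>

text \<open>A connected subset of a Jordan curve with two points contains one of the two arcs between them:
if it missed a point on each arc, these two points would separate it.\<close>

lemma Jordan_curve_connected_subset:
  fixes c :: "real \<Rightarrow> complex"
  assumes c: "simple_path c" "pathfinish c = pathstart c"
    and L: "connected L" "L \<subseteq> path_image c" "a \<in> L" "b \<in> L" "a \<noteq> b"
  obtains x r where "x \<in> path_image c" "0 < r" "path_image c \<inter> ball x r \<subseteq> L"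
proof -
  note finish = that
  obtain u d where ud: "arc u" "arc d" "pathstart u = a" "pathfinish u = b"
      "pathstart d = b" "pathfinish d = a"
      "path_image u \<inter> path_image d = {a,b}" "path_image u \<union> path_image d = path_image c"
    using exists_double_arc[OF c, of a b] L by blast
  have closed_arc: "closed (path_image g)" "connected (path_image g)" if "arc g" for g :: "real \<Rightarrow> complex"
    using that by (auto simp: arc_imp_path closed_path_image connected_path_image)
  have "path_image u \<subseteq> L \<or> path_image d \<subseteq> L"
  proof (rule ccontr)
    assume "\<not> ?thesis"
    then obtain m n where m: "m \<in> path_image u" "m \<notin> L" and n: "n \<in> path_image d" "n \<notin> L" by blast
    have mn: "m \<noteq> n" using m n ud(7) L(3,4) by auto
    obtain v w where vw: "arc v" "arc w" "pathstart v = m" "pathfinish v = n"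
        "pathstart w = n" "pathfinish w = m"
        "path_image v \<inter> path_image w = {m,n}" "path_image v \<union> path_image w = path_image c"
      using exists_double_arc[OF c, of m n] m n ud(8) mn by blast
    have split: False if A: "arc A" "arc A'" "path_image A \<inter> path_image A' = {m,n}"
        "path_image A \<union> path_image A' = path_image c" "m \<in> path_image A'" "n \<in> path_image A'"
        "L \<subseteq> path_image A" for A A' :: "real \<Rightarrow> complex"
    proof -
      have ab: "a \<notin> path_image A'" "b \<notin> path_image A'" using A(3,7) L(3,4) m(2) n(2) by auto
      have "path_image A' \<inter> path_image u \<inter> path_image A' = {} \<or> path_image A' \<inter> path_image d \<inter> path_image A' = {}"
        using closed_arc[OF A(2)] closed_arc[OF ud(1)] closed_arc[OF ud(2)] ud(7,8) A(4) ab
        unfolding connected_closed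
        by (smt (verit) Int_Un_distrib Int_assoc Int_commute Int_insert_right_if0 Un_upper2 closed_Int inf.absorb_iff1 inf_bot_right)
      then show False using A(5,6) m n by blast
    qed
    have "path_image v \<inter> L = {} \<or> path_image w \<inter> L = {}"
    proof -
      have "L \<subseteq> path_image v \<union> path_image w" "path_image v \<inter> path_image w \<inter> L = {}"
        using vw(7,8) L(2) m(2) n(2) by auto
      then show ?thesis using L(1) closed_arc[OF vw(1)] closed_arc[OF vw(2)]
        unfolding connected_closed by blast
    qed
    then have "L \<subseteq> path_image w \<or> L \<subseteq> path_image v" using vw(8) L(2) by blast
    moreover have "m \<in> path_image v" "n \<in> path_image v" "m \<in> path_image w" "n \<in> path_image w"
      using vw(7) by auto
    ultimately show False
      using split[of v w] split[of w v] vw by (auto simp: Int_commute Un_commute)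
  qed
  moreover have thesis if A: "arc A" "arc A'" "path_image A \<inter> path_image A' = {a,b}"
        "path_image A \<union> path_image A' = path_image c" "path_image A \<subseteq> L" for A A' :: "real \<Rightarrow> complex"
  proof -
    have "infinite (path_image A)"
    proof
      assume "finite (path_image A)"
      moreover have "a \<in> path_image A" "b \<in> path_image A" using A(3) by auto
      ultimately show False using connected_finite_iff_sing closed_arc(2)[OF A(1)] L(5) by (metis empty_iff singletonD)
    qed
    then have "\<not> path_image A \<subseteq> {a,b}" by (meson finite.emptyI finite_insert finite_subset)
    then obtain x where x: "x \<in> path_image A" "x \<notin> path_image A'" using A(3) by blast
    then obtain r where "r > 0" "ball x r \<inter> path_image A' = {}"
      using closed_arc(1)[OF A(2)] by (metis Diff_disjoint Int_commute open_Compl open_contains_ball ComplI disjoint_eq_subset_Compl)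
    then show thesis using finish[of x r] x A by blast
  qed
  ultimately show thesis using ud by (metis Int_commute Un_commute)
qed

text \<open>If \<open>z\<close> and \<open>w\<close> are close to \<open>a\<close>, they are joined within the domain by a path close to \<open>a\<close>. On the image
of this path in the disc \<open>\<phi> - a\<close> is small, so by \<open>Koebe_lemma\<close> its ends have nearly the same direction;
as they are also close to the unit circle, they are close to each other.\<close>

lemma boundary_oscillation:
  fixes c :: "real \<Rightarrow> complex"
  assumes c: "simple_path c" "pathfinish c = pathstart c"
    and \<phi>: "\<phi> holomorphic_on ball 0 1" "\<phi> ` ball 0 1 \<subseteq> inside (path_image c)"
    and \<psi>: "\<psi> holomorphic_on inside (path_image c)" "\<psi> ` inside (path_image c) \<subseteq> ball 0 1"
    and \<phi>\<psi>: "\<And>z. z \<in> inside (path_image c) \<Longrightarrow> \<phi> (\<psi> z) = z"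
    and a: "a \<in> path_image c" and e: "0 < e"
  obtains d where "0 < d" "\<And>z w. \<lbrakk>z \<in> inside (path_image c); w \<in> inside (path_image c); dist z a < d; dist w a < d\<rbrakk>
      \<Longrightarrow> dist (\<psi> z) (\<psi> w) < e"
proof -
  define D where "D = inside (path_image c)"
  note J = Jordan_inside_outside[OF c]
  have D: "open D" "connected D" "bounded D" "D \<inter> path_image c = {}"
    using J by (auto simp: D_def)
  obtain M where M: "M > 0" "\<And>z. z \<in> D \<Longrightarrow> norm (z - a) \<le> M"
  proof -
    obtain b where b: "b > 0" "\<And>z. z \<in> D \<Longrightarrow> norm z \<le> b" using D(3) unfolding bounded_pos by blast
    show thesis
    proof (rule that[of "b + norm a"])
      show "b + norm a > 0" using b(1) norm_ge_zero[of a] by linarith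
      show "norm (z - a) \<le> b + norm a" if "z \<in> D" for z
        using b(2)[OF that] norm_triangle_ineq4[of z a] by linarith
    qed
  qed
  define f where "f = (\<lambda>u. \<phi> u - a)"
  have f: "f holomorphic_on ball 0 1" using \<phi> by (auto simp: f_def intro: holomorphic_intros)
  have fM: "norm (f z) \<le> M" if "z \<in> ball 0 1" for z using M(2) \<phi>(2) that by (simp add: f_def D_def image_subset_iff)
  have "\<phi> 0 \<in> D" using \<phi>(2) by (force simp: D_def)
  then have f0: "norm (f 0) > 0" using D(4) a by (auto simp: f_def)
  \<comment> \<open>With this \<open>N\<close> directions that \<open>Koebe_lemma\<close> cannot distinguish differ by less than \<open>e / 2\<close>.\<close>
  obtain N :: nat where N: "4 * pi / e < N" using reals_Archimedean2 by blast
  have N0: "0 < N" using N e pi_gt_zero by (metis divide_pos_pos less_trans mult_pos_pos of_nat_0_less_iff zero_less_numeral)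
  have N2: "2 * pi / N < e / 2" using N N0 e by (simp add: field_simps)
  \<comment> \<open>Half of the value excluded by \<open>Koebe_lemma\<close>.\<close>
  define \<epsilon> where "\<epsilon> = norm (f 0) ^ (2 * N) / M ^ (2 * N - 1) / 2"
  have \<epsilon>: "\<epsilon> > 0" "\<epsilon> * M ^ (2 * N - 1) < norm (f 0) ^ (2 * N)"
    using f0 M(1) by (auto simp: \<epsilon>_def)
  define \<rho> where "\<rho> = max 0 (1 - e / 8)"
  have \<rho>: "0 \<le> \<rho>" "\<rho> < 1" "1 - \<rho> \<le> e / 8" using e by (auto simp: \<rho>_def max_def)
  have "compact (\<phi> ` cball 0 \<rho>)"
    using \<rho> holomorphic_on_imp_continuous_on[OF \<phi>(1)]
    by (intro compact_continuous_image) (auto elim!: continuous_on_subset)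
  moreover have "a \<notin> \<phi> ` cball 0 \<rho>" using \<phi>(2) \<rho> D(4) a by (fastforce simp: D_def)
  ultimately obtain d1 where d1: "d1 > 0" "ball a d1 \<inter> \<phi> ` cball 0 \<rho> = {}"
    by (metis compact_imp_closed open_Compl open_contains_ball ComplI disjoint_eq_subset_Compl)
  obtain d2 where d2: "d2 > 0" and acc: "\<And>z w. \<lbrakk>dist z a < d2; dist w a < d2; connected_component (- path_image c) z w\<rbrakk>
       \<Longrightarrow> connected_component (ball a \<epsilon> - path_image c) z w"
    using Jordan_curve_locally_accessible[OF c a \<epsilon>(1)] by metis
  have near: "dist u (sgn u) \<le> e / 8" if "u \<in> ball 0 1" "\<phi> u \<in> ball a d1" for u
  proof -
    have "u \<notin> cball 0 \<rho>" using that d1 by blast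
    then have u: "\<rho> < norm u" "u \<noteq> 0" using \<rho> by auto
    have "u - sgn u = of_real (norm u - 1) * sgn u" using u by (simp add: sgn_eq diff_divide_distrib right_diff_distrib left_diff_distrib)
    then have "dist u (sgn u) = \<bar>norm u - 1\<bar>"
      using u by (simp only: dist_norm norm_mult norm_of_real) (simp add: norm_sgn)
    then show ?thesis using u that \<rho> by auto
  qed
  show thesis
  proof (rule that[of "min d1 d2"])
    show "0 < min d1 d2" using d1 d2 by simp
    fix z w assume "z \<in> inside (path_image c)" "w \<in> inside (path_image c)" and d: "dist z a < min d1 d2" "dist w a < min d1 d2"
    then have zw: "z \<in> D" "w \<in> D" by (auto simp: D_def)
    have "connected_component (- path_image c) z w"
      using D zw by (auto simp: connected_component_def intro!: exI[of _ D])
    then have "connected_component (ball a \<epsilon> - path_image c) z w" using acc d by auto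
    moreover have "open (ball a \<epsilon> - path_image c)" using c by (simp add: closed_simple_path_image open_Diff)
    ultimately have "path_component (ball a \<epsilon> - path_image c) z w"
      by (simp add: open_path_connected_component)
    then obtain p where p: "path p" "path_image p \<subseteq> ball a \<epsilon> - path_image c" "pathstart p = z" "pathfinish p = w"
      by (auto simp: path_component_def)
    have "path_image p \<subseteq> D"
    proof -
      have "z \<in> path_image p" using p by auto
      moreover have "path_image p \<subseteq> D \<union> outside (path_image c)" "D \<inter> outside (path_image c) \<inter> path_image p = {}"
        using J p by (auto simp: D_def)
      ultimately have "outside (path_image c) \<inter> path_image p = {}"
        using connectedD[OF connected_path_image[OF p(1)], of D "outside (path_image c)"] J zw D by blast
      then show ?thesis using \<open>path_image p \<subseteq> D \<union> _\<close> by blast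
    qed
    have "dist (sgn (\<psi> z)) (sgn (\<psi> w)) \<le> 2 * pi / N"
    proof (rule ccontr)
      assume "\<not> ?thesis"
      then have far: "2 * pi / N < dist (sgn (pathstart (\<psi> \<circ> p))) (sgn (pathfinish (\<psi> \<circ> p)))"
        using p by (simp add: pathstart_compose pathfinish_compose)
      have "norm (f 0) ^ (2 * N) \<le> \<epsilon> * M ^ (2 * N - 1)"
      proof (rule Koebe_lemma[OF f fM N0 _ _ _ far])
        show "path (\<psi> \<circ> p)"
          using p \<open>path_image p \<subseteq> D\<close> holomorphic_on_imp_continuous_on[OF \<psi>(1)]
          by (intro path_continuous_image) (auto simp: D_def elim: continuous_on_subset)
        show "path_image (\<psi> \<circ> p) \<subseteq> ball 0 1"
          using \<psi>(2) \<open>path_image p \<subseteq> D\<close> by (auto simp: path_image_compose D_def)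
        show "norm (f u) \<le> \<epsilon>" if "u \<in> path_image (\<psi> \<circ> p)" for u
          using that p(2) \<open>path_image p \<subseteq> D\<close> \<phi>\<psi> unfolding path_image_compose
          by (force simp: f_def D_def dist_norm norm_minus_commute)
      qed
      then show False using \<epsilon> by simp
    qed
    moreover have "dist (\<psi> z) (sgn (\<psi> z)) \<le> e / 8" "dist (\<psi> w) (sgn (\<psi> w)) \<le> e / 8"
      using near[of "\<psi> z"] near[of "\<psi> w"] zw \<psi>(2) \<phi>\<psi> d by (auto simp: D_def dist_commute)
    ultimately show "dist (\<psi> z) (\<psi> w) < e"
      using N2 e dist_triangle[of "\<psi> z" "\<psi> w" "sgn (\<psi> z)"] dist_triangle2[of "sgn (\<psi> z)" "\<psi> w" "sgn (\<psi> w)"]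
      by linarith
  qed
qed

text \<open>A Lebesgue number for the cover of the closure by the balls of radius \<open>d a\<close>.\<close>

lemma uniformly_continuous_from_oscillation:
  fixes \<psi> :: "'a::heine_borel \<Rightarrow> 'b::metric_space"
  assumes D: "bounded D"
    and osc: "\<And>a e. a \<in> closure D \<Longrightarrow> 0 < e \<Longrightarrow> \<exists>d>0. \<forall>z\<in>D. \<forall>w\<in>D. dist z a < d \<longrightarrow> dist w a < d \<longrightarrow> dist (\<psi> z) (\<psi> w) < e"
  shows "uniformly_continuous_on D \<psi>"
  unfolding uniformly_continuous_on_def
proof (intro allI impI)
  fix e :: real assume e: "0 < e"
  obtain d where d: "\<And>a. a \<in> closure D \<Longrightarrow> d a > 0"
    "\<And>a z w. \<lbrakk>a \<in> closure D; z \<in> D; w \<in> D; dist z a < d a; dist w a < d a\<rbrakk> \<Longrightarrow> dist (\<psi> z) (\<psi> w) < e"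
    using osc[OF _ e] by metis
  have "compact (closure D)" using D by (simp add: compact_closure)
  moreover have "closure D \<subseteq> \<Union>((\<lambda>a. ball a (d a)) ` closure D)" using d(1) by force
  ultimately obtain \<delta> where \<delta>: "\<delta> > 0" "\<And>x. x \<in> closure D \<Longrightarrow> \<exists>G\<in>(\<lambda>a. ball a (d a)) ` closure D. ball x \<delta> \<subseteq> G"
    by (rule Heine_Borel_lemma) auto
  show "\<exists>d>0. \<forall>x\<in>D. \<forall>x'\<in>D. dist x' x < d \<longrightarrow> dist (\<psi> x') (\<psi> x) < e"
  proof (intro exI[of _ \<delta>] conjI ballI impI \<delta>(1))
    fix x x' assume xx: "x \<in> D" "x' \<in> D" "dist x' x < \<delta>"
    obtain a where "a \<in> closure D" "ball x \<delta> \<subseteq> ball a (d a)"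
      using \<delta>(2)[of x] xx closure_subset by blast
    moreover have "x \<in> ball x \<delta>" "x' \<in> ball x \<delta>" using xx \<delta> by (auto simp: dist_commute)
    ultimately have "x \<in> ball a (d a)" "x' \<in> ball a (d a)" by blast+
    then have "dist x a < d a" "dist x' a < d a" by (auto simp: dist_commute)
    then show "dist (\<psi> x') (\<psi> x) < e" using d(2) \<open>a \<in> closure D\<close> xx by blast
  qed
qed

text \<open>By \<open>boundary_oscillation\<close> the inverse \<open>\<psi>\<close> of the Riemann map extends continuously to the closure. If
the extension \<open>h\<close> took the same value \<open>\<zeta>\<close> at two boundary points, its fibre over \<open>\<zeta>\<close>, a decreasing
intersection of connected sets, would contain a piece of the curve, and then \<open>h - \<zeta>\<close> would have a
zero inside by \<open>holomorphic_zero_on_boundary_piece\<close>.\<close>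

theorem Caratheodory_extension:
  fixes c :: "real \<Rightarrow> complex"
  assumes c: "simple_path c" "pathfinish c = pathstart c" and z0: "z0 \<in> inside (path_image c)"
  obtains \<phi> \<psi> where "\<phi> holomorphic_on ball 0 1" "\<phi> 0 = z0"
    "homeomorphism (cball 0 1) (closure (inside (path_image c))) \<phi> \<psi>"
    "\<phi> ` ball 0 1 = inside (path_image c)" "\<phi> ` sphere 0 1 = path_image c"
proof -
  define D where "D = inside (path_image c)"
  note J = Jordan_inside_outside[OF c]
  have D: "open D" "connected D" "bounded D" "D \<noteq> {}" "frontier D = path_image c"
    using J by (auto simp: D_def)
  have clD: "closure D = D \<union> path_image c" using D by (metis closure_Un_frontier)
  have dis: "D \<inter> path_image c = {}" using J by (auto simp: D_def)
  have "simply_connected D" using c by (simp add: D_def simply_connected_inside_simple_path)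
  moreover have "D \<noteq> UNIV" using D(3) not_bounded_UNIV by blast
  ultimately have "\<exists>f g. f holomorphic_on D \<and> g holomorphic_on ball 0 1 \<and>
      (\<forall>z\<in>D. f z \<in> ball 0 1 \<and> g (f z) = z) \<and> (\<forall>z\<in>ball 0 1. g z \<in> D \<and> f (g z) = z)"
    using Riemann_mapping_theorem[of D] D(1,4) by blast
  then obtain f g where fg: "f holomorphic_on D" "g holomorphic_on ball 0 1"
      "\<And>z. z \<in> D \<Longrightarrow> f z \<in> ball 0 1 \<and> g (f z) = z" "\<And>z. z \<in> ball 0 1 \<Longrightarrow> g z \<in> D \<and> f (g z) = z"
    by blast
  obtain F G where FG: "F (f z0) = 0" "F holomorphic_on ball 0 1" "F ` ball 0 1 \<subseteq> ball 0 1"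
      "G holomorphic_on ball 0 1" "G ` ball 0 1 \<subseteq> ball 0 1"
      "\<And>z. z \<in> ball 0 1 \<Longrightarrow> F (G z) = z" "\<And>z. z \<in> ball 0 1 \<Longrightarrow> G (F z) = z"
    using ball_biholomorphism_exists[of "f z0"] fg(3) z0 D_def by metis
  define \<phi> where "\<phi> = g \<circ> G"
  define \<psi> where "\<psi> = F \<circ> f"
  have \<phi>: "\<phi> holomorphic_on ball 0 1" "\<phi> ` ball 0 1 \<subseteq> D"
    unfolding \<phi>_def using FG fg by (auto intro!: holomorphic_on_compose_gen[of G _ g "ball 0 1"])
  have \<psi>: "\<psi> holomorphic_on D" "\<psi> ` D \<subseteq> ball 0 1"
    unfolding \<psi>_def using FG fg by (auto intro!: holomorphic_on_compose_gen[of f D F "ball 0 1"])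
  have \<phi>\<psi>: "\<phi> (\<psi> z) = z" if "z \<in> D" for z using fg(3)[OF that] FG by (simp add: \<phi>_def \<psi>_def)
  have \<psi>\<phi>: "\<psi> (\<phi> z) = z" if "z \<in> ball 0 1" for z
    using FG(5,6) fg(4) that by (auto simp: \<phi>_def \<psi>_def image_subset_iff)
  have \<phi>0: "\<phi> 0 = z0" using FG(1) FG(7)[of "f z0"] fg(3)[of z0] z0 by (auto simp: \<phi>_def D_def)
  have "uniformly_continuous_on D \<psi>"
  proof (rule uniformly_continuous_from_oscillation[OF D(3)])
    fix a and e :: real assume a: "a \<in> closure D" and e: "0 < e"
    show "\<exists>d>0. \<forall>z\<in>D. \<forall>w\<in>D. dist z a < d \<longrightarrow> dist w a < d \<longrightarrow> dist (\<psi> z) (\<psi> w) < e"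
    proof (cases "a \<in> D")
      case True
      have "continuous_on D \<psi>" using \<psi> by (simp add: holomorphic_on_imp_continuous_on)
      then obtain d where "d > 0" "\<And>z. z \<in> D \<Longrightarrow> dist z a < d \<Longrightarrow> dist (\<psi> z) (\<psi> a) < e / 2"
        using True e unfolding continuous_on_iff by (meson half_gt_zero)
      then show ?thesis by (meson dist_triangle_half_l)
    next
      case False
      then have "a \<in> path_image c" using a clD by blast
      then obtain d where "0 < d" "\<And>z w. \<lbrakk>z \<in> D; w \<in> D; dist z a < d; dist w a < d\<rbrakk> \<Longrightarrow> dist (\<psi> z) (\<psi> w) < e"
        using boundary_oscillation[OF c \<phi>[unfolded D_def] \<psi>[unfolded D_def] \<phi>\<psi>[unfolded D_def] _ e]
        unfolding D_def by metis
      then show ?thesis by blast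
    qed
  qed
  then obtain h where h: "uniformly_continuous_on (closure D) h" "\<And>x. x \<in> D \<Longrightarrow> \<psi> x = h x"
    using uniformly_continuous_on_extension_on_closure by metis
  have hc: "continuous_on (closure D) h" using h by (simp add: uniformly_continuous_imp_continuous)
  have hle: "h ` closure D \<subseteq> cball 0 1"
    by (rule image_closure_subset[OF hc]) (use \<psi>(2) h(2) in auto)
  have hb: "norm (h a) = 1" if a: "a \<in> path_image c" for a
  proof (rule ccontr)
    assume ne: "norm (h a) \<noteq> 1"
    have acl: "a \<in> closure D" using a clD by blast
    then have u: "h a \<in> ball 0 1" using hle ne by (force simp: image_subset_iff)
    obtain x where x: "\<And>n. x n \<in> D" "x \<longlonglongrightarrow> a" using acl closure_sequential by metis
    have "(\<lambda>n. h (x n)) \<longlonglongrightarrow> h a"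
      using hc acl x closure_subset[of D] unfolding continuous_on_sequentially by (simp add: o_def subset_iff)
    then have "(\<lambda>n. \<psi> (x n)) \<longlonglongrightarrow> h a" using h(2) x by simp
    moreover have "isCont \<phi> (h a)"
      using u holomorphic_on_imp_continuous_on[OF \<phi>(1)] by (metis continuous_on_eq_continuous_at open_ball)
    ultimately have "(\<lambda>n. \<phi> (\<psi> (x n))) \<longlonglongrightarrow> \<phi> (h a)" by (rule isCont_tendsto_compose[rotated])
    then have "x \<longlonglongrightarrow> \<phi> (h a)" using \<phi>\<psi> x(1) by simp
    then have "a = \<phi> (h a)" using x(2) LIMSEQ_unique by blast
    then show False using \<phi>(2) u a dis by blast
  qed
  have him: "h ` closure D = cball 0 1"
  proof
    have "ball 0 1 \<subseteq> h ` closure D"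
    proof
      fix u :: complex assume u: "u \<in> ball 0 1"
      then have "\<phi> u \<in> D" "h (\<phi> u) = u" using \<phi>(2) \<psi>\<phi>[OF u] h(2) by (auto simp: image_subset_iff)
      then show "u \<in> h ` closure D" using closure_subset by (metis image_eqI subsetD)
    qed
    moreover have "closed (h ` closure D)"
      using D(3) hc by (simp add: compact_closure compact_continuous_image compact_imp_closed)
    ultimately show "cball 0 1 \<subseteq> h ` closure D"
      using closure_minimal[of "ball 0 1" "h ` closure D"] closure_ball[of 1 "0::complex"] by simp
  qed (rule hle)
  have inj: "inj_on h (closure D)"
  proof (rule inj_onI, rule ccontr)
    fix a b assume ab: "a \<in> closure D" "b \<in> closure D" "h a = h b" "a \<noteq> b"
    have inD: "norm (h x) < 1" if "x \<in> D" for x using \<psi>(2) h(2) that by force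
    have "a \<notin> D \<or> b \<notin> D" using ab h(2) \<phi>\<psi> by metis
    then have ab': "a \<in> path_image c" "b \<in> path_image c" using ab inD hb clD by (metis UnE less_irrefl)+
    define \<zeta> where "\<zeta> = h a"
    have n\<zeta>: "norm \<zeta> = 1" using hb ab' by (simp add: \<zeta>_def)
    define K where "K = (\<lambda>n::nat. closure (\<phi> ` (ball \<zeta> (1 / Suc n) \<inter> ball 0 1)))"
    \<comment> \<open>\<open>L\<close> turns out to be the fibre of \<open>h\<close> over \<open>\<zeta>\<close>.\<close>
    define L where "L = \<Inter>(range K)"
    have Kc: "K n \<subseteq> closure D" for n unfolding K_def using \<phi>(2) by (intro closure_mono) auto
    have "connected L" unfolding L_def
    proof (rule connected_nest)
      fix n
      show "compact (K n)" using Kc[of n] D(3) by (metis K_def bounded_closure bounded_subset closed_closure compact_eq_bounded_closed)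
      have "connected (ball \<zeta> (1 / Suc n) \<inter> ball 0 1)" by (intro convex_connected convex_Int convex_ball)
      then show "connected (K n)" unfolding K_def
        using \<phi>(1) by (intro connected_imp_connected_closure connected_continuous_image)
          (auto intro: continuous_on_subset holomorphic_on_imp_continuous_on)
    next
      fix m n :: nat assume "m \<le> n"
      then have "1 / Suc n \<le> 1 / real (Suc m)" by (simp add: frac_le)
      then have "ball \<zeta> (1 / Suc n) \<subseteq> ball \<zeta> (1 / Suc m)" by (rule subset_ball)
      then show "K n \<subseteq> K m" unfolding K_def by (intro closure_mono) auto
    qed
    have L: "x \<in> L" if x: "x \<in> closure D" "h x = \<zeta>" for x
      unfolding L_def K_def
    proof (clarsimp)
      fix n :: nat
      obtain y where y: "\<And>n. y n \<in> D" "y \<longlonglongrightarrow> x" using x closure_sequential by metis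
      have "(\<lambda>n. h (y n)) \<longlonglongrightarrow> h x"
        using hc x(1) y closure_subset[of D] unfolding continuous_on_sequentially by (simp add: o_def subset_iff)
      then have "\<forall>\<^sub>F k in sequentially. dist (h (y k)) \<zeta> < 1 / Suc n"
        using x by (intro tendstoD) auto
      then have "\<forall>\<^sub>F k in sequentially. y k \<in> \<phi> ` (ball \<zeta> (1 / Suc n) \<inter> ball 0 1)"
      proof (rule eventually_mono)
        fix k assume "dist (h (y k)) \<zeta> < 1 / Suc n"
        then show "y k \<in> \<phi> ` (ball \<zeta> (1 / Suc n) \<inter> ball 0 1)"
          using y(1)[of k] h(2) \<phi>\<psi> \<psi>(2) by (intro image_eqI[of _ _ "\<psi> (y k)"]) (auto simp: dist_commute image_subset_iff)
      qed
      then show "x \<in> closure (\<phi> ` (ball \<zeta> (1 / (1 + real n)) \<inter> ball 0 1))"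
        using y(2) by (intro Lim_in_closed_set[OF closed_closure _ sequentially_bot y(2)])
          (auto elim!: eventually_mono intro: subsetD[OF closure_subset])
    qed
    have L\<zeta>: "h x = \<zeta>" "x \<in> closure D" if "x \<in> L" for x
    proof -
      show xD: "x \<in> closure D" using that Kc by (auto simp: L_def)
      have "dist \<zeta> (h x) \<le> 1 / Suc n" for n
      proof -
        have "h ` K n \<subseteq> cball \<zeta> (1 / Suc n)" unfolding K_def
        proof (rule image_closure_subset)
          show "continuous_on (closure (\<phi> ` (ball \<zeta> (1 / Suc n) \<inter> ball 0 1))) h"
            using hc Kc[of n] by (auto simp: K_def elim: continuous_on_subset)
          show "h ` \<phi> ` (ball \<zeta> (1 / Suc n) \<inter> ball 0 1) \<subseteq> cball \<zeta> (1 / Suc n)"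
            using \<phi>(2) \<psi>\<phi> h(2) by (auto simp: image_subset_iff)
        qed auto
        then show ?thesis using that by (simp add: L_def image_subset_iff)
      qed
      then have "dist \<zeta> (h x) \<le> 0"
        using LIMSEQ_le_const[OF LIMSEQ_inverse_real_of_nat] by (metis inverse_eq_divide)
      then show "h x = \<zeta>" by simp
    qed
    have Lsub: "L \<subseteq> path_image c" using L\<zeta> n\<zeta> inD clD by force
    obtain x r where x: "x \<in> path_image c" "0 < r" "path_image c \<inter> ball x r \<subseteq> L"
      by (rule Jordan_curve_connected_subset[OF c \<open>connected L\<close> Lsub, of a b])
         (use L ab in \<open>auto simp: \<zeta>_def\<close>)
    obtain z where "z \<in> D" "h z - \<zeta> = 0"
    proof (rule holomorphic_zero_on_boundary_piece[of D "\<lambda>z. h z - \<zeta>" r x])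
      show "(\<lambda>z. h z - \<zeta>) holomorphic_on D"
        using holomorphic_transform[OF \<psi>(1) h(2)] by (intro holomorphic_intros)
      show "x \<in> closure D" using x clD by blast
      have "outside (path_image c) \<inter> closure D = {}" using J clD unfolding D_def by blast
      then have "outside (path_image c) \<subseteq> - closure D" by blast
      moreover have "x \<in> closure (outside (path_image c))"
        using J x(1) unfolding closure_Un_frontier by simp
      ultimately show "x \<in> closure (- closure D)" using closure_mono by blast
      show "h z - \<zeta> = 0" if "z \<in> frontier D" "dist x z < r" for z
        using that x D(5) L\<zeta> by auto
      show "continuous_on (closure D) (\<lambda>z. h z - \<zeta>)" using hc by (intro continuous_intros)
    qed (use D x in auto)
    then show False using inD[of z] n\<zeta> by simp
  qed
  obtain k where k: "homeomorphism (closure D) (cball 0 1) h k"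
    using homeomorphism_compact[OF _ hc him inj] D(3) by (auto simp: compact_closure)
  have k\<phi>: "k u = \<phi> u" if u: "u \<in> ball 0 1" for u
  proof -
    have "\<phi> u \<in> D" "h (\<phi> u) = u" using \<phi>(2) \<psi>\<phi>[OF u] h(2) u by (auto simp: image_subset_iff)
    moreover have "k (h x) = x" if "x \<in> closure D" for x using k that by (simp add: homeomorphism_def)
    ultimately show ?thesis using closure_subset[of D] by (metis subsetD)
  qed
  show thesis
  proof
    show "k holomorphic_on ball 0 1" by (rule holomorphic_transform[OF \<phi>(1)]) (simp add: k\<phi>)
    show "k 0 = z0" by (simp add: k\<phi> \<phi>0)
    show "homeomorphism (cball 0 1) (closure (inside (path_image c))) k h"
      using k homeomorphism_sym unfolding D_def by blast
    show b: "k ` ball 0 1 = inside (path_image c)"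
    proof -
      have "k ` ball 0 1 = \<phi> ` ball 0 1" using k\<phi> by (intro image_cong) auto
      also have "\<dots> = D"
      proof
        show "D \<subseteq> \<phi> ` ball 0 1"
        proof
          fix z assume "z \<in> D"
          then have "z = \<phi> (\<psi> z)" "\<psi> z \<in> ball 0 1" using \<phi>\<psi> \<psi>(2) by auto
          then show "z \<in> \<phi> ` ball 0 1" by (rule image_eqI)
        qed
      qed (rule \<phi>(2))
      finally show ?thesis by (simp add: D_def)
    qed
    have "k ` cball 0 1 = D \<union> path_image c" using homeomorphism_image2[OF k] clD by simp
    moreover have "k ` sphere 0 1 = k ` cball 0 1 - k ` ball 0 1"
    proof -
      have "inj_on k (cball 0 1)" using k unfolding homeomorphism_def by (intro inj_on_inverseI[of _ h]) simp
      moreover have "sphere (0::complex) 1 = cball 0 1 - ball 0 1" by auto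
      moreover have "cball 0 1 - ball 0 1 \<subseteq> cball (0::complex) 1" "ball 0 1 \<subseteq> cball (0::complex) 1" by auto
      ultimately show ?thesis using inj_on_image_set_diff[of k "cball 0 1" "cball 0 1" "ball 0 1"] by simp
    qed
    ultimately have "k ` sphere 0 1 = (D \<union> path_image c) - D" using b by (simp only: D_def)
    also have "\<dots> = path_image c" using dis by blast
    finally show "k ` sphere 0 1 = path_image c" .
  qed
qed

section \<open>The Schoenflies theorem\<close>

lemma homeomorphism_glue:
  fixes f1 :: "'a::topological_space \<Rightarrow> 'b::topological_space"
  assumes h1: "homeomorphism A A' f1 g1" and h2: "homeomorphism B B' f2 g2"
    and cl: "closed A" "closed B" "closed A'" "closed B'" and un: "A \<union> B = UNIV" "A' \<union> B' = UNIV"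
    and eq: "\<And>x. x \<in> A \<Longrightarrow> x \<in> B \<Longrightarrow> f1 x = f2 x" "\<And>y. y \<in> A' \<Longrightarrow> y \<in> B' \<Longrightarrow> g1 y = g2 y"
  shows "homeomorphism UNIV UNIV (\<lambda>x. if x \<in> A then f1 x else f2 x) (\<lambda>y. if y \<in> A' then g1 y else g2 y)"
    (is "homeomorphism _ _ ?f ?g")
proof (rule homeomorphismI)
  have c: "continuous_on A f1" "continuous_on B f2" "continuous_on A' g1" "continuous_on B' g2"
    using h1 h2 by (auto simp: homeomorphism_def)
  have "continuous_on (A \<union> B) ?f"
    by (rule continuous_on_cases) (use c cl eq in auto)
  then show "continuous_on UNIV ?f" by (simp add: un)
  have "continuous_on (A' \<union> B') ?g"
    by (rule continuous_on_cases) (use c cl eq in auto)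
  then show "continuous_on UNIV ?g" by (simp add: un)
  have im: "f1 x \<in> A'" "g1 (f1 x) = x" if "x \<in> A" for x using h1 that by (auto simp: homeomorphism_def)
  have im2: "f2 x \<in> B'" "g2 (f2 x) = x" if "x \<in> B" for x using h2 that by (auto simp: homeomorphism_def)
  have im': "g1 x \<in> A" "f1 (g1 x) = x" if "x \<in> A'" for x using h1 that by (auto simp: homeomorphism_def)
  have im2': "g2 x \<in> B" "f2 (g2 x) = x" if "x \<in> B'" for x using h2 that by (auto simp: homeomorphism_def)
  show "?g (?f x) = x" for x
  proof (cases "x \<in> A")
    case False
    then have "x \<in> B" using un by blast
    then show ?thesis using False im2[of x] eq(2)[of "f2 x"] by simp
  qed (simp add: im)
  show "?f (?g x) = x" for x
  proof (cases "x \<in> A'")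
    case False
    then have "x \<in> B'" using un by blast
    then show ?thesis using False im2'[of x] eq(1)[of "g2 x"] by simp
  qed (simp add: im')
qed auto

text \<open>A homeomorphism of the unit circle extends to its exterior by acting on directions only.\<close>

lemma homeomorphism_radial_extension:
  fixes \<tau> \<sigma> :: "complex \<Rightarrow> complex"
  assumes "homeomorphism (sphere (0::complex) 1) (sphere 0 1) \<tau> \<sigma>"
  shows "homeomorphism {z. 1 \<le> norm z} {z. 1 \<le> norm z}
           (\<lambda>z. of_real (norm z) * \<tau> (sgn z)) (\<lambda>z. of_real (norm z) * \<sigma> (sgn z))"
proof -
  have *: "continuous_on {z. 1 \<le> norm z} (\<lambda>z. of_real (norm z) * \<alpha> (sgn z))"
      "norm (of_real (norm z) * \<alpha> (sgn z)) = norm z"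
      "1 \<le> norm z \<Longrightarrow> of_real (norm (of_real (norm z) * \<alpha> (sgn z))) * \<beta> (sgn (of_real (norm z) * \<alpha> (sgn z))) = z"
    if h: "homeomorphism (sphere (0::complex) 1) (sphere 0 1) \<alpha> \<beta>" and "1 \<le> norm z" for \<alpha> \<beta> :: "complex \<Rightarrow> complex" and z
  proof -
    have \<alpha>: "continuous_on (sphere 0 1) \<alpha>" "\<And>x. norm x = 1 \<Longrightarrow> norm (\<alpha> x) = 1 \<and> \<beta> (\<alpha> x) = x"
      using h by (auto simp: homeomorphism_def)
    show "continuous_on {z. 1 \<le> norm z} (\<lambda>z. of_real (norm z) * \<alpha> (sgn z))"
      by (intro continuous_intros continuous_on_compose2[OF \<alpha>(1)]) (auto simp: norm_sgn)
    have n: "norm (sgn z) = 1" using that by (auto simp: norm_sgn)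
    then show 1: "norm (of_real (norm z) * \<alpha> (sgn z)) = norm z" using \<alpha>(2) by (simp add: norm_mult)
    have "sgn (norm z) = (1::real)" using n by (cases "z = 0") auto
    then have "sgn (of_real (norm z) * \<alpha> (sgn z)) = \<alpha> (sgn z)"
      using \<alpha>(2)[OF n] by (simp add: sgn_mult sgn_of_real sgn_eq[of "\<alpha> (sgn z)"])
    then show "of_real (norm (of_real (norm z) * \<alpha> (sgn z))) * \<beta> (sgn (of_real (norm z) * \<alpha> (sgn z))) = z"
      unfolding 1 using \<alpha>(2)[OF n] that by (simp add: sgn_eq)
  qed
  show ?thesis
  proof (rule homeomorphismI)
    show "continuous_on {z. 1 \<le> norm z} (\<lambda>z. of_real (norm z) * \<tau> (sgn z))"
      using *(1)[OF assms, of 1] by simp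
    show "continuous_on {z. 1 \<le> norm z} (\<lambda>z. of_real (norm z) * \<sigma> (sgn z))"
      using *(1)[OF homeomorphism_symD[OF assms], of 1] by simp
    show "(\<lambda>z. of_real (norm z) * \<tau> (sgn z)) ` {z. 1 \<le> norm z} \<subseteq> {z. 1 \<le> norm z}"
      using *(2)[OF assms] by auto
    show "(\<lambda>z. of_real (norm z) * \<sigma> (sgn z)) ` {z. 1 \<le> norm z} \<subseteq> {z. 1 \<le> norm z}"
      using *(2)[OF homeomorphism_symD[OF assms]] by auto
  qed (use *(3)[OF assms] *(3)[OF homeomorphism_symD[OF assms]] in auto)
qed

lemma Jordan_sides:
  fixes c :: "real \<Rightarrow> complex"
  assumes "simple_path c" "pathfinish c = pathstart c"
  shows "open (inside (path_image c))" "connected (inside (path_image c))" "inside (path_image c) \<noteq> {}"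
    "open (outside (path_image c))" "connected (outside (path_image c))" "outside (path_image c) \<noteq> {}"
    "bounded (inside (path_image c))"
    "frontier (inside (path_image c)) = path_image c" "frontier (outside (path_image c)) = path_image c"
    "inside (path_image c) \<inter> outside (path_image c) = {}"
    "inside (path_image c) \<inter> path_image c = {}" "outside (path_image c) \<inter> path_image c = {}"
    "inside (path_image c) \<union> outside (path_image c) \<union> path_image c = UNIV"
  using Jordan_inside_outside[OF assms] by blast+

lemma Jordan_connected_cases:
  fixes c :: "real \<Rightarrow> complex"
  assumes c: "simple_path c" "pathfinish c = pathstart c" and S: "connected S" "S \<inter> path_image c = {}"
  shows "S \<subseteq> inside (path_image c) \<or> S \<subseteq> outside (path_image c)"
proof -
  note J = Jordan_sides[OF c]
  have "S \<subseteq> inside (path_image c) \<union> outside (path_image c)" using J(13) S(2) by blast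
  moreover have "inside (path_image c) \<inter> outside (path_image c) \<inter> S = {}" using J(10) by blast
  ultimately have "inside (path_image c) \<inter> S = {} \<or> outside (path_image c) \<inter> S = {}"
    using connectedD[OF S(1), of "inside (path_image c)" "outside (path_image c)"] J(1,4) by blast
  then show ?thesis using \<open>S \<subseteq> inside (path_image c) \<union> outside (path_image c)\<close> by blast
qed

text \<open>Inversion at a point inside the curve exchanges the inside and the outside, with the centre and
infinity swapped.\<close>

lemma inside_inversion:
  fixes c :: "real \<Rightarrow> complex"
  assumes c: "simple_path c" "pathfinish c = pathstart c" and z0: "z0 \<in> inside (path_image c)"
  defines "c' \<equiv> (\<lambda>z. 1 / (z - z0)) \<circ> c"
  shows "simple_path c'" "pathfinish c' = pathstart c'" "path_image c' = (\<lambda>z. 1 / (z - z0)) ` path_image c"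
    "inside (path_image c') = insert 0 ((\<lambda>z. 1 / (z - z0)) ` outside (path_image c))"
proof -
  note J = Jordan_sides[OF c]
  define \<iota> where "\<iota> = (\<lambda>z. 1 / (z - z0))"
  have inj: "inj \<iota>" by (auto simp: inj_on_def \<iota>_def)
  have cont: "continuous_on S \<iota>" if "z0 \<notin> S" for S
    unfolding \<iota>_def using that by (intro continuous_intros) auto
  have z0c: "z0 \<notin> path_image c" "z0 \<notin> outside (path_image c)" using J(10,11) z0 by blast+
  show c': "simple_path c'"
    unfolding c'_def \<iota>_def[symmetric]
    by (rule simple_path_continuous_image[OF c(1) cont[OF z0c(1)]]) (rule inj_on_subset[OF inj], simp)
  show "pathfinish c' = pathstart c'"
    unfolding c'_def by (simp add: pathstart_compose pathfinish_compose c(2))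
  show im: "path_image c' = (\<lambda>z. 1 / (z - z0)) ` path_image c" by (simp add: c'_def path_image_compose)
  note c' = \<open>simple_path c'\<close> \<open>pathfinish c' = pathstart c'\<close>
  note J' = Jordan_sides[OF c']
  \<comment> \<open>\<open>Out\<close> and \<open>In\<close> are the candidates for the two sides of the inverted curve; \<open>In\<close> is unbounded since \<open>z0\<close> is inside.\<close>
  define Out where "Out = insert 0 (\<iota> ` outside (path_image c))"
  define In where "In = \<iota> ` (inside (path_image c) - {z0})"
  have ipc: "path_image c' = \<iota> ` path_image c" by (simp add: im \<iota>_def)
  have \<iota>0: "\<iota> z = 0 \<longleftrightarrow> z = z0" for z by (simp add: \<iota>_def)
  have cover: "w = \<iota> (z0 + 1 / w)" if "w \<noteq> 0" for w using that by (simp add: \<iota>_def)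
  have dis: "In \<inter> Out = {}" "In \<inter> path_image c' = {}" "Out \<inter> path_image c' = {}"
  proof -
    have n0: "0 \<notin> \<iota> ` A" if z: "z0 \<notin> A" for A
    proof
      assume "0 \<in> \<iota> ` A"
      then obtain z where "z \<in> A" "\<iota> z = 0" by auto
      then show False using \<iota>0[of z] z by simp
    qed
    have *: "\<iota> ` A \<inter> \<iota> ` B = {}" if "A \<inter> B = {}" for A B
      unfolding image_Int[OF inj, symmetric] that by simp
    have "(inside (path_image c) - {z0}) \<inter> outside (path_image c) = {}"
      "(inside (path_image c) - {z0}) \<inter> path_image c = {}" using J(10,11) by blast+
    then show "In \<inter> Out = {}" "In \<inter> path_image c' = {}" "Out \<inter> path_image c' = {}"
      unfolding In_def Out_def ipc using n0[of "inside (path_image c) - {z0}"] n0[OF z0c(1)] *[OF J(12)]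
      by (simp_all add: *)
  qed
  have all: "In \<union> Out = - path_image c'"
  proof -
    have "w \<in> In \<union> Out \<union> path_image c'" for w
    proof (cases "w = 0")
      case False
      have "z0 + 1 / w \<noteq> z0" using False by simp
      moreover have "z0 + 1 / w \<in> inside (path_image c) \<union> outside (path_image c) \<union> path_image c" using J(13) by blast
      ultimately show ?thesis using cover[OF False] unfolding In_def Out_def ipc by blast
    qed (simp add: Out_def)
    then show ?thesis using dis by blast
  qed
  obtain B where B: "B > 0" "inside (path_image c) \<union> path_image c \<subseteq> ball 0 B"
  proof -
    have "bounded (inside (path_image c) \<union> path_image c)"
      using J(7) c(1) by (simp add: bounded_simple_path_image)
    then show thesis using that bounded_subset_ballD[of _ 0] by blast
  qed
  have conIn: "connected In" unfolding In_def
  proof (rule connected_continuous_image)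
    show "connected (inside (path_image c) - {z0})"
      by (rule connected_open_delete) (use J(1,2) in simp_all)
  qed (simp add: cont)
  have zero_cl: "0 \<in> closure (\<iota> ` outside (path_image c))"
    unfolding closure_approachable
  proof (intro allI impI)
    fix e :: real assume e: "0 < e"
    define r where "r = max B (1 / e) + norm z0 + 1"
    have "1 / e < r - norm z0" "B < r" "norm z0 < r"
      using B norm_ge_zero[of z0] max.cobounded1[of B "1/e"] max.cobounded2[of "1/e" B]
      unfolding r_def by linarith+
    have "of_real r \<notin> inside (path_image c) \<union> path_image c" using B \<open>B < r\<close> by (auto simp: subset_iff)
    then have "of_real r \<in> outside (path_image c)" using J(13) by blast
    moreover have "dist (\<iota> (of_real r)) 0 < e"
    proof -
      have "norm (of_real r - z0) \<ge> r - norm z0" using norm_triangle_ineq2[of "of_real r" z0] B \<open>B < r\<close> by simp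
      then have "1 / e < norm (of_real r - z0)" using \<open>1 / e < r - norm z0\<close> by simp
      then show ?thesis using e \<open>norm z0 < r\<close>
        by (simp add: \<iota>_def norm_divide divide_simps mult.commute) 
    qed
    ultimately show "\<exists>y\<in>\<iota> ` outside (path_image c). dist y 0 < e" by blast
  qed
  have conOut: "connected Out"
  proof -
    have "connected (\<iota> ` outside (path_image c))"
      by (rule connected_continuous_image[OF cont[OF z0c(2)]]) (rule J(5))
    moreover have "Out \<subseteq> closure (\<iota> ` outside (path_image c))" "\<iota> ` outside (path_image c) \<subseteq> Out"
      using zero_cl closure_subset[of "\<iota> ` outside (path_image c)"] by (auto simp: Out_def)
    ultimately show ?thesis using connected_intermediate_closure by blast
  qed
  have "\<not> bounded In"
  proof
    assume "bounded In"
    then obtain b where b: "b > 0" "\<And>w. w \<in> In \<Longrightarrow> norm w \<le> b" unfolding bounded_pos by blast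
    obtain s where s: "s > 0" "ball z0 s \<subseteq> inside (path_image c)" using J(1) z0 open_contains_ball by blast
    define t where "t = min (s / 2) (1 / (2 * b))"
    have t: "0 < t" "t < s" "t \<le> 1 / (2 * b)" using s b by (auto simp: t_def)
    have "z0 + of_real t \<in> inside (path_image c) - {z0}" using s t by (auto simp: subset_iff dist_norm)
    then have "norm (\<iota> (z0 + of_real t)) \<le> b" using b by (auto simp: In_def)
    then have "1 / t \<le> b" using t by (simp add: \<iota>_def norm_divide)
    then have "1 \<le> b * t" using t by (simp add: field_simps)
    also have "\<dots> \<le> b * (1 / (2 * b))" using t b by (intro mult_left_mono) auto
    finally show False using b by simp
  qed
  then have "\<not> In \<subseteq> inside (path_image c')" using J'(7) bounded_subset by blast
  then have "In \<subseteq> outside (path_image c')" using Jordan_connected_cases[OF c' conIn dis(2)] by blast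
  then have "inside (path_image c') \<subseteq> Out" using all J'(10,11) by blast
  moreover have "Out \<subseteq> inside (path_image c')"
    using Jordan_connected_cases[OF c' conOut dis(3)] calculation J'(3,10) by blast
  ultimately have "inside (path_image c') = Out" by (rule equalityI)
  then show "inside (path_image c') = insert 0 ((\<lambda>z. 1 / (z - z0)) ` outside (path_image c))"
    unfolding Out_def \<iota>_def .
qed

text \<open>The inside is parametrised by \<open>Caratheodory_extension\<close>. Inversion reduces the outside to the inside
of the inverted curve. The two parametrisations differ on the unit circle by a homeomorphism, which
is absorbed by its radial extension to the exterior.\<close>

theorem Schoenflies:
  fixes c :: "real \<Rightarrow> complex"
  assumes c: "simple_path c" "pathfinish c = pathstart c" and z0: "z0 \<in> inside (path_image c)"
  obtains \<Theta> \<Theta>' where "homeomorphism UNIV UNIV \<Theta> \<Theta>'" "\<Theta> holomorphic_on ball 0 1" "\<Theta> 0 = z0"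
    "\<Theta> ` ball 0 1 = inside (path_image c)" "\<Theta> ` sphere 0 1 = path_image c"
proof -
  note J = Jordan_sides[OF c]
  define D where "D = inside (path_image c)"
  obtain \<phi> \<eta> where \<phi>: "\<phi> holomorphic_on ball 0 1" "\<phi> 0 = z0" "homeomorphism (cball 0 1) (closure D) \<phi> \<eta>"
    "\<phi> ` ball 0 1 = D" "\<phi> ` sphere 0 1 = path_image c"
    using Caratheodory_extension[OF c z0, folded D_def] by blast
  define c' where "c' = (\<lambda>z. 1 / (z - z0)) \<circ> c"
  note inv = inside_inversion[OF c z0, folded c'_def]
  have "0 \<in> inside (path_image c')" by (simp add: inv(4))
  from Caratheodory_extension[OF inv(1,2) this] obtain \<omega> \<kappa> where "\<omega> holomorphic_on ball 0 1"
    and \<omega>: "\<omega> 0 = 0" "homeomorphism (cball 0 1) (closure (inside (path_image c'))) \<omega> \<kappa>"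
      "\<omega> ` ball 0 1 = inside (path_image c')" "\<omega> ` sphere 0 1 = path_image c'"
    by blast
  note J' = Jordan_sides[OF inv(1,2)]
  define D' where "D' = closure (inside (path_image c'))"
  have D'eq: "D' = insert 0 ((\<lambda>z. 1 / (z - z0)) ` (- D))"
  proof -
    have "D' = inside (path_image c') \<union> path_image c'" unfolding D'_def using J'(8) by (metis closure_Un_frontier)
    also have "\<dots> = insert 0 ((\<lambda>z. 1 / (z - z0)) ` (outside (path_image c) \<union> path_image c))"
      unfolding inv(4) image_Un using inv(3) by simp
    also have "outside (path_image c) \<union> path_image c = - D" using J(10,11,13) unfolding D_def by blast
    finally show ?thesis .
  qed
  have z0D: "z0 \<in> D" using z0 by (simp add: D_def)
  have \<omega>h: "continuous_on (cball 0 1) \<omega>" "continuous_on D' \<kappa>" "\<And>u. norm u \<le> 1 \<Longrightarrow> \<omega> u \<in> D' \<and> \<kappa> (\<omega> u) = u"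
    "\<And>w. w \<in> D' \<Longrightarrow> norm (\<kappa> w) \<le> 1 \<and> \<omega> (\<kappa> w) = w"
    using \<omega>(2) unfolding homeomorphism_def D'_def[symmetric] by (auto simp: image_iff) 
  define E where "E = (\<lambda>u. z0 + 1 / \<omega> (1 / u))"
  define E' where "E' = (\<lambda>z. 1 / \<kappa> (1 / (z - z0)))"
  have inv_le: "norm (1 / u) \<le> 1" if "1 \<le> norm u" for u :: complex using that by (auto simp: norm_divide divide_le_eq)
  have \<omega>0: "\<omega> (1 / u) \<noteq> 0" if "1 \<le> norm u" for u
    using \<omega>h(3)[OF inv_le[OF that]] \<omega>h(3)[of 0] \<omega>(1) that by force
  have \<kappa>0: "1 / (z - z0) \<in> D'" "\<kappa> (1 / (z - z0)) \<noteq> 0" if "z \<notin> D" for z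
  proof -
    show "1 / (z - z0) \<in> D'" using that by (auto simp: D'eq)
    then have "\<omega> (\<kappa> (1 / (z - z0))) = 1 / (z - z0)" using \<omega>h(4) by blast
    then show "\<kappa> (1 / (z - z0)) \<noteq> 0" using \<omega>(1) that z0D by force
  qed
  have E: "homeomorphism {u. 1 \<le> norm u} (- D) E E'"
  proof (rule homeomorphismI)
    show "continuous_on {u. 1 \<le> norm u} E"
      unfolding E_def using \<omega>0 inv_le
      by (intro continuous_intros continuous_on_compose2[OF \<omega>h(1)]) (auto simp: norm_divide)
    show "continuous_on (- D) E'"
      unfolding E'_def using \<kappa>0 z0D
      by (intro continuous_intros continuous_on_compose2[OF \<omega>h(2)]) auto
    show "E ` {u. 1 \<le> norm u} \<subseteq> - D"
    proof clarify
      fix u :: complex assume u: "1 \<le> norm u" "E u \<in> D"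
      have "\<omega> (1 / u) \<in> D'" "\<omega> (1 / u) \<noteq> 0" using \<omega>h(3)[OF inv_le[OF u(1)]] \<omega>0[OF u(1)] by auto
      then obtain z where z: "z \<notin> D" "\<omega> (1 / u) = 1 / (z - z0)" by (auto simp: D'eq)
      then have "E u = z" using z0D by (simp add: E_def)
      then show False using z u by simp
    qed
    show "E' ` (- D) \<subseteq> {u. 1 \<le> norm u}"
    proof clarify
      fix z assume "z \<notin> D"
      then have "norm (\<kappa> (1 / (z - z0))) \<le> 1" "\<kappa> (1 / (z - z0)) \<noteq> 0" using \<kappa>0 \<omega>h(4) by blast+
      then show "1 \<le> norm (E' z)" by (simp add: E'_def norm_divide divide_simps)
    qed
    show "E' (E u) = u" if "u \<in> {u. 1 \<le> norm u}" for u
      using that \<omega>0[of u] \<omega>h(3)[OF inv_le, of u] by (simp add: E_def E'_def)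
    show "E (E' z) = z" if "z \<in> - D" for z
      using that \<kappa>0[of z] \<omega>h(4) by (simp add: E_def E'_def)
  qed
  have E1: "E ` sphere 0 1 = path_image c"
  proof -
    have "(\<lambda>u. 1 / u) ` sphere (0::complex) 1 = sphere 0 1"
    proof
      show "sphere 0 1 \<subseteq> (\<lambda>u. 1 / u) ` sphere (0::complex) 1"
        by (rule subsetI, rule_tac x = "1 / x" in image_eqI) (auto simp: norm_divide)
    qed (auto simp: norm_divide)
    then have "E ` sphere 0 1 = (\<lambda>w. z0 + 1 / w) ` \<omega> ` sphere 0 1"
      unfolding E_def by (metis (no_types, lifting) image_image image_cong)
    also have "\<dots> = (\<lambda>z. z0 + 1 / (1 / (z - z0))) ` path_image c"
      unfolding \<omega>(4) inv(3) by (simp add: image_image)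
    also have "\<dots> = path_image c" by simp
    finally show ?thesis .
  qed
  have \<phi>h: "homeomorphism (sphere 0 1) (path_image c) \<phi> \<eta>"
    by (rule homeomorphism_of_subsets[OF \<phi>(3) sphere_cball empty_subsetI \<phi>(5)])
  have Eh: "homeomorphism (sphere 0 1) (path_image c) E E'"
    by (rule homeomorphism_of_subsets[OF E _ empty_subsetI E1]) auto
  have \<tau>: "homeomorphism (sphere 0 1) (sphere 0 1) (E' \<circ> \<phi>) (\<eta> \<circ> E)"
    by (rule homeomorphism_compose[OF \<phi>h homeomorphism_symD[OF Eh]])
  \<comment> \<open>On the unit circle \<open>E' \<circ> \<phi>\<close> measures the mismatch of the two parametrisations.\<close>
  define \<rho> where "\<rho> = (\<lambda>z. of_real (norm z) * (E' \<circ> \<phi>) (sgn z))"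
  define \<rho>' where "\<rho>' = (\<lambda>z. of_real (norm z) * (\<eta> \<circ> E) (sgn z))"
  have "homeomorphism {z. 1 \<le> norm z} {z. 1 \<le> norm z} \<rho> \<rho>'"
    unfolding \<rho>_def \<rho>'_def by (rule homeomorphism_radial_extension[OF \<tau>])
  then have ext: "homeomorphism {z. 1 \<le> norm z} (- D) (E \<circ> \<rho>) (\<rho>' \<circ> E')"
    using homeomorphism_compose E by blast
  have on1: "(E \<circ> \<rho>) z = \<phi> z" if "norm z = 1" for z
  proof -
    have "sgn z = z" using that by (simp add: sgn_eq)
    moreover have "\<phi> z \<in> - D"
    proof -
      have "\<phi> z \<in> \<phi> ` sphere 0 1" using that by simp
      then show ?thesis using J(11) unfolding \<phi>(5) D_def by blast
    qed
    ultimately show ?thesis using that E by (simp add: \<rho>_def homeomorphism_def)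
  qed
  have on1': "(\<rho>' \<circ> E') w = \<eta> w" if w: "w \<in> path_image c" for w
  proof -
    have "norm (E' w) = 1" using Eh w by (auto simp: homeomorphism_def)
    moreover from this have "sgn (E' w) = E' w" by (simp add: sgn_eq)
    ultimately show ?thesis using Eh w by (simp add: \<rho>'_def homeomorphism_def)
  qed
  let ?\<Theta> = "\<lambda>z. if z \<in> cball 0 1 then \<phi> z else (E \<circ> \<rho>) z"
  let ?\<Theta>' = "\<lambda>w. if w \<in> closure D then \<eta> w else (\<rho>' \<circ> E') w"
  have clD: "closure D = D \<union> path_image c" using J(8) by (metis D_def closure_Un_frontier)
  have "homeomorphism UNIV UNIV ?\<Theta> ?\<Theta>'"
  proof (rule homeomorphism_glue[OF \<phi>(3) ext])
    show "closed {z::complex. 1 \<le> norm z}" by (intro closed_Collect_le continuous_intros)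
    show "closed (- D)" using J(1) by (simp add: D_def closed_def)
    show "cball 0 1 \<union> {z::complex. 1 \<le> norm z} = UNIV" by auto
    show "closure D \<union> - D = UNIV" using closure_subset by blast
    show "\<phi> x = (E \<circ> \<rho>) x" if "x \<in> cball 0 1" "x \<in> {z. 1 \<le> norm z}" for x using on1[of x] that by auto
    show "\<eta> y = (\<rho>' \<circ> E') y" if "y \<in> closure D" "y \<in> - D" for y using on1'[of y] that clD by auto
  qed auto
  moreover have "?\<Theta> holomorphic_on ball 0 1" by (rule holomorphic_transform[OF \<phi>(1)]) auto
  moreover have "?\<Theta> ` ball 0 1 = inside (path_image c)"
    using \<phi>(4) by (auto simp: D_def[symmetric] image_iff Bex_def)
  moreover have "?\<Theta> ` sphere 0 1 = path_image c" 
    using \<phi>(5) by (auto simp: image_iff Bex_def)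
  moreover have "?\<Theta> 0 = z0" using \<phi>(2) by simp
  ultimately show thesis by (intro that[of ?\<Theta> ?\<Theta>']) assumption+
qed

section \<open>Isotopies of the plane\<close>

text \<open>The image is open by invariance of domain, and closed because the map is the identity off a compact set.\<close>

lemma homeomorphism_bounded_support:
  fixes f :: "complex \<Rightarrow> complex"
  assumes cont: "continuous_on UNIV f" and inj: "inj f" and out: "\<And>z. R \<le> norm z \<Longrightarrow> f z = z"
  obtains g where "homeomorphism UNIV UNIV f g"
proof -
  have "open (range f)"
    using invariance_of_domain[OF cont open_UNIV] inj by simp
  moreover have "closed (range f)"
  proof -
    have "range f = f ` cball 0 R \<union> {z. R \<le> norm z}"
    proof
      show "f ` cball 0 R \<union> {z. R \<le> norm z} \<subseteq> range f" using out by (auto, metis rangeI)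
      show "range f \<subseteq> f ` cball 0 R \<union> {z. R \<le> norm z}" 
      proof
        fix y assume "y \<in> range f"
        then obtain x where x: "y = f x" by blast
        show "y \<in> f ` cball 0 R \<union> {z. R \<le> norm z}"
          using x out[of x] by (cases "R \<le> norm x") auto
      qed
    qed
    moreover have "compact (f ` cball 0 R)"
      using cont by (intro compact_continuous_image) (auto elim: continuous_on_subset)
    moreover have "closed {z::complex. R \<le> norm z}" by (intro closed_Collect_le continuous_intros)
    ultimately show ?thesis by (simp add: compact_imp_closed closed_Un)
  qed
  ultimately have "range f = UNIV" using clopen[of "range f"] by blast
  then show thesis
    using invariance_of_domain_homeomorphism[OF open_UNIV cont _ inj] that by auto
qed

definition plane_isotopic :: "complex set \<Rightarrow> complex set \<Rightarrow> complex set \<Rightarrow> bool" where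
  "plane_isotopic F A B \<longleftrightarrow> (\<exists>h. continuous_on ({0..1::real} \<times> UNIV) (\<lambda>(t, z). h t z) \<and>
     (\<forall>t\<in>{0..1}. \<exists>k. homeomorphism UNIV UNIV (h t) k) \<and> (\<forall>z. h 0 z = z) \<and>
     (\<forall>t\<in>{0..1}. \<forall>z\<in>F. h t z = z) \<and> h 1 ` A = B)"

lemma plane_isotopic_mono: "plane_isotopic F A B \<Longrightarrow> F' \<subseteq> F \<Longrightarrow> plane_isotopic F' A B"
  unfolding plane_isotopic_def by (elim ex_forward conj_forward) auto

lemma plane_isotopic_trans:
  assumes "plane_isotopic F A B" "plane_isotopic F B C"
  shows "plane_isotopic F A C"
proof -
  obtain h where h: "continuous_on ({0..1::real} \<times> UNIV) (\<lambda>(t, z). h t z)"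
     "\<forall>t\<in>{0..1}. \<exists>k. homeomorphism UNIV UNIV (h t) k" "\<forall>z. h 0 z = z"
     "\<forall>t\<in>{0..1}. \<forall>z\<in>F. h t z = z" "h 1 ` A = B"
    using assms(1) unfolding plane_isotopic_def by blast
  obtain k where k: "continuous_on ({0..1::real} \<times> UNIV) (\<lambda>(t, z). k t z)"
     "\<forall>t\<in>{0..1}. \<exists>j. homeomorphism UNIV UNIV (k t) j" "\<forall>z. k 0 z = z"
     "\<forall>t\<in>{0..1}. \<forall>z\<in>F. k t z = z" "k 1 ` B = C"
    using assms(2) unfolding plane_isotopic_def by blast
  show ?thesis
    unfolding plane_isotopic_def
  proof (intro exI[of _ "\<lambda>t. k t \<circ> h t"] conjI ballI)
    have "continuous_on ({0..1} \<times> UNIV) (\<lambda>x. (\<lambda>(t, z). k t z) ((\<lambda>(t, z). (t, h t z)) x))"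
      using h(1) by (intro continuous_on_compose2[OF k(1)])
        (auto simp: case_prod_unfold intro!: continuous_intros)
    then show "continuous_on ({0..1} \<times> UNIV) (\<lambda>(t, z). (k t \<circ> h t) z)" by (simp add: case_prod_unfold)
    show "\<exists>j. homeomorphism UNIV UNIV (k t \<circ> h t) j" if "t \<in> {0..1}" for t
      using h(2) k(2) that homeomorphism_compose by blast
    show "(k 1 \<circ> h 1) ` A = C" unfolding image_comp[symmetric] h(5) k(5) ..
  qed (use h k in auto)
qed

lemma plane_isotopic_sym:
  assumes "plane_isotopic F A B"
  shows "plane_isotopic F B A"
proof -
  obtain h where h: "continuous_on ({0..1::real} \<times> UNIV) (\<lambda>(t, z). h t z)"
     "\<forall>t\<in>{0..1}. \<exists>k. homeomorphism UNIV UNIV (h t) k" "\<forall>z. h 0 z = z"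
     "\<forall>t\<in>{0..1}. \<forall>z\<in>F. h t z = z" "h 1 ` A = B"
    using assms unfolding plane_isotopic_def by blast
  obtain k where k: "homeomorphism UNIV UNIV (h 1) k" using h(2)[THEN bspec, of 1] by auto
  then have kh: "k (h 1 z) = z" "h 1 (k z) = z" and kc: "continuous_on UNIV k" for z
    by (auto simp: homeomorphism_def)
  show ?thesis
    unfolding plane_isotopic_def
  proof (intro exI[of _ "\<lambda>t. h (1 - t) \<circ> k"] conjI ballI allI)
    have "continuous_on ({0..1} \<times> UNIV) (\<lambda>x. (\<lambda>(t, z). h t z) ((\<lambda>(t, z). (1 - t, k z)) x))"
      using kc by (intro continuous_on_compose2[OF h(1)])
        (auto simp: case_prod_unfold intro!: continuous_intros elim: continuous_on_compose2)
    then show "continuous_on ({0..1} \<times> UNIV) (\<lambda>(t, z). (h (1 - t) \<circ> k) z)" by (simp add: case_prod_unfold)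
    show "\<exists>j. homeomorphism UNIV UNIV (h (1 - t) \<circ> k) j" if "t \<in> {0..1}" for t
    proof -
      have "1 - t \<in> {0..1}" using that by auto
      then obtain j where "homeomorphism UNIV UNIV (h (1 - t)) j" using h(2) \<open>1 - t \<in> {0..1}\<close> by blast
      then show ?thesis using homeomorphism_compose[OF homeomorphism_symD[OF k]] by blast
    qed
    show "(h (1 - t) \<circ> k) z = z" if "t \<in> {0..1}" "z \<in> F" for t z
    proof -
      have "h 1 z = z" using h(4) that by auto
      then have "k z = z" using kh(1)[of z] by simp
      then show ?thesis using h(4) that by auto
    qed
    show "(h (1 - 1) \<circ> k) ` B = A" using h(3,5) kh by (auto simp: image_iff)
  qed (use kh in auto)
qed

lemma plane_isotopic_conj:
  assumes "plane_isotopic F A B" and g: "homeomorphism UNIV UNIV g g'"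
  shows "plane_isotopic (g ` F) (g ` A) (g ` B)"
proof -
  obtain h where h: "continuous_on ({0..1::real} \<times> UNIV) (\<lambda>(t, z). h t z)"
     "\<forall>t\<in>{0..1}. \<exists>k. homeomorphism UNIV UNIV (h t) k" "\<forall>z. h 0 z = z"
     "\<forall>t\<in>{0..1}. \<forall>z\<in>F. h t z = z" "h 1 ` A = B"
    using assms unfolding plane_isotopic_def by blast
  have gg: "g' (g z) = z" "g (g' z) = z" and gc: "continuous_on UNIV g" "continuous_on UNIV g'" for z
    using g by (auto simp: homeomorphism_def)
  show ?thesis
    unfolding plane_isotopic_def
  proof (intro exI[of _ "\<lambda>t. g \<circ> h t \<circ> g'"] conjI ballI allI)
    have "continuous_on ({0..1} \<times> UNIV) (\<lambda>x. (\<lambda>(t, z). h t z) ((\<lambda>(t, z). (t, g' z)) x))"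
      using gc by (intro continuous_on_compose2[OF h(1)])
        (auto simp: case_prod_unfold intro!: continuous_intros elim: continuous_on_compose2)
    then have "continuous_on ({0..1} \<times> UNIV) (\<lambda>x. g ((\<lambda>(t, z). h t z) ((\<lambda>(t, z). (t, g' z)) x)))"
      by (rule continuous_on_compose2[OF gc(1)]) auto
    then show "continuous_on ({0..1} \<times> UNIV) (\<lambda>(t, z). (g \<circ> h t \<circ> g') z)" by (simp add: case_prod_unfold)
    show "\<exists>j. homeomorphism UNIV UNIV (g \<circ> h t \<circ> g') j" if "t \<in> {0..1}" for t
    proof -
      from bspec[OF h(2) that] obtain j where j: "homeomorphism UNIV UNIV (h t) j" ..
      show ?thesis
        by (rule exI, rule homeomorphism_compose[OF homeomorphism_symD[OF g] homeomorphism_compose[OF j g]])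
    qed
    have "(g \<circ> h 1 \<circ> g') ` g ` A = g ` h 1 ` A" using gg by (simp add: image_image)
    then show "(g \<circ> h 1 \<circ> g') ` g ` A = g ` B" using h(5) by simp
  qed (use gg h in auto)
qed

text \<open>A tent function supported on \<open>[a, d]\<close> whose height at \<open>b\<close> is \<open>c - b\<close>.\<close>

definition radial_bump :: "real \<Rightarrow> real \<Rightarrow> real \<Rightarrow> real \<Rightarrow> real \<Rightarrow> real" where
  "radial_bump a b c d r = (c - b) * max 0 (min ((r - a) / (b - a)) ((d - r) / (d - b)))"

text \<open>The map \<open>r + t \<beta> r\<close> is increasing because the two slopes of the tent are greater than \<open>-1\<close>; this is where
\<open>a < c < d\<close> enters.\<close>

lemma radial_bump_props:
  fixes a b c d t :: real
  assumes abcd: "0 < a" "a < b" "b < d" "a < c" "c < d" and t: "t \<in> {0..1}"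
  defines "\<beta> \<equiv> radial_bump a b c d"
  shows "r < s \<Longrightarrow> r + t * \<beta> r < s + t * \<beta> s"
    "r \<le> a \<or> d \<le> r \<Longrightarrow> \<beta> r = 0" "\<beta> b = c - b"
proof -
  note \<beta>_def = \<beta>_def radial_bump_def
  define \<gamma> where "\<gamma> = (\<lambda>r. max 0 (min ((r - a) / (b - a)) ((d - r) / (d - b))))"
  show "\<beta> r = 0" if "r \<le> a \<or> d \<le> r"
  proof -
    have "(r - a) / (b - a) \<le> 0 \<or> (d - r) / (d - b) \<le> 0"
      using that abcd by (auto simp: divide_nonpos_pos)
    then have "min ((r - a) / (b - a)) ((d - r) / (d - b)) \<le> 0" by linarith
    then show ?thesis by (simp add: \<beta>_def max_absorb1)
  qed
  show "\<beta> b = c - b" using abcd by (simp add: \<beta>_def)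
  show "r + t * \<beta> r < s + t * \<beta> s" if rs: "r < s"
  proof -
    have u: "(s - a) / (b - a) = (r - a) / (b - a) + (s - r) / (b - a)"
      and v: "(d - r) / (d - b) = (d - s) / (d - b) + (s - r) / (d - b)"
      by (simp_all add: diff_divide_distrib)
    have p: "0 < (s - r) / (b - a)" "0 < (s - r) / (d - b)" using rs abcd by auto
    have up: "\<gamma> s - \<gamma> r \<le> (s - r) / (b - a)" and lo: "\<gamma> r - \<gamma> s \<le> (s - r) / (d - b)"
    proof -
      have *: "max 0 (min u' v') - max 0 (min u0 v0) \<le> x \<and> max 0 (min u0 v0) - max 0 (min u' v') \<le> y"
        if "u' = u0 + x" "v0 = v' + y" "0 < x" "0 < y" for u' u0 v' v0 x y :: real
        using that by linarith
      show "\<gamma> s - \<gamma> r \<le> (s - r) / (b - a)" "\<gamma> r - \<gamma> s \<le> (s - r) / (d - b)"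
        unfolding \<gamma>_def using *[OF u v p] by blast+
    qed
    have \<beta>: "\<beta> x = (c - b) * \<gamma> x" for x by (simp add: \<beta>_def \<gamma>_def)
    have "\<beta> r - \<beta> s < s - r"
    proof (cases "b \<le> c")
      case True
      have "\<beta> r - \<beta> s = (c - b) * (\<gamma> r - \<gamma> s)" by (simp add: \<beta> algebra_simps)
      also have "\<dots> \<le> (c - b) * ((s - r) / (d - b))" using lo True by (intro mult_left_mono) auto
      also have "\<dots> < (d - b) * ((s - r) / (d - b))" using p abcd by (intro mult_strict_right_mono) auto
      also have "\<dots> = s - r" using abcd by simp
      finally show ?thesis .
    next
      case False
      have "\<beta> r - \<beta> s = (b - c) * (\<gamma> s - \<gamma> r)" by (simp add: \<beta> algebra_simps)
      also have "\<dots> \<le> (b - c) * ((s - r) / (b - a))" using up False by (intro mult_left_mono) auto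
      also have "\<dots> < (b - a) * ((s - r) / (b - a))" using p abcd by (intro mult_strict_right_mono) auto
      also have "\<dots> = s - r" using abcd by simp
      finally show ?thesis .
    qed
    then have "t * (\<beta> r - \<beta> s) < s - r"
    proof (cases "\<beta> r - \<beta> s \<le> 0")
      case True
      then have "t * (\<beta> r - \<beta> s) \<le> 0" using t by (intro mult_nonneg_nonpos) auto
      then show ?thesis using rs by simp
    next
      case False
      then have "t * (\<beta> r - \<beta> s) \<le> \<beta> r - \<beta> s" using t by (intro mult_left_le_one_le) auto
      then show ?thesis using \<open>\<beta> r - \<beta> s < s - r\<close> by simp
    qed
    then show ?thesis by (simp add: algebra_simps)
  qed
qed

text \<open>An isotopy that moves the circle of radius \<open>b\<close> to the one of radius \<open>c\<close> and is supported in the annulus \<open>a < \<bar>z\<bar> < d\<close>.\<close>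

lemma radial_push:
  fixes a b c d :: real
  assumes abcd: "0 < a" "a < b" "b < d" "a < c" "c < d"
  obtains h :: "real \<Rightarrow> complex \<Rightarrow> complex" where "continuous_on ({0..1} \<times> UNIV) (\<lambda>(t, z). h t z)"
    "\<And>t. t \<in> {0..1} \<Longrightarrow> \<exists>k. homeomorphism UNIV UNIV (h t) k" "\<And>z. h 0 z = z"
    "\<And>t z. norm z \<le> a \<or> d \<le> norm z \<Longrightarrow> h t z = z"
    "h 1 ` sphere 0 b = sphere 0 c" "\<And>z. norm z < b \<Longrightarrow> norm (h 1 z) < c"
proof -
  define \<beta> where "\<beta> = radial_bump a b c d"
  note bump = radial_bump_props[OF abcd, folded \<beta>_def]
  have \<beta>0: "\<beta> r = 0" if "r \<le> a \<or> d \<le> r" for r using bump(2)[of 0 r] that by simp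
  have \<beta>b: "\<beta> b = c - b" using bump(3)[of 0] by simp
  have mono: "r < s \<Longrightarrow> t \<in> {0..1} \<Longrightarrow> r + t * \<beta> r < s + t * \<beta> s" for r s t using bump(1) by blast
  define h :: "real \<Rightarrow> complex \<Rightarrow> complex" where "h = (\<lambda>t z. of_real (1 + t * \<beta> (norm z) / max a (norm z)) * z)"
  have ch: "continuous_on S (\<lambda>(t, z). h t z)" for S
    unfolding h_def \<beta>_def radial_bump_def case_prod_unfold using abcd
    by (intro continuous_intros) (auto simp: max_def)
  have nh: "norm (h t z) = norm z + t * \<beta> (norm z)" and hpos: "z \<noteq> 0 \<Longrightarrow> 1 + t * \<beta> (norm z) / max a (norm z) > 0"
    if t: "t \<in> {0..1}" for t z
  proof -
    have *: "(1 + t * \<beta> (norm z) / max a (norm z)) * norm z = norm z + t * \<beta> (norm z)"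
    proof (cases "norm z \<le> a")
      case False
      then have "max a (norm z) = norm z" "norm z \<noteq> 0" using abcd by auto
      then show ?thesis by (simp only: distrib_right) simp
    qed (simp add: \<beta>0)
    have "0 \<le> norm z + t * \<beta> (norm z)" "z \<noteq> 0 \<Longrightarrow> 0 < norm z + t * \<beta> (norm z)"
      using mono[of 0 "norm z" t] t \<beta>0[of 0] abcd by (cases "z = 0"; simp)+
    then show "z \<noteq> 0 \<Longrightarrow> 1 + t * \<beta> (norm z) / max a (norm z) > 0"
      using * by (metis norm_ge_zero zero_less_mult_pos2 zero_less_norm_iff)
    then have "0 \<le> 1 + t * \<beta> (norm z) / max a (norm z)" using \<beta>0[of 0] abcd by (cases "z = 0") auto
    then show "norm (h t z) = norm z + t * \<beta> (norm z)"
      using * unfolding h_def norm_mult norm_of_real by simp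
  qed
  have hfix: "h t z = z" if "norm z \<le> a \<or> d \<le> norm z" for t z
    using that by (simp add: h_def \<beta>0)
  have inj: "inj (h t)" if t: "t \<in> {0..1}" for t
  proof (rule injI)
    fix z w assume eq: "h t z = h t w"
    then have "norm z + t * \<beta> (norm z) = norm w + t * \<beta> (norm w)" using nh[OF t] by metis
    then have nn: "norm z = norm w" using mono[of "norm z" "norm w" t] mono[of "norm w" "norm z" t] t
      by (cases "norm z" "norm w" rule: linorder_cases) auto
    show "z = w"
    proof (cases "z = 0")
      case True then show ?thesis using nn by simp
    next
      case False
      then have "1 + t * \<beta> (norm z) / max a (norm z) \<noteq> 0" using hpos[OF t False] by simp
      then have "complex_of_real (1 + t * \<beta> (norm z) / max a (norm z)) \<noteq> 0" by (simp only: of_real_eq_0_iff) simp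
      then show ?thesis using eq unfolding h_def nn by (simp only: mult_cancel_left) simp
    qed
  qed
  have homeo: "\<exists>k. homeomorphism UNIV UNIV (h t) k" if t: "t \<in> {0..1}" for t
  proof -
    have "continuous_on UNIV (\<lambda>z. (\<lambda>(t, z). h t z) (t, z))"
      by (rule continuous_on_compose2[OF ch[of UNIV]]) (auto intro!: continuous_intros)
    then have "continuous_on UNIV (h t)" by simp
    then show ?thesis using homeomorphism_bounded_support[OF _ inj[OF t], of d] hfix by metis
  qed
  have in1: "norm (h 1 z) < c" if "norm z < b" for z using mono[OF that, of 1] nh[of 1 z] \<beta>b by simp
  have "h 1 ` sphere 0 b = sphere 0 c"
  proof
    show "h 1 ` sphere 0 b \<subseteq> sphere 0 c" using nh[of 1] \<beta>b by auto
    show "sphere 0 c \<subseteq> h 1 ` sphere 0 b"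
    proof
      fix w :: complex assume w: "w \<in> sphere 0 c"
      obtain k where k: "homeomorphism UNIV UNIV (h 1) k" using homeo[of 1] by auto
      define z where "z = k w"
      have hz: "h 1 z = w" using k by (simp add: z_def homeomorphism_def)
      have "norm z + \<beta> (norm z) = b + \<beta> b" using nh[of 1 z] hz w \<beta>b by simp
      then have "norm z = b" using mono[of "norm z" b 1] mono[of b "norm z" 1] 
        by (cases "norm z" b rule: linorder_cases) auto
      then show "w \<in> h 1 ` sphere 0 b" using hz by force
    qed
  qed
  moreover have "h 0 z = z" for z by (simp add: h_def)
  ultimately show thesis by (intro that[OF ch homeo _ hfix _ in1]) assumption+
qed

section \<open>A round circle inside a Jordan curve\<close>

text \<open>Interpolate between \<open>\<Theta>\<close> and its derivative at \<open>0\<close>: on a small disc the error \<open>\<Theta> z - c z\<close> has Lipschitz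
constant \<open>\<bar>c\<bar>/4\<close>, and the cut-off function \<open>\<xi>\<close> costs a factor of at most \<open>3\<close>, so the interpolation \<open>T\<close>
is still injective. Then \<open>G\<close> is \<open>T\<close> followed by the inverse of \<open>\<Theta>\<close>.\<close>

lemma linearise_near_zero:
  fixes \<Theta> :: "complex \<Rightarrow> complex"
  assumes hom: "homeomorphism UNIV UNIV \<Theta> \<Theta>'" and hol: "\<Theta> holomorphic_on ball 0 1" and z: "\<Theta> 0 = 0"
  obtains G G' c s where "homeomorphism UNIV UNIV G G'" "c \<noteq> 0" "0 < s"
    "\<And>z. norm z \<le> s \<Longrightarrow> \<Theta> (G z) = c * z" "\<And>z. 1 / 2 \<le> norm z \<Longrightarrow> G z = z"
proof -
  have inj: "inj \<Theta>" using hom by (auto simp: homeomorphism_def intro: inj_on_inverseI)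
  have contT: "continuous_on UNIV \<Theta>" "continuous_on UNIV \<Theta>'" and TT: "\<Theta>' (\<Theta> z) = z" "\<Theta> (\<Theta>' z) = z" for z
    using hom by (auto simp: homeomorphism_def)
  define c where "c = deriv \<Theta> 0"
  have c0: "c \<noteq> 0" unfolding c_def
    by (rule holomorphic_injective_imp_regular[OF hol]) (use inj in \<open>auto intro: inj_on_subset\<close>)
  have "continuous_on (ball 0 1) (deriv \<Theta>)"
    using hol by (intro holomorphic_on_imp_continuous_on holomorphic_deriv) auto
  then have "\<forall>e>0. \<exists>d>0. \<forall>w\<in>ball 0 1. dist w 0 < d \<longrightarrow> dist (deriv \<Theta> w) c < e"
    unfolding continuous_on_iff c_def by (rule bspec) simp
  moreover have "norm c / 4 > 0" using c0 by simp
  ultimately obtain \<delta> where \<delta>: "\<delta> > 0" "\<forall>w\<in>ball 0 1. dist w 0 < \<delta> \<longrightarrow> dist (deriv \<Theta> w) c < norm c / 4"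
    by blast
  define r where "r = min \<delta> (1 / 2) / 2"
  have r: "0 < r" "r < \<delta>" "r \<le> 1 / 4" using \<delta>(1) by (auto simp: r_def)
  define e where "e = (\<lambda>z. \<Theta> z - c * z)"
  have e0: "e 0 = 0" by (simp add: e_def z)
  have de: "(e has_field_derivative (deriv \<Theta> w - c)) (at w within cball 0 r)" if "w \<in> cball 0 r" for w
  proof -
    have "(\<Theta> has_field_derivative deriv \<Theta> w) (at w)"
      by (rule holomorphic_derivI[OF hol]) (use that r in auto)
    then have "(e has_field_derivative (deriv \<Theta> w - c)) (at w)"
      unfolding e_def by (auto intro!: derivative_eq_intros)
    then show ?thesis by (rule has_field_derivative_at_within)
  qed
  have Lip: "norm (e x - e y) \<le> norm c / 4 * norm (x - y)" if "x \<in> cball 0 r" "y \<in> cball 0 r" for x y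
  proof (rule field_differentiable_bound[OF convex_cball de _ that])
    show "norm (deriv \<Theta> w - c) \<le> norm c / 4" if "w \<in> cball 0 r" for w
      using bspec[OF \<delta>(2), of w] that r by (simp add: dist_norm)
  qed
  define \<xi> where "\<xi> = (\<lambda>z::complex. max 0 (2 * norm z / r - 1))"
  have \<xi>01: "0 \<le> \<xi> z" "norm z \<le> r \<Longrightarrow> \<xi> z \<le> 1" "norm z \<le> r / 2 \<Longrightarrow> \<xi> z = 0"
    "norm z = r \<Longrightarrow> \<xi> z = 1" for z
    using r by (auto simp: \<xi>_def field_simps)
  have \<xi>L: "\<bar>\<xi> x - \<xi> y\<bar> \<le> 2 / r * norm (x - y)" for x y
  proof -
    have "\<bar>\<xi> x - \<xi> y\<bar> \<le> \<bar>2 * norm x / r - 2 * norm y / r\<bar>" unfolding \<xi>_def by linarith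
    also have "\<dots> = \<bar>2 / r * (norm x - norm y)\<bar>" by (simp add: right_diff_distrib)
    also have "\<dots> = 2 / r * \<bar>norm x - norm y\<bar>" using r by (simp only: abs_mult) simp
    also have "\<dots> \<le> 2 / r * norm (x - y)" using r norm_triangle_ineq3[of x y] by (intro mult_left_mono) auto
    finally show ?thesis .
  qed
  define T where "T = (\<lambda>z. c * z + of_real (\<xi> z) * e z)"
  have Tinj: "inj_on T (cball 0 r)"
  proof (rule inj_onI, rule ccontr)
    fix x y assume xy: "x \<in> cball 0 r" "y \<in> cball 0 r" "T x = T y" "x \<noteq> y"
    have "c * (x - y) = - (of_real (\<xi> x) * (e x - e y) + of_real (\<xi> x - \<xi> y) * e y)"
      using xy(3) by (simp add: T_def algebra_simps)
    then have "norm c * norm (x - y) \<le> norm (of_real (\<xi> x) * (e x - e y)) + norm (of_real (\<xi> x - \<xi> y) * e y)"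
      by (metis norm_minus_cancel norm_mult norm_triangle_ineq)
    also have "norm (of_real (\<xi> x) * (e x - e y)) \<le> 1 * (norm c / 4 * norm (x - y))"
      unfolding norm_mult using \<xi>01[of x] xy Lip by (intro mult_mono) auto
    also have "norm (of_real (\<xi> x - \<xi> y) * e y) \<le> (2 / r * norm (x - y)) * (norm c / 4 * r)"
    proof -
      have "norm (e y) \<le> norm c / 4 * norm y" using Lip[of y 0] xy r e0 by simp
      also have "\<dots> \<le> norm c / 4 * r" using xy by (intro mult_left_mono) auto
      finally show ?thesis unfolding norm_mult using \<xi>L[of x y] r by (intro mult_mono) (auto simp: norm_of_real simp del: of_real_diff)
    qed
    also have "1 * (norm c / 4 * norm (x - y)) + 2 / r * norm (x - y) * (norm c / 4 * r) = 3 / 4 * (norm c * norm (x - y))"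
      using r by (simp add: field_simps)
    finally show False using c0 xy(4) by simp
  qed
  have contE: "continuous_on S e" for S
    unfolding e_def using contT continuous_on_subset by (intro continuous_intros) auto
  have cont\<xi>: "continuous_on S \<xi>" for S
    unfolding \<xi>_def using r by (intro continuous_intros) auto
  have contTT: "continuous_on S T" for S unfolding T_def by (intro continuous_intros contE cont\<xi>)
  have Tr: "T w = \<Theta> w" if "norm w = r" for w using \<xi>01(4)[OF that] by (simp add: T_def e_def)
  define G where "G = (\<lambda>z. if z \<in> cball 0 r then \<Theta>' (T z) else z)"
  have "continuous_on (cball 0 r \<union> {z. r \<le> norm z}) G"
    unfolding G_def
  proof (rule continuous_on_cases)
    show "closed {z::complex. r \<le> norm z}" by (intro closed_Collect_le continuous_intros)
    show "continuous_on (cball 0 r) (\<lambda>z. \<Theta>' (T z))"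
      by (rule continuous_on_compose2[OF contT(2) contTT]) auto
    show "\<forall>x. x \<in> cball 0 r \<and> x \<notin> cball 0 r \<or> x \<in> {z. r \<le> norm z} \<and> x \<in> cball 0 r \<longrightarrow> \<Theta>' (T x) = x"
      using Tr TT by auto
  qed auto
  moreover have "cball 0 r \<union> {z::complex. r \<le> norm z} = UNIV" by auto
  ultimately have contG: "continuous_on UNIV G" by simp
  have Gb: "norm (G w) < r" if w: "norm w < r" for w
  proof (rule ccontr)
    assume neg: "\<not> norm (G w) < r"
    have "connected (G ` ball 0 r)"
      using contG by (intro connected_continuous_image) (auto elim: continuous_on_subset)
    moreover have "continuous_on (G ` ball 0 r) norm" by (intro continuous_intros)
    ultimately have "connected (norm ` G ` ball 0 r)" by (rule connected_continuous_image[rotated])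
    moreover have "norm (G 0) = 0"
    proof -
      have "T 0 = \<Theta> 0" by (simp add: T_def e0 z)
      then show ?thesis using r TT by (simp add: G_def)
    qed
    then have "0 \<in> norm ` G ` ball 0 r" using r by (metis centre_in_ball imageI)
    moreover have "norm (G w) \<in> norm ` G ` ball 0 r" using w by auto
    ultimately have "{0..norm (G w)} \<subseteq> norm ` G ` ball 0 r" by (rule connected_contains_Icc)
    then have "r \<in> norm ` G ` ball 0 r" using neg r by (auto simp: subset_iff)
    then obtain v where v: "norm v < r" "norm (G v) = r" by auto
    then have "T v = \<Theta> (G v)" using TT by (simp add: G_def)
    also have "\<dots> = T (G v)" using Tr v by simp
    finally have "v = G v" using Tinj v by (auto dest: inj_onD)
    then show False using v by simp
  qed
  have "inj G"
  proof (rule injI)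
    fix x y assume eq: "G x = G y"
    have inn: "x = y" if "norm x \<le> r" "norm y \<le> r" "G x = G y" for x y
    proof -
      have "\<Theta>' (T x) = \<Theta>' (T y)" using that by (simp add: G_def)
      then have "T x = T y" by (metis TT(2))
      then show ?thesis using Tinj that by (auto dest: inj_onD)
    qed
    have out: "G x = x" if "r \<le> norm x" for x using that Tr TT by (auto simp: G_def)
    show "x = y"
    proof (cases "norm x < r")
      case True
      then have "norm (G y) < r" using Gb eq by metis
      then have "norm y < r" using out[of y] by (cases "r \<le> norm y") auto
      then show ?thesis using inn True eq by auto
    next
      case False
      then have "\<not> norm (G y) < r" using out[of x] eq by simp
      then have "\<not> norm y < r" using Gb by blast
      then show ?thesis using out False eq by simp
    qed
  qed
  have Gout: "G x = x" if "1 / 2 \<le> norm x" for x using that r by (auto simp: G_def)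
  obtain G' where "homeomorphism UNIV UNIV G G'"
    using homeomorphism_bounded_support[OF contG \<open>inj G\<close> Gout] by blast
  moreover have "\<Theta> (G x) = c * x" if "norm x \<le> r / 2" for x
    using that \<xi>01(3)[OF that] r TT by (simp add: G_def T_def)
  ultimately show thesis by (intro that[of G G' c "r/2"] Gout) (use c0 r in auto)
qed

lemma closed_avoid_sphere:
  fixes A :: "complex set"
  assumes "closed A" "A \<inter> sphere 0 1 = {}"
  obtains \<eta> where "0 < \<eta>" "\<eta> < 1" "\<And>z. z \<in> A \<Longrightarrow> norm z \<le> 1 - \<eta> \<or> 1 + \<eta> \<le> norm z"
proof -
  obtain d where d: "d > 0" "\<And>x y. x \<in> sphere 0 1 \<Longrightarrow> y \<in> A \<Longrightarrow> d \<le> dist x y"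
    using separate_compact_closed[OF compact_sphere assms(1), of 0 1] assms(2) by (metis Int_commute)
  define \<eta> where "\<eta> = min d (1 / 2)"
  show thesis
  proof (rule that[of \<eta>])
    fix z assume z: "z \<in> A"
    show "norm z \<le> 1 - \<eta> \<or> 1 + \<eta> \<le> norm z"
    proof (cases "z = 0")
      case False
      have "d \<le> dist (sgn z) z" using d(2)[of "sgn z" z] z False by (simp add: norm_sgn)
      also have "dist (sgn z) z = \<bar>1 - norm z\<bar>"
      proof -
        have "sgn z - z = of_real (1 - norm z) * sgn z" using False by (simp add: sgn_eq right_diff_distrib left_diff_distrib diff_divide_distrib)
        then show ?thesis using False by (simp only: dist_norm norm_mult norm_of_real) (simp add: norm_sgn)
      qed
      finally show ?thesis by (auto simp: \<eta>_def abs_if split: if_splits)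
    qed (use d(1) in \<open>auto simp: \<eta>_def\<close>)
  qed (use d in \<open>auto simp: \<eta>_def\<close>)
qed

lemma plane_isotopic_push:
  fixes a b c d :: real
  assumes "0 < a" "a < b" "b < d" "a < c" "c < d"
  shows "plane_isotopic {z. norm z \<le> a \<or> d \<le> norm z} (sphere 0 b) (sphere 0 c)"
proof -
  obtain h :: "real \<Rightarrow> complex \<Rightarrow> complex" where h: "continuous_on ({0..1} \<times> UNIV) (\<lambda>(t, z). h t z)"
    "\<And>t. t \<in> {0..1} \<Longrightarrow> \<exists>k. homeomorphism UNIV UNIV (h t) k" "\<And>z. h 0 z = z"
    "\<And>t z. norm z \<le> a \<or> d \<le> norm z \<Longrightarrow> h t z = z" "h 1 ` sphere 0 b = sphere 0 c"
    "\<And>z. norm z < b \<Longrightarrow> norm (h 1 z) < c"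
    by (rule radial_push[OF assms], rule that)
  then show ?thesis unfolding plane_isotopic_def by (intro exI[of _ h]) auto
qed

lemma push_homeomorphism:
  fixes a b c d :: real
  assumes "0 < a" "a < b" "b < d" "a < c" "c < d"
  obtains p p' :: "complex \<Rightarrow> complex" where "homeomorphism UNIV UNIV p p'"
    "\<And>z. norm z \<le> a \<or> d \<le> norm z \<Longrightarrow> p z = z" "p ` sphere 0 b = sphere 0 c"
    "\<And>z. norm z < b \<Longrightarrow> norm (p z) < c"
proof -
  obtain h :: "real \<Rightarrow> complex \<Rightarrow> complex" where
    "continuous_on ({0..1} \<times> UNIV) (\<lambda>(t, z). h t z)"
    and h: "\<And>t. t \<in> {0..1} \<Longrightarrow> \<exists>k. homeomorphism UNIV UNIV (h t) k" "\<And>z. h 0 z = z"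
    "\<And>t z. norm z \<le> a \<or> d \<le> norm z \<Longrightarrow> h t z = z" "h 1 ` sphere 0 b = sphere 0 c"
    "\<And>z. norm z < b \<Longrightarrow> norm (h 1 z) < c"
    by (rule radial_push[OF assms], rule that)
  obtain k where "homeomorphism UNIV UNIV (h 1) k" using h(1)[of 1] by auto
  then show thesis by (rule that) (use h in auto)
qed

text \<open>In Schoenflies coordinates \<open>T\<close> the curve is the unit circle and has a collar avoiding \<open>F\<close>, so it can be
pushed to the curve \<open>C\<close> of radius slightly greater than \<open>1\<close>. The claim is that the round circle can be
pushed to the same \<open>C\<close>. As \<open>T\<close> is linear near \<open>0\<close>, the circle can be shrunk radially to a small circle,
which is round also in the coordinates \<open>T\<close>, and then be expanded to the curve; this gives a
homeomorphism \<open>g\<close> of the plane, which need not fix \<open>F\<close>. But \<open>g\<close> is the identity near \<open>C\<close> and maps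
the unit disc into the inside, so conjugating the push of the curve to \<open>C\<close> by \<open>g\<close> gives a push of the
round circle to \<open>C\<close>, and its support avoids \<open>F\<close>.\<close>

lemma circle_isotopic_to_surrounding_curve:
  fixes c :: "real \<Rightarrow> complex"
  assumes c: "simple_path c" "pathfinish c = pathstart c"
    and D: "cball 0 1 \<subseteq> inside (path_image c)"
    and F: "closed F" "F \<inter> closure (inside (path_image c)) \<subseteq> ball 0 1"
  shows "plane_isotopic F (sphere 0 1) (path_image c)"
proof -
  define J where "J = path_image c"
  define I where "I = inside J"
  note JS = Jordan_sides[OF c, folded J_def]
  have clI: "closure I = I \<union> J" using JS(8) unfolding I_def by (metis closure_Un_frontier)
  have "0 \<in> inside (path_image c)" using D by (auto simp: subset_iff)
  then obtain \<Theta> \<Theta>i where \<Theta>: "homeomorphism UNIV UNIV \<Theta> \<Theta>i" "\<Theta> holomorphic_on ball 0 1" "\<Theta> 0 = 0"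
    "\<Theta> ` ball 0 1 = I" "\<Theta> ` sphere 0 1 = J"
    unfolding I_def J_def by (rule Schoenflies[OF c])
  obtain G Gi \<nu> s where G: "homeomorphism UNIV UNIV G Gi" "\<nu> \<noteq> 0" "0 < s"
    "\<And>z. norm z \<le> s \<Longrightarrow> \<Theta> (G z) = \<nu> * z" "\<And>z. 1 / 2 \<le> norm z \<Longrightarrow> G z = z"
    by (rule linearise_near_zero[OF \<Theta>(1-3)], rule that)
  define T where "T = \<Theta> \<circ> G"
  define T' where "T' = Gi \<circ> \<Theta>i"
  have hT: "homeomorphism UNIV UNIV T T'" unfolding T_def T'_def by (rule homeomorphism_compose[OF G(1) \<Theta>(1)])
  have TT: "T' (T z) = z" "T (T' z) = z" and Tc: "continuous_on S T" "continuous_on S T'" for z S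
    using hT by (auto simp: homeomorphism_def elim: continuous_on_subset)
  have Tinv: "z \<in> T ` A \<longleftrightarrow> T' z \<in> A" for z A using TT by (metis imageE imageI)
  have G1: "G ` ball 0 1 = ball 0 1"
  proof -
    have Gi: "Gi (G z) = z" "G (Gi z) = z" for z using G(1) by (auto simp: homeomorphism_def)
    have Gi2: "1 / 2 \<le> norm z \<Longrightarrow> Gi z = z" for z using G(5)[of z] Gi(1)[of z] by simp
    have "norm (G z) < 1" if "norm z < 1" for z
      using G(5)[of z] that Gi2[of "G z"] Gi(1)[of z] by (cases "1/2 \<le> norm (G z)") auto
    moreover have "norm (Gi z) < 1" if "norm z < 1" for z
      using Gi2[of z] that G(5)[of "Gi z"] Gi(2)[of z] by (cases "1/2 \<le> norm (Gi z)") auto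
    ultimately show ?thesis
      by (intro equalityI subsetI) (auto intro!: image_eqI[of _ G "Gi x" for x] simp: Gi)
  qed
  have TI: "T ` ball 0 1 = I" unfolding T_def image_comp[symmetric] G1 \<Theta>(4) ..
  have TJ: "T ` sphere 0 1 = J"
  proof -
    have "G ` sphere 0 1 = sphere 0 1" using G(5) by (force simp: image_iff)
    then show ?thesis unfolding T_def image_comp[symmetric] \<Theta>(5)[symmetric] by simp
  qed
  have Tlin: "T z = \<nu> * z" if "norm z \<le> s" for z using G(4)[OF that] by (simp add: T_def)
  \<comment> \<open>collar of \<open>J\<close> avoiding \<open>F\<close>\<close>
  have "closed (T' ` F)"
  proof -
    have "T' ` F = T -` F" using TT by (auto simp: image_iff) (metis TT(1))
    then show ?thesis using closed_vimage[OF F(1) Tc(1)] by simp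
  qed
  moreover have "F \<inter> J = {}"
  proof -
    have "F \<inter> J \<subseteq> ball 0 1" using F(2) clI unfolding I_def J_def by blast
    moreover have "ball 0 1 \<inter> J = {}" using D JS(11) ball_subset_cball unfolding J_def by blast
    ultimately show ?thesis by blast
  qed
  have "T' ` F \<inter> sphere 0 1 = {}"
  proof (rule equals0I)
    fix z assume "z \<in> T' ` F \<inter> sphere 0 1"
    then obtain x where "x \<in> F" "z = T' x" "z \<in> sphere 0 1" by blast
    then have "T z = x" "T z \<in> J" using TT TJ by blast+
    then show False using \<open>x \<in> F\<close> \<open>F \<inter> J = {}\<close> by blast
  qed
  ultimately obtain \<eta> where \<eta>: "0 < \<eta>" "\<eta> < 1" "\<And>z. z \<in> T' ` F \<Longrightarrow> norm z \<le> 1 - \<eta> \<or> 1 + \<eta> \<le> norm z"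
    by (rule closed_avoid_sphere) blast
  \<comment> \<open>a little room between the unit circle and \<open>J\<close>\<close>
  obtain \<epsilon> where \<epsilon>: "0 < \<epsilon>" "cball 0 (1 + \<epsilon>) \<subseteq> I"
  proof -
    have "closed (- I)" using JS(1) by (simp add: I_def closed_def)
    moreover have "- I \<inter> sphere 0 1 = {}"
      using D sphere_cball[of "0::complex" 1] unfolding I_def J_def by blast
    ultimately obtain e where e: "0 < e" "e < 1" "\<And>z. z \<in> - I \<Longrightarrow> norm z \<le> 1 - e \<or> 1 + e \<le> norm z"
      by (rule closed_avoid_sphere) blast
    have "cball 0 (1 + e / 2) \<subseteq> I"
    proof
      fix z :: complex assume z: "z \<in> cball 0 (1 + e/2)"
      show "z \<in> I"
      proof (rule ccontr)
        assume "z \<notin> I"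
        then have "norm z \<le> 1 - e \<or> 1 + e \<le> norm z" using e(3) by blast
        then have "norm z \<le> 1" using z e(1) by auto
        then have "z \<in> cball 0 1" by simp
        then show False using D \<open>z \<notin> I\<close> unfolding I_def J_def by blast
      qed
    qed
    then show thesis using that[of "e/2"] e by simp
  qed
  define r where "r = min s (min (1 / 2) (1 / (2 * norm \<nu>)))"
  have r: "0 < r" "r \<le> s" "r < 1" "norm \<nu> * r < 1"
  proof -
    show "0 < r" "r \<le> s" "r < 1" using G(2,3) by (auto simp: r_def)
    have "norm \<nu> * r \<le> norm \<nu> * (1 / (2 * norm \<nu>))" by (intro mult_left_mono) (auto simp: r_def)
    then show "norm \<nu> * r < 1" using G(2) by simp
  qed
  have lr: "0 < norm \<nu> * r" using r G(2) by simp
  have pc: "0 < norm \<nu> * r / 2" "norm \<nu> * r / 2 < 1" "1 < 1 + \<epsilon>" "norm \<nu> * r / 2 < norm \<nu> * r" "norm \<nu> * r < 1 + \<epsilon>"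
    using lr r(4) \<epsilon>(1) by linarith+
  have qc: "0 < r / 2" "r / 2 < r" "r < 1 + \<eta> / 3" "r / 2 < 1" "1 < 1 + \<eta> / 3"
    using r \<eta> by auto
  obtain p p' :: "complex \<Rightarrow> complex" where p: "homeomorphism UNIV UNIV p p'"
    "\<And>z. norm z \<le> norm \<nu> * r / 2 \<or> 1 + \<epsilon> \<le> norm z \<Longrightarrow> p z = z" "p ` sphere 0 1 = sphere 0 (norm \<nu> * r)"
    "\<And>z. norm z < 1 \<Longrightarrow> norm (p z) < norm \<nu> * r"
    by (rule push_homeomorphism[OF pc], rule that)
  obtain q q' :: "complex \<Rightarrow> complex" where q: "homeomorphism UNIV UNIV q q'"
    "\<And>z. norm z \<le> r / 2 \<or> 1 + \<eta> / 3 \<le> norm z \<Longrightarrow> q z = z" "q ` sphere 0 r = sphere 0 1"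
    "\<And>z. norm z < r \<Longrightarrow> norm (q z) < 1"
    by (rule push_homeomorphism[OF qc], rule that)
  \<comment> \<open>First \<open>p\<close> shrinks the unit circle to radius \<open>norm \<nu> * r\<close>, which is radius \<open>r\<close> in the coordinates \<open>T\<close>; then \<open>q\<close>, acting in these coordinates, expands it to the curve.\<close>
  define g where "g = (T \<circ> (q \<circ> T')) \<circ> p"
  define g' where "g' = p' \<circ> ((T \<circ> q') \<circ> T')"
  have hg: "homeomorphism UNIV UNIV g g'" unfolding g_def g'_def
    by (rule homeomorphism_compose[OF p(1) homeomorphism_compose[OF homeomorphism_compose[OF homeomorphism_symD[OF hT] q(1)] hT]])
  have gg: "g' (g z) = z" "g (g' z) = z" for z using hg by (auto simp: homeomorphism_def)
  have Tsmall: "T' w = w / \<nu>" if "norm w \<le> norm \<nu> * r" for w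
  proof -
    have "norm (w / \<nu>) \<le> r" using that r G(2) by (simp add: norm_divide field_simps)
    then have "norm (w / \<nu>) \<le> s" using r by linarith
    then have "T (w / \<nu>) = w" using Tlin[of "w / \<nu>"] G(2) by simp
    then show ?thesis using TT(1) by metis
  qed
  have T'r: "T' ` sphere 0 (norm \<nu> * r) = sphere 0 r"
  proof -
    have "T' ` sphere 0 (norm \<nu> * r) = (\<lambda>w. w / \<nu>) ` sphere 0 (norm \<nu> * r)" using Tsmall by (intro image_cong) auto
    also have "\<dots> = sphere 0 r"
    proof
      show "sphere 0 r \<subseteq> (\<lambda>w. w / \<nu>) ` sphere 0 (norm \<nu> * r)"
      proof
        fix x :: complex assume "x \<in> sphere 0 r"
        then show "x \<in> (\<lambda>w. w / \<nu>) ` sphere 0 (norm \<nu> * r)"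
          using G(2) by (intro image_eqI[of _ _ "\<nu> * x"]) (auto simp: norm_mult)
      qed
    qed (use G(2) in \<open>auto simp: norm_divide\<close>)
    finally show ?thesis .
  qed
  have gJ: "g ` sphere 0 1 = J" unfolding g_def image_comp[symmetric] p(3) T'r q(3) TJ ..
  have gin: "norm (T' (g z)) < 1" if "norm z < 1" for z
  proof -
    have "norm (p z) < norm \<nu> * r" using p(4)[OF that] .
    moreover from this have "norm (T' (p z)) = norm (p z) / norm \<nu>"
      using Tsmall[of "p z"] by (simp only: norm_divide)
    ultimately have "norm (T' (p z)) < r" using G(2) by (simp add: pos_divide_less_eq mult.commute)
    then show ?thesis using q(4) by (simp add: g_def TT)
  qed
  have gout: "g z = z" if "1 + \<eta> / 3 \<le> norm (T' z)" for z
  proof -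
    have "T' z \<notin> ball 0 1" using that \<eta> by auto
    then have "z \<notin> I" using TI Tinv by blast
    then have "1 + \<epsilon> \<le> norm z" using \<epsilon>(2) by (cases "norm z \<le> 1 + \<epsilon>") (auto simp: subset_iff)
    then show ?thesis using p(2)[of z] q(2)[of "T' z"] that by (simp add: g_def TT)
  qed
  define C where "C = T ` sphere 0 (1 + \<eta> / 2)"
  have JC: "plane_isotopic F J C"
  proof -
    have "plane_isotopic {z. norm z \<le> 1 - \<eta> \<or> 1 + \<eta> \<le> norm z} (sphere 0 1) (sphere 0 (1 + \<eta> / 2))"
      by (rule plane_isotopic_push) (use \<eta> in auto)
    then have "plane_isotopic (T ` {z. norm z \<le> 1 - \<eta> \<or> 1 + \<eta> \<le> norm z}) J C"
      using plane_isotopic_conj[OF _ hT] unfolding C_def TJ[symmetric] by blast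
    then show ?thesis by (rule plane_isotopic_mono) (use \<eta>(3) Tinv in auto)
  qed
  have SC: "plane_isotopic F (sphere 0 1) C"
  proof -
    \<comment> \<open>Only this part of \<open>F\<close> can come close to the curve under \<open>g\<close>; the rest is far outside, where \<open>g\<close> is the identity.\<close>
    define F2 where "F2 = F \<inter> closure I"
    have "bounded I" using JS(7) by (simp add: I_def)
    then have "compact F2" unfolding F2_def using F(1) by (simp add: closed_Int_compact compact_closure)
    then have "compact ((T' \<circ> g) ` F2)"
      using hg Tc by (intro compact_continuous_image continuous_on_compose) (auto simp: homeomorphism_def elim: continuous_on_subset)
    moreover have "(T' \<circ> g) ` F2 \<inter> sphere 0 1 = {}"
      using gin F(2) unfolding F2_def I_def J_def by force
    ultimately obtain \<mu> where \<mu>: "0 < \<mu>" "\<mu> < 1" "\<And>z. z \<in> (T' \<circ> g) ` F2 \<Longrightarrow> norm z \<le> 1 - \<mu> \<or> 1 + \<mu> \<le> norm z"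
      using closed_avoid_sphere[OF compact_imp_closed] by metis
    have "plane_isotopic {z. norm z \<le> 1 - \<mu> \<or> 1 + \<eta> \<le> norm z} (sphere 0 1) (sphere 0 (1 + \<eta> / 2))"
      by (rule plane_isotopic_push) (use \<eta> \<mu> in auto)
    then have 1: "plane_isotopic (g' ` T ` {z. norm z \<le> 1 - \<mu> \<or> 1 + \<eta> \<le> norm z}) (g' ` J) (g' ` C)"
      using plane_isotopic_conj[OF plane_isotopic_conj[OF _ hT] homeomorphism_symD[OF hg]] unfolding C_def TJ[symmetric] by blast
    have 2: "g' ` J = sphere 0 1" unfolding gJ[symmetric] by (simp add: image_image gg)
    have "g' z = z" if "z \<in> C" for z
    proof -
      have "norm (T' z) = 1 + \<eta> / 2" using that by (auto simp: C_def TT)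
      then have "g z = z" using gout \<eta> by auto
      then show ?thesis using gg(1) by metis
    qed
    then have 3: "g' ` C = C" by simp
    have "F \<subseteq> g' ` T ` {z. norm z \<le> 1 - \<mu> \<or> 1 + \<eta> \<le> norm z}"
    proof
      fix x assume x: "x \<in> F"
      have "norm (T' (g x)) \<le> 1 - \<mu> \<or> 1 + \<eta> \<le> norm (T' (g x))"
      proof (cases "1 + \<eta> \<le> norm (T' x)")
        case True
        then have "g x = x" using gout \<eta> by auto
        then show ?thesis using True by simp
      next
        case False
        then have "T' x \<in> ball 0 1" using \<eta>(3)[of "T' x"] x \<eta>(1) by force
        then have "x \<in> I" using TI Tinv by blast
        then have "x \<in> F2" using x closure_subset by (auto simp: F2_def)
        moreover have "norm x < 1" using F(2) \<open>x \<in> F2\<close> by (auto simp: F2_def I_def J_def)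
        then have "norm (T' (g x)) < 1" by (rule gin)
        ultimately show ?thesis using \<mu>(3)[of "T' (g x)"] \<mu>(1) by force
      qed
      then have "g x \<in> T ` {z. norm z \<le> 1 - \<mu> \<or> 1 + \<eta> \<le> norm z}" using Tinv by simp
      then show "x \<in> g' ` T ` {z. norm z \<le> 1 - \<mu> \<or> 1 + \<eta> \<le> norm z}" using gg(1) by (metis imageI)
    qed
    then show ?thesis using plane_isotopic_mono 1 unfolding 2 3 by blast
  qed
  show ?thesis using plane_isotopic_trans[OF SC plane_isotopic_sym[OF JC]] by (simp add: J_def)
qed

section \<open>Nested Jordan curves in the plane\<close>

text \<open>A homeomorphism of the plane maps unbounded sets to unbounded sets, so it preserves the unbounded side.\<close>

lemma homeomorphism_inside:
  fixes c :: "real \<Rightarrow> complex" and g g' :: "complex \<Rightarrow> complex"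
  assumes c: "simple_path c" "pathfinish c = pathstart c" and g: "homeomorphism UNIV UNIV g g'"
  shows "simple_path (g \<circ> c)" "pathfinish (g \<circ> c) = pathstart (g \<circ> c)" "path_image (g \<circ> c) = g ` path_image c"
    "inside (path_image (g \<circ> c)) = g ` inside (path_image c)"
proof -
  have gg: "g' (g z) = z" "g (g' z) = z" and gc: "continuous_on S g" "continuous_on S g'" for z S
    using g by (auto simp: homeomorphism_def elim: continuous_on_subset)
  have inj: "inj g" using gg(1) by (rule inj_on_inverseI)
  show gsc: "simple_path (g \<circ> c)"
    by (rule simple_path_continuous_image[OF c(1) gc(1)]) (rule inj_on_subset[OF inj], simp)
  show gcl: "pathfinish (g \<circ> c) = pathstart (g \<circ> c)" by (simp add: pathfinish_compose pathstart_compose c)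
  show im: "path_image (g \<circ> c) = g ` path_image c" by (rule path_image_compose)
  note J = Jordan_sides[OF c] and J' = Jordan_sides[OF gsc gcl]
  have con: "connected (g ` S)" if "connected S" for S using that gc by (intro connected_continuous_image)
  have dis: "g ` S \<inter> path_image (g \<circ> c) = {}" if "S \<inter> path_image c = {}" for S
    unfolding im image_Int[OF inj, symmetric] that by simp
  have bdd: "bounded (f ` S)" if "bounded S" "\<And>A. continuous_on A f" for f :: "complex \<Rightarrow> complex" and S
  proof -
    have "compact (f ` closure S)" using that by (intro compact_continuous_image) (auto simp: compact_closure)
    then show ?thesis by (meson closure_subset compact_imp_bounded bounded_subset image_mono)
  qed
  have "\<not> bounded (g ` outside (path_image c))"
  proof
    assume "bounded (g ` outside (path_image c))"
    then have "bounded (g' ` g ` outside (path_image c))" by (rule bdd) (rule gc(2))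
    then have "bounded (outside (path_image c))" by (simp add: image_image gg)
    moreover have "\<not> bounded (outside (path_image c))" using Jordan_inside_outside[OF c] by blast
    ultimately show False by simp
  qed
  then have "\<not> g ` outside (path_image c) \<subseteq> inside (path_image (g \<circ> c))" using J'(7) bounded_subset by blast
  then have out: "g ` outside (path_image c) \<subseteq> outside (path_image (g \<circ> c))"
    using Jordan_connected_cases[OF gsc gcl con[OF J(5)] dis[OF J(12)]] by blast
  have "surj g" using gg(2) by (metis surjI)
  then have un: "g ` inside (path_image c) \<union> g ` outside (path_image c) \<union> path_image (g \<circ> c) = UNIV"
    unfolding im image_Un[symmetric] J(13) by simp
  have 1: "inside (path_image (g \<circ> c)) \<subseteq> g ` inside (path_image c)"
    using un out J'(10,11) by blast
  then have "\<not> g ` inside (path_image c) \<subseteq> outside (path_image (g \<circ> c))" using J'(3,10) by blast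
  then have "g ` inside (path_image c) \<subseteq> inside (path_image (g \<circ> c))"
    using Jordan_connected_cases[OF gsc gcl con[OF J(2)] dis[OF J(11)]] by blast
  with 1 show "inside (path_image (g \<circ> c)) = g ` inside (path_image c)" by (rule equalityI)
qed

text \<open>Schoenflies coordinates for the inner curve reduce this to \<open>circle_isotopic_to_surrounding_curve\<close>.\<close>

theorem nested_Jordan_curves_isotopic:
  fixes c1 c2 :: "real \<Rightarrow> complex"
  assumes c1: "simple_path c1" "pathfinish c1 = pathstart c1" and c2: "simple_path c2" "pathfinish c2 = pathstart c2"
    and nest: "inside (path_image c2) \<union> path_image c2 \<subseteq> inside (path_image c1)"
    and F: "closed F" "F \<inter> (inside (path_image c1) \<union> path_image c1) \<subseteq> inside (path_image c2)"
  shows "plane_isotopic F (path_image c2) (path_image c1)"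
proof -
  note J2 = Jordan_sides[OF c2]
  obtain z0 where z0: "z0 \<in> inside (path_image c2)" using J2(3) by blast
  obtain \<Theta> \<Theta>i where "homeomorphism UNIV UNIV \<Theta> \<Theta>i" and "\<Theta> holomorphic_on ball 0 1" and "\<Theta> 0 = z0"
    and \<Theta>: "\<Theta> ` ball 0 1 = inside (path_image c2)" "\<Theta> ` sphere 0 1 = path_image c2"
    by (rule Schoenflies[OF c2 z0], rule that)
  note hom = \<open>homeomorphism UNIV UNIV \<Theta> \<Theta>i\<close>
  have TT: "\<Theta>i (\<Theta> z) = z" "\<Theta> (\<Theta>i z) = z" and Tc: "continuous_on UNIV \<Theta>" for z
    using hom by (auto simp: homeomorphism_def)
  note ins = homeomorphism_inside[OF c1 homeomorphism_symD[OF hom]]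
  have undo: "\<Theta>i ` \<Theta> ` S = S" "\<Theta> ` \<Theta>i ` S = S" for S by (simp_all add: image_image TT)
  have "\<Theta>i ` (inside (path_image c2) \<union> path_image c2) = \<Theta>i ` (\<Theta> ` ball 0 1 \<union> \<Theta> ` sphere 0 1)"
    by (simp only: \<Theta>)
  also have "\<dots> = ball 0 1 \<union> sphere 0 1" by (simp only: image_Un undo)
  also have "\<dots> = cball (0::complex) 1" by auto
  finally have cb1: "\<Theta>i ` (inside (path_image c2) \<union> path_image c2) = cball 0 1" .
  then have cb: "cball 0 1 \<subseteq> inside (path_image (\<Theta>i \<circ> c1))"
    unfolding ins(4) using image_mono[OF nest, of \<Theta>i] by simp
  have clF: "closed (\<Theta>i ` F)"
  proof -
    have "\<Theta>i ` F = \<Theta> -` F" using TT by (auto simp: image_iff) (metis TT(1))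
    then show ?thesis using closed_vimage[OF F(1) Tc] by simp
  qed
  have "closure (inside (path_image (\<Theta>i \<circ> c1))) = \<Theta>i ` (inside (path_image c1) \<union> path_image c1)"
    using closure_Un_frontier[of "inside (path_image (\<Theta>i \<circ> c1))"] Jordan_sides(8)[OF ins(1,2)]
    by (simp add: image_Un) (subst ins(4), subst ins(3), rule refl)
  moreover have "\<Theta>i ` F \<inter> \<Theta>i ` (inside (path_image c1) \<union> path_image c1) = \<Theta>i ` (F \<inter> (inside (path_image c1) \<union> path_image c1))"
    by (rule image_Int[symmetric]) (use TT in \<open>auto intro: inj_on_inverseI\<close>)
  moreover have "\<dots> \<subseteq> \<Theta>i ` \<Theta> ` ball 0 1" unfolding \<Theta>(1) using F(2) by (rule image_mono)
  ultimately have sub: "\<Theta>i ` F \<inter> closure (inside (path_image (\<Theta>i \<circ> c1))) \<subseteq> ball 0 1" by (simp add: undo)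
  have "plane_isotopic (\<Theta>i ` F) (sphere 0 1) (path_image (\<Theta>i \<circ> c1))"
    by (rule circle_isotopic_to_surrounding_curve[OF ins(1,2) cb clF sub])
  then have "plane_isotopic (\<Theta> ` \<Theta>i ` F) (\<Theta> ` sphere 0 1) (\<Theta> ` path_image (\<Theta>i \<circ> c1))"
    by (rule plane_isotopic_conj[OF _ hom])
  then show ?thesis by (simp only: undo \<Theta>(2) ins(3))
qed

section \<open>Charts of a punctured sphere\<close>

text \<open>A sphere with a distinguished point \<open>q\<close> and mutually inverse homeomorphisms \<open>l\<close>, \<open>m\<close> between the
complement of \<open>q\<close> and the plane.\<close>

locale punctured_plane =
  fixes X :: "'a topology" and q :: 'a and l :: "'a \<Rightarrow> complex" and m :: "complex \<Rightarrow> 'a"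
  assumes cpt: "compact_space X" and haus: "Hausdorff_space X" and qX: "q \<in> topspace X"
    and maps: "homeomorphic_maps (subtopology X (topspace X - {q})) euclidean l m"
begin

lemma lm [simp]: "l (m z) = z" and ml [simp]: "x \<in> topspace X \<Longrightarrow> x \<noteq> q \<Longrightarrow> m (l x) = x"
  and m_in [simp]: "m z \<in> topspace X" "m z \<noteq> q"
proof -
  have m: "m z \<in> topspace X \<inter> (topspace X - {q})" for z
    using maps by (auto simp: homeomorphic_maps_def continuous_map_def)
  then show "m z \<in> topspace X" "m z \<noteq> q" by auto
  show "l (m z) = z" using maps by (simp add: homeomorphic_maps_def)
  show "x \<in> topspace X \<Longrightarrow> x \<noteq> q \<Longrightarrow> m (l x) = x" using maps by (simp add: homeomorphic_maps_def)
qed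

lemma ml_image: "A \<subseteq> topspace X - {q} \<Longrightarrow> m ` l ` A = A"
  by (force simp: image_iff subset_iff)

lemma inj_m: "inj m" by (rule inj_on_inverseI[of _ l]) simp

lemma inj_l: "inj_on l (topspace X - {q})" by (rule inj_on_inverseI[of _ m]) simp

lemma range_m: "range m = topspace X - {q}"
proof
  show "topspace X - {q} \<subseteq> range m"
  proof
    fix x assume "x \<in> topspace X - {q}"
    then have "x = m (l x)" by simp
    then show "x \<in> range m" by (rule range_eqI)
  qed
qed (use m_in in blast)

lemma open_X_minus: "openin X (topspace X - {q})"
  using haus qX by (simp add: Hausdorff_imp_t1_space openin_diff closedin_t1_singleton)

lemma hm_l: "homeomorphic_map (subtopology X (topspace X - {q})) euclidean l"
  and hm_m: "homeomorphic_map euclidean (subtopology X (topspace X - {q})) m"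
  using maps[THEN homeomorphic_maps_map[THEN iffD1]] by simp_all

lemma openin_m: "open U \<Longrightarrow> openin X (m ` U)"
proof -
  assume "open U"
  then have "openin (subtopology X (topspace X - {q})) (m ` U)"
    using homeomorphic_map_openness[OF hm_m, of U] by (simp add: open_openin[symmetric])
  then show ?thesis using open_X_minus by (rule openin_trans_full)
qed

lemma open_l: "openin X U \<Longrightarrow> q \<notin> U \<Longrightarrow> open (l ` U)"
proof -
  assume U: "openin X U" "q \<notin> U"
  then have "U \<subseteq> topspace X - {q}" using openin_subset by blast
  moreover have "openin (subtopology X (topspace X - {q})) U"
    using U calculation by (simp add: open_X_minus openin_open_subtopology)
  moreover have "U \<subseteq> topspace X" using U openin_subset by blast
  ultimately show ?thesis using homeomorphic_map_openness[OF hm_l, of U] by (simp add: open_openin[symmetric])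
qed

lemma cont_m: "continuous_map euclidean X m"
  using maps by (simp add: homeomorphic_maps_def continuous_map_in_subtopology)

lemma cont_l: "continuous_map (subtopology X (topspace X - {q})) euclidean l"
  using maps by (simp add: homeomorphic_maps_def)

lemma compact_l: "closedin X K \<Longrightarrow> q \<notin> K \<Longrightarrow> compact (l ` K)"
proof -
  assume K: "closedin X K" "q \<notin> K"
  then have "compactin X K" using cpt closedin_compact_space by blast
  moreover have "K \<subseteq> topspace X - {q}" using K closedin_subset by blast
  ultimately have "compactin (subtopology X (topspace X - {q})) K" by (simp add: compactin_subtopology)
  then have "compactin euclidean (l ` K)" using cont_l by (rule image_compactin)
  then show ?thesis by simp
qed

lemma closedin_m: "compact C \<Longrightarrow> closedin X (m ` C)"
  using image_compactin[OF _ cont_m, of C] haus compactin_imp_closedin by auto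

lemma connected_l: "connectedin X A \<Longrightarrow> q \<notin> A \<Longrightarrow> connected (l ` A)"
proof -
  assume A: "connectedin X A" "q \<notin> A"
  then have "A \<subseteq> topspace X - {q}" using connectedin_subset_topspace by blast
  with A have "connectedin (subtopology X (topspace X - {q})) A" by (simp add: connectedin_subtopology)
  then have "connectedin euclidean (l ` A)" using cont_l by (rule connectedin_continuous_map_image[rotated])
  then show ?thesis by (simp add: connectedin_iff_connected)
qed

lemma connectedin_m: "connected B \<Longrightarrow> connectedin X (m ` B)"
  using connectedin_continuous_map_image[OF cont_m, of B] by (simp add: connectedin_iff_connected)

text \<open>The point \<open>q\<close> is the point at infinity of the plane.\<close>

lemma bounded_near_q:
  assumes "openin X U" "q \<in> U"
  obtains R :: real where "0 < R" "\<And>z. R \<le> norm z \<Longrightarrow> m z \<in> U"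
proof -
  have "compact (l ` (topspace X - U))" using assms by (intro compact_l) auto
  then have "bounded (l ` (topspace X - U))" by (rule compact_imp_bounded)
  then obtain B where B: "B > 0" "\<And>w. w \<in> l ` (topspace X - U) \<Longrightarrow> norm w \<le> B" unfolding bounded_pos by blast
  show thesis
  proof (rule that[of "B + 1"])
    fix z :: complex assume z: "B + 1 \<le> norm z"
    show "m z \<in> U"
    proof (rule ccontr)
      assume "m z \<notin> U"
      then have "z \<in> l ` (topspace X - U)" by (intro image_eqI[of _ _ "m z"]) auto
      then show False using B(2)[of z] z by simp
    qed
  qed (use B in simp)
qed

lemma openin_insert_q: "compact C \<Longrightarrow> openin X (insert q (m ` (- C)))"
proof -
  assume C: "compact C"
  have "insert q (m ` (- C)) = topspace X - m ` C"
  proof -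
    have "m ` (- C) = topspace X - {q} - m ` C"
      using image_set_diff[OF inj_m, of UNIV C] by (simp add: range_m Compl_eq_Diff_UNIV)
    moreover have "q \<notin> m ` C" using m_in(2) by blast
    ultimately show ?thesis using qX by blast
  qed
  then show ?thesis using closedin_m[OF C] by auto
qed

end

definition topological_sphere :: "'a topology \<Rightarrow> bool" where
  "topological_sphere X \<longleftrightarrow> X homeomorphic_space top_of_set (sphere (0::real^3) 1)"

lemma topological_sphere_chart:
  assumes "topological_sphere X" "q \<in> topspace X"
  obtains l m where "punctured_plane X q l m"
proof -
  obtain f g where fg: "homeomorphic_maps X (top_of_set (sphere (0::real^3) 1)) f g"
    using assms by (auto simp: topological_sphere_def homeomorphic_space_def)
  then have fh: "homeomorphic_map X (top_of_set (sphere (0::real^3) 1)) f"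
    unfolding homeomorphic_maps_map by (rule conjunct1)
  have fq: "f q \<in> sphere 0 1" using fg assms by (auto simp: homeomorphic_maps_def continuous_map_def)
  have "(sphere (0::real^3) 1 - {f q}) homeomorphic (UNIV :: complex set)"
    by (rule homeomorphic_punctured_sphere_affine) (use fq in \<open>auto simp: affine_UNIV\<close>)
  then obtain u v where "homeomorphism (sphere (0::real^3) 1 - {f q}) (UNIV :: complex set) u v"
    by (auto simp: homeomorphic_def)
  then have "homeomorphic_maps (top_of_set (sphere (0::real^3) 1 - {f q})) (euclidean :: complex topology) u v"
    by (auto simp: homeomorphism_def homeomorphic_maps_def continuous_map_in_subtopology)
  then have "top_of_set (sphere (0::real^3) 1 - {f q}) homeomorphic_space (euclidean :: complex topology)"
    unfolding homeomorphic_space_def by blast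
  moreover have "subtopology X (topspace X - {q}) homeomorphic_space top_of_set (sphere (0::real^3) 1 - {f q})"
  proof -
    have "f ` (topspace X - {q}) = sphere 0 1 - {f q}"
      using homeomorphic_imp_surjective_map[OF fh] homeomorphic_imp_injective_map[OF fh] assms(2)
      by (auto simp: inj_on_def)
    then have "homeomorphic_map (subtopology X (topspace X - {q})) (subtopology (top_of_set (sphere (0::real^3) 1)) (sphere 0 1 - {f q})) f"
      by (intro homeomorphic_map_subtopologies[OF fh]) auto
    moreover have "subtopology (top_of_set (sphere (0::real^3) 1)) (sphere 0 1 - {f q}) = top_of_set (sphere (0::real^3) 1 - {f q})"
    proof -
      have "sphere 0 1 \<inter> (sphere 0 1 - {f q}) = sphere 0 1 - {f q}" by blast
      then show ?thesis by (simp add: subtopology_subtopology)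
    qed
    ultimately show ?thesis by (metis homeomorphic_space)
  qed
  ultimately have "subtopology X (topspace X - {q}) homeomorphic_space (euclidean :: complex topology)"
    by (rule homeomorphic_space_trans[rotated])
  then obtain l m where "homeomorphic_maps (subtopology X (topspace X - {q})) (euclidean :: complex topology) l m"
    by (auto simp: homeomorphic_space_def)
  moreover have "compact_space X"
    using homeomorphic_compact_space[of X "top_of_set (sphere (0::real^3) 1)"] assms(1)
    by (simp add: topological_sphere_def compact_space_subtopology)
  moreover have "Hausdorff_space X"
    using homeomorphic_Hausdorff_space[of X "top_of_set (sphere (0::real^3) 1)"] assms(1)
    by (simp add: topological_sphere_def Hausdorff_space_subtopology)
  ultimately show thesis using that assms(2) by (simp add: punctured_plane_def)
qed

section \<open>Jordan curves on the sphere\<close>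

lemma topological_sphere_connected:
  assumes "topological_sphere X" shows "connected_space X"
proof -
  have "connected (sphere (0::real^3) 1)" by (intro connected_sphere) simp
  then have "connected_space (top_of_set (sphere (0::real^3) 1))" by (simp add: connected_space_subtopology connectedin_iff_connected)
  then show ?thesis using homeomorphic_connected_space assms unfolding topological_sphere_def by blast
qed

lemma topological_sphere_other_point:
  assumes "topological_sphere X" "x \<in> topspace X"
  obtains q where "q \<in> topspace X" "q \<noteq> x"
proof -
  obtain l m where "punctured_plane X x l m" using topological_sphere_chart[OF assms] by blast
  then interpret punctured_plane X x l m .
  show thesis by (rule that[of "m 0"]) simp_all
qed

lemma topological_sphere_compact_Hausdorff:
  assumes "topological_sphere X" shows "compact_space X" "Hausdorff_space X"
proof -
  have *: "compact_space X \<and> Hausdorff_space X" if "q \<in> topspace X" for q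
    using topological_sphere_chart[OF assms that] by (metis punctured_plane.cpt punctured_plane.haus)
  have "topspace X \<noteq> {}" 
  proof
    assume "topspace X = {}"
    then have "X = trivial_topology" by simp
    then have "top_of_set (sphere (0::real^3) 1) = trivial_topology"
      using homeomorphic_empty_space assms unfolding topological_sphere_def by blast
    then have "sphere (0::real^3) 1 = {}" by (metis topspace_euclidean_subtopology topspace_discrete_topology)
    moreover have "axis 1 (1::real) \<in> sphere (0::real^3) 1" by (simp add: norm_axis_1)
    ultimately show False by simp
  qed
  then obtain x where "x \<in> topspace X" by blast
  then show "compact_space X" "Hausdorff_space X" using *[of x] by simp_all
qed

lemma topological_sphere_locally_connected:
  assumes "topological_sphere X" shows "locally_connected_space X"
  unfolding locally_connected_space
proof (intro allI impI)
  fix V x assume V: "openin X V \<and> x \<in> V"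
  then have x: "x \<in> topspace X" using openin_subset by blast
  obtain q where q: "q \<in> topspace X" "q \<noteq> x" using topological_sphere_other_point[OF assms x] by blast
  obtain l m where "punctured_plane X q l m" using topological_sphere_chart[OF assms q(1)] by blast
  then interpret punctured_plane X q l m .
  have "openin X (V \<inter> (topspace X - {q}))" using V open_X_minus by blast
  then have "open (l ` (V \<inter> (topspace X - {q})))" by (rule open_l) simp
  moreover have "l x \<in> l ` (V \<inter> (topspace X - {q}))" using V q x by blast
  ultimately obtain e where e: "e > 0" "ball (l x) e \<subseteq> l ` (V \<inter> (topspace X - {q}))"
    using open_contains_ball by blast
  have "m ` ball (l x) e \<subseteq> m ` l ` (V \<inter> (topspace X - {q}))" using e by (intro image_mono)
  also have "\<dots> = V \<inter> (topspace X - {q})" by (rule ml_image) auto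
  finally have "m ` ball (l x) e \<subseteq> V" by blast
  moreover have "x \<in> m ` ball (l x) e" using e x q by (intro image_eqI[of _ _ "l x"]) auto
  moreover have "openin X (m ` ball (l x) e)" by (rule openin_m) simp
  moreover have "connectedin X (m ` ball (l x) e)" by (rule connectedin_m) simp
  ultimately show "\<exists>U. openin X U \<and> connectedin X U \<and> x \<in> U \<and> U \<subseteq> V" by blast
qed

lemma clopen_connected_is_component:
  assumes "connectedin Z U" "openin Z U" "closedin Z U" "U \<noteq> {}"
  shows "U \<in> connected_components_of Z"
proof -
  have "Z \<noteq> trivial_topology" using assms openin_subset by fastforce
  then obtain C where C: "C \<in> connected_components_of Z" "U \<subseteq> C"
    using exists_connected_component_of_superset[OF assms(1)] by blast
  have "connectedin Z C" using C(1) by (rule connectedin_connected_components_of)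
  then have "C \<subseteq> U \<or> disjnt C U" using connectedin_clopen_cases assms(2,3) by metis
  then have "C = U" using C(2) assms(4) by (auto simp: disjnt_def)
  then show ?thesis using C by simp
qed

lemma complement_component_props:
  assumes X: "topological_sphere X" and K: "closedin X K" and C: "C \<in> complement_components X K"
  shows "openin X C" "connectedin X C" "C \<noteq> {}" "C \<subseteq> topspace X - K" "X frontier_of C \<subseteq> K"
    "openin X U \<Longrightarrow> connectedin X U \<Longrightarrow> U \<subseteq> topspace X - K \<Longrightarrow> U \<inter> C \<noteq> {} \<Longrightarrow> U \<subseteq> C"
proof -
  let ?Y = "subtopology X (topspace X - K)"
  have op: "openin X (topspace X - K)" using K by blast
  have lc: "locally_connected_space ?Y"
    using locally_connected_space_open_subset[OF topological_sphere_locally_connected[OF X] op] .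
  have C': "C \<in> connected_components_of ?Y" using C by (simp add: complement_components_def)
  have "openin ?Y C" using openin_connected_components_of_locally_connected_space[OF lc C'] .
  then show oC: "openin X C" using op by (rule openin_trans_full)
  have "connectedin ?Y C" using C' by (rule connectedin_connected_components_of)
  then show "connectedin X C" by (simp add: connectedin_subtopology)
  show "C \<noteq> {}" using C' by (rule nonempty_connected_components_of)
  show sub: "C \<subseteq> topspace X - K" using connected_components_of_subset[OF C'] by simp
  have "closedin ?Y C" using C' by (rule closedin_connected_components_of)
  then have "?Y closure_of C = C" by (rule closure_of_closedin)
  then have *: "X closure_of C \<inter> (topspace X - K) \<subseteq> C"
  proof -
    have "(topspace X - K) \<inter> C = C" using sub by blast
    then show ?thesis using \<open>?Y closure_of C = C\<close> closure_of_subtopology[of X "topspace X - K" C] by auto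
  qed
  show "X frontier_of C \<subseteq> K"
    using * oC closure_of_subset_topspace[of X C] by (auto simp: frontier_of_openin)
  show "U \<subseteq> C" if "openin X U" "connectedin X U" "U \<subseteq> topspace X - K" "U \<inter> C \<noteq> {}"
  proof (rule connected_components_of_maximal[OF C'])
    show "connectedin ?Y U" using that by (simp add: connectedin_subtopology)
    show "\<not> disjnt C U" using that by (auto simp: disjnt_def)
  qed
qed

lemma complement_component_ex:
  assumes "x \<in> topspace X - K"
  obtains C where "C \<in> complement_components X K" "x \<in> C"
proof -
  have "x \<in> topspace (subtopology X (topspace X - K))" using assms by simp
  then have "x \<in> \<Union>(connected_components_of (subtopology X (topspace X - K)))"
    by (simp only: Union_connected_components_of)
  then show thesis using that by (auto simp: complement_components_def)
qed

lemma complement_components_disjoint: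
  "C \<in> complement_components X K \<Longrightarrow> C' \<in> complement_components X K \<Longrightarrow> C \<inter> C' \<noteq> {} \<Longrightarrow> C = C'"
  unfolding complement_components_def
  using pairwise_disjoint_connected_components_of[of "subtopology X (topspace X - K)"]
  by (auto simp: pairwise_def disjnt_def)

context punctured_plane begin

lemma jordan_curve_chart:
  assumes "jordan_curve X \<gamma>" "q \<notin> \<gamma>"
  obtains c where "simple_path c" "pathfinish c = pathstart c" "l ` \<gamma> = path_image c" "\<gamma> = m ` path_image c"
proof -
  obtain h k where hk: "homeomorphic_maps (subtopology X \<gamma>) (top_of_set (sphere (0::complex) 1)) h k"
    using assms by (auto simp: jordan_curve_def homeomorphic_space_def)
  have sub: "\<gamma> \<subseteq> topspace X - {q}" using assms by (auto simp: jordan_curve_def)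
  have ck: "continuous_map (top_of_set (sphere (0::complex) 1)) (subtopology X \<gamma>) k"
    using hk by (simp add: homeomorphic_maps_def)
  have "subtopology X \<gamma> = subtopology (subtopology X (topspace X - {q})) \<gamma>"
    using sub by (simp add: subtopology_subtopology Int_absorb1)
  then have cl: "continuous_map (subtopology X \<gamma>) euclidean l"
    using continuous_map_from_subtopology[OF cont_l] by metis
  have "continuous_map (top_of_set (sphere (0::complex) 1)) euclidean (l \<circ> k)"
    using ck cl by (rule continuous_map_compose)
  then have c1: "continuous_on (sphere 0 1) (l \<circ> k)" by simp
  have k\<gamma>: "k ` sphere 0 1 = \<gamma>"
  proof -
    have "homeomorphic_map (top_of_set (sphere (0::complex) 1)) (subtopology X \<gamma>) k"
      using hk[THEN homeomorphic_maps_map[THEN iffD1]] by simp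
    then show ?thesis using sub homeomorphic_imp_surjective_map by fastforce
  qed
  have inj: "inj_on (l \<circ> k) (sphere 0 1)"
  proof (rule comp_inj_on)
    show "inj_on k (sphere 0 1)" using hk by (intro inj_on_inverseI[of _ h]) (simp add: homeomorphic_maps_def)
    show "inj_on l (k ` sphere 0 1)" unfolding k\<gamma> using inj_l sub by (rule inj_on_subset)
  qed
  have im: "path_image (circlepath 0 1) = sphere (0::complex) 1" by simp
  define c where "c = (l \<circ> k) \<circ> circlepath 0 1"
  have "simple_path c" unfolding c_def
    by (rule simple_path_continuous_image) (use c1 inj in \<open>simp_all add: simple_path_circlepath\<close>)
  moreover have "pathfinish c = pathstart c" unfolding c_def by (simp add: pathfinish_compose pathstart_compose)
  moreover have pc: "l ` \<gamma> = path_image c"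
    unfolding c_def path_image_compose im image_comp[symmetric] k\<gamma> ..
  moreover have "\<gamma> = m ` path_image c" unfolding pc[symmetric] using ml_image[OF sub] by simp
  ultimately show thesis by (rule that)
qed

text \<open>The sides of a curve avoiding \<open>q\<close> are the inside and the outside in the plane; \<open>q\<close> belongs to the latter.\<close>

lemma outside_q_sides:
  assumes c: "simple_path c" "pathfinish c = pathstart c"
  defines "A \<equiv> m ` inside (path_image c)" and "B \<equiv> insert q (m ` outside (path_image c))" and "\<gamma> \<equiv> m ` path_image c"
  shows "complement_components X \<gamma> = {A, B}" "A \<noteq> B" "A \<inter> B = {}" "topspace X - \<gamma> = A \<union> B"
    "X closure_of A = A \<union> \<gamma>" "X closure_of B = B \<union> \<gamma>"
proof -
  note J = Jordan_sides[OF c]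
  have oA: "openin X A" unfolding A_def using J(1) by (rule openin_m)
  have "compact (inside (path_image c) \<union> path_image c)"
    using J(7,8) closure_Un_frontier[of "inside (path_image c)"] by (metis compact_closure)
  moreover have out: "- (inside (path_image c) \<union> path_image c) = outside (path_image c)" using J(10,12,13) by blast
  ultimately have oB: "openin X B" unfolding B_def using openin_insert_q by metis
  have cA: "connectedin X A" unfolding A_def using J(2) by (rule connectedin_m)
  have cO: "connectedin X (m ` outside (path_image c))" using J(5) by (rule connectedin_m)
  have "q \<in> X closure_of (m ` outside (path_image c))"
    unfolding in_closure_of
  proof (intro conjI allI impI qX)
    fix U assume "q \<in> U \<and> openin X U"
    then obtain R where R: "0 < R" "\<And>z. R \<le> norm z \<Longrightarrow> m z \<in> U" using bounded_near_q by metis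
    have "bounded (inside (path_image c) \<union> path_image c)" using J(7) c by (simp add: bounded_simple_path_image)
    then obtain b where b: "\<And>z. z \<in> inside (path_image c) \<union> path_image c \<Longrightarrow> norm z \<le> b" unfolding bounded_iff by blast
    define z where "z = complex_of_real (max R (b + 1))"
    have nz: "norm z = max R (b + 1)" using R(1) by (simp add: z_def)
    then have "z \<notin> inside (path_image c) \<union> path_image c" using b[of z] by auto
    then have "z \<in> outside (path_image c)" using J(13) by blast
    moreover have "m z \<in> U" using R(2) nz by simp
    ultimately show "\<exists>y. y \<in> m ` outside (path_image c) \<and> y \<in> U" by blast
  qed
  then have cB: "connectedin X B" unfolding B_def
    by (intro connectedin_intermediate_closure_of[OF cO])
       (use closure_of_subset[of "m ` outside (path_image c)" X] m_in(1) in blast)+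
  have mm: "m ` S \<inter> m ` T = {}" if "S \<inter> T = {}" for S T
    using that unfolding image_Int[OF inj_m, symmetric] by simp
  have qm: "q \<notin> m ` S" for S using m_in(2) by blast
  show AB: "A \<inter> B = {}" unfolding A_def B_def using mm[OF J(10)] qm by blast
  have "insert q (m ` (inside (path_image c) \<union> outside (path_image c) \<union> path_image c)) = topspace X"
    unfolding J(13) range_m using qX by blast
  then have tX: "A \<union> B \<union> \<gamma> = topspace X" unfolding A_def B_def \<gamma>_def image_Un by blast
  have "A \<inter> \<gamma> = {}" "B \<inter> \<gamma> = {}" unfolding A_def B_def \<gamma>_def using mm[OF J(11)] mm[OF J(12)] qm by blast+
  then show un: "topspace X - \<gamma> = A \<union> B" using tX by blast
  have A0: "A \<noteq> {}" using J(3) by (simp add: A_def)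
  have B0: "B \<noteq> {}" by (simp add: B_def)
  show "A \<noteq> B" using AB A0 by blast
  let ?Y = "subtopology X (topspace X - \<gamma>)"
  have op: "openin ?Y A" "openin ?Y B" using oA oB un by (auto simp: openin_subtopology)
  have tY: "topspace ?Y = A \<union> B" using un by auto
  have "closedin ?Y A" "closedin ?Y B"
  proof -
    have "topspace ?Y - A = B" "topspace ?Y - B = A" unfolding tY using AB by blast+
    then show "closedin ?Y A" "closedin ?Y B" using op tY by (auto simp: closedin_def)
  qed
  moreover have "connectedin ?Y A" "connectedin ?Y B" using cA cB un by (auto simp: connectedin_subtopology)
  ultimately have comp: "A \<in> connected_components_of ?Y" "B \<in> connected_components_of ?Y"
    using op A0 B0 by (simp_all add: clopen_connected_is_component)
  show "complement_components X \<gamma> = {A, B}"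
  proof
    show "{A, B} \<subseteq> complement_components X \<gamma>" using comp by (simp add: complement_components_def)
    show "complement_components X \<gamma> \<subseteq> {A, B}"
    proof
      fix C assume "C \<in> complement_components X \<gamma>"
      then have C: "C \<in> connected_components_of ?Y" by (simp add: complement_components_def)
      then have "C \<noteq> {}" "C \<subseteq> A \<union> B" using nonempty_connected_components_of connected_components_of_subset tY by blast+
      then have "C \<inter> A \<noteq> {} \<or> C \<inter> B \<noteq> {}" by blast
      then show "C \<in> {A, B}"
        using pairwiseD[OF pairwise_disjoint_connected_components_of C comp(1)]
          pairwiseD[OF pairwise_disjoint_connected_components_of C comp(2)] by (auto simp: disjnt_def)
    qed
  qed
  have clA: "closedin X (A \<union> \<gamma>)"
  proof -
    have "topspace X - (A \<union> \<gamma>) = B" using tX AB \<open>B \<inter> \<gamma> = {}\<close> by blast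
    then show ?thesis using oB tX by (auto simp: closedin_def)
  qed
  have clB: "closedin X (B \<union> \<gamma>)"
  proof -
    have "topspace X - (B \<union> \<gamma>) = A" using tX AB \<open>A \<inter> \<gamma> = {}\<close> by blast
    then show ?thesis using oA tX by (auto simp: closedin_def)
  qed
  have near: "x \<in> X closure_of (m ` S)" if S: "frontier S = path_image c" and x: "x \<in> \<gamma>" for S x
    unfolding in_closure_of
  proof (intro conjI allI impI)
    show "x \<in> topspace X" using x tX by blast
    fix U assume U: "x \<in> U \<and> openin X U"
    obtain z where z: "z \<in> path_image c" "x = m z" using x by (auto simp: \<gamma>_def)
    have "openin X (U \<inter> (topspace X - {q}))" using U open_X_minus by blast
    then have "open (l ` (U \<inter> (topspace X - {q})))" by (rule open_l) simp
    moreover have "z \<in> l ` (U \<inter> (topspace X - {q}))" using z U by (intro image_eqI[of _ _ x]) auto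
    moreover have "z \<in> closure S" using z S by (metis closure_Un_frontier UnI2)
    ultimately obtain y where "y \<in> S" "y \<in> l ` (U \<inter> (topspace X - {q}))"
      using open_Int_closure_eq_empty[of "l ` (U \<inter> (topspace X - {q}))" S] by blast
    then obtain x' where "x' \<in> U" "x' \<in> topspace X" "x' \<noteq> q" "y = l x'" using \<open>y \<in> l ` _\<close> by blast
    then have "m y \<in> U" by simp
    moreover have "m y \<in> m ` S" using \<open>y \<in> S\<close> by (rule imageI)
    ultimately show "\<exists>y. y \<in> m ` S \<and> y \<in> U" by blast
  qed
  show "X closure_of A = A \<union> \<gamma>"
  proof
    show "X closure_of A \<subseteq> A \<union> \<gamma>" using clA by (intro closure_of_minimal) auto
    have "\<gamma> \<subseteq> X closure_of A" unfolding A_def using near[OF J(8)] by blast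
    then show "A \<union> \<gamma> \<subseteq> X closure_of A" using closure_of_subset[of A X] tX by blast
  qed
  show "X closure_of B = B \<union> \<gamma>"
  proof
    show "X closure_of B \<subseteq> B \<union> \<gamma>" using clB by (intro closure_of_minimal) auto
    have "X closure_of (m ` outside (path_image c)) \<subseteq> X closure_of B" by (rule closure_of_mono) (auto simp: B_def)
    then have "\<gamma> \<subseteq> X closure_of B" using near[OF J(9)] by blast
    then show "B \<union> \<gamma> \<subseteq> X closure_of B" using closure_of_subset[of B X] tX by blast
  qed
qed

end

lemma jordan_curve_closedin:
  assumes "topological_sphere X" "jordan_curve X \<gamma>" shows "closedin X \<gamma>" "connectedin X \<gamma>" "\<gamma> \<noteq> {}" "infinite \<gamma>"
proof -
  obtain h where h: "homeomorphic_map (top_of_set (sphere (0::complex) 1)) (subtopology X \<gamma>) h"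
    using assms by (metis homeomorphic_space homeomorphic_space_sym jordan_curve_def)
  have \<gamma>: "h ` sphere 0 1 = \<gamma>"
    using homeomorphic_imp_surjective_map[OF h] assms(2) by (auto simp: jordan_curve_def)
  have c: "continuous_map (top_of_set (sphere (0::complex) 1)) X h"
    using h by (auto simp: homeomorphic_imp_continuous_map dest: homeomorphic_imp_continuous_map continuous_map_into_fulltopology)
  have "compactin X (h ` sphere 0 1)"
    by (rule image_compactin[OF _ c]) (simp add: compactin_subtopology)
  then show "closedin X \<gamma>"
    using topological_sphere_compact_Hausdorff[OF assms(1)] \<gamma> compactin_imp_closedin by auto
  have "connectedin (top_of_set (sphere (0::complex) 1)) (sphere 0 1)"
    by (simp add: connectedin_subtopology connectedin_iff_connected connected_sphere)
  then show "connectedin X \<gamma>" using connectedin_continuous_map_image[OF c] \<gamma> by metis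
  show "\<gamma> \<noteq> {}" using \<gamma> by auto
  have "infinite (sphere (0::complex) 1)"
  proof
    assume "finite (sphere (0::complex) 1)"
    moreover have "connected (sphere (0::complex) 1)" by (simp add: connected_sphere)
    moreover have "1 \<in> sphere (0::complex) 1" "-1 \<in> sphere (0::complex) 1" by auto
    ultimately show False using connected_finite_iff_sing by (metis empty_iff one_neq_neg_one singletonD)
  qed
  moreover have "inj_on h (sphere 0 1)" using homeomorphic_imp_injective_map[OF h] by simp
  ultimately show "infinite \<gamma>" using \<gamma> finite_imageD by blast
qed

lemma jordan_curve_sides:
  assumes X: "topological_sphere X" and \<gamma>: "jordan_curve X \<gamma>" and q: "q \<in> topspace X - \<gamma>"
    and D: "D \<in> complement_components X \<gamma>"
  shows "X frontier_of D = \<gamma>" "X closure_of D = D \<union> \<gamma>"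
    "topspace X - (D \<union> \<gamma>) \<in> complement_components X \<gamma>"
    "E \<in> complement_components X \<gamma> \<Longrightarrow> E = D \<or> E = topspace X - (D \<union> \<gamma>)"
proof -
  have qX': "q \<in> topspace X" and q\<gamma>: "q \<notin> \<gamma>" using q by simp_all
  from topological_sphere_chart[OF X qX'] obtain l m where "punctured_plane X q l m" .
  then interpret punctured_plane X q l m .
  obtain c where c: "simple_path c" "pathfinish c = pathstart c" and "l ` \<gamma> = path_image c" and c\<gamma>: "\<gamma> = m ` path_image c"
    by (rule jordan_curve_chart[OF \<gamma> q\<gamma>])
  define A where "A = m ` inside (path_image c)"
  define B where "B = insert q (m ` outside (path_image c))"
  note S = outside_q_sides[OF c, folded c\<gamma> A_def B_def]
  have op: "openin X D" and sub: "D \<subseteq> topspace X - \<gamma>"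
    using complement_component_props(1,4)[OF X jordan_curve_closedin(1)[OF X \<gamma>] D] .
  have "D = A \<or> D = B" using D S(1) by blast
  then show cl: "X closure_of D = D \<union> \<gamma>" using S(5,6) by blast
  show "X frontier_of D = \<gamma>" using op cl sub by (auto simp: frontier_of_openin)
  have "topspace X - (D \<union> \<gamma>) = (if D = A then B else A)"
    using S(2-4) \<open>D = A \<or> D = B\<close> by (simp add: Un_commute flip: Diff_Diff_Int) blast
  then show "topspace X - (D \<union> \<gamma>) \<in> complement_components X \<gamma>"
    "E \<in> complement_components X \<gamma> \<Longrightarrow> E = D \<or> E = topspace X - (D \<union> \<gamma>)"
    using S(1) \<open>D = A \<or> D = B\<close> by auto
qed

lemma jordan_curve_side_chart:
  assumes X: "topological_sphere X" and \<gamma>: "jordan_curve X \<gamma>" and q: "q \<in> topspace X - \<gamma>"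
    and D: "D \<in> complement_components X \<gamma>" "q \<notin> D" and lm: "punctured_plane X q l m"
  obtains c where "simple_path c" "pathfinish c = pathstart c" "\<gamma> = m ` path_image c" "D = m ` inside (path_image c)"
proof -
  interpret punctured_plane X q l m by (rule lm)
  have q\<gamma>: "q \<notin> \<gamma>" using q by simp
  obtain c where c: "simple_path c" "pathfinish c = pathstart c" and "l ` \<gamma> = path_image c" and c\<gamma>: "\<gamma> = m ` path_image c"
    by (rule jordan_curve_chart[OF \<gamma> q\<gamma>])
  have "D = m ` inside (path_image c)"
    using outside_q_sides(1)[OF c, folded c\<gamma>] D by blast
  then show thesis using that c c\<gamma> by blast
qed

section \<open>Separation, local accessibility and unbranched coverings of discs\<close>

text \<open>The set \<open>K\<close> does not separate \<open>z\<close> from \<open>w\<close>.\<close>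

definition joined_off :: "'a topology \<Rightarrow> 'a set \<Rightarrow> 'a \<Rightarrow> 'a \<Rightarrow> bool" where
  "joined_off X K z w \<longleftrightarrow> (\<exists>C. connectedin X C \<and> C \<subseteq> topspace X - K \<and> z \<in> C \<and> w \<in> C)"

lemma complement_component_maximal:
  assumes "C \<in> complement_components X K" "connectedin X U" "U \<subseteq> topspace X - K" "U \<inter> C \<noteq> {}"
  shows "U \<subseteq> C"
proof (rule connected_components_of_maximal)
  show "C \<in> connected_components_of (subtopology X (topspace X - K))"
    using assms(1) by (simp add: complement_components_def)
  show "connectedin (subtopology X (topspace X - K)) U" using assms by (simp add: connectedin_subtopology)
  show "\<not> disjnt C U" using assms by (auto simp: disjnt_def)
qed

lemma joined_off_component:
  assumes "C \<in> complement_components X K" "z \<in> C" "joined_off X K z w" shows "w \<in> C"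
  using complement_component_maximal[OF assms(1)] assms(2,3) unfolding joined_off_def by blast

text \<open>A chart at \<open>q'\<close> turns this into a fact about open subsets of the plane.\<close>

lemma open_connected_minus_point:
  assumes X: "topological_sphere X" and U: "openin X U" "connectedin X U" and q: "q' \<in> topspace X" "q' \<notin> U"
  shows "connectedin X (U - {q})"
proof -
  from topological_sphere_chart[OF X q(1)] obtain l m where "punctured_plane X q' l m" .
  then interpret punctured_plane X q' l m .
  have sub: "U \<subseteq> topspace X - {q'}" using U(1) q(2) openin_subset by blast
  have "connected (l ` U - {l q})"
    by (rule connected_open_delete) (use open_l[OF U(1) q(2)] connected_l[OF U(2) q(2)] in simp_all)
  then have "connectedin X (m ` (l ` U - {l q}))" by (rule connectedin_m)
  moreover have "m ` (l ` U - {l q}) = U - {q}" if "q \<in> U"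
  proof -
    have "q \<in> topspace X - {q'}" using that sub by blast
    then have "m ` {l q} = {q}" by simp
    then show ?thesis by (simp only: image_set_diff[OF inj_m] ml_image[OF sub])
  qed
  ultimately show ?thesis using U(2) by (cases "q \<in> U") auto
qed

text \<open>Janiszewski's theorem on the sphere: disjoint closed sets that do not separate two points do not
separate them together. A point \<open>q\<close> of \<open>K\<close> is sent to infinity; then \<open>K\<close> becomes a closed and \<open>L\<close> a compact subset of
the plane.\<close>

lemma joined_off_Un:
  assumes X: "topological_sphere X" and K: "closedin X K" and L: "closedin X L" and dis: "K \<inter> L = {}"
    and zK: "joined_off X K z w" and zL: "joined_off X L z w"
  shows "joined_off X (K \<union> L) z w"
proof (cases "K = {} \<or> L = {}")
  case True then show ?thesis using zK zL by auto
next
  case False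
  then obtain q q' where q: "q \<in> K" and q': "q' \<in> L" by blast
  have qq: "q \<in> topspace X" "q' \<in> topspace X" using q q' K L closedin_subset by blast+
  from topological_sphere_chart[OF X qq(1)] obtain l m where "punctured_plane X q l m" .
  then interpret punctured_plane X q l m .
  have z: "z \<in> topspace X - K" "w \<in> topspace X - K" "z \<in> topspace X - L" "w \<in> topspace X - L"
    using zK zL unfolding joined_off_def by blast+
  obtain D where D: "D \<in> complement_components X K" "z \<in> D" using complement_component_ex[OF z(1)] by blast
  obtain E where E: "E \<in> complement_components X L" "z \<in> E" using complement_component_ex[OF z(3)] by blast
  note D' = complement_component_props[OF X K D(1)] and E' = complement_component_props[OF X L E(1)]
  have w: "w \<in> D" "w \<in> E" using joined_off_component D E zK zL by metis+
  define T where "T = - l ` (topspace X - K)"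
  \<comment> \<open>In the plane, \<open>T\<close> is the image of \<open>K\<close> without \<open>q\<close>.\<close>
  define S where "S = l ` L"
  have "open (l ` (topspace X - K))" by (rule open_l) (use K q in auto)
  then have cT: "closed T" by (simp add: T_def closed_def)
  have qL: "q \<notin> L" using q dis by blast
  then have cS: "compact S" unfolding S_def using L by (intro compact_l)
  have "S \<inter> T = {}" unfolding S_def T_def using dis L closedin_subset by fastforce
  have "connected_component (- (S \<union> T)) (l z) (l w)"
  proof (rule Janiszewski[OF cS cT])
    show "connected (S \<inter> T)" using \<open>S \<inter> T = {}\<close> by simp
    have "q \<notin> D" using D'(4) q by blast
    then have "connected (l ` D)" by (rule connected_l[OF D'(2)])
    moreover have "l ` D \<subseteq> - T" unfolding T_def using D'(4) by auto
    ultimately show "connected_component (- T) (l z) (l w)"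
      using D(2) w(1) unfolding connected_component_def by blast
    have "connectedin X (E - {q})"
      using open_connected_minus_point[OF X E'(1,2) qq(2)] E'(4) q' by blast
    then have "connected (l ` (E - {q}))" by (rule connected_l) simp
    moreover have "l ` (E - {q}) \<subseteq> - S"
    proof
      fix y assume "y \<in> l ` (E - {q})"
      then obtain x where x: "x \<in> E" "x \<noteq> q" "y = l x" by blast
      show "y \<in> - S"
      proof
        assume "y \<in> S"
        then obtain x' where "x' \<in> L" "l x' = l x" using x by (auto simp: S_def)
        moreover have "x' \<in> topspace X - {q}" "x \<in> topspace X - {q}"
          using \<open>x' \<in> L\<close> qL L closedin_subset x E'(4) by blast+
        ultimately have "x' = x" using inj_l by (auto dest: inj_onD)
        then show False using \<open>x' \<in> L\<close> x E'(4) by blast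
      qed
    qed
    moreover have "z \<noteq> q" "w \<noteq> q" using z q by auto
    ultimately show "connected_component (- S) (l z) (l w)"
      using E(2) w(2) unfolding connected_component_def by blast
  qed
  then obtain B where B: "connected B" "B \<subseteq> - (S \<union> T)" "l z \<in> B" "l w \<in> B"
    unfolding connected_component_def by blast
  show ?thesis
    unfolding joined_off_def
  proof (intro exI conjI)
    show "connectedin X (m ` B)" using B(1) by (rule connectedin_m)
    show "m ` B \<subseteq> topspace X - (K \<union> L)"
    proof
      fix x assume "x \<in> m ` B"
      then obtain b where b: "b \<in> B" "x = m b" by blast
      then obtain x' where x': "x' \<in> topspace X - K" "b = l x'" using B(2) by (auto simp: T_def)
      then have "x' \<noteq> q" "x' \<in> topspace X" using q by auto
      then have "x = x'" using b \<open>b = l x'\<close> by simp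
      moreover have "x \<notin> L" using b B(2) by (force simp: S_def)
      ultimately show "x \<in> topspace X - (K \<union> L)" using \<open>x' \<in> topspace X - K\<close> by blast
    qed
    have "z \<noteq> q" "w \<noteq> q" using z q by auto
    then have "z = m (l z)" "w = m (l w)" using z by simp_all
    then show "z \<in> m ` B" "w \<in> m ` B" using B(3,4) by (metis imageI)+
  qed
qed

lemma joined_off_Union:
  assumes X: "topological_sphere X" and fin: "finite \<J>" and cl: "\<And>K. K \<in> \<J> \<Longrightarrow> closedin X K"
    and dis: "pairwise disjnt \<J>" and zw: "z \<in> topspace X" "w \<in> topspace X"
    and j: "\<And>K. K \<in> \<J> \<Longrightarrow> joined_off X K z w"
  shows "joined_off X (\<Union>\<J>) z w"
  using fin cl dis j
proof (induction \<J> rule: finite_induct)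
  case empty
  have "connectedin X (topspace X)" using topological_sphere_connected[OF X] by (simp add: connectedin_topspace)
  then show ?case using zw unfolding joined_off_def by auto
next
  case (insert K \<J>)
  have "joined_off X (K \<union> \<Union>\<J>) z w"
  proof (rule joined_off_Un[OF X])
    show "closedin X K" "joined_off X K z w" using insert.prems by auto
    show "closedin X (\<Union>\<J>)" using insert by (intro closedin_Union) auto
    show "K \<inter> \<Union>\<J> = {}" using insert by (auto simp: pairwise_insert disjnt_def)
    show "joined_off X (\<Union>\<J>) z w" using insert by (auto simp: pairwise_insert)
  qed
  then show ?case by simp
qed

text \<open>\<open>Jordan_curve_locally_accessible\<close> in a chart at a point of the other side.\<close>

lemma side_locally_accessible:
  assumes X: "topological_sphere X" and \<gamma>: "jordan_curve X \<gamma>" and p: "p \<in> topspace X - \<gamma>"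
    and D: "D \<in> complement_components X \<gamma>" and a: "a \<in> \<gamma>" and N: "openin X N" "a \<in> N"
  obtains N' where "openin X N'" "a \<in> N'" "N' \<subseteq> N"
    "\<And>z w. z \<in> N' \<inter> D \<Longrightarrow> w \<in> N' \<inter> D \<Longrightarrow> \<exists>C. connectedin X C \<and> z \<in> C \<and> w \<in> C \<and> C \<subseteq> N \<inter> D"
proof -
  note S = jordan_curve_sides[OF X \<gamma> p D]
  have cl: "closedin X \<gamma>" using jordan_curve_closedin(1)[OF X \<gamma>] .
  note C = complement_component_props[OF X cl D]
  obtain q where q: "q \<in> topspace X - (D \<union> \<gamma>)"
    using complement_component_props(3)[OF X cl S(3)] by blast
  then have q1: "q \<in> topspace X" "q \<in> topspace X - \<gamma>" "q \<notin> D" "q \<notin> \<gamma>" by blast+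
  from topological_sphere_chart[OF X q1(1)] obtain l m where ch: "punctured_plane X q l m" .
  interpret punctured_plane X q l m by (rule ch)
  obtain c where c: "simple_path c" "pathfinish c = pathstart c" and \<gamma>c: "\<gamma> = m ` path_image c"
    and Dc: "D = m ` inside (path_image c)"
    by (rule jordan_curve_side_chart[OF X \<gamma> q1(2) D q1(3) ch])
  have "openin X (N \<inter> (topspace X - {q}))" using N(1) open_X_minus by blast
  then have oN: "open (l ` (N \<inter> (topspace X - {q})))" by (rule open_l) simp
  have aX: "a \<in> topspace X" "a \<noteq> q" using a q1(4) \<gamma> by (auto simp: jordan_curve_def)
  have "l a \<in> l ` (N \<inter> (topspace X - {q}))" using N(2) aX by blast
  then obtain e where e: "e > 0" "ball (l a) e \<subseteq> l ` (N \<inter> (topspace X - {q}))"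
    using oN open_contains_ball by blast
  have mN: "m z \<in> N" if zb: "z \<in> ball (l a) e" for z
  proof -
    obtain x where "x \<in> N" "x \<in> topspace X" "x \<noteq> q" "z = l x" using e(2) zb by blast
    then show ?thesis by simp
  qed
  have lac: "l a \<in> path_image c" using a unfolding \<gamma>c by auto
  obtain d where d: "0 < d" and acc: "\<And>z w. \<lbrakk>dist z (l a) < d; dist w (l a) < d; connected_component (- path_image c) z w\<rbrakk>
       \<Longrightarrow> connected_component (ball (l a) e - path_image c) z w"
    using Jordan_curve_locally_accessible[OF c lac e(1)] by metis
  define N' where "N' = m ` ball (l a) (min d e)"
  note J = Jordan_sides[OF c]
  show thesis
  proof (rule that)
    show "openin X N'" unfolding N'_def by (rule openin_m) simp
    show "a \<in> N'" unfolding N'_def using aX d e(1) by (intro image_eqI[of _ _ "l a"]) auto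
    show "N' \<subseteq> N" unfolding N'_def using mN by auto
    fix z w assume "z \<in> N' \<inter> D" "w \<in> N' \<inter> D"
    moreover have "\<exists>y'. y' \<in> inside (path_image c) \<and> y = m y' \<and> dist y' (l a) < d" if y: "y \<in> N' \<inter> D" for y
    proof -
      obtain u v where u: "y = m u" "u \<in> ball (l a) (min d e)" and v: "y = m v" "v \<in> inside (path_image c)"
        using y unfolding N'_def Dc by blast
      then have "u = v" using injD[OF inj_m] by metis
      then show ?thesis using u v by (auto simp: dist_commute)
    qed
    ultimately obtain z' w' where z': "z' \<in> inside (path_image c)" "z = m z'" "dist z' (l a) < d"
      and w': "w' \<in> inside (path_image c)" "w = m w'" "dist w' (l a) < d"
      by meson
    have "connected_component (- path_image c) z' w'"
      unfolding connected_component_def using J(2,11) z'(1) w'(1) by blast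
    then have "connected_component (ball (l a) e - path_image c) z' w'" by (rule acc[OF z'(3) w'(3)])
    then obtain B where B: "connected B" "B \<subseteq> ball (l a) e - path_image c" "z' \<in> B" "w' \<in> B"
      unfolding connected_component_def by blast
    have "B \<subseteq> inside (path_image c)"
    proof -
      have "B \<inter> path_image c = {}" using B(2) by blast
      then show ?thesis using Jordan_connected_cases[OF c B(1)] B(3) z'(1) J(10) by blast
    qed
    then have "m ` B \<subseteq> N \<inter> D" using B(2) mN unfolding Dc by blast
    then show "\<exists>C. connectedin X C \<and> z \<in> C \<and> w \<in> C \<and> C \<subseteq> N \<inter> D"
      using connectedin_m[OF B(1)] B(3,4) z'(2) w'(2) by blast
  qed
qed

text \<open>A fibre \<open>F\<close> is compact and discrete, hence finite. Remove from a small disc about \<open>y\<close> the image of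
everything that maps to it from outside small balls about the points of \<open>F\<close>; properness makes this
image compact, so what remains is evenly covered.\<close>

lemma proper_local_homeo_covering:
  fixes p :: "complex \<Rightarrow> complex"
  assumes V: "open V" and cont: "continuous_on V p" and G: "open G" and sub: "p ` V \<subseteq> G" and onto: "G \<subseteq> p ` V"
    and inj: "\<And>x. x \<in> V \<Longrightarrow> \<exists>U. open U \<and> x \<in> U \<and> U \<subseteq> V \<and> inj_on p U"
    and proper: "\<And>K. compact K \<Longrightarrow> K \<subseteq> G \<Longrightarrow> compact (V \<inter> p -` K)"
  shows "covering_space V p G"
proof (rule covering_spaceI[OF cont])
  show "p ` V = G" using sub onto by blast
  fix y assume y: "y \<in> G"
  define F where "F = V \<inter> p -` {y}"
  have cF: "compact F" unfolding F_def by (rule proper) (use y in auto)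
  obtain U where U: "\<And>x. x \<in> V \<Longrightarrow> open (U x) \<and> x \<in> U x \<and> U x \<subseteq> V \<and> inj_on p (U x)"
    using inj by metis
  have "F \<subseteq> \<Union>(U ` F)" using U by (auto simp: F_def)
  then obtain F' where F': "F' \<subseteq> F" "finite F'" "F \<subseteq> \<Union>(U ` F')"
    using compactE_image[OF cF, of F U] U by (auto simp: F_def)
  have "F = F'"
  proof
    show "F \<subseteq> F'"
    proof
      fix x assume x: "x \<in> F"
      then obtain x' where x': "x' \<in> F'" "x \<in> U x'" using F' by blast
      then have "x' \<in> V" "p x = p x'" using x F'(1) by (auto simp: F_def)
      then have "x = x'" using U[of x'] x'(2) by (auto dest: inj_onD)
      then show "x \<in> F'" using x' by simp
    qed
  qed (use F' in blast)
  then have finF: "finite F" using F'(2) by simp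
  obtain r where r: "r > 0" "\<And>x x'. x \<in> F \<Longrightarrow> x' \<in> F \<Longrightarrow> x \<noteq> x' \<Longrightarrow> 2 * r \<le> dist x x'" "\<And>x. x \<in> F \<Longrightarrow> ball x r \<subseteq> U x"
  proof -
    have "\<exists>e>0. \<forall>x'\<in>F. x' \<noteq> x \<longrightarrow> e \<le> dist x x'" for x
      using finite_set_avoid[OF finF, of x] by auto
    then obtain e1 where e1: "\<And>x. e1 x > 0 \<and> (\<forall>x'\<in>F. x' \<noteq> x \<longrightarrow> e1 x \<le> dist x x')" by metis
    have "\<exists>e>0. ball x e \<subseteq> U x" if "x \<in> F" for x
      using U[of x] that open_contains_ball unfolding F_def by blast
    then obtain e2 where e2: "\<And>x. x \<in> F \<Longrightarrow> e2 x > 0 \<and> ball x (e2 x) \<subseteq> U x" by metis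
    define e where "e = (\<lambda>x. min (e1 x / 2) (e2 x))"
    define r where "r = Min (insert 1 (e ` F))"
    have r0: "r > 0" unfolding r_def using finF e1 e2 by (auto simp: e_def)
    have re: "r \<le> e x" if "x \<in> F" for x unfolding r_def using finF that by (intro Min_le) auto
    moreover have "2 * r \<le> dist x x'" if "x \<in> F" "x' \<in> F" "x \<noteq> x'" for x x'
    proof -
      have "2 * r \<le> e1 x" using re[OF that(1)] by (simp add: e_def)
      also have "e1 x \<le> dist x x'" using e1[of x] that(2,3) by auto
      finally show ?thesis .
    qed
    moreover have "ball x r \<subseteq> U x" if "x \<in> F" for x
    proof -
      have "r \<le> e2 x" using re[OF that] by (simp add: e_def)
      then show ?thesis using e2[OF that] subset_ball by blast
    qed
    ultimately show thesis by (intro that[OF r0])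
  qed
  have bV: "ball x r \<subseteq> V" "inj_on p (ball x r)" if "x \<in> F" for x
    using r(3)[OF that] U[of x] that inj_on_subset unfolding F_def by blast+
  have op: "open (p ` B)" if "open B" "B \<subseteq> V" "inj_on p B" for B
    using invariance_of_domain[of B p] that cont continuous_on_subset by blast
  define O0 where "O0 = G \<inter> (\<Inter>x\<in>F. p ` ball x r)"
  have "open O0" unfolding O0_def using G finF op bV by (intro open_Int open_INT) auto
  moreover have "y \<in> O0" using y r(1) by (auto simp: O0_def F_def)
  ultimately obtain \<epsilon> where \<epsilon>: "\<epsilon> > 0" "cball y \<epsilon> \<subseteq> O0" using open_contains_cball by blast
  \<comment> \<open>Everything over the disc that is not close to the fibre.\<close>
  define K where "K = (V \<inter> p -` cball y \<epsilon>) - (\<Union>x\<in>F. ball x r)"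
  have "compact (V \<inter> p -` cball y \<epsilon>)" using \<epsilon>(2) by (intro proper) (auto simp: O0_def)
  then have "compact K" unfolding K_def by (intro compact_diff) auto
  then have "compact (p ` K)" using cont by (intro compact_continuous_image) (auto simp: K_def elim: continuous_on_subset)
  then have oT: "open (ball y \<epsilon> - p ` K)" by (intro open_Diff) (auto simp: compact_imp_closed)
  define T where "T = ball y \<epsilon> - p ` K"
  have yT: "y \<in> T" using \<epsilon>(1) r(1) by (auto simp: T_def K_def F_def)
  have TG: "T \<subseteq> O0" using \<epsilon>(2) unfolding T_def by (meson Diff_subset ball_subset_cball order_trans)
  have pre: "V \<inter> p -` T \<subseteq> (\<Union>x\<in>F. ball x r)" unfolding T_def K_def by auto
  define v where "v = (\<lambda>x. ball x r \<inter> p -` T) ` F"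
  have ou: "open (ball x r \<inter> p -` T)" if "x \<in> F" for x
    using continuous_open_preimage[OF continuous_on_subset[OF cont bV(1)[OF that]]] oT by (simp add: T_def)
  show "\<exists>T. y \<in> T \<and> openin (top_of_set G) T \<and>
        (\<exists>v. \<Union> v = V \<inter> p -` T \<and> (\<forall>u\<in>v. openin (top_of_set V) u) \<and> pairwise disjnt v \<and> (\<forall>u\<in>v. \<exists>q. homeomorphism u T p q))"
  proof (intro exI[of _ T] exI[of _ v] conjI yT)
    show "openin (top_of_set G) T" using oT TG by (auto simp: T_def[symmetric] O0_def intro: open_subset)
    show "\<Union> v = V \<inter> p -` T" using pre bV(1) by (auto simp: v_def)
    show "\<forall>u\<in>v. openin (top_of_set V) u" using ou bV(1) by (auto simp: v_def intro!: open_subset)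
    have bd: "ball x r \<inter> ball x' r = {}" if "x \<in> F" "x' \<in> F" "x \<noteq> x'" for x x'
    proof (rule equals0I)
      fix z assume "z \<in> ball x r \<inter> ball x' r"
      then have "dist x x' < 2 * r" using dist_triangle2[of x x' z] by (auto simp: dist_commute)
      then show False using r(2)[OF that] by simp
    qed
    then show "pairwise disjnt v" unfolding v_def pairwise_def disjnt_def by blast
    show "\<forall>u\<in>v. \<exists>q. homeomorphism u T p q"
    proof
      fix u assume "u \<in> v"
      then obtain x where x: "x \<in> F" "u = ball x r \<inter> p -` T" by (auto simp: v_def)
      have "p ` u = T"
      proof
        show "T \<subseteq> p ` u"
        proof
          fix t assume t: "t \<in> T"
          then have "t \<in> p ` ball x r" using TG x(1) unfolding O0_def by blast
          then show "t \<in> p ` u" using t unfolding x(2) by blast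
        qed
      qed (use x in auto)
      have u: "open u" "u \<subseteq> V" using ou[OF x(1)] bV(1)[OF x(1)] x(2) by auto
      have "inj_on p u" unfolding x(2) using bV(2)[OF x(1)] by (rule inj_on_subset) simp
      obtain q where "homeomorphism u (p ` u) p q"
        by (rule invariance_of_domain_homeomorphism[OF u(1) continuous_on_subset[OF cont u(2)] _ \<open>inj_on p u\<close>]) simp
      then show "\<exists>q. homeomorphism u T p q" unfolding \<open>p ` u = T\<close> by blast
    qed
  qed
qed

text \<open>Such a map is a covering of a simply connected domain, so a path joining two points of a fibre is
closed by monodromy.\<close>

lemma proper_local_homeo_injective:
  fixes p :: "complex \<Rightarrow> complex"
  assumes V: "open V" "connected V" "V \<noteq> {}" and cont: "continuous_on V p"
    and G: "open G" "connected G" "simply_connected G" and sub: "p ` V \<subseteq> G"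
    and inj: "\<And>x. x \<in> V \<Longrightarrow> \<exists>U. open U \<and> x \<in> U \<and> U \<subseteq> V \<and> inj_on p U"
    and proper: "\<And>K. compact K \<Longrightarrow> K \<subseteq> G \<Longrightarrow> compact (V \<inter> p -` K)"
  shows "inj_on p V" "p ` V = G"
proof -
  have "open (p ` V)"
  proof (subst open_subopen, clarify)
    fix x assume "x \<in> V"
    then obtain U where U: "open U" "x \<in> U" "U \<subseteq> V" "inj_on p U" using inj by blast
    then have "open (p ` U)" using invariance_of_domain[of U p] cont continuous_on_subset by blast
    then show "\<exists>T. open T \<and> p x \<in> T \<and> T \<subseteq> p ` V" using U by blast
  qed
  moreover have "closedin (top_of_set G) (p ` V)"
    unfolding closedin_limpt
  proof (intro conjI sub allI impI)
    fix y assume y: "y islimpt p ` V \<and> y \<in> G"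
    then obtain e where e: "e > 0" "cball y e \<subseteq> G" using G(1) open_contains_cball by blast
    have "compact (V \<inter> p -` cball y e)" by (rule proper) (use e in auto)
    then have "compact (p ` (V \<inter> p -` cball y e))" using cont by (intro compact_continuous_image) (auto elim: continuous_on_subset)
    moreover have "p ` (V \<inter> p -` cball y e) = p ` V \<inter> cball y e" by auto
    ultimately have "closed (p ` V \<inter> cball y e)" by (simp add: compact_imp_closed)
    moreover have "y \<in> closure (p ` V \<inter> cball y e)"
      unfolding closure_approachable
    proof (intro allI impI)
      fix d :: real assume "0 < d"
      then obtain w where "w \<in> p ` V" "dist w y < min d e"
        using y e(1) unfolding islimpt_approachable by (metis min_less_iff_conj)
      then show "\<exists>w\<in>p ` V \<inter> cball y e. dist w y < d" by (intro bexI[of _ w]) (auto simp: dist_commute)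
    qed
    ultimately have "y \<in> p ` V \<inter> cball y e" by simp
    then show "y \<in> p ` V" by simp
  qed
  ultimately have "p ` V = {} \<or> p ` V = G"
    using G(2) sub by (metis connected_clopen open_subset)
  then show surj: "p ` V = G" using V(3) by blast
  then have cov: "covering_space V p G"
    by (intro proper_local_homeo_covering[OF V(1) cont G(1) sub _ inj proper]) auto
  show "inj_on p V"
  proof (rule inj_onI)
    fix x y assume xy: "x \<in> V" "y \<in> V" "p x = p y"
    have "path_connected V" using V by (simp add: connected_open_path_connected)
    then obtain g where g: "path g" "path_image g \<subseteq> V" "pathstart g = x" "pathfinish g = y"
      using xy unfolding path_connected_def by blast
    have "path (p \<circ> g)" using g cont by (intro path_continuous_image) (auto elim: continuous_on_subset)
    moreover have "path_image (p \<circ> g) \<subseteq> G" using g sub by (auto simp: path_image_compose)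
    moreover have pxG: "p x \<in> G" using sub xy(1) by blast
    ultimately have hom: "homotopic_paths G (p \<circ> g) (linepath (p x) (p x))"
      using G(3) xy g unfolding simply_connected_eq_homotopic_paths
      by (auto simp: pathstart_compose pathfinish_compose)
    have "pathfinish g = pathfinish (linepath x x)"
    proof (rule covering_space_monodromy[OF cov \<open>path (p \<circ> g)\<close> \<open>path_image (p \<circ> g) \<subseteq> G\<close> _ _ hom g(1,2)])
      show "p (linepath x x t) = linepath (p x) (p x) t" for t by (simp add: linepath_refl)
    qed (use xy pxG g in auto)
    then show "x = y" using g by simp
  qed
qed

section \<open>Parallel curves are isotopic\<close>

text \<open>The homeomorphism condition in \<open>isotopic_rel\<close> depends only on values on the sphere, as the calculus of
\<open>homotopic_with\<close> requires.\<close>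

lemma homeomorphic_rel_eq:
  assumes "P \<subseteq> topspace X" "\<And>x. x \<in> topspace X \<Longrightarrow> h x = k x"
  shows "(homeomorphic_map X X h \<and> (\<forall>p\<in>P. h p = p)) \<longleftrightarrow> (homeomorphic_map X X k \<and> (\<forall>p\<in>P. k p = p))"
  using assms homeomorphic_map_eq[of X X h k] homeomorphic_map_eq[of X X k h] by (metis subsetD)

text \<open>If \<open>g\<close> is the end of the isotopy, compose the isotopy with the inverse of \<open>g\<close> and reverse the time.\<close>

lemma isotopic_rel_sym:
  assumes P: "P \<subseteq> topspace X" and \<gamma>: "\<gamma> \<subseteq> topspace X" and iso: "isotopic_rel X P \<gamma> \<gamma>'"
  shows "isotopic_rel X P \<gamma>' \<gamma>"
proof -
  let ?Q = "\<lambda>h. homeomorphic_map X X h \<and> (\<forall>p\<in>P. h p = p)"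
  obtain g where g: "homotopic_with ?Q X X id g" "g ` \<gamma> = \<gamma>'" using iso unfolding isotopic_rel_def by blast
  have gQ: "homeomorphic_map X X g" "\<And>p. p \<in> P \<Longrightarrow> g p = p" using homotopic_with_imp_property[OF g(1)] by auto
  obtain k where k: "homeomorphic_maps X X g k" using gQ(1)[THEN homeomorphic_map_maps[THEN iffD1]] ..
  have km: "homeomorphic_map X X k" using k[THEN homeomorphic_maps_map[THEN iffD1]] by simp
  have kg: "k (g x) = x" "g (k x) = x" if "x \<in> topspace X" for x using k that by (auto simp: homeomorphic_maps_def)
  have kP: "k p = p" if "p \<in> P" for p using kg(1)[of p] gQ(2)[OF that] P that by auto
  have "homotopic_with ?Q X X (id \<circ> k) (g \<circ> k)"
  proof (rule homotopic_with_compose_continuous_map_right[OF g(1)])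
    show "continuous_map X X k" using km by (rule homeomorphic_imp_continuous_map)
    show "?Q (j \<circ> k)" if "?Q j" for j using that km kP homeomorphic_map_compose[OF km] by auto
  qed
  then have "homotopic_with ?Q X X k id"
  proof (rule homotopic_with_eq)
    show "?Q h \<longleftrightarrow> ?Q k" if "\<And>x. x \<in> topspace X \<Longrightarrow> h x = k x" for h k
      using P that by (rule homeomorphic_rel_eq)
  qed (simp_all add: kg)
  then have "homotopic_with ?Q X X id k" by (rule homotopic_with_symD)
  moreover have "k ` \<gamma>' = \<gamma>" unfolding g(2)[symmetric] using kg(1) \<gamma> by (force simp: image_iff)
  ultimately show ?thesis unfolding isotopic_rel_def by blast
qed

lemma isotopic_rel_trans:
  assumes "isotopic_rel X P \<gamma> \<gamma>'" "isotopic_rel X P \<gamma>' \<gamma>''"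
  shows "isotopic_rel X P \<gamma> \<gamma>''"
proof -
  let ?Q = "\<lambda>h. homeomorphic_map X X h \<and> (\<forall>p\<in>P. h p = p)"
  obtain g where g: "homotopic_with ?Q X X id g" "g ` \<gamma> = \<gamma>'" using assms(1) unfolding isotopic_rel_def by blast
  obtain k where k: "homotopic_with ?Q X X id k" "k ` \<gamma>' = \<gamma>''" using assms(2) unfolding isotopic_rel_def by blast
  have gQ: "homeomorphic_map X X g" "\<And>p. p \<in> P \<Longrightarrow> g p = p" using homotopic_with_imp_property[OF g(1)] by auto
  have "homotopic_with ?Q X X (id \<circ> g) (k \<circ> g)"
  proof (rule homotopic_with_compose_continuous_map_right[OF k(1)])
    show "continuous_map X X g" using gQ(1) by (rule homeomorphic_imp_continuous_map)
    show "?Q (j \<circ> g)" if "?Q j" for j using that gQ homeomorphic_map_compose[OF gQ(1)] by auto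
  qed
  then have "homotopic_with ?Q X X id (k \<circ> g)" using g(1) homotopic_with_trans by auto
  moreover have "(k \<circ> g) ` \<gamma> = \<gamma>''" unfolding image_comp[symmetric] g(2) k(2) ..
  ultimately show ?thesis unfolding isotopic_rel_def by blast
qed

lemma isotopic_rel_homeomorphism:
  assumes "isotopic_rel X P \<gamma> \<gamma>'"
  obtains g where "homeomorphic_map X X g" "\<And>p. p \<in> P \<Longrightarrow> g p = p" "g ` \<gamma> = \<gamma>'"
proof -
  obtain g where g: "homotopic_with (\<lambda>h. homeomorphic_map X X h \<and> (\<forall>p\<in>P. h p = p)) X X id g" "g ` \<gamma> = \<gamma>'"
    using assms unfolding isotopic_rel_def by blast
  then show thesis using that homotopic_with_imp_property[OF g(1)] by blast
qed

lemma homeomorphic_map_complement_components: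
  assumes g: "homeomorphic_map X X g" and \<gamma>: "\<gamma> \<subseteq> topspace X"
  shows "complement_components X (g ` \<gamma>) = (`) g ` complement_components X \<gamma>"
proof -
  have "g ` (topspace X - \<gamma>) = topspace X - g ` \<gamma>"
    using inj_on_image_set_diff[OF homeomorphic_imp_injective_map[OF g], of "topspace X" \<gamma>] \<gamma>
      homeomorphic_imp_surjective_map[OF g] by auto
  then have "homeomorphic_map (subtopology X (topspace X - \<gamma>)) (subtopology X (topspace X - g ` \<gamma>)) g"
    by (intro homeomorphic_map_subtopologies[OF g]) (simp add: Int_absorb1)
  then show ?thesis
    unfolding complement_components_def by (rule homeomorphic_map_connected_components_of)
qed

lemma isotopic_rel_sides:
  assumes P: "P \<subseteq> topspace X" and \<gamma>: "\<gamma> \<subseteq> topspace X" and iso: "isotopic_rel X P \<gamma> \<gamma>'" and W: "W \<in> complement_components X \<gamma>"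
  obtains W' where "W' \<in> complement_components X \<gamma>'" "W' \<inter> P = W \<inter> P"
proof -
  obtain g where g: "homeomorphic_map X X g" "\<And>p. p \<in> P \<Longrightarrow> g p = p" "g ` \<gamma> = \<gamma>'"
    using isotopic_rel_homeomorphism[OF iso] by metis
  have "W \<subseteq> topspace X" using connected_components_of_subset W unfolding complement_components_def by fastforce
  have inj: "inj_on g (topspace X)" using g(1) by (rule homeomorphic_imp_injective_map)
  have "g ` W \<inter> P = W \<inter> P"
  proof
    show "g ` W \<inter> P \<subseteq> W \<inter> P"
    proof
      fix p assume "p \<in> g ` W \<inter> P"
      then obtain x where x: "x \<in> W" "p = g x" "p \<in> P" by blast
      then have "g x = g p" using g(2) by simp
      then have "x = p" using inj x \<open>W \<subseteq> topspace X\<close> P by (meson inj_onD subsetD)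
      then show "p \<in> W \<inter> P" using x by simp
    qed
    show "W \<inter> P \<subseteq> g ` W \<inter> P" using g(2) by (auto simp: image_iff) (metis g(2))
  qed
  moreover have "g ` W \<in> complement_components X \<gamma>'"
    using homeomorphic_map_complement_components[OF g(1) \<gamma>] W g(3) by blast
  ultimately show thesis by (rule that[rotated])
qed

lemma isotopic_rel_jordan_curve:
  assumes \<gamma>: "jordan_curve X \<gamma>" and iso: "isotopic_rel X P \<gamma> \<gamma>'"
  shows "jordan_curve X \<gamma>'"
proof -
  obtain g where g: "homeomorphic_map X X g" "g ` \<gamma> = \<gamma>'"
    using isotopic_rel_homeomorphism[OF iso] by metis
  have sub: "\<gamma> \<subseteq> topspace X" "\<gamma>' \<subseteq> topspace X"
    using \<gamma> g homeomorphic_imp_surjective_map[OF g(1)] by (auto simp: jordan_curve_def)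
  then have "homeomorphic_map (subtopology X \<gamma>) (subtopology X \<gamma>') g"
    using g(2) by (intro homeomorphic_map_subtopologies[OF g(1)]) (simp add: Int_absorb1)
  then have "subtopology X \<gamma>' homeomorphic_space subtopology X \<gamma>"
    by (metis homeomorphic_space homeomorphic_space_sym)
  then show ?thesis using \<gamma> sub homeomorphic_space_trans unfolding jordan_curve_def by blast
qed

context punctured_plane begin

text \<open>An isotopy of the plane that is the identity near infinity extends continuously to \<open>q\<close>.\<close>

lemma plane_isotopic_lift:
  assumes iso: "plane_isotopic (l ` (P - {q}) \<union> {z. R \<le> norm z}) A B" and P: "P \<subseteq> topspace X"
  shows "isotopic_rel X P (m ` A) (m ` B)"
proof -
  obtain h where h: "continuous_on ({0..1::real} \<times> UNIV) (\<lambda>(t, z). h t z)"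
     and hh: "\<And>t. t \<in> {0..1} \<Longrightarrow> \<exists>k. homeomorphism UNIV UNIV (h t) k" and h0: "\<And>z. h 0 z = z"
     and hfix: "\<And>t z. t \<in> {0..1} \<Longrightarrow> z \<in> l ` (P - {q}) \<union> {z. R \<le> norm z} \<Longrightarrow> h t z = z" and h1: "h 1 ` A = B"
    using iso unfolding plane_isotopic_def by blast
  \<comment> \<open>Extend the isotopy by the identity at \<open>q\<close>; continuity is checked on the two open sets of the pasting lemma.\<close>
  define H where "H = (\<lambda>(t::real, x). if x \<in> topspace X - {q} then m (h t (l x)) else x)"
  let ?I = "top_of_set {0..1::real}"
  have Hq: "H (t, x) = x" if "t \<in> {0..1}" "x \<in> insert q (m ` (- cball 0 R))" for t x
    using that hfix[of t] by (auto simp: H_def)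
  have cH: "continuous_map (prod_topology ?I X) X H"
  proof (rule pasting_lemma[where I = UNIV and T = "\<lambda>b. {0..1} \<times> (if b then topspace X - {q} else insert q (m ` (- cball 0 R)))"
        and f = "\<lambda>b. if b then (\<lambda>(t, x). m (h t (l x))) else snd"])
    fix b :: bool
    show "openin (prod_topology ?I X) ({0..1} \<times> (if b then topspace X - {q} else insert q (m ` (- cball 0 R))))"
      using open_X_minus openin_insert_q[OF compact_cball] by (auto simp: openin_prod_Times_iff)
    have "continuous_map (prod_topology ?I (subtopology X (topspace X - {q}))) X (\<lambda>(t, x). m (h t (l x)))"
    proof -
      have "continuous_map (prod_topology ?I (subtopology X (topspace X - {q}))) (prod_topology ?I euclidean) (\<lambda>(t, x). (t, l x))"
        using cont_l by (simp add: continuous_map_prod_top)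
      moreover have "prod_topology ?I (euclidean :: complex topology) = top_of_set ({0..1} \<times> UNIV)"
        using prod_topology_subtopology_eu[of "{0..1::real}" "UNIV :: complex set"] by (simp only: subtopology_UNIV)
      moreover have "continuous_map (top_of_set ({0..1} \<times> UNIV)) euclidean (\<lambda>(t, z). h t z)" using h by simp
      ultimately have "continuous_map (prod_topology ?I (subtopology X (topspace X - {q}))) euclidean ((\<lambda>(t, z). h t z) \<circ> (\<lambda>(t, x). (t, l x)))"
        using continuous_map_compose by metis
      then have "continuous_map (prod_topology ?I (subtopology X (topspace X - {q}))) X (m \<circ> ((\<lambda>(t, z). h t z) \<circ> (\<lambda>(t, x). (t, l x))))"
        using cont_m by (rule continuous_map_compose)
      then show ?thesis by (simp add: o_def case_prod_unfold)
    qed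
    moreover have "continuous_map (prod_topology ?I (subtopology X N)) X snd" for N
      using continuous_map_snd continuous_map_into_fulltopology by metis
    ultimately show "continuous_map (subtopology (prod_topology ?I X) ({0..1} \<times> (if b then topspace X - {q} else insert q (m ` (- cball 0 R))))) X
        (if b then (\<lambda>(t, x). m (h t (l x))) else snd)"
      by (simp add: subtopology_Times subtopology_subtopology)
  next
    fix b b' :: bool and x
    assume x: "x \<in> topspace (prod_topology ?I X) \<inter> ({0..1} \<times> (if b then topspace X - {q} else insert q (m ` (- cball 0 R)))) \<inter>
        ({0..1} \<times> (if b' then topspace X - {q} else insert q (m ` (- cball 0 R))))"
    show "(if b then (\<lambda>(t, x). m (h t (l x))) else snd) x = (if b' then (\<lambda>(t, x). m (h t (l x))) else snd) x"
    proof (cases "b = b'")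
      case False
      obtain t y where ty: "x = (t, y)" by (cases x)
      have t: "t \<in> {0..1}" and y: "y \<in> topspace X - {q}" "y \<in> insert q (m ` (- cball 0 R))"
        using x False unfolding ty by (auto split: if_splits)
      have "H (t, y) = y" using t y(2) by (rule Hq)
      moreover have "H (t, y) = m (h t (l y))" using y(1) by (simp add: H_def)
      ultimately have "m (h t (l y)) = y" by simp
      then show ?thesis using False by (auto simp: ty)
    qed simp
  next
    fix x assume x: "x \<in> topspace (prod_topology ?I X)"
    show "\<exists>b. b \<in> UNIV \<and> x \<in> {0..1} \<times> (if b then topspace X - {q} else insert q (m ` (- cball 0 R))) \<and>
          H x = (if b then (\<lambda>(t, x). m (h t (l x))) else snd) x"
      by (rule exI[of _ "snd x \<noteq> q"]) (use x in \<open>auto simp: H_def\<close>)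
  qed
  have homeo: "homeomorphic_map X X (\<lambda>x. H (t, x))" if t: "t \<in> {0..1}" for t
  proof (rule continuous_imp_homeomorphic_map)
    have "continuous_map X (prod_topology ?I X) (\<lambda>x. (t, x))" using t by (simp add: continuous_map_pairwise o_def)
    then have "continuous_map X X (H \<circ> (\<lambda>x. (t, x)))" using cH by (rule continuous_map_compose)
    then show "continuous_map X X (\<lambda>x. H (t, x))" by (simp add: o_def)
    obtain k where k: "homeomorphism UNIV UNIV (h t) k" using hh[OF t] by blast
    have kh: "k (h t z) = z" "h t (k z) = z" for z using k by (simp_all add: homeomorphism_def)
    have "x \<in> (\<lambda>x. H (t, x)) ` topspace X" if x: "x \<in> topspace X" for x
    proof (cases "x = q")
      case False
      then have "H (t, m (k (l x))) = x" using x by (simp add: H_def kh)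
      then show ?thesis by (metis imageI m_in(1))
    qed (use qX in \<open>auto simp: H_def image_iff\<close>)
    moreover have "H (t, x) \<in> topspace X" if "x \<in> topspace X" for x using that qX by (simp add: H_def)
    ultimately show "(\<lambda>x. H (t, x)) ` topspace X = topspace X" by blast
    show "inj_on (\<lambda>x. H (t, x)) (topspace X)"
    proof (rule inj_onI)
      fix x y assume xy: "x \<in> topspace X" "y \<in> topspace X" "H (t, x) = H (t, y)"
      have *: "H (t, x) = q \<longleftrightarrow> x = q" if "x \<in> topspace X" for x using that by (simp add: H_def)
      show "x = y"
      proof (cases "x = q")
        case True then show ?thesis using * xy by metis
      next
        case False
        then have "y \<noteq> q" using * xy by metis
        then have "m (h t (l x)) = m (h t (l y))" using xy False by (simp add: H_def)
        then have "l x = l y" using injD[OF inj_m] kh(1) by metis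
        then show ?thesis using False \<open>y \<noteq> q\<close> xy by (metis ml)
      qed
    qed
  qed (use cpt haus in auto)
  have fixP: "H (t, p) = p" if "t \<in> {0..1}" "p \<in> P" for t p
  proof (cases "p = q")
    case False
    then have "h t (l p) = l p" using hfix[OF that(1)] that(2) by blast
    then show ?thesis using False that(2) P by (auto simp: H_def)
  qed (simp add: H_def)
  have "homotopic_with (\<lambda>h. homeomorphic_map X X h \<and> (\<forall>p\<in>P. h p = p)) X X id (\<lambda>x. H (1, x))"
    unfolding homotopic_with_def
  proof (intro exI[of _ H] conjI allI ballI cH)
    show "H (0, x) = id x" for x by (simp add: H_def h0)
  qed (use homeo fixP in auto)
  moreover have "(\<lambda>x. H (1, x)) ` m ` A = m ` B"
    unfolding h1[symmetric] image_image by (simp add: H_def)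
  ultimately show ?thesis unfolding isotopic_rel_def by blast
qed

end

lemma disjoint_Jordan_curves_nested:
  fixes c1 c2 :: "real \<Rightarrow> complex"
  assumes c1: "simple_path c1" "pathfinish c1 = pathstart c1" and c2: "simple_path c2" "pathfinish c2 = pathstart c2"
    and dis: "path_image c1 \<inter> path_image c2 = {}" and meet: "inside (path_image c1) \<inter> inside (path_image c2) \<noteq> {}"
  shows "inside (path_image c2) \<union> path_image c2 \<subseteq> inside (path_image c1) \<or>
    inside (path_image c1) \<union> path_image c1 \<subseteq> inside (path_image c2)"
proof -
  note J1 = Jordan_sides[OF c1] and J2 = Jordan_sides[OF c2]
  have con2: "connected (path_image c2)" using c2(1) by (simp add: connected_simple_path_image)
  have "path_image c2 \<inter> path_image c1 = {}" using dis by blast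
  from Jordan_connected_cases[OF c1 con2 this] show ?thesis
  proof
    assume ins: "path_image c2 \<subseteq> inside (path_image c1)"
    have cl: "closure (outside (path_image c1)) = outside (path_image c1) \<union> path_image c1"
      using J1(9) closure_Un_frontier by metis
    have con: "connected (outside (path_image c1) \<union> path_image c1)"
      unfolding cl[symmetric] using J1(5) by (rule connected_imp_connected_closure)
    have "(outside (path_image c1) \<union> path_image c1) \<inter> path_image c2 = {}" using ins J1(10,11) by blast
    moreover have "\<not> bounded (outside (path_image c1))" using Jordan_inside_outside[OF c1] by blast
    then have "\<not> outside (path_image c1) \<union> path_image c1 \<subseteq> inside (path_image c2)"
      using J2(7) bounded_subset by blast
    ultimately have "outside (path_image c1) \<union> path_image c1 \<subseteq> outside (path_image c2)"
      using Jordan_connected_cases[OF c2 con] by blast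
    then have "inside (path_image c2) \<subseteq> inside (path_image c1)" using J1(13) J2(10) by blast
    then show ?thesis using ins by blast
  next
    assume out: "path_image c2 \<subseteq> outside (path_image c1)"
    then have "inside (path_image c1) \<inter> path_image c2 = {}" using J1(10) by blast
    then have sub: "inside (path_image c1) \<subseteq> inside (path_image c2)"
      using Jordan_connected_cases[OF c2 J1(2)] meet J2(10) by blast
    have "path_image c1 \<subseteq> closure (inside (path_image c1))" using J1(8) closure_Un_frontier by blast
    also have "\<dots> \<subseteq> closure (inside (path_image c2))" using sub by (rule closure_mono)
    also have "\<dots> = inside (path_image c2) \<union> path_image c2" using J2(8) closure_Un_frontier by metis
    finally show ?thesis using sub dis by blast
  qed
qed

text \<open>Place a marked point outside \<open>D1\<close> at infinity. Then the curves are nested in the plane, and no marked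
point lies between them.\<close>

theorem parallel_curves_isotopic:
  assumes X: "topological_sphere X" and P: "finite P" "P \<subseteq> topspace X"
    and \<gamma>1: "jordan_curve X \<gamma>1" "\<gamma>1 \<inter> P = {}" and \<gamma>2: "jordan_curve X \<gamma>2" "\<gamma>2 \<inter> P = {}"
    and dis: "\<gamma>1 \<inter> \<gamma>2 = {}"
    and D1: "D1 \<in> complement_components X \<gamma>1" and D2: "D2 \<in> complement_components X \<gamma>2"
    and eq: "D1 \<inter> P = D2 \<inter> P" and ne: "D1 \<inter> P \<noteq> {}" "P - D1 \<noteq> {}"
  shows "isotopic_rel X P \<gamma>1 \<gamma>2"
proof -
  obtain q where q: "q \<in> P" "q \<notin> D1" using ne(2) by blast
  have qs: "q \<in> topspace X" "q \<in> topspace X - \<gamma>1" "q \<in> topspace X - \<gamma>2" "q \<notin> D2"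
    using q P \<gamma>1(2) \<gamma>2(2) eq by blast+
  from topological_sphere_chart[OF X qs(1)] obtain l m where ch: "punctured_plane X q l m" .
  interpret punctured_plane X q l m by (rule ch)
  have main: "isotopic_rel X P (m ` path_image c2) (m ` path_image c1)"
    if c1: "simple_path c1" "pathfinish c1 = pathstart c1" and c2: "simple_path c2" "pathfinish c2 = pathstart c2"
      and eq: "m ` inside (path_image c1) \<inter> P = m ` inside (path_image c2) \<inter> P" and P1: "m ` path_image c1 \<inter> P = {}"
      and nest: "inside (path_image c2) \<union> path_image c2 \<subseteq> inside (path_image c1)"
    for c1 c2 :: "real \<Rightarrow> complex"
  proof -
    have "bounded (inside (path_image c1) \<union> path_image c1)"
      using Jordan_sides(7)[OF c1] c1 by (simp add: bounded_simple_path_image)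
    then obtain R where R: "\<And>z. z \<in> inside (path_image c1) \<union> path_image c1 \<Longrightarrow> norm z < R"
      unfolding bounded_pos_less by blast
    define F where "F = l ` (P - {q}) \<union> {z. R \<le> norm z}"
    have "plane_isotopic F (path_image c2) (path_image c1)"
    proof (rule nested_Jordan_curves_isotopic[OF c1 c2 nest])
      have "closed (l ` (P - {q}))" using P(1) by (intro finite_imp_closed) auto
      moreover have "closed {z::complex. R \<le> norm z}" by (intro closed_Collect_le continuous_intros)
      ultimately show "closed F" unfolding F_def by (rule closed_Un)
      show "F \<inter> (inside (path_image c1) \<union> path_image c1) \<subseteq> inside (path_image c2)"
      proof
        fix z assume z: "z \<in> F \<inter> (inside (path_image c1) \<union> path_image c1)"
        then have "norm z < R" using R by blast
        then have "z \<in> l ` (P - {q})" using z by (auto simp: F_def)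
        then obtain p where p: "p \<in> P" "p \<noteq> q" "z = l p" by blast
        then have mz: "m z = p" using P by auto
        then have "m z \<in> m ` inside (path_image c1) \<inter> P" using z p(1) P1 by blast
        then have "m z \<in> m ` inside (path_image c2)" using eq by blast
        then show "z \<in> inside (path_image c2)" using injD[OF inj_m] by blast
      qed
    qed
    then show ?thesis unfolding F_def using P(2) by (rule plane_isotopic_lift)
  qed
  obtain c1 where c1: "simple_path c1" "pathfinish c1 = pathstart c1" and g1: "\<gamma>1 = m ` path_image c1"
    and d1: "D1 = m ` inside (path_image c1)"
    by (rule jordan_curve_side_chart[OF X \<gamma>1(1) qs(2) D1 q(2) ch])
  obtain c2 where c2: "simple_path c2" "pathfinish c2 = pathstart c2" and g2: "\<gamma>2 = m ` path_image c2"
    and d2: "D2 = m ` inside (path_image c2)"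
    by (rule jordan_curve_side_chart[OF X \<gamma>2(1) qs(3) D2 qs(4) ch])
  have "path_image c1 \<inter> path_image c2 = {}" using dis unfolding g1 g2 by blast
  moreover have "inside (path_image c1) \<inter> inside (path_image c2) \<noteq> {}"
  proof -
    obtain p where "p \<in> D1" "p \<in> D2" using ne(1) eq by blast
    then obtain z w where "p = m z" "z \<in> inside (path_image c1)" "p = m w" "w \<in> inside (path_image c2)"
      unfolding d1 d2 by blast
    then show ?thesis using injD[OF inj_m] by blast
  qed
  ultimately consider "inside (path_image c2) \<union> path_image c2 \<subseteq> inside (path_image c1)" |
    "inside (path_image c1) \<union> path_image c1 \<subseteq> inside (path_image c2)"
    using disjoint_Jordan_curves_nested[OF c1 c2] by blast
  then show ?thesis
  proof cases
    case 1
    have "isotopic_rel X P \<gamma>2 \<gamma>1"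
      unfolding g1 g2 by (rule main[OF c1 c2 _ _ 1]) (use eq \<gamma>1(2) in \<open>simp_all add: d1 d2 g1\<close>)
    then show ?thesis using isotopic_rel_sym[OF P(2)] \<gamma>2(1) by (simp add: jordan_curve_def)
  next
    case 2
    show ?thesis
      unfolding g1 g2 by (rule main[OF c2 c1 _ _ 2]) (use eq \<gamma>2(2) in \<open>simp_all add: d1 d2 g2\<close>)
  qed
qed

section \<open>Local degrees and critical points\<close>

lemma chart_openin:
  assumes "is_chart X (U, \<phi>)"
  shows "inj_on \<phi> U" "U \<subseteq> topspace X" "openin X N \<Longrightarrow> open (\<phi> ` (N \<inter> U))"
    "open W \<Longrightarrow> openin X {x \<in> U. \<phi> x \<in> W}"
proof -
  have U: "openin X U" and op: "open (\<phi> ` U)" and h: "homeomorphic_map (subtopology X U) (top_of_set (\<phi> ` U)) \<phi>"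
    using assms by (auto simp: is_chart_def)
  show sub: "U \<subseteq> topspace X" using U by (rule openin_subset)
  then have tU: "topspace (subtopology X U) = U" by auto
  show "inj_on \<phi> U" using homeomorphic_imp_injective_map[OF h] tU by simp
  show "open (\<phi> ` (N \<inter> U))" if "openin X N"
  proof -
    have "openin (subtopology X U) (N \<inter> U)" using that by (rule openin_subtopology_Int)
    then have "openin (top_of_set (\<phi> ` U)) (\<phi> ` (N \<inter> U))"
      using homeomorphic_map_openness[OF h, of "N \<inter> U"] le_infI2[OF sub, of N] by (simp add: tU)
    then show ?thesis using op by (rule openin_open_trans)
  qed
  show "openin X {x \<in> U. \<phi> x \<in> W}" if "open W"
  proof -
    have "continuous_map (subtopology X U) euclidean \<phi>"
      by (rule continuous_map_into_fulltopology[OF homeomorphic_imp_continuous_map[OF h]])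
    moreover have "openin euclidean W" using that by (simp only: open_openin)
    ultimately have "openin (subtopology X U) {x \<in> topspace (subtopology X U). \<phi> x \<in> W}"
      by (rule openin_continuous_map_preimage)
    then show ?thesis unfolding tU using U by (rule openin_trans_full)
  qed
qed

text \<open>The local degree is the number of preimages near \<open>p\<close> of a point close to \<open>f p\<close>, for arbitrarily small
neighbourhoods of \<open>p\<close>. So it does not depend on the charts.\<close>

lemma local_degree_count:
  assumes deg: "has_local_degree X \<A> f p d" and N: "openin X N" "p \<in> N"
  obtains N1 B where "openin X N1" "p \<in> N1" "N1 \<subseteq> N" "openin X B" "f p \<in> B" "B \<subseteq> f ` N1"
    "\<And>y. y \<in> B \<Longrightarrow> y \<noteq> f p \<Longrightarrow> finite {x \<in> N1. f x = y} \<and> card {x \<in> N1. f x = y} = d"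
proof -
  obtain U \<phi> V \<psi> where oc: "oriented_chart X \<A> (U, \<phi>)" "oriented_chart X \<A> (V, \<psi>)" and d: "d \<ge> 1"
    and pU: "p \<in> U" "\<phi> p = 0" "f p \<in> V" "\<psi> (f p) = 0" "f ` U \<subseteq> V" and f: "\<And>x. x \<in> U \<Longrightarrow> \<psi> (f x) = \<phi> x ^ d"
    using deg unfolding has_local_degree_def by blast
  have ch: "is_chart X (U, \<phi>)" "is_chart X (V, \<psi>)" using oc by (auto simp: oriented_chart_def)
  note cU = chart_openin[OF ch(1)] and cV = chart_openin[OF ch(2)]
  have "open (\<phi> ` (N \<inter> U))" "0 \<in> \<phi> ` (N \<inter> U)" using cU(3)[OF N(1)] N(2) pU by (force+)
  then obtain r where r: "r > 0" "ball 0 r \<subseteq> \<phi> ` (N \<inter> U)" using open_contains_ball by blast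
  define N1 where "N1 = {x \<in> U. \<phi> x \<in> ball 0 r}"
  have oN1: "openin X N1" unfolding N1_def by (rule cU(4)) simp
  have pN1: "p \<in> N1" using pU r by (simp add: N1_def)
  have N1N: "N1 \<subseteq> N"
  proof
    fix x assume x: "x \<in> N1"
    then have "\<phi> x \<in> \<phi> ` (N \<inter> U)" using r(2) unfolding N1_def by blast
    then obtain x' where "x' \<in> N" "x' \<in> U" "\<phi> x = \<phi> x'" by blast
    then show "x \<in> N" using inj_onD[OF cU(1)] x by (auto simp: N1_def)
  qed
  define B where "B = {y \<in> V. \<psi> y \<in> ball 0 (r ^ d)}"
  have oB: "openin X B" unfolding B_def by (rule cV(4)) simp
  have pB: "f p \<in> B" using pU r by (simp add: B_def)
  have bij: "bij_betw \<phi> {x \<in> N1. f x = y} {z. z ^ d = \<psi> y}" if y: "y \<in> B" for y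
    unfolding bij_betw_def
  proof
    show "inj_on \<phi> {x \<in> N1. f x = y}" using cU(1) by (rule inj_on_subset) (auto simp: N1_def)
    show "\<phi> ` {x \<in> N1. f x = y} = {z. z ^ d = \<psi> y}"
    proof
      show "\<phi> ` {x \<in> N1. f x = y} \<subseteq> {z. z ^ d = \<psi> y}" using f by (auto simp: N1_def)
      show "{z. z ^ d = \<psi> y} \<subseteq> \<phi> ` {x \<in> N1. f x = y}"
      proof
        fix z assume "z \<in> {z. z ^ d = \<psi> y}"
        then have z: "z ^ d = \<psi> y" by simp
        then have "norm z ^ d < r ^ d" using y by (simp add: B_def flip: norm_power)
        then have zr: "z \<in> ball 0 r" using power_less_imp_less_base[of "norm z" d r] r(1) by simp
        then obtain x where x: "x \<in> U" "z = \<phi> x" using r(2) by blast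
        then have "\<psi> (f x) = \<psi> y" "f x \<in> V" "y \<in> V" using f z pU(5) y by (auto simp: B_def)
        then have "f x = y" using inj_onD[OF cV(1)] by blast
        then show "z \<in> \<phi> ` {x \<in> N1. f x = y}" using x zr by (auto simp: N1_def)
      qed
    qed
  qed
  have sub: "B \<subseteq> f ` N1"
  proof
    fix y assume y: "y \<in> B"
    have "{z. z ^ d = \<psi> y} \<noteq> {}"
    proof (cases "\<psi> y = 0")
      case True
      then have "0 \<in> {z. z ^ d = \<psi> y}" using d by simp
      then show ?thesis by blast
    next
      case False
      then have "card {z. z ^ d = \<psi> y} = d" using d by (intro card_nth_roots) auto
      then show ?thesis using d by force
    qed
    then show "y \<in> f ` N1" using bij[OF y] unfolding bij_betw_def by blast
  qed
  have "finite {x \<in> N1. f x = y} \<and> card {x \<in> N1. f x = y} = d" if y: "y \<in> B" "y \<noteq> f p" for y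
  proof -
    have "\<psi> y \<noteq> 0" using inj_onD[OF cV(1), of y "f p"] y pU by (auto simp: B_def)
    then have "card {z. z ^ d = \<psi> y} = d" "finite {z. z ^ d = \<psi> y}" using d by (auto intro!: card_nth_roots finite_nth_roots)
    then show ?thesis using bij_betw_same_card[OF bij[OF y(1)]] bij_betw_finite[OF bij[OF y(1)]] by simp
  qed
  then show thesis using that oN1 pN1 N1N oB pB sub by blast
qed

lemma sphere_no_isolated_point:
  assumes X: "topological_sphere X" and O: "openin X B" "y \<in> B"
  obtains y' where "y' \<in> B" "y' \<noteq> y"
proof (rule ccontr)
  assume "\<not> thesis"
  then have B: "B = {y}" using that O(2) by blast
  have yX: "y \<in> topspace X" using O openin_subset by blast
  then obtain q where q: "q \<in> topspace X" "q \<noteq> y" by (rule topological_sphere_other_point[OF X])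
  have "closedin X {y}" using topological_sphere_compact_Hausdorff(2)[OF X] yX
    by (simp add: Hausdorff_imp_t1_space closedin_t1_singleton)
  then have "{y} = {} \<or> {y} = topspace X"
    using topological_sphere_connected[OF X] O(1) unfolding B connected_space_clopen_in by blast
  then show False using q by auto
qed

lemma local_degree_unique:
  assumes X: "topological_sphere X" and d: "has_local_degree X \<A> f p d" and e: "has_local_degree X \<A> f p e"
  shows "d \<le> e"
proof -
  obtain U \<phi> where "oriented_chart X \<A> (U, \<phi>)" "p \<in> U" using d unfolding has_local_degree_def by blast
  then have "p \<in> topspace X" using chart_openin(2)[of X U \<phi>] unfolding oriented_chart_def by blast
  then have top: "openin X (topspace X)" "p \<in> topspace X" by auto
  obtain N1 B1 where N1: "openin X N1" "p \<in> N1" and "N1 \<subseteq> topspace X"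
    and B1: "openin X B1" "f p \<in> B1" and "B1 \<subseteq> f ` N1"
    and c1: "\<And>y. y \<in> B1 \<Longrightarrow> y \<noteq> f p \<Longrightarrow> finite {x \<in> N1. f x = y} \<and> card {x \<in> N1. f x = y} = e"
    by (rule local_degree_count[OF e top], rule that)
  obtain N2 B2 where "openin X N2" "p \<in> N2" and N2: "N2 \<subseteq> N1"
    and B2: "openin X B2" "f p \<in> B2" and "B2 \<subseteq> f ` N2"
    and c2: "\<And>y. y \<in> B2 \<Longrightarrow> y \<noteq> f p \<Longrightarrow> finite {x \<in> N2. f x = y} \<and> card {x \<in> N2. f x = y} = d"
    by (rule local_degree_count[OF d N1], rule that)
  obtain y where y: "y \<in> B1 \<inter> B2" "y \<noteq> f p"
    by (rule sphere_no_isolated_point[OF X, of "B1 \<inter> B2" "f p"]) (use B1 B2 in auto)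
  have "card {x \<in> N2. f x = y} \<le> card {x \<in> N1. f x = y}"
    using c1[of y] y N2 by (intro card_mono) auto
  then show ?thesis using c1[of y] c2[of y] y by simp
qed

lemma local_degree_eq:
  assumes X: "topological_sphere X" and d: "has_local_degree X \<A> f p d"
  shows "local_degree X \<A> f p = d"
  unfolding local_degree_def
proof (rule the_equality)
  show "has_local_degree X \<A> f p d" by (rule d)
  show "e = d" if "has_local_degree X \<A> f p e" for e
    using local_degree_unique[OF X d that] local_degree_unique[OF X that d] by simp
qed

lemma branched_covering_open_map:
  assumes "branched_covering X \<A> f"
  shows "open_map X X f"
  unfolding open_map_def
proof (intro allI impI)
  fix N assume N: "openin X N"
  show "openin X (f ` N)"
  proof (subst openin_subopen, clarify)
    fix p assume p: "p \<in> N"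
    then have "p \<in> topspace X" using N openin_subset by blast
    then obtain d where deg: "has_local_degree X \<A> f p d" using assms unfolding branched_covering_def by blast
    obtain N1 B where "openin X N1" "p \<in> N1" "N1 \<subseteq> N" "openin X B" "f p \<in> B" "B \<subseteq> f ` N1"
      "\<And>y. y \<in> B \<Longrightarrow> y \<noteq> f p \<Longrightarrow> finite {x \<in> N1. f x = y} \<and> card {x \<in> N1. f x = y} = d"
    by (rule local_degree_count[OF deg N p], rule that)
    have "B \<subseteq> f ` N" using \<open>B \<subseteq> f ` N1\<close> image_mono[OF \<open>N1 \<subseteq> N\<close>] by (rule order_trans)
    then show "\<exists>T. openin X T \<and> f p \<in> T \<and> T \<subseteq> f ` N" using \<open>openin X B\<close> \<open>f p \<in> B\<close> by (intro exI[of _ B] conjI)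
  qed
qed

lemma noncritical_locally_injective:
  assumes X: "topological_sphere X" and f: "branched_covering X \<A> f" and p: "p \<in> topspace X" "p \<notin> critical_points X \<A> f"
  obtains U where "openin X U" "p \<in> U" "inj_on f U"
proof -
  obtain d where d: "has_local_degree X \<A> f p d" using f p(1) unfolding branched_covering_def by blast
  then have "d = 1" using p local_degree_eq[OF X d] unfolding critical_points_def has_local_degree_def by auto
  then obtain U \<phi> V \<psi> where "oriented_chart X \<A> (U, \<phi>)" "p \<in> U" and f: "\<And>x. x \<in> U \<Longrightarrow> \<psi> (f x) = \<phi> x ^ 1"
    using d unfolding has_local_degree_def by blast
  then have ch: "is_chart X (U, \<phi>)" by (simp add: oriented_chart_def)
  have "inj_on f U"
  proof (rule inj_onI)
    fix x y assume "x \<in> U" "y \<in> U" "f x = f y"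
    then have "\<phi> x = \<phi> y" using f by (metis power_one_right)
    then show "x = y" using inj_onD[OF chart_openin(1)[OF ch]] \<open>x \<in> U\<close> \<open>y \<in> U\<close> by blast
  qed
  moreover have "openin X U" using ch by (simp add: is_chart_def)
  ultimately show thesis using that \<open>p \<in> U\<close> by blast
qed

text \<open>In a chart \<open>z ^ d\<close> the map is locally injective away from the centre, so critical points are isolated.\<close>

lemma critical_points_finite:
  assumes X: "topological_sphere X" and f: "branched_covering X \<A> f"
  shows "finite (critical_points X \<A> f)"
proof -
  have "\<exists>U. openin X U \<and> p \<in> U \<and> U \<inter> critical_points X \<A> f \<subseteq> {p}" if p: "p \<in> topspace X" for p
  proof -
    obtain d where "has_local_degree X \<A> f p d" using f p unfolding branched_covering_def by blast
    then obtain U \<phi> V \<psi> where oc: "oriented_chart X \<A> (U, \<phi>)" and d: "d \<ge> 1"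
      and pU: "p \<in> U" "\<phi> p = 0" and fd: "\<And>x. x \<in> U \<Longrightarrow> \<psi> (f x) = \<phi> x ^ d"
      unfolding has_local_degree_def by blast
    have ch: "is_chart X (U, \<phi>)" using oc by (simp add: oriented_chart_def)
    note cU = chart_openin[OF ch]
    have "q \<notin> critical_points X \<A> f" if q: "q \<in> U" "q \<noteq> p" for q
    proof -
      have "\<phi> q \<noteq> 0" using inj_onD[OF cU(1), of q p] q pU by auto
      moreover have "deriv (\<lambda>z. z ^ d) (\<phi> q) = of_nat d * \<phi> q ^ (d - 1)"
        by (rule DERIV_imp_deriv) (auto intro!: derivative_eq_intros)
      ultimately have "deriv (\<lambda>z. z ^ d) (\<phi> q) \<noteq> 0" using d by simp
      then obtain r where r: "r > 0" "inj_on (\<lambda>z. z ^ d) (ball (\<phi> q) r)"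
        by (rule has_complex_derivative_locally_injective[of "\<lambda>z. z ^ d" UNIV "\<phi> q", rotated 3])
           (auto intro: holomorphic_intros)
      define M where "M = {x \<in> U. \<phi> x \<in> ball (\<phi> q) r}"
      have M: "openin X M" "q \<in> M" unfolding M_def using cU(4)[OF open_ball] q r by simp_all
      have injM: "inj_on f M"
      proof (rule inj_onI)
        fix x y assume xy: "x \<in> M" "y \<in> M" "f x = f y"
        then have "\<phi> x ^ d = \<phi> y ^ d" using fd by (metis (no_types, lifting) M_def mem_Collect_eq)
        then have "\<phi> x = \<phi> y" using inj_onD[OF r(2)] xy unfolding M_def by blast
        then show "x = y" using inj_onD[OF cU(1)] xy unfolding M_def by blast
      qed
      have "q \<in> topspace X" using q cU(2) by blast
      then obtain e where e: "has_local_degree X \<A> f q e" using f unfolding branched_covering_def by blast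
      obtain N1 B where "openin X N1" "q \<in> N1" and N1: "N1 \<subseteq> M"
        and B: "openin X B" "f q \<in> B" and "B \<subseteq> f ` N1"
        and cB: "\<And>y. y \<in> B \<Longrightarrow> y \<noteq> f q \<Longrightarrow> finite {x \<in> N1. f x = y} \<and> card {x \<in> N1. f x = y} = e"
    by (rule local_degree_count[OF e M], rule that)
      obtain y where y: "y \<in> B" "y \<noteq> f q" by (rule sphere_no_isolated_point[OF X B])
      have "card {x \<in> N1. f x = y} \<le> Suc 0"
        using cB[OF y] injM N1 by (subst card_le_Suc0_iff_eq) (auto dest: inj_onD)
      then have "e \<le> 1" using cB[OF y] by simp
      then show ?thesis using local_degree_eq[OF X e] by (auto simp: critical_points_def)
    qed
    then show ?thesis using ch pU(1) by (intro exI[of _ U]) (auto simp: is_chart_def)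
  qed
  then obtain U where U: "\<And>p. p \<in> topspace X \<Longrightarrow> openin X (U p) \<and> p \<in> U p \<and> U p \<inter> critical_points X \<A> f \<subseteq> {p}"
    by metis
  have "compactin X (topspace X)" using topological_sphere_compact_Hausdorff(1)[OF X] by (simp add: compact_space_def)
  then have "\<exists>\<F>. finite \<F> \<and> \<F> \<subseteq> U ` topspace X \<and> topspace X \<subseteq> \<Union>\<F>"
    by (rule compactinD) (use U in auto)
  then obtain \<F> where "finite \<F>" "\<F> \<subseteq> U ` topspace X" "topspace X \<subseteq> \<Union>\<F>" by blast
  then obtain T where T: "finite T" "T \<subseteq> topspace X" "\<F> = U ` T" by (meson finite_subset_image)
  have "critical_points X \<A> f \<subseteq> T"
  proof
    fix p assume p: "p \<in> critical_points X \<A> f"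
    then have "p \<in> topspace X" by (simp add: critical_points_def)
    then obtain t where "t \<in> T" "p \<in> U t" using \<open>topspace X \<subseteq> \<Union>\<F>\<close> T by blast
    then have "p = t" using U[of t] T(2) p by blast
    then show "p \<in> T" using \<open>t \<in> T\<close> by simp
  qed
  then show ?thesis using T(1) finite_subset by blast
qed

lemma postcritical_eq_critical:
  assumes "\<forall>c\<in>critical_points X \<A> f. f c = c"
  shows "postcritical_set X \<A> f = critical_points X \<A> f"
proof -
  have "(f ^^ n) c = c" if "c \<in> critical_points X \<A> f" for n c
    by (induction n) (use assms that in auto)
  then have "(f ^^ n) ` critical_points X \<A> f = critical_points X \<A> f" for n by force
  then show ?thesis unfolding postcritical_set_def by auto
qed

section \<open>Maps branched only at fixed points\<close>

text \<open>The properties of a critically fixed Thurston map that are used below: it is a continuous open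
surjection which is locally injective off a set \<open>P\<close> of fixed points.\<close>

locale fixed_branch_map =
  fixes X :: "'a topology" and f :: "'a \<Rightarrow> 'a" and P :: "'a set"
  assumes sphere: "topological_sphere X"
    and cont: "continuous_map X X f" and onto: "f ` topspace X = topspace X" and opn: "open_map X X f"
    and PX: "P \<subseteq> topspace X" and fixP: "\<And>p. p \<in> P \<Longrightarrow> f p = p"
    and locinj: "\<And>x. x \<in> topspace X \<Longrightarrow> x \<notin> P \<Longrightarrow> \<exists>U. openin X U \<and> x \<in> U \<and> inj_on f U"
begin

definition preim :: "'a set \<Rightarrow> 'a set" where "preim S = {x \<in> topspace X. f x \<in> S}"

definition pre_components :: "'a set \<Rightarrow> 'a set set" where
  "pre_components S = connected_components_of (subtopology X (preim S))"

lemma f_in: "x \<in> topspace X \<Longrightarrow> f x \<in> topspace X"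
  using onto by blast

lemma haus: "Hausdorff_space X" and cpt: "compact_space X"
  using topological_sphere_compact_Hausdorff[OF sphere] by auto

lemma preim_sub: "preim S \<subseteq> topspace X" by (auto simp: preim_def)

lemma openin_preim: "openin X S \<Longrightarrow> openin X (preim S)"
  unfolding preim_def using cont by (rule openin_continuous_map_preimage)

lemma closedin_preim: "closedin X S \<Longrightarrow> closedin X (preim S)"
  unfolding preim_def using cont by (rule closedin_continuous_map_preimage)

lemma pre_component_complement:
  assumes "V \<in> pre_components S" shows "V \<in> complement_components X (topspace X - preim S)"
proof -
  have "topspace X - (topspace X - preim S) = preim S" using preim_sub by blast
  then show ?thesis using assms by (simp add: pre_components_def complement_components_def)
qed

lemma pre_component_props:
  assumes S: "openin X S" and V: "V \<in> pre_components S"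
  shows "openin X V" "connectedin X V" "V \<noteq> {}" "V \<subseteq> preim S" "X closure_of V \<inter> preim S \<subseteq> V"
proof -
  have cl: "closedin X (topspace X - preim S)" using openin_preim[OF S] by blast
  note C = complement_component_props[OF sphere cl pre_component_complement[OF V]]
  show o: "openin X V" "connectedin X V" "V \<noteq> {}" using C by auto
  show "V \<subseteq> preim S" using C(4) by blast
  show "X closure_of V \<inter> preim S \<subseteq> V" using C(5) o(1) by (auto simp: frontier_of_openin)
qed

lemma pre_component_maximal:
  assumes V: "V \<in> pre_components S" and U: "connectedin X U" "U \<subseteq> preim S" "U \<inter> V \<noteq> {}"
  shows "U \<subseteq> V"
proof (rule complement_component_maximal[OF pre_component_complement[OF V] U(1) _ U(3)])
  show "U \<subseteq> topspace X - (topspace X - preim S)" using U(2) preim_sub by blast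
qed

lemma pre_component_ex:
  assumes "x \<in> preim S" obtains V where "V \<in> pre_components S" "x \<in> V"
proof -
  have "x \<in> \<Union>(connected_components_of (subtopology X (preim S)))"
    unfolding Union_connected_components_of using assms preim_sub by auto
  then show thesis using that unfolding pre_components_def by blast
qed

lemma pre_component_eq:
  "V \<in> pre_components S \<Longrightarrow> V' \<in> pre_components S \<Longrightarrow> V \<inter> V' \<noteq> {} \<Longrightarrow> V = V'"
  unfolding pre_components_def
  using pairwise_disjoint_connected_components_of[of "subtopology X (preim S)"]
  by (auto simp: pairwise_def disjnt_def)

lemma pre_component_connected: "V \<in> pre_components S \<Longrightarrow> connectedin X V \<and> V \<subseteq> preim S \<and> V \<noteq> {}"
  unfolding pre_components_def
  using connectedin_connected_components_of[of V "subtopology X (preim S)"] nonempty_connected_components_of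
  by (auto simp: connectedin_subtopology)

text \<open>Over the image of an open set on which \<open>f\<close> is injective, connected sets lift.\<close>

lemma lift_connected:
  assumes N: "openin X N" "inj_on f N" and C: "connectedin X C" "C \<subseteq> f ` N"
  shows "connectedin X {u \<in> N. f u \<in> C}"
proof -
  have NX: "N \<subseteq> topspace X" using N(1) by (rule openin_subset)
  have fNX: "f ` N \<subseteq> topspace X" using NX onto by blast
  have "homeomorphic_map (subtopology X N) (subtopology X (f ` N)) f"
  proof (rule bijective_open_imp_homeomorphic_map)
    show "continuous_map (subtopology X N) (subtopology X (f ` N)) f"
      using continuous_map_from_subtopology[OF cont] by (simp add: continuous_map_in_subtopology NX)
    show "open_map (subtopology X N) (subtopology X (f ` N)) f"
      unfolding open_map_def
    proof (intro allI impI)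
      fix U assume "openin (subtopology X N) U"
      then have U: "openin X U" "U \<subseteq> N" using N(1) openin_open_subtopology by blast+
      then have "openin X (f ` U)" using opn by (simp add: open_map_def)
      moreover have "f ` U = f ` U \<inter> f ` N" using U(2) by blast
      ultimately show "openin (subtopology X (f ` N)) (f ` U)" unfolding openin_subtopology by blast
    qed
    show "f ` topspace (subtopology X N) = topspace (subtopology X (f ` N))" using NX fNX by auto
    show "inj_on f (topspace (subtopology X N))" using N(2) NX by (simp add: Int_absorb1)
  qed
  moreover have sub: "{u \<in> N. f u \<in> C} \<subseteq> topspace (subtopology X N)" using NX by auto
  moreover have im: "f ` {u \<in> N. f u \<in> C} = C" using C(2) by auto
  ultimately have "connectedin (subtopology X N) {u \<in> N. f u \<in> C}"
    using homeomorphic_map_connectedness[of "subtopology X N" "subtopology X (f ` N)" f "{u \<in> N. f u \<in> C}"] C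
    by (simp add: connectedin_subtopology)
  then show ?thesis by (simp add: connectedin_subtopology)
qed

lemma preim_avoids_P: "S \<inter> P = {} \<Longrightarrow> preim S \<inter> P = {}"
  using fixP by (auto simp: preim_def)

context
  fixes \<gamma> G V
  assumes \<gamma>: "jordan_curve X \<gamma>" and \<gamma>P: "\<gamma> \<inter> P = {}" and ne: "\<exists>p. p \<in> topspace X - \<gamma>" and G: "G \<in> complement_components X \<gamma>"
    and V: "V \<in> pre_components G" and VP: "V \<inter> P = {}"
begin

lemma G_open: "openin X G" and \<gamma>_closed: "closedin X \<gamma>" and \<gamma>X: "\<gamma> \<subseteq> topspace X" and G\<gamma>: "G \<inter> \<gamma> = {}"
  and clG: "X closure_of G = G \<union> \<gamma>" and \<gamma>_ne: "\<gamma> \<noteq> {}"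
proof -
  show cl: "closedin X \<gamma>" "\<gamma> \<noteq> {}" using jordan_curve_closedin[OF sphere \<gamma>] by auto
  show "openin X G" "G \<inter> \<gamma> = {}" using complement_component_props(1,4)[OF sphere cl(1) G] by auto
  show "\<gamma> \<subseteq> topspace X" using \<gamma> by (simp add: jordan_curve_def)
  obtain p where "p \<in> topspace X - \<gamma>" using ne by blast
  then show "X closure_of G = G \<union> \<gamma>" using jordan_curve_sides(2)[OF sphere \<gamma> _ G] by blast
qed

lemmas Vp = pre_component_props[OF G_open V]

text \<open>Over the disc \<open>G\<close> the map \<open>f\<close> restricted to \<open>V\<close> is a proper local homeomorphism: points of \<open>V\<close> stay
away from the boundary of \<open>V\<close> if their images stay in a compact subset of \<open>G\<close>.\<close>

lemma unbranched_disc_component_inj: "inj_on f V" "f ` V = G"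
proof -
  obtain y where y: "y \<in> \<gamma>" using \<gamma>_ne by blast
  then obtain q where q: "q \<in> topspace X" "f q \<in> \<gamma>" using onto \<gamma>X by (metis imageE subsetD)
  then have qV: "q \<notin> V" using Vp(4) G\<gamma> by (auto simp: preim_def)
  obtain p where p: "p \<in> topspace X - \<gamma>" using ne by blast
  note S = jordan_curve_sides[OF sphere \<gamma> p G]
  obtain q2 where q2: "q2 \<in> topspace X - (G \<union> \<gamma>)"
    using complement_component_props(3)[OF sphere \<gamma>_closed S(3)] by blast
  then have q2': "q2 \<in> topspace X" "q2 \<in> topspace X - \<gamma>" "q2 \<notin> G" by auto
  from topological_sphere_chart[OF sphere q(1)] obtain l m where ch: "punctured_plane X q l m" .
  from topological_sphere_chart[OF sphere q2'(1)] obtain l2 m2 where ch2: "punctured_plane X q2 l2 m2" .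
  interpret A: punctured_plane X q l m by (rule ch)
  interpret B: punctured_plane X q2 l2 m2 by (rule ch2)
  obtain c where c: "simple_path c" "pathfinish c = pathstart c" and "\<gamma> = m2 ` path_image c" and Gc: "G = m2 ` inside (path_image c)"
    by (rule jordan_curve_side_chart[OF sphere \<gamma> q2'(2) G q2'(3) ch2])
  note J = Jordan_sides[OF c]
  define I where "I = inside (path_image c)"
  define p' where "p' = l2 \<circ> f \<circ> m"
  define W where "W = l ` V"
  have VX: "V \<subseteq> topspace X - {q}" using Vp(1) qV openin_subset by blast
  have mlV: "m (l u) = u" if "u \<in> V" for u using that VX by (intro A.ml) auto
  have mW: "m ` W = V" unfolding W_def by (rule A.ml_image[OF VX])
  have l2G: "l2 z \<in> I" "m2 (l2 z) = z" if "z \<in> G" for z using that unfolding Gc I_def by auto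
  have fV: "f (m z) \<in> G" if "z \<in> W" for z using that mW Vp(4) by (auto simp: preim_def)
  have p'm: "m2 (p' z) = f (m z)" if "z \<in> W" for z using l2G(2)[OF fV[OF that]] by (simp add: p'_def)
  have oW: "open W" unfolding W_def using Vp(1) qV by (rule A.open_l)
  have cW: "connected W" unfolding W_def using Vp(2) qV by (rule A.connected_l)
  have cp: "continuous_on W p'"
  proof -
    have "continuous_map (top_of_set W) X m"
      using continuous_map_from_subtopology[OF A.cont_m] by simp
    then have "continuous_map (top_of_set W) X (f \<circ> m)" using cont by (rule continuous_map_compose)
    moreover have "(f \<circ> m) ` W \<subseteq> topspace X - {q2}" using fV q2' G_open openin_subset by fastforce
    ultimately have "continuous_map (top_of_set W) (subtopology X (topspace X - {q2})) (f \<circ> m)"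
      by (intro continuous_map_into_subtopology) auto
    then have "continuous_map (top_of_set W) euclidean (l2 \<circ> (f \<circ> m))" using B.cont_l by (rule continuous_map_compose)
    then show ?thesis by (simp add: p'_def o_assoc)
  qed
  have inj: "\<exists>U. open U \<and> z \<in> U \<and> U \<subseteq> W \<and> inj_on p' U" if z: "z \<in> W" for z
  proof -
    have "m z \<in> V" using z mW by blast
    then have "m z \<in> topspace X" "m z \<notin> P" using VX VP by auto
    then obtain U where U: "openin X U" "m z \<in> U" "inj_on f U" using locinj by blast
    have "openin X (U \<inter> V)" using U(1) Vp(1) by blast
    then have o: "open (l ` (U \<inter> V))" by (rule A.open_l) (use qV in blast)
    have "inj_on p' (l ` (U \<inter> V))"
    proof (rule inj_onI)
      fix x y assume xy: "x \<in> l ` (U \<inter> V)" "y \<in> l ` (U \<inter> V)" "p' x = p' y"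
      then have "x \<in> W" "y \<in> W" by (auto simp: W_def)
      then have "f (m x) = f (m y)" using p'm xy(3) by metis
      moreover have "m x \<in> U" "m y \<in> U" using xy(1,2) mlV by auto
      ultimately have "m x = m y" using U(3) by (auto dest: inj_onD)
      then show "x = y" using injD[OF A.inj_m] by blast
    qed
    moreover have "z \<in> l ` (U \<inter> V)" using U(2) \<open>m z \<in> V\<close> by (intro image_eqI[of _ _ "m z"]) auto
    ultimately show ?thesis using o by (intro exI[of _ "l ` (U \<inter> V)"]) (auto simp: W_def)
  qed
  have proper: "compact (W \<inter> p' -` K)" if K: "compact K" "K \<subseteq> I" for K
  proof -
    have "closedin X (m2 ` K)" using K(1) by (rule B.closedin_m)
    then have "closedin X (preim (m2 ` K))" by (rule closedin_preim)
    then have "closedin X (X closure_of V \<inter> preim (m2 ` K))" using closedin_Int[OF closedin_closure_of] by blast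
    moreover have "preim (m2 ` K) \<subseteq> preim G" using K(2) by (auto simp: preim_def Gc I_def)
    then have "X closure_of V \<inter> preim (m2 ` K) = V \<inter> preim (m2 ` K)"
      using Vp(5) closure_of_subset[OF openin_subset[OF Vp(1)]] by blast
    ultimately have "compact (l ` (V \<inter> preim (m2 ` K)))" using qV by (intro A.compact_l) auto
    moreover have "l ` (V \<inter> preim (m2 ` K)) = W \<inter> p' -` K"
    proof
      show "l ` (V \<inter> preim (m2 ` K)) \<subseteq> W \<inter> p' -` K"
      proof
        fix z assume "z \<in> l ` (V \<inter> preim (m2 ` K))"
        then obtain x k where x: "x \<in> V" "z = l x" "f x = m2 k" "k \<in> K" by (auto simp: preim_def)
        then have "m z = x" using mlV by simp
        then have "p' z = k" using x by (simp add: p'_def)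
        then show "z \<in> W \<inter> p' -` K" using x by (auto simp: W_def)
      qed
      show "W \<inter> p' -` K \<subseteq> l ` (V \<inter> preim (m2 ` K))"
      proof
        fix z assume z: "z \<in> W \<inter> p' -` K"
        then have "m z \<in> V" "f (m z) \<in> m2 ` K" using mW p'm[of z] by auto (metis imageI)+
        then have "m z \<in> V \<inter> preim (m2 ` K)" using VX by (auto simp: preim_def)
        then show "z \<in> l ` (V \<inter> preim (m2 ` K))" by (intro image_eqI[of _ _ "m z"]) auto
      qed
    qed
    ultimately show ?thesis by simp
  qed
  have sub: "p' ` W \<subseteq> I" using fV l2G(1) by (auto simp: p'_def)
  have "simply_connected I" unfolding I_def using c(1) by (rule simply_connected_inside_simple_path)
  moreover have "W \<noteq> {}" using Vp(3) by (simp add: W_def)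
  moreover have "open I" "connected I" using J by (simp_all add: I_def)
  ultimately have res: "inj_on p' W" "p' ` W = I"
    using proper_local_homeo_injective[OF oW cW _ cp _ _ _ sub inj proper] by blast+
  show "inj_on f V"
  proof (rule inj_onI)
    fix x y assume xy: "x \<in> V" "y \<in> V" "f x = f y"
    then have "m (l x) = x" "m (l y) = y" using mlV by auto
    then have "p' (l x) = p' (l y)" using xy by (simp add: p'_def)
    then have "l x = l y" using res(1) xy by (auto simp: W_def dest: inj_onD)
    then show "x = y" using \<open>m (l x) = x\<close> \<open>m (l y) = y\<close> by metis
  qed
  show "f ` V = G"
  proof -
    have "G = m2 ` p' ` W" unfolding res(2) by (simp add: Gc I_def)
    also have "\<dots> = (\<lambda>z. f (m z)) ` W" unfolding image_image using p'm by (rule image_cong[OF refl])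
    also have "\<dots> = f ` m ` W" by (simp add: image_image)
    finally show ?thesis by (simp add: mW)
  qed
qed

definition "Fr = X frontier_of V"

lemma clV: "X closure_of V = V \<union> Fr" "V \<inter> Fr = {}"
  using Vp(1) closure_of_subset[OF openin_subset[OF Vp(1)]] unfolding Fr_def by (auto simp: frontier_of_openin)

text \<open>\<open>f\<close> maps the closure of \<open>V\<close> onto a closed set, which contains \<open>G\<close> and hence the closure of \<open>G\<close>.\<close>

lemma f_clV: "f ` (X closure_of V) = G \<union> \<gamma>"
proof
  have "f ` (X closure_of V) \<subseteq> X closure_of (f ` V)"
    using cont by (simp add: continuous_map_image_closure_subset)
  then show "f ` (X closure_of V) \<subseteq> G \<union> \<gamma>" by (simp add: unbranched_disc_component_inj clG)
  have "compactin X (X closure_of V)" by (simp add: closedin_compact_space cpt)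
  then have "compactin X (f ` (X closure_of V))" using cont by (rule image_compactin)
  then have "closedin X (f ` (X closure_of V))" using haus compactin_imp_closedin by blast
  moreover have "G \<subseteq> f ` (X closure_of V)"
    using unbranched_disc_component_inj(2) closure_of_subset[OF openin_subset[OF Vp(1)]] by blast
  ultimately have "X closure_of G \<subseteq> f ` (X closure_of V)" by (rule closure_of_minimal[rotated])
  then show "G \<union> \<gamma> \<subseteq> f ` (X closure_of V)" by (simp add: clG)
qed

lemma f_Fr: "f ` Fr = \<gamma>" "Fr \<subseteq> preim \<gamma>" "Fr \<inter> P = {}"
proof -
  have FrX: "Fr \<subseteq> topspace X" unfolding Fr_def by (rule frontier_of_subset_topspace)
  have "f x \<notin> G" if "x \<in> Fr" for x
  proof
    assume "f x \<in> G"
    then have "x \<in> V" using Vp(5) that FrX clV(1) by (auto simp: preim_def)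
    then show False using that clV(2) by blast
  qed
  then have 1: "f ` Fr \<subseteq> \<gamma>" using f_clV clV(1) by blast
  then show sub: "Fr \<subseteq> preim \<gamma>" using FrX by (auto simp: preim_def)
  then show "Fr \<inter> P = {}" using preim_avoids_P[OF \<gamma>P] by blast
  have "\<gamma> \<subseteq> f ` V \<union> f ` Fr" using f_clV clV(1) by blast
  then show "f ` Fr = \<gamma>" using 1 G\<gamma> unbranched_disc_component_inj(2) by blast
qed

text \<open>If two boundary points \<open>x\<close> and \<open>y\<close> of \<open>V\<close> had the same image, then points of \<open>G\<close> near this image,
being joined within \<open>G\<close> by connected sets near it, would have preimages in \<open>V\<close> both near \<open>x\<close> and near \<open>y\<close>,
contrary to injectivity on \<open>V\<close>.\<close>

lemma inj_clV: "inj_on f (X closure_of V)"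
proof -
  have FrX: "Fr \<subseteq> topspace X" unfolding Fr_def by (rule frontier_of_subset_topspace)
  have injFr: "x = y" if xy: "x \<in> Fr" "y \<in> Fr" "f x = f y" for x y
  proof (rule ccontr)
    assume "x \<noteq> y"
    have xX: "x \<in> topspace X" "y \<in> topspace X" "x \<notin> P" "y \<notin> P" using xy FrX f_Fr(3) by auto
    obtain A B where AB: "openin X A" "openin X B" "x \<in> A" "y \<in> B" "disjnt A B"
      using haus xX \<open>x \<noteq> y\<close> unfolding Hausdorff_space_def by meson
    obtain U where U: "openin X U" "x \<in> U" "inj_on f U" using locinj xX by blast
    obtain U' where U': "openin X U'" "y \<in> U'" "inj_on f U'" using locinj xX by blast
    define N where "N = A \<inter> U"
    define M where "M = B \<inter> U'"
    have N: "openin X N" "x \<in> N" "inj_on f N" and M: "openin X M" "y \<in> M" and NM: "N \<inter> M = {}"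
      using AB U(1,2) U'(1,2) inj_on_subset[OF U(3), of N] by (auto simp: N_def M_def disjnt_def)
    have "openin X (f ` N \<inter> f ` M)" using N M opn by (auto simp: open_map_def)
    moreover have "f x \<in> f ` N \<inter> f ` M" using N M xy(3) by (metis IntI imageI)
    moreover have fx: "f x \<in> \<gamma>" using f_Fr(1) xy by blast
    obtain p where p: "p \<in> topspace X - \<gamma>" using ne by blast
    ultimately obtain N' where N': "openin X N'" "f x \<in> N'" "N' \<subseteq> f ` N \<inter> f ` M"
      and acc: "\<And>z w. z \<in> N' \<inter> G \<Longrightarrow> w \<in> N' \<inter> G \<Longrightarrow> \<exists>C. connectedin X C \<and> z \<in> C \<and> w \<in> C \<and> C \<subseteq> (f ` N \<inter> f ` M) \<inter> G"
      using side_locally_accessible[OF sphere \<gamma> p G fx] by metis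
    have near: "\<exists>z. z \<in> V \<inter> Q \<and> f z \<in> N'" if "openin X Q" "u \<in> Q" "u \<in> Fr" "f u = f x" for Q u
    proof -
      have "openin X (Q \<inter> preim N')" using that openin_preim[OF N'(1)] by blast
      moreover have "u \<in> Q \<inter> preim N'" using that N'(2) FrX by (auto simp: preim_def)
      moreover have "u \<in> X closure_of V" using that clV(1) by blast
      ultimately obtain z where "z \<in> V" "z \<in> Q \<inter> preim N'" unfolding in_closure_of by blast
      then show ?thesis by (auto simp: preim_def)
    qed
    obtain z where z: "z \<in> V \<inter> N" "f z \<in> N'" using near[OF N(1,2) xy(1)] by blast
    obtain w where w: "w \<in> V \<inter> M" "f w \<in> N'" using near[OF M(1,2) xy(2)] xy(3) by metis
    have "f z \<in> N' \<inter> G" "f w \<in> N' \<inter> G" using z w unbranched_disc_component_inj(2) by blast+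
    then obtain C where C: "connectedin X C" "f z \<in> C" "f w \<in> C" "C \<subseteq> (f ` N \<inter> f ` M) \<inter> G" using acc by meson
    define C' where "C' = {u \<in> N. f u \<in> C}"
    have "connectedin X C'" unfolding C'_def using N(1,3) C(1) by (rule lift_connected) (use C(4) in blast)
    moreover have "C' \<subseteq> preim G" using C(4) openin_subset[OF N(1)] by (auto simp: C'_def preim_def)
    moreover have "z \<in> C' \<inter> V" using z C by (auto simp: C'_def)
    ultimately have "C' \<subseteq> V" using pre_component_maximal[OF V] by blast
    obtain u where u: "u \<in> N" "f u = f w" using C(3,4) by (metis IntE imageE subsetD)
    then have "u \<in> V" using \<open>C' \<subseteq> V\<close> C(3) by (auto simp: C'_def)
    then have "u = w" using inj_onD[OF unbranched_disc_component_inj(1) u(2)] w by blast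
    then show False using u(1) w NM by blast
  qed
  show ?thesis
  proof (rule inj_onI)
    fix x y assume xy: "x \<in> X closure_of V" "y \<in> X closure_of V" "f x = f y"
    have V: "f u \<in> G" if "u \<in> V" for u using that unbranched_disc_component_inj(2) by blast
    have F: "f u \<in> \<gamma>" if "u \<in> Fr" for u using that f_Fr(1) by blast
    consider "x \<in> V" "y \<in> V" | "x \<in> Fr" "y \<in> Fr"
      using xy V F G\<gamma> clV(1) by (metis Un_iff disjoint_iff)
    then show "x = y"
      by cases (use inj_onD[OF unbranched_disc_component_inj(1) xy(3)] injFr xy(3) in blast)+
  qed
qed

lemma Fr_jordan: "jordan_curve X Fr" and V_side: "V \<in> complement_components X Fr"
proof -
  have FrX: "Fr \<subseteq> topspace X" unfolding Fr_def by (rule frontier_of_subset_topspace)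
  have cF: "closedin X Fr" unfolding Fr_def by (rule closedin_frontier_of)
  have "homeomorphic_map (subtopology X Fr) (subtopology X \<gamma>) f"
  proof (rule continuous_imp_homeomorphic_map)
    show "continuous_map (subtopology X Fr) (subtopology X \<gamma>) f"
      using continuous_map_from_subtopology[OF cont] f_Fr(1) by (auto simp: continuous_map_in_subtopology)
    show "compact_space (subtopology X Fr)" using cF cpt by (simp add: closedin_compact_space compact_space_subtopology)
    show "Hausdorff_space (subtopology X \<gamma>)" using haus by (rule Hausdorff_space_subtopology)
    show "f ` topspace (subtopology X Fr) = topspace (subtopology X \<gamma>)" using f_Fr(1) FrX \<gamma>X by (simp add: Int_absorb1)
    show "inj_on f (topspace (subtopology X Fr))" using inj_clV clV(1) by (auto intro: inj_on_subset)
  qed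
  then have "subtopology X Fr homeomorphic_space subtopology X \<gamma>"
    by (rule homeomorphic_map_imp_homeomorphic_space)
  then show "jordan_curve X Fr" using \<gamma> FrX homeomorphic_space_trans unfolding jordan_curve_def by blast
  let ?Y = "subtopology X (topspace X - Fr)"
  have VY: "V \<subseteq> topspace X - Fr" using clV(2) openin_subset[OF Vp(1)] by blast
  show "V \<in> complement_components X Fr"
    unfolding complement_components_def
  proof (rule clopen_connected_is_component[OF _ _ _ Vp(3)])
    show "connectedin ?Y V" using Vp(2) VY by (simp add: connectedin_subtopology)
    show "openin ?Y V" using Vp(1) VY by (metis inf.absorb1 openin_subtopology_Int)
    have "closedin ?Y (X closure_of V \<inter> (topspace X - Fr))" unfolding closedin_subtopology by (intro exI[of _ "X closure_of V"]) simp
    moreover have "X closure_of V \<inter> (topspace X - Fr) = V" using clV VY by blast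
    ultimately show "closedin ?Y V" by simp
  qed
qed

text \<open>The frontier of \<open>V\<close> is open in the preimage of \<open>\<gamma>\<close>: near one of its points \<open>y\<close>, every point over \<open>\<gamma>\<close> has
the same image as some point of the frontier close to \<open>y\<close>, by injectivity on the closure of \<open>V\<close>, and so
coincides with it by injectivity near \<open>y\<close>.\<close>

lemma Fr_component: "Fr \<in> pre_components \<gamma>"
  unfolding pre_components_def
proof (rule clopen_connected_is_component)
  have FrX: "Fr \<subseteq> topspace X" unfolding Fr_def by (rule frontier_of_subset_topspace)
  have cF: "closedin X Fr" unfolding Fr_def by (rule closedin_frontier_of)
  show "connectedin (subtopology X (preim \<gamma>)) Fr"
    using jordan_curve_closedin(2)[OF sphere Fr_jordan] f_Fr(2) by (simp add: connectedin_subtopology)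
  show "Fr \<noteq> {}" using f_Fr(1) \<gamma>_ne by blast
  show "closedin (subtopology X (preim \<gamma>)) Fr" using cF f_Fr(2) unfolding closedin_subtopology by (intro exI[of _ Fr]) auto
  show "openin (subtopology X (preim \<gamma>)) Fr"
  proof (subst openin_subopen, clarify)
    fix y assume y: "y \<in> Fr"
    then obtain U where U: "openin X U" "y \<in> U" "inj_on f U" using locinj FrX f_Fr(3) by blast
    \<comment> \<open>the points of \<open>\<gamma>\<close> whose preimage in \<open>Fr\<close> lies in \<open>U\<close> form a neighbourhood of \<open>f y\<close> in \<open>\<gamma>\<close>\<close>
    have "closedin X (Fr - U)" using cF U(1) by blast
    then have "compactin X (Fr - U)" using cpt closedin_compact_space by blast
    then have "compactin X (f ` (Fr - U))" using cont by (rule image_compactin)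
    then have cl: "closedin X (f ` (Fr - U))" using haus compactin_imp_closedin by blast
    define N where "N = U \<inter> preim (topspace X - f ` (Fr - U))"
    have "openin X N" unfolding N_def using U(1) openin_preim[of "topspace X - f ` (Fr - U)"] cl by blast
    have "f y \<notin> f ` (Fr - U)"
    proof
      assume "f y \<in> f ` (Fr - U)"
      then obtain u where u: "u \<in> Fr" "u \<notin> U" "f y = f u" by blast
      then have "y = u" using inj_onD[OF inj_clV] y clV(1) by blast
      then show False using u U(2) by blast
    qed
    then have "y \<in> N" using U(2) y FrX f_in by (auto simp: N_def preim_def)
    have "N \<inter> preim \<gamma> \<subseteq> Fr"
    proof
      fix x assume x: "x \<in> N \<inter> preim \<gamma>"
      then have "f x \<in> \<gamma>" by (simp add: preim_def)
      then obtain u where u: "u \<in> Fr" "f x = f u" using f_Fr(1) by blast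
      then have "u \<in> U" using x by (auto simp: N_def preim_def)
      then have "x = u" using inj_onD[OF U(3) u(2)] x by (auto simp: N_def)
      then show "x \<in> Fr" using u by simp
    qed
    moreover have "openin (subtopology X (preim \<gamma>)) (N \<inter> preim \<gamma>)" using \<open>openin X N\<close> by (rule openin_subtopology_Int)
    ultimately show "\<exists>T. openin (subtopology X (preim \<gamma>)) T \<and> y \<in> T \<and> T \<subseteq> Fr"
      using \<open>y \<in> N\<close> y f_Fr(2) by (intro exI[of _ "N \<inter> preim \<gamma>"]) auto
  qed
qed

end

end

section \<open>Matching the sides of a curve with the sides of a preimage curve\<close>

text \<open>A circle is not homeomorphic to the sphere, since it is not simply connected.\<close>

lemma jordan_curve_proper:
  assumes X: "topological_sphere X" and \<gamma>: "jordan_curve X \<gamma>"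
  obtains q where "q \<in> topspace X - \<gamma>"
proof (cases "\<gamma> = topspace X")
  case True
  have "subtopology X \<gamma> homeomorphic_space top_of_set (sphere (0::complex) 1)" using \<gamma> by (simp add: jordan_curve_def)
  moreover have "X homeomorphic_space top_of_set (sphere (0::real^3) 1)" using X by (simp add: topological_sphere_def)
  ultimately have "top_of_set (sphere (0::complex) 1) homeomorphic_space top_of_set (sphere (0::real^3) 1)"
    unfolding True subtopology_topspace using homeomorphic_space_trans homeomorphic_space_sym by blast
  then obtain g h where gh: "homeomorphic_maps (top_of_set (sphere (0::complex) 1)) (top_of_set (sphere (0::real^3) 1)) g h"
    by (auto simp: homeomorphic_space_def)
  have "sphere (0::complex) 1 homeomorphic sphere (0::real^3) 1"
    unfolding homeomorphic_def homeomorphism_def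
  proof (intro exI conjI)
    have g: "continuous_map (top_of_set (sphere 0 1)) (top_of_set (sphere 0 1)) g"
      and h: "continuous_map (top_of_set (sphere 0 1)) (top_of_set (sphere 0 1)) h"
      and hg: "\<forall>x\<in>sphere 0 1. h (g x) = x" and gh: "\<forall>y\<in>sphere 0 1. g (h y) = y"
      using gh unfolding homeomorphic_maps_def by auto
    show "\<forall>x\<in>sphere 0 1. h (g x) = x" "\<forall>y\<in>sphere 0 1. g (h y) = y" by (fact hg gh)+
    have gi: "g ` sphere 0 1 \<subseteq> sphere 0 1" and hi: "h ` sphere 0 1 \<subseteq> sphere 0 1"
      using continuous_map_image_subset_topspace[OF g] continuous_map_image_subset_topspace[OF h] by auto
    show "g ` sphere 0 1 = sphere 0 1" "h ` sphere 0 1 = sphere 0 1" using gi hi hg gh by (force simp: image_iff)+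
    show "continuous_on (sphere 0 1) g" "continuous_on (sphere 0 1) h"
      using g h continuous_map_iff_continuous continuous_map_in_subtopology by blast+
  qed
  then have "simply_connected (sphere (0::complex) 1)"
    using homeomorphic_simply_connected_eq simply_connected_sphere_eq[of "0::real^3" 1] by auto
  then show ?thesis using not_simply_connected_circle[of 1 0] by simp
next
  case False
  then show ?thesis using \<gamma> that by (auto simp: jordan_curve_def)
qed

lemma jordan_side:
  assumes X: "topological_sphere X" and \<gamma>: "jordan_curve X \<gamma>" and D: "D \<in> complement_components X \<gamma>"
  shows "openin X D" "connectedin X D" "D \<noteq> {}" "D \<inter> \<gamma> = {}" "D \<subseteq> topspace X" "X closure_of D = D \<union> \<gamma>"
    "topspace X - (D \<union> \<gamma>) \<in> complement_components X \<gamma>" "\<gamma> \<subseteq> topspace X"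
    "E \<in> complement_components X \<gamma> \<Longrightarrow> E = D \<or> E = topspace X - (D \<union> \<gamma>)"
    "topspace X - (topspace X - (D \<union> \<gamma>) \<union> \<gamma>) = D"
proof -
  note C = complement_component_props[OF X jordan_curve_closedin(1)[OF X \<gamma>] D]
  show "openin X D" "connectedin X D" "D \<noteq> {}" by (fact C)+
  show "D \<inter> \<gamma> = {}" "D \<subseteq> topspace X" using C(4) by auto
  obtain q where q: "q \<in> topspace X - \<gamma>" using jordan_curve_proper[OF X \<gamma>] by blast
  show "X closure_of D = D \<union> \<gamma>" "topspace X - (D \<union> \<gamma>) \<in> complement_components X \<gamma>"
    "E \<in> complement_components X \<gamma> \<Longrightarrow> E = D \<or> E = topspace X - (D \<union> \<gamma>)"
    using jordan_curve_sides[OF X \<gamma> q D] by blast+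
  show "\<gamma> \<subseteq> topspace X" using \<gamma> by (simp add: jordan_curve_def)
  show "topspace X - (topspace X - (D \<union> \<gamma>) \<union> \<gamma>) = D" using C(4) by blast
qed

lemma side_absorbs:
  assumes X: "topological_sphere X" and \<gamma>: "jordan_curve X \<gamma>" and D: "D \<in> complement_components X \<gamma>"
    and C: "connectedin X C" "C \<inter> \<gamma> = {}" "C \<inter> (D \<union> \<gamma>) \<noteq> {}"
  shows "C \<subseteq> D"
proof (rule complement_component_maximal[OF D C(1)])
  show "C \<subseteq> topspace X - \<gamma>" using C(1,2) connectedin_subset_topspace by blast
  show "C \<inter> D \<noteq> {}" using C(2,3) by blast
qed

lemma side_cases:
  assumes X: "topological_sphere X" and \<gamma>: "jordan_curve X \<gamma>" and D: "D \<in> complement_components X \<gamma>"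
    and C: "connectedin X C" "C \<inter> \<gamma> = {}"
  shows "C \<subseteq> D \<or> C \<subseteq> topspace X - (D \<union> \<gamma>)"
proof (cases "C \<inter> (D \<union> \<gamma>) = {}")
  case True
  then show ?thesis using C(1) connectedin_subset_topspace by blast
next
  case False
  then show ?thesis using side_absorbs[OF X \<gamma> D C] by blast
qed

text \<open>Points of \<open>S\<close> close to \<open>y\<close> are joined within \<open>S\<close> close to \<open>y\<close>. Here \<open>y\<close> need not belong to \<open>S\<close>.\<close>

definition locally_accessible :: "'a topology \<Rightarrow> 'a set \<Rightarrow> 'a \<Rightarrow> bool" where
  "locally_accessible X S y \<longleftrightarrow> (\<forall>M. openin X M \<and> y \<in> M \<longrightarrow>
     (\<exists>N. openin X N \<and> y \<in> N \<and> N \<subseteq> M \<and>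
        (\<forall>z\<in>N \<inter> S. \<forall>w\<in>N \<inter> S. \<exists>C. connectedin X C \<and> z \<in> C \<and> w \<in> C \<and> C \<subseteq> M \<inter> S)))"

lemma jordan_side_accessible:
  assumes X: "topological_sphere X" and \<gamma>: "jordan_curve X \<gamma>" and D: "D \<in> complement_components X \<gamma>" and y: "y \<in> \<gamma>"
  shows "locally_accessible X D y"
  unfolding locally_accessible_def
proof (intro allI impI)
  fix M assume M: "openin X M \<and> y \<in> M"
  obtain q where q: "q \<in> topspace X - \<gamma>" using jordan_curve_proper[OF X \<gamma>] by blast
  obtain N where "openin X N" "y \<in> N" "N \<subseteq> M"
    "\<And>z w. z \<in> N \<inter> D \<Longrightarrow> w \<in> N \<inter> D \<Longrightarrow> \<exists>C. connectedin X C \<and> z \<in> C \<and> w \<in> C \<and> C \<subseteq> M \<inter> D"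
    by (rule side_locally_accessible[OF X \<gamma> q D y conjunct1[OF M] conjunct2[OF M]], rule that)
  then show "\<exists>N. openin X N \<and> y \<in> N \<and> N \<subseteq> M \<and>
        (\<forall>z\<in>N \<inter> D. \<forall>w\<in>N \<inter> D. \<exists>C. connectedin X C \<and> z \<in> C \<and> w \<in> C \<and> C \<subseteq> M \<inter> D)" by blast
qed

lemma jordan_curve_accessible:
  assumes X: "topological_sphere X" and \<gamma>: "jordan_curve X \<gamma>" and y: "y \<in> \<gamma>"
  shows "locally_accessible X \<gamma> y"
  unfolding locally_accessible_def
proof (intro allI impI)
  fix M assume M: "openin X M \<and> y \<in> M"
  have "locally_connected_space (top_of_set (sphere (0::complex) 1))"
    unfolding locally_connected_space
    using locally_connected_sphere[of "0::complex" 1] unfolding locally_connected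
    by (metis connectedin_subtopology connectedin_iff_connected openin_subset topspace_euclidean_subtopology)
  then have "locally_connected_space (subtopology X \<gamma>)"
    using \<gamma> homeomorphic_locally_connected_space by (auto simp: jordan_curve_def)
  moreover have "openin (subtopology X \<gamma>) (M \<inter> \<gamma>)" "y \<in> M \<inter> \<gamma>" using M y by (auto intro: openin_subtopology_Int)
  ultimately obtain U where U: "openin (subtopology X \<gamma>) U" "connectedin (subtopology X \<gamma>) U" "y \<in> U" "U \<subseteq> M \<inter> \<gamma>"
    unfolding locally_connected_space by meson
  then obtain T where T: "openin X T" "U = T \<inter> \<gamma>" by (auto simp: openin_subtopology)
  have "connectedin X U" using U(2) by (simp add: connectedin_subtopology)
  moreover have "openin X (T \<inter> M)" using T M by blast
  ultimately show "\<exists>N. openin X N \<and> y \<in> N \<and> N \<subseteq> M \<and>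
        (\<forall>z\<in>N \<inter> \<gamma>. \<forall>w\<in>N \<inter> \<gamma>. \<exists>C. connectedin X C \<and> z \<in> C \<and> w \<in> C \<and> C \<subseteq> M \<inter> \<gamma>)"
    using U T M by (intro exI[of _ "T \<inter> M"]) blast
qed

lemma connectedin_locally_constant:
  assumes S: "connectedin X S"
    and loc: "\<And>x. x \<in> S \<Longrightarrow> \<exists>N. openin X N \<and> x \<in> N \<and> (\<forall>y\<in>N \<inter> S. Q y \<longleftrightarrow> Q x)"
    and x: "x \<in> S" "Q x" and y: "y \<in> S"
  shows "Q y"
proof (rule ccontr)
  assume nQ: "\<not> Q y"
  define E1 where "E1 = \<Union>{N. openin X N \<and> (\<forall>u\<in>N \<inter> S. Q u)}"
  define E2 where "E2 = \<Union>{N. openin X N \<and> (\<forall>u\<in>N \<inter> S. \<not> Q u)}"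
  have "openin X E1" "openin X E2" unfolding E1_def E2_def by (auto intro: openin_Union)
  moreover have "u \<in> E1 \<union> E2" if "u \<in> S" for u
    using loc[OF that] unfolding E1_def E2_def by (cases "Q u") blast+
  moreover have "E1 \<inter> E2 \<inter> S = {}" unfolding E1_def E2_def by blast
  moreover have "x \<in> E1" "y \<in> E2" using loc[OF x(1)] loc[OF y] x(2) nQ unfolding E1_def E2_def by blast+
  ultimately show False using S x y unfolding connectedin by (metis IntI empty_iff subsetI)
qed

context fixed_branch_map
begin

lemma preim_disjoint: "S \<inter> T = {} \<Longrightarrow> preim S \<inter> preim T = {}"
  by (auto simp: preim_def)

text \<open>Local accessibility passes to the preimage, since \<open>f\<close> is a local homeomorphism at \<open>x\<close>.\<close>

lemma accessible_lift:
  assumes x: "x \<in> topspace X" "x \<notin> P" and S: "locally_accessible X S (f x)"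
  obtains N where "openin X N" "x \<in> N" "\<And>z w. z \<in> N \<inter> preim S \<Longrightarrow> w \<in> N \<inter> preim S \<Longrightarrow>
      \<exists>C. connectedin X C \<and> z \<in> C \<and> w \<in> C \<and> C \<subseteq> preim S"
proof -
  obtain U where U: "openin X U" "x \<in> U" "inj_on f U" using locinj x by blast
  have "openin X (f ` U)" using U(1) opn by (simp add: open_map_def)
  moreover have "f x \<in> f ` U" using U(2) by blast
  ultimately obtain N' where N': "openin X N'" "f x \<in> N'" "N' \<subseteq> f ` U"
    and acc: "\<forall>z\<in>N' \<inter> S. \<forall>w\<in>N' \<inter> S. \<exists>C. connectedin X C \<and> z \<in> C \<and> w \<in> C \<and> C \<subseteq> f ` U \<inter> S"
    using S unfolding locally_accessible_def by meson
  show thesis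
  proof
    show "openin X (U \<inter> preim N')" using U(1) openin_preim[OF N'(1)] by blast
    show "x \<in> U \<inter> preim N'" using U(2) N'(2) x by (simp add: preim_def)
    fix z w assume zw: "z \<in> (U \<inter> preim N') \<inter> preim S" "w \<in> (U \<inter> preim N') \<inter> preim S"
    then have "f z \<in> N' \<inter> S" "f w \<in> N' \<inter> S" by (auto simp: preim_def)
    then obtain C where C: "connectedin X C" "f z \<in> C" "f w \<in> C" "C \<subseteq> f ` U \<inter> S" using acc by meson
    have "connectedin X {u \<in> U. f u \<in> C}" using U(1,3) C(1) by (rule lift_connected) (use C(4) in blast)
    moreover have "{u \<in> U. f u \<in> C} \<subseteq> preim S" using C(4) openin_subset[OF U(1)] by (auto simp: preim_def)
    ultimately show "\<exists>C. connectedin X C \<and> z \<in> C \<and> w \<in> C \<and> C \<subseteq> preim S"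
      using zw C by (intro exI[of _ "{u \<in> U. f u \<in> C}"]) auto
  qed
qed

lemma nbhd_in_pre_component:
  assumes x: "x \<in> topspace X" "x \<notin> P" and S: "locally_accessible X S (f x)"
    and V: "V \<in> pre_components S" "x \<in> X closure_of V"
  obtains N where "openin X N" "x \<in> N" "N \<inter> preim S \<subseteq> V"
proof -
  obtain N where N: "openin X N" "x \<in> N" and acc: "\<And>z w. z \<in> N \<inter> preim S \<Longrightarrow> w \<in> N \<inter> preim S \<Longrightarrow>
      \<exists>C. connectedin X C \<and> z \<in> C \<and> w \<in> C \<and> C \<subseteq> preim S"
    by (rule accessible_lift[OF x S], rule that)
  obtain z where z: "z \<in> V" "z \<in> N" using V(2) N unfolding in_closure_of by blast
  have VS: "V \<subseteq> preim S" using pre_component_connected[OF V(1)] by blast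
  have "N \<inter> preim S \<subseteq> V"
  proof
    fix w assume "w \<in> N \<inter> preim S"
    then obtain C where C: "connectedin X C" "z \<in> C" "w \<in> C" "C \<subseteq> preim S" using acc[of z w] z VS by blast
    then have "C \<subseteq> V" using pre_component_maximal[OF V(1) C(1,4)] z by blast
    then show "w \<in> V" using C by blast
  qed
  then show thesis using that N by blast
qed

lemma pre_component_curve_nbhd:
  assumes \<gamma>: "jordan_curve X \<gamma>" "\<gamma> \<inter> P = {}" and d: "\<delta> \<in> pre_components \<gamma>" and x: "x \<in> \<delta>"
  obtains N where "openin X N" "x \<in> N" "N \<inter> preim \<gamma> \<subseteq> \<delta>"
proof -
  have dd: "\<delta> \<subseteq> preim \<gamma>" using pre_component_connected[OF d] by blast
  have x': "x \<in> topspace X" "x \<notin> P" "f x \<in> \<gamma>" using dd x preim_avoids_P[OF \<gamma>(2)] by (auto simp: preim_def)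
  moreover have "x \<in> X closure_of \<delta>" using closure_of_subset[of \<delta> X] dd preim_sub x by blast
  ultimately show thesis
    using nbhd_in_pre_component[OF x'(1,2) jordan_curve_accessible[OF sphere \<gamma>(1) x'(3)] d] that by blast
qed

lemma pre_component_curve_closed:
  assumes \<gamma>: "jordan_curve X \<gamma>" and d: "\<delta> \<in> pre_components \<gamma>"
  shows "closedin X \<delta>"
proof -
  have "closedin X (preim \<gamma>)" using closedin_preim jordan_curve_closedin(1)[OF sphere \<gamma>] by blast
  moreover have "closedin (subtopology X (preim \<gamma>)) \<delta>"
    using d unfolding pre_components_def by (rule closedin_connected_components_of)
  ultimately show ?thesis using closedin_trans_full by blast
qed

text \<open>At a point over \<open>\<gamma>\<close>, exactly one component over each side of \<open>\<gamma>\<close> is adjacent, and the same one at all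
nearby points over \<open>\<gamma>\<close>.\<close>

lemma adjacent_at_point:
  assumes \<gamma>: "jordan_curve X \<gamma>" "\<gamma> \<inter> P = {}" and G: "G \<in> complement_components X \<gamma>" and x: "x \<in> preim \<gamma>"
  obtains N V where "V \<in> pre_components G" "x \<in> X closure_of V" "openin X N" "x \<in> N" "N \<inter> preim G \<subseteq> V"
    "\<And>y. y \<in> N \<inter> preim \<gamma> \<Longrightarrow> y \<in> X closure_of V"
proof -
  have x': "x \<in> topspace X" "x \<notin> P" "f x \<in> \<gamma>" using x preim_avoids_P[OF \<gamma>(2)] by (auto simp: preim_def)
  note acc = jordan_side_accessible[OF sphere \<gamma>(1) G]
  obtain N where N: "openin X N" "x \<in> N" and con: "\<And>z w. z \<in> N \<inter> preim G \<Longrightarrow> w \<in> N \<inter> preim G \<Longrightarrow>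
      \<exists>C. connectedin X C \<and> z \<in> C \<and> w \<in> C \<and> C \<subseteq> preim G"
    by (rule accessible_lift[OF x'(1,2) acc[OF x'(3)]], rule that)
  have near: "\<exists>z. z \<in> M \<inter> preim G" if M: "openin X M" "y \<in> M" "y \<in> preim \<gamma>" for M y
  proof -
    have "openin X (f ` M)" using M(1) opn by (simp add: open_map_def)
    moreover have "f y \<in> f ` M" "f y \<in> X closure_of G"
      using M jordan_side(6)[OF sphere \<gamma>(1) G] by (auto simp: preim_def)
    ultimately obtain u where "u \<in> G" "u \<in> f ` M" unfolding in_closure_of by blast
    then show ?thesis using openin_subset[OF M(1)] by (auto simp: preim_def)
  qed
  obtain z where z: "z \<in> N \<inter> preim G" using near[OF N x] by blast
  then obtain V where V: "V \<in> pre_components G" "z \<in> V" using pre_component_ex by blast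
  have sub: "N \<inter> preim G \<subseteq> V"
  proof
    fix w assume "w \<in> N \<inter> preim G"
    then obtain C where C: "connectedin X C" "z \<in> C" "w \<in> C" "C \<subseteq> preim G" using con[of z w] z by blast
    then have "C \<subseteq> V" using pre_component_maximal[OF V(1) C(1,4)] V(2) by blast
    then show "w \<in> V" using C by blast
  qed
  have cl: "y \<in> X closure_of V" if y: "y \<in> N \<inter> preim \<gamma>" for y
    unfolding in_closure_of
  proof (intro conjI allI impI)
    show "y \<in> topspace X" using y preim_sub by blast
    fix M assume M: "y \<in> M \<and> openin X M"
    then have "openin X (N \<inter> M)" using N by blast
    then have "\<exists>z. z \<in> (N \<inter> M) \<inter> preim G" by (rule near) (use M y in auto)
    then show "\<exists>z. z \<in> V \<and> z \<in> M" using sub by blast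
  qed
  show thesis by (rule that[OF V(1) cl N sub cl]) (use N x in auto)
qed

text \<open>The adjacent component is locally constant along \<open>\<delta>\<close>, so it is the same along all of \<open>\<delta>\<close>.\<close>

lemma adjacent_component:
  assumes \<gamma>: "jordan_curve X \<gamma>" "\<gamma> \<inter> P = {}" and G: "G \<in> complement_components X \<gamma>" and d: "\<delta> \<in> pre_components \<gamma>"
  obtains V where "V \<in> pre_components G" "\<delta> \<subseteq> X closure_of V"
    "\<And>x. x \<in> \<delta> \<Longrightarrow> \<exists>N. openin X N \<and> x \<in> N \<and> N \<inter> preim G \<subseteq> V"
proof -
  have dd: "connectedin X \<delta>" "\<delta> \<subseteq> preim \<gamma>" "\<delta> \<noteq> {}" using pre_component_connected[OF d] by auto
  then obtain x0 where x0: "x0 \<in> \<delta>" by blast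
  then have x0': "x0 \<in> preim \<gamma>" using dd by blast
  obtain V where V: "V \<in> pre_components G" "x0 \<in> X closure_of V"
    using adjacent_at_point[OF \<gamma> G x0'] by metis
  have uniq: "V = V'" if V': "V' \<in> pre_components G" "x \<in> X closure_of V'" and x: "x \<in> X closure_of V" "openin X N" "x \<in> N" "N \<inter> preim G \<subseteq> V'" for x V' N
  proof -
    obtain z where "z \<in> V" "z \<in> N" using x unfolding in_closure_of by blast
    moreover have "V \<subseteq> preim G" using pre_component_connected[OF V(1)] by blast
    ultimately have "V \<inter> V' \<noteq> {}" using x(4) by blast
    then show ?thesis using pre_component_eq[OF V(1) V'(1)] by blast
  qed
  have all: "y \<in> X closure_of V" if y: "y \<in> \<delta>" for y
  proof (rule connectedin_locally_constant[where Q = "\<lambda>y. y \<in> X closure_of V", OF dd(1) _ x0 V(2) y])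
    fix x assume x: "x \<in> \<delta>"
    then have xp: "x \<in> preim \<gamma>" using dd by blast
    obtain N V' where N: "V' \<in> pre_components G" "x \<in> X closure_of V'" "openin X N" "x \<in> N" "N \<inter> preim G \<subseteq> V'"
      and cl: "\<And>y. y \<in> N \<inter> preim \<gamma> \<Longrightarrow> y \<in> X closure_of V'" by (rule adjacent_at_point[OF \<gamma> G xp], rule that)
    have "y \<in> X closure_of V \<longleftrightarrow> x \<in> X closure_of V" if "y \<in> N" "y \<in> \<delta>" for y
    proof
      assume "y \<in> X closure_of V"
      then have "V = V'" using uniq[OF N(1) cl] that N dd(2) by blast
      then show "x \<in> X closure_of V" using N by simp
    next
      assume "x \<in> X closure_of V"
      then have "V = V'" using uniq[OF N(1,2)] N by blast
      then show "y \<in> X closure_of V" using cl that dd(2) by blast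
    qed
    then show "\<exists>N. openin X N \<and> x \<in> N \<and> (\<forall>y\<in>N \<inter> \<delta>. y \<in> X closure_of V \<longleftrightarrow> x \<in> X closure_of V)"
      using N(3,4) by blast
  qed
  show thesis
  proof (rule that[OF V(1)])
    show "\<delta> \<subseteq> X closure_of V" using all by blast
    fix x assume x: "x \<in> \<delta>"
    then have xp: "x \<in> preim \<gamma>" using dd by blast
    obtain N V' where N: "V' \<in> pre_components G" "x \<in> X closure_of V'" "openin X N" "x \<in> N" "N \<inter> preim G \<subseteq> V'"
      by (rule adjacent_at_point[OF \<gamma> G xp], rule that)
    then have "V = V'" using uniq[OF N(1,2)] all x by blast
    then show "\<exists>N. openin X N \<and> x \<in> N \<and> N \<inter> preim G \<subseteq> V" using N by blast
  qed
qed

text \<open>The side \<open>W\<close> of the preimage curve \<open>\<delta>\<close> is mapped, near \<open>\<delta>\<close>, to the side \<open>G\<close> of the image curve: \<open>W\<close> contains the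
component \<open>V\<close> over \<open>G\<close> that is adjacent to \<open>\<delta>\<close>.\<close>

definition label :: "'a set \<Rightarrow> 'a set \<Rightarrow> 'a set \<Rightarrow> bool" where
  "label \<delta> W G \<longleftrightarrow> (\<exists>V\<in>pre_components G. V \<subseteq> W \<and> \<delta> \<subseteq> X closure_of V \<and>
     (\<forall>x\<in>\<delta>. \<exists>N. openin X N \<and> x \<in> N \<and> N \<inter> preim G \<subseteq> V))"

lemma labelI:
  assumes "V \<in> pre_components G" "V \<subseteq> W" "\<delta> \<subseteq> X closure_of V"
    "\<And>x. x \<in> \<delta> \<Longrightarrow> \<exists>N. openin X N \<and> x \<in> N \<and> N \<inter> preim G \<subseteq> V"
  shows "label \<delta> W G"
  unfolding label_def using assms by (intro bexI[of _ V] conjI ballI)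

context
  fixes \<gamma> \<delta> W G
  assumes \<gamma>: "jordan_curve X \<gamma>" and \<gamma>P: "\<gamma> \<inter> P = {}" and d: "\<delta> \<in> pre_components \<gamma>" and \<delta>: "jordan_curve X \<delta>"
    and W: "W \<in> complement_components X \<delta>" and G: "G \<in> complement_components X \<gamma>"
begin

text \<open>The component over \<open>G\<close> adjacent to \<open>\<delta>\<close> does not meet \<open>\<delta>\<close>, so it is on one side of it.\<close>

lemma label_side: "label \<delta> W G \<or> label \<delta> (topspace X - (W \<union> \<delta>)) G"
proof -
  obtain V where V: "V \<in> pre_components G" "\<delta> \<subseteq> X closure_of V"
    "\<And>x. x \<in> \<delta> \<Longrightarrow> \<exists>N. openin X N \<and> x \<in> N \<and> N \<inter> preim G \<subseteq> V"
    by (rule adjacent_component[OF \<gamma> \<gamma>P G d], rule that)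
  note Vc = pre_component_connected[OF V(1)]
  have "\<delta> \<subseteq> preim \<gamma>" using pre_component_connected[OF d] by blast
  moreover have "V \<subseteq> preim G" using Vc by blast
  ultimately have "V \<inter> \<delta> = {}" using preim_disjoint[OF jordan_side(4)[OF sphere \<gamma> G]] by blast
  then have "V \<subseteq> W \<or> V \<subseteq> topspace X - (W \<union> \<delta>)" using side_cases[OF sphere \<delta> W] Vc by blast
  then show ?thesis using labelI[OF V(1) _ V(2,3)] by (elim disjE) simp_all
qed

text \<open>If both sides of \<open>\<gamma>\<close> were matched with \<open>W\<close>, there would be no points near \<open>\<delta>\<close> on the other side of \<open>\<delta>\<close>.\<close>

lemma label_distinct:
  assumes "label \<delta> W G" "label \<delta> W (topspace X - (G \<union> \<gamma>))" shows False
proof -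
  obtain V where V: "V \<subseteq> W" "\<forall>x\<in>\<delta>. \<exists>N. openin X N \<and> x \<in> N \<and> N \<inter> preim G \<subseteq> V"
    using assms(1) unfolding label_def by blast
  obtain V' where V': "V' \<subseteq> W" "\<forall>x\<in>\<delta>. \<exists>N. openin X N \<and> x \<in> N \<and> N \<inter> preim (topspace X - (G \<union> \<gamma>)) \<subseteq> V'"
    using assms(2) unfolding label_def by blast
  obtain x where x: "x \<in> \<delta>" using jordan_curve_closedin(3)[OF sphere \<delta>] by blast
  obtain N where N: "openin X N" "x \<in> N" "N \<inter> preim G \<subseteq> V" using V(2) x by blast
  obtain N' where N': "openin X N'" "x \<in> N'" "N' \<inter> preim (topspace X - (G \<union> \<gamma>)) \<subseteq> V'" using V'(2) x by blast
  obtain M where M: "openin X M" "x \<in> M" "M \<inter> preim \<gamma> \<subseteq> \<delta>" by (rule pre_component_curve_nbhd[OF \<gamma> \<gamma>P d x], rule that)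
  have o: "openin X (N \<inter> N' \<inter> M)" using N N' M by blast
  have "x \<in> X closure_of (topspace X - (W \<union> \<delta>))"
    using jordan_side(6)[OF sphere \<delta> jordan_side(7)[OF sphere \<delta> W]] x by blast
  then obtain z where z: "z \<in> topspace X - (W \<union> \<delta>)" "z \<in> N \<inter> N' \<inter> M"
    using o N N' M unfolding in_closure_of by (meson IntI)
  then have "f z \<in> topspace X" using f_in by blast
  then have "z \<in> preim G \<or> z \<in> preim \<gamma> \<or> z \<in> preim (topspace X - (G \<union> \<gamma>))" using z(1) by (auto simp: preim_def)
  then show False using z N(3) N'(3) M(3) V(1) V'(1) by blast
qed

end

context
  fixes \<gamma> \<delta> W G
  assumes \<gamma>: "jordan_curve X \<gamma>" and \<gamma>P: "\<gamma> \<inter> P = {}" and d: "\<delta> \<in> pre_components \<gamma>" and \<delta>: "jordan_curve X \<delta>"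
    and W: "W \<in> complement_components X \<delta>" and G: "G \<in> complement_components X \<gamma>"
begin

text \<open>So the matching is a bijection between the sides of \<open>\<delta>\<close> and the sides of \<open>\<gamma>\<close>.\<close>

lemma label_opp:
  assumes "label \<delta> W G" shows "label \<delta> (topspace X - (W \<union> \<delta>)) (topspace X - (G \<union> \<gamma>))"
  using label_side[OF \<gamma> \<gamma>P d \<delta> W jordan_side(7)[OF sphere \<gamma> G]] label_distinct[OF \<gamma> \<gamma>P d \<delta> W G assms] by blast

end

context
  fixes \<gamma> \<delta> W G
  assumes \<gamma>: "jordan_curve X \<gamma>" and \<gamma>P: "\<gamma> \<inter> P = {}" and d: "\<delta> \<in> pre_components \<gamma>" and \<delta>: "jordan_curve X \<delta>"
    and W: "W \<in> complement_components X \<delta>" and G: "G \<in> complement_components X \<gamma>"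
begin

text \<open>If the adjacent component \<open>V\<close> contained no marked point, its frontier would be \<open>\<delta>\<close>, and \<open>V\<close> would be all
of \<open>W\<close>.\<close>

lemma label_marked:
  assumes l: "label \<delta> W G" and WP: "W \<inter> P \<noteq> {}"
  obtains V where "V \<in> pre_components G" "V \<subseteq> W" "\<delta> \<subseteq> X closure_of V" "V \<inter> P \<noteq> {}"
    "\<And>x. x \<in> \<delta> \<Longrightarrow> \<exists>N. openin X N \<and> x \<in> N \<and> N \<inter> preim G \<subseteq> V"
proof -
  obtain V where V: "V \<in> pre_components G" "V \<subseteq> W" "\<delta> \<subseteq> X closure_of V"
    "\<forall>x\<in>\<delta>. \<exists>N. openin X N \<and> x \<in> N \<and> N \<inter> preim G \<subseteq> V"
    using l unfolding label_def by blast
  have "V \<inter> P \<noteq> {}"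
  proof
    assume VP: "V \<inter> P = {}"
    obtain p where "p \<in> topspace X - \<gamma>" using jordan_curve_proper[OF sphere \<gamma>] by blast
    then have ne: "\<exists>p. p \<in> topspace X - \<gamma>" by blast
    have "\<delta> \<inter> V = {}" using jordan_side(4)[OF sphere \<delta> W] V(2) by blast
    then have "\<delta> \<subseteq> Fr V" using V(3) clV(1)[OF \<gamma> \<gamma>P ne G V(1) VP] by blast
    then have "Fr V = \<delta>"
      using pre_component_eq[OF Fr_component[OF \<gamma> \<gamma>P ne G V(1) VP] d] jordan_curve_closedin(3)[OF sphere \<delta>] by blast
    then have "V \<in> complement_components X \<delta>" using V_side[OF \<gamma> \<gamma>P ne G V(1) VP] by simp
    then have "V = W" using complement_components_disjoint[OF _ W] V(2) pre_component_connected[OF V(1)] by blast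
    then show False using VP WP by blast
  qed
  then show thesis using V(4) by (intro that[OF V(1-3)]) simp_all
qed

text \<open>Marked points are fixed, so a marked point of the component over \<open>G\<close> belongs to \<open>G\<close>.\<close>

lemma label_common_marked:
  assumes l: "label \<delta> W G" and WP: "W \<inter> P \<noteq> {}"
  shows "W \<inter> G \<inter> P \<noteq> {}"
proof -
  obtain V where V: "V \<in> pre_components G" "V \<subseteq> W" "V \<inter> P \<noteq> {}" using label_marked[OF assms] by metis
  then obtain p where p: "p \<in> V" "p \<in> P" by blast
  then have "f p \<in> G" using pre_component_connected[OF V(1)] by (auto simp: preim_def)
  then show ?thesis using p fixP V(2) by auto
qed

end

text \<open>If \<open>G\<close> were matched with the other side of \<open>\<delta>\<close>, then by \<open>label_common_marked\<close> it would contain a marked point outside \<open>W\<close>.\<close>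

lemma inner_label:
  assumes \<gamma>: "jordan_curve X \<gamma>" and \<gamma>P: "\<gamma> \<inter> P = {}" and d: "\<delta> \<in> pre_components \<gamma>" and \<delta>: "jordan_curve X \<delta>"
    and W: "W \<in> complement_components X \<delta>" and G: "G \<in> complement_components X \<gamma>"
    and in_W: "G \<inter> P \<subseteq> W" and out: "P - (W \<union> \<delta>) \<noteq> {}"
  shows "label \<delta> W G"
proof (rule ccontr)
  assume "\<not> label \<delta> W G"
  then have l: "label \<delta> (topspace X - (W \<union> \<delta>)) G" using label_side[OF \<gamma> \<gamma>P d \<delta> W G] by blast
  have "(topspace X - (W \<union> \<delta>)) \<inter> P \<noteq> {}" using out PX by blast
  then have "(topspace X - (W \<union> \<delta>)) \<inter> G \<inter> P \<noteq> {}"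
    by (rule label_common_marked[OF \<gamma> \<gamma>P d \<delta> jordan_side(7)[OF sphere \<delta> W] G l])
  then show False using in_W by blast
qed

text \<open>A component without marked points over a side of \<open>\<gamma>\<close> is bounded by every preimage curve adjacent to
it; hence there is only one such curve, and it bounds a disc without marked points.\<close>

lemma disc_pre_component:
  assumes \<gamma>: "jordan_curve X \<gamma>" and \<gamma>P: "\<gamma> \<inter> P = {}" and d: "\<delta> \<in> pre_components \<gamma>"
    and G: "G \<in> complement_components X \<gamma>" and V: "V \<in> pre_components G" "V \<inter> P = {}" "\<delta> \<inter> X closure_of V \<noteq> {}"
  shows "jordan_curve X \<delta>" "V \<in> complement_components X \<delta>" "inj_on f \<delta>" "f ` \<delta> = \<gamma>"
proof -
  obtain p where "p \<in> topspace X - \<gamma>" using jordan_curve_proper[OF sphere \<gamma>] by blast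
  then have ne: "\<exists>p. p \<in> topspace X - \<gamma>" by blast
  note a = \<gamma> \<gamma>P ne G V(1,2)
  have "\<delta> \<subseteq> preim \<gamma>" "V \<subseteq> preim G" using pre_component_connected[OF d] pre_component_connected[OF V(1)] by auto
  then have "\<delta> \<inter> V = {}" using preim_disjoint[OF jordan_side(4)[OF sphere \<gamma> G]] by blast
  then have "\<delta> \<inter> Fr V \<noteq> {}" using V(3) clV(1)[OF a] by blast
  then have eq: "\<delta> = Fr V" using pre_component_eq[OF Fr_component[OF a] d] by blast
  show "jordan_curve X \<delta>" "V \<in> complement_components X \<delta>" "f ` \<delta> = \<gamma>"
    unfolding eq using Fr_jordan[OF a] V_side[OF a] f_Fr(1)[OF a] by auto
  show "inj_on f \<delta>" unfolding eq using inj_on_subset[OF inj_clV[OF a]] clV(1)[OF a] by blast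
qed

end

section \<open>Invariant multicurves\<close>

text \<open>This is the side of \<open>\<gamma>2\<close> that does not contain \<open>\<gamma>\<close>.\<close>

lemma nested_side:
  assumes X: "topological_sphere X" and \<gamma>: "jordan_curve X \<gamma>" and G: "G \<in> complement_components X \<gamma>"
    and \<gamma>2: "jordan_curve X \<gamma>2" and sub: "\<gamma>2 \<subseteq> G"
  obtains F where "F \<in> complement_components X \<gamma>2" "F \<subseteq> G"
proof -
  have dis: "\<gamma> \<inter> \<gamma>2 = {}" using sub jordan_side(4)[OF X \<gamma> G] by blast
  obtain q where q: "q \<in> topspace X - \<gamma>2" using jordan_curve_proper[OF X \<gamma>2] by blast
  obtain D where D: "D \<in> complement_components X \<gamma>2" using complement_component_ex[OF q] by metis
  have "\<exists>F. F \<in> complement_components X \<gamma>2 \<and> F \<inter> \<gamma> = {}"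
    using side_cases[OF X \<gamma>2 D jordan_curve_closedin(2)[OF X \<gamma>] dis] D jordan_side(7)[OF X \<gamma>2 D] by blast
  then obtain F where F: "F \<in> complement_components X \<gamma>2" "F \<inter> \<gamma> = {}" by blast
  note f = jordan_side[OF X \<gamma>2 F(1)] and g = jordan_side[OF X \<gamma> G]
  obtain x where x: "x \<in> \<gamma>2" using jordan_curve_closedin(3)[OF X \<gamma>2] by blast
  then have "x \<in> X closure_of F" "x \<in> G" using f(6) sub by auto
  then obtain y where "y \<in> F" "y \<in> G" using g(1) unfolding in_closure_of by blast
  then have "F \<subseteq> G" using side_absorbs[OF X \<gamma> G f(2) F(2)] by blast
  then show thesis using that F by blast
qed

text \<open>The curves are disjoint, so the four regions are nested in one of four ways; three of them contradict
the position of the marked points.\<close>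

lemma side_subset:
  assumes X: "topological_sphere X" and \<gamma>: "jordan_curve X \<gamma>" and W: "W \<in> complement_components X \<gamma>"
    and \<gamma>2: "jordan_curve X \<gamma>2" and Y: "Y \<in> complement_components X \<gamma>2" and dis: "\<gamma>2 \<inter> \<gamma> = {}"
    and P: "P \<subseteq> topspace X" "Y \<inter> P \<subset> W \<inter> P" "Y \<inter> P \<noteq> {}" "P - W \<noteq> {}"
  shows "Y \<subseteq> W"
proof -
  let ?W' = "topspace X - (W \<union> \<gamma>)"
  note W' = jordan_side(7)[OF X \<gamma> W]
  from side_cases[OF X \<gamma> W jordan_curve_closedin(2)[OF X \<gamma>2] dis] show ?thesis
  proof
    assume s: "\<gamma>2 \<subseteq> W"
    obtain F where F: "F \<in> complement_components X \<gamma>2" "F \<subseteq> W" by (rule nested_side[OF X \<gamma> W \<gamma>2 s], rule that)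
    from jordan_side(9)[OF X \<gamma>2 F(1) Y] show ?thesis
    proof
      assume Y: "Y = topspace X - (F \<union> \<gamma>2)"
      obtain p where "p \<in> P" "p \<notin> W" using P(4) by blast
      then have "p \<in> Y \<inter> P" using P(1) F(2) s Y by blast
      then show ?thesis using P(2) \<open>p \<notin> W\<close> by blast
    qed (use F in simp)
  next
    assume s: "\<gamma>2 \<subseteq> ?W'"
    obtain F where F: "F \<in> complement_components X \<gamma>2" "F \<subseteq> ?W'" by (rule nested_side[OF X \<gamma> W' \<gamma>2 s], rule that)
    from jordan_side(9)[OF X \<gamma>2 F(1) Y] show ?thesis
    proof
      assume "Y = F"
      then show ?thesis using F(2) P(2,3) by blast
    next
      assume "Y = topspace X - (F \<union> \<gamma>2)"
      then have "W \<inter> P \<subseteq> Y \<inter> P" using F(2) s P(1) by blast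
      then show ?thesis using P(2) by blast
    qed
  qed
qed

locale invariant_multicurve = fixed_branch_map X f P for X :: "'a topology" and f P +
  fixes \<Gamma> :: "'a set set"
  assumes finP: "finite P" and mult: "multicurve X P \<Gamma>"
    and inv: "\<And>\<gamma>. \<gamma> \<in> \<Gamma> \<Longrightarrow> \<exists>\<delta>\<in>pre_components (\<Union>\<Gamma>). isotopic_rel X P \<gamma> \<delta>"
begin

lemma fin\<Gamma>: "finite \<Gamma>" and jc: "\<gamma> \<in> \<Gamma> \<Longrightarrow> jordan_curve X \<gamma>" and cP: "\<gamma> \<in> \<Gamma> \<Longrightarrow> \<gamma> \<inter> P = {}"
  and disj: "\<gamma> \<in> \<Gamma> \<Longrightarrow> \<gamma>2 \<in> \<Gamma> \<Longrightarrow> \<gamma> \<noteq> \<gamma>2 \<Longrightarrow> \<gamma> \<inter> \<gamma>2 = {}"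
  and not_isotopic: "\<gamma> \<in> \<Gamma> \<Longrightarrow> \<gamma>2 \<in> \<Gamma> \<Longrightarrow> \<gamma> \<noteq> \<gamma>2 \<Longrightarrow> \<not> isotopic_rel X P \<gamma> \<gamma>2"
  and side_marked: "\<gamma> \<in> \<Gamma> \<Longrightarrow> U \<in> complement_components X \<gamma> \<Longrightarrow> U \<inter> P \<noteq> {}"
proof -
  note M = mult[unfolded multicurve_def]
  have c: "\<forall>\<gamma>\<in>\<Gamma>. jordan_curve X \<gamma> \<and> \<gamma> \<inter> P = {} \<and> essential_curve X P \<gamma>"
    and d: "\<forall>\<gamma>\<in>\<Gamma>. \<forall>\<gamma>'\<in>\<Gamma>. \<gamma> \<noteq> \<gamma>' \<longrightarrow> \<gamma> \<inter> \<gamma>' = {} \<and> \<not> isotopic_rel X P \<gamma> \<gamma>'"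
    using M by auto
  show "finite \<Gamma>" using M by simp
  show "jordan_curve X \<gamma>" "\<gamma> \<inter> P = {}" if "\<gamma> \<in> \<Gamma>" using c that by auto
  show "\<gamma> \<inter> \<gamma>2 = {}" "\<not> isotopic_rel X P \<gamma> \<gamma>2" if "\<gamma> \<in> \<Gamma>" "\<gamma>2 \<in> \<Gamma>" "\<gamma> \<noteq> \<gamma>2"
    using d that by auto
  assume "\<gamma> \<in> \<Gamma>" and U: "U \<in> complement_components X \<gamma>"
  then have "essential_curve X P \<gamma>" using c by blast
  then show "U \<inter> P \<noteq> {}" using U unfolding essential_curve_def by fast
qed

lemma opp_marked:
  assumes "\<gamma> \<in> \<Gamma>" "U \<in> complement_components X \<gamma>" shows "P - (U \<union> \<gamma>) \<noteq> {}"
proof -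
  have "(topspace X - (U \<union> \<gamma>)) \<inter> P \<noteq> {}"
    by (rule side_marked[OF assms(1) jordan_side(7)[OF sphere jc[OF assms(1)] assms(2)]])
  then show ?thesis by blast
qed

text \<open>Otherwise the two curves would be isotopic by \<open>parallel_curves_isotopic\<close>.\<close>

lemma not_parallel:
  assumes "\<gamma> \<in> \<Gamma>" "\<gamma>2 \<in> \<Gamma>" "\<gamma> \<noteq> \<gamma>2" and G: "G \<in> complement_components X \<gamma>" "G2 \<in> complement_components X \<gamma>2"
  shows "G \<inter> P \<noteq> G2 \<inter> P"
proof
  assume eq: "G \<inter> P = G2 \<inter> P"
  have "P - G \<noteq> {}" using opp_marked[OF assms(1) G(1)] by blast
  then have "isotopic_rel X P \<gamma> \<gamma>2"
    by (rule parallel_curves_isotopic[OF sphere finP PX jc[OF assms(1)] cP[OF assms(1)] jc[OF assms(2)] cP[OF assms(2)]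
        disj[OF assms(1-3)] G eq side_marked[OF assms(1) G(1)]])
  then show False using not_isotopic assms by blast
qed

lemma openin_pre_component:
  assumes \<gamma>: "\<gamma> \<in> \<Gamma>" and d: "\<delta> \<in> pre_components \<gamma>"
  shows "openin (subtopology X (preim (\<Union>\<Gamma>))) \<delta>"
proof (subst openin_subopen, intro ballI)
  note dc = pre_component_connected[OF d]
  have "closedin X (\<Union>(\<Gamma> - {\<gamma>}))"
    using fin\<Gamma> jordan_curve_closedin(1)[OF sphere jc] by (intro closedin_Union) auto
  then have o: "openin X (topspace X - preim (\<Union>(\<Gamma> - {\<gamma>})))" using closedin_preim by blast
  fix x assume x: "x \<in> \<delta>"
  obtain N where N: "openin X N" "x \<in> N" "N \<inter> preim \<gamma> \<subseteq> \<delta>"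
    by (rule pre_component_curve_nbhd[OF jc[OF \<gamma>] cP[OF \<gamma>] d x], rule that)
  define M where "M = N \<inter> (topspace X - preim (\<Union>(\<Gamma> - {\<gamma>})))"
  have xp: "x \<in> topspace X" "f x \<in> \<gamma>" using x dc by (auto simp: preim_def)
  have "f x \<notin> \<Union>(\<Gamma> - {\<gamma>})" using xp disj[OF \<gamma>] by blast
  then have "x \<in> M" using N(2) xp by (simp add: M_def preim_def)
  have "M \<inter> preim (\<Union>\<Gamma>) \<subseteq> N \<inter> preim \<gamma>" by (auto simp: M_def preim_def)
  moreover have "openin (subtopology X (preim (\<Union>\<Gamma>))) (M \<inter> preim (\<Union>\<Gamma>))"
    using N(1) o unfolding M_def by (intro openin_subtopology_Int openin_Int)
  moreover have "x \<in> preim (\<Union>\<Gamma>)" using xp \<gamma> by (auto simp: preim_def)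
  ultimately show "\<exists>T. openin (subtopology X (preim (\<Union>\<Gamma>))) T \<and> x \<in> T \<and> T \<subseteq> \<delta>"
    using N(3) \<open>x \<in> M\<close> by (intro exI[of _ "M \<inter> preim (\<Union>\<Gamma>)"]) blast
qed

lemma pre_components_Union: "pre_components (\<Union>\<Gamma>) = (\<Union>\<gamma>\<in>\<Gamma>. pre_components \<gamma>)"
proof -
  have 1: "\<delta> \<in> pre_components (\<Union>\<Gamma>)" if \<gamma>: "\<gamma> \<in> \<Gamma>" and d: "\<delta> \<in> pre_components \<gamma>" for \<gamma> \<delta>
  proof -
    note dc = pre_component_connected[OF d]
    have sub: "\<delta> \<subseteq> preim (\<Union>\<Gamma>)" using dc \<gamma> by (auto simp: preim_def)
    show ?thesis unfolding pre_components_def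
    proof (rule clopen_connected_is_component)
      show "connectedin (subtopology X (preim (\<Union>\<Gamma>))) \<delta>" using dc sub by (simp add: connectedin_subtopology)
      show "\<delta> \<noteq> {}" using dc by blast
      show "closedin (subtopology X (preim (\<Union>\<Gamma>))) \<delta>"
        using pre_component_curve_closed[OF jc[OF \<gamma>] d] sub unfolding closedin_subtopology by (intro exI[of _ \<delta>]) auto
      show "openin (subtopology X (preim (\<Union>\<Gamma>))) \<delta>" by (rule openin_pre_component[OF \<gamma> d])
    qed
  qed
  moreover have "\<exists>\<gamma>\<in>\<Gamma>. \<delta> \<in> pre_components \<gamma>" if d: "\<delta> \<in> pre_components (\<Union>\<Gamma>)" for \<delta>
  proof -
    note dc = pre_component_connected[OF d]
    then obtain x where x: "x \<in> \<delta>" "x \<in> preim (\<Union>\<Gamma>)" by blast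
    then obtain \<gamma> where \<gamma>: "\<gamma> \<in> \<Gamma>" "x \<in> preim \<gamma>" by (auto simp: preim_def)
    then obtain \<delta>2 where \<delta>2: "\<delta>2 \<in> pre_components \<gamma>" "x \<in> \<delta>2" using pre_component_ex by blast
    then have "\<delta> = \<delta>2" using pre_component_eq[OF d 1[OF \<gamma>(1) \<delta>2(1)]] x by blast
    then show ?thesis using \<gamma> \<delta>2 by blast
  qed
  ultimately show ?thesis by blast
qed

lemma pre_component_P: "\<delta> \<in> pre_components (\<Union>\<Gamma>) \<Longrightarrow> \<delta> \<inter> P = {}"
  using pre_component_connected preim_avoids_P[of "\<Union>\<Gamma>"] cP by blast

lemma isotopic_pre_component:
  assumes \<gamma>: "\<gamma> \<in> \<Gamma>" and iso: "isotopic_rel X P \<gamma> \<delta>" and G: "G \<in> complement_components X \<gamma>"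
  obtains Y where "jordan_curve X \<delta>" "Y \<in> complement_components X \<delta>" "Y \<inter> P = G \<inter> P"
proof -
  have sub: "\<gamma> \<subseteq> topspace X" using jc[OF \<gamma>] by (simp add: jordan_curve_def)
  obtain Y where "Y \<in> complement_components X \<delta>" "Y \<inter> P = G \<inter> P"
    by (rule isotopic_rel_sides[OF PX sub iso G], rule that)
  then show thesis using that isotopic_rel_jordan_curve[OF jc[OF \<gamma>] iso] by blast
qed

text \<open>Induction on the number of marked points in \<open>W\<close>: a counterexample produces another one, \<open>Y\<close> with label
\<open>G2\<close>, for which this number is smaller.\<close>

lemma no_shrinking_label:
  assumes "\<gamma> \<in> \<Gamma>" "\<delta> \<in> pre_components \<gamma>" "jordan_curve X \<delta>" "W \<in> complement_components X \<delta>"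
    "G \<in> complement_components X \<gamma>" "label \<delta> W G" "P - W \<noteq> {}" "G \<inter> P \<subset> W \<inter> P"
  shows False
  using assms
proof (induction "card (W \<inter> P)" arbitrary: \<gamma> \<delta> W G rule: less_induct)
  case less
  \<comment> \<open>\<open>\<delta>'\<close> is the preimage curve isotopic to \<open>\<gamma>\<close>, and it lies over \<open>\<gamma>2\<close>.\<close>
  note \<gamma> = less.prems(1) and d = less.prems(2) and \<delta> = less.prems(3) and W = less.prems(4) and G = less.prems(5)
    and l = less.prems(6) and PW = less.prems(7) and GW = less.prems(8)
  have d': "\<delta> \<in> pre_components (\<Union>\<Gamma>)" using pre_components_Union \<gamma> d by blast
  obtain \<delta>' where \<delta>': "\<delta>' \<in> pre_components (\<Union>\<Gamma>)" "isotopic_rel X P \<gamma> \<delta>'" using inv[OF \<gamma>] by blast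
  obtain Y where J: "jordan_curve X \<delta>'" and Y: "Y \<in> complement_components X \<delta>'" and YG: "Y \<inter> P = G \<inter> P"
    by (rule isotopic_pre_component[OF \<gamma> \<delta>'(2) G], rule that)
  obtain \<gamma>2 where \<gamma>2: "\<gamma>2 \<in> \<Gamma>" and d2: "\<delta>' \<in> pre_components \<gamma>2" using pre_components_Union \<delta>'(1) by blast
  note GP = side_marked[OF \<gamma> G]
  have "\<delta>' \<noteq> \<delta>"
  proof
    assume "\<delta>' = \<delta>"
    then have "Y = W \<or> Y = topspace X - (W \<union> \<delta>)" using jordan_side(9)[OF sphere \<delta> W] Y by blast
    then show False using YG GW GP by blast
  qed
  then have dis: "\<delta>' \<inter> \<delta> = {}" using pre_component_eq[OF \<delta>'(1) d'] by blast
  have YW: "Y \<subseteq> W"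
    by (rule side_subset[OF sphere \<delta> W J Y dis PX]) (use YG GW GP PW in auto)
  have WP: "W \<inter> P \<noteq> {}" using GW by blast
  obtain V where V: "V \<in> pre_components G" "V \<subseteq> W" "\<delta> \<subseteq> X closure_of V" "V \<inter> P \<noteq> {}"
    by (rule label_marked[OF jc[OF \<gamma>] cP[OF \<gamma>] d \<delta> W G l WP], rule that)
  note Vc = pre_component_connected[OF V(1)]
  obtain p where p: "p \<in> V" "p \<in> P" using V(4) by blast
  then have "f p \<in> G" using Vc by (auto simp: preim_def)
  then have pY: "p \<in> Y" using fixP p YG by auto
  have "V \<inter> \<delta>' \<noteq> {}"
  proof
    assume "V \<inter> \<delta>' = {}"
    then have "V \<subseteq> Y" using side_absorbs[OF sphere J Y] Vc p pY by blast
    then have "\<delta> \<subseteq> Y \<union> \<delta>'" using V(3) closure_of_mono[of V Y X] jordan_side(6)[OF sphere J Y] by blast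
    then have "\<delta> \<subseteq> W" using dis YW by blast
    then show False using jordan_side(4)[OF sphere \<delta> W] jordan_curve_closedin(3)[OF sphere \<delta>] by blast
  qed
  then obtain x where x: "x \<in> V" "x \<in> \<delta>'" by blast
  then have fx: "f x \<in> G" "f x \<in> \<gamma>2" using Vc pre_component_connected[OF d2] by (auto simp: preim_def)
  then have "\<gamma>2 \<noteq> \<gamma>" using jordan_side(4)[OF sphere jc[OF \<gamma>] G] by blast
  then have dis2: "\<gamma>2 \<inter> \<gamma> = {}" using disj[OF \<gamma>2 \<gamma>] by blast
  have gG: "\<gamma>2 \<subseteq> G" using side_absorbs[OF sphere jc[OF \<gamma>] G jordan_curve_closedin(2)[OF sphere jc[OF \<gamma>2]] dis2] fx by blast
  obtain G2 where G2: "G2 \<in> complement_components X \<gamma>2" "G2 \<subseteq> G"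
    by (rule nested_side[OF sphere jc[OF \<gamma>] G jc[OF \<gamma>2] gG], rule that)
  have "label \<delta>' Y G2"
  proof (rule inner_label[OF jc[OF \<gamma>2] cP[OF \<gamma>2] d2 J Y G2(1)])
    show "G2 \<inter> P \<subseteq> Y" using G2(2) YG by blast
    show "P - (Y \<union> \<delta>') \<noteq> {}" using PW YW pre_component_P[OF \<delta>'(1)] by blast
  qed
  moreover have "card (Y \<inter> P) < card (W \<inter> P)" using YG GW finP by (intro psubset_card_mono) auto
  moreover have "P - Y \<noteq> {}" using PW YW by blast
  moreover have "G2 \<inter> P \<subset> Y \<inter> P" using G2 YG not_parallel[OF \<gamma> \<gamma>2 \<open>\<gamma>2 \<noteq> \<gamma>\<close>[symmetric] G G2(1)] by blast
  ultimately show False using less.hyps[OF _ \<gamma>2 d2 J Y G2(1)] by blast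
qed

text \<open>If \<open>\<delta>\<close> were over a curve \<open>\<gamma>2\<close> other than \<open>\<gamma>\<close>, the side of \<open>\<delta>\<close> that corresponds to the side of \<open>\<gamma>\<close> containing
\<open>\<gamma>2\<close> would be matched with the inner side of \<open>\<gamma>2\<close>, which has fewer marked points; this contradicts
\<open>no_shrinking_label\<close>.\<close>

lemma essential_label:
  assumes \<gamma>: "\<gamma> \<in> \<Gamma>" and d: "\<delta> \<in> pre_components (\<Union>\<Gamma>)" and iso: "isotopic_rel X P \<gamma> \<delta>"
  shows "jordan_curve X \<delta>" "\<delta> \<in> pre_components \<gamma>"
    "G \<in> complement_components X \<gamma> \<Longrightarrow> \<exists>Y\<in>complement_components X \<delta>. Y \<inter> P = G \<inter> P \<and> label \<delta> Y G"
proof -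
  show J: "jordan_curve X \<delta>" using isotopic_rel_jordan_curve[OF jc[OF \<gamma>] iso] .
  obtain \<gamma>2 where \<gamma>2: "\<gamma>2 \<in> \<Gamma>" and d2: "\<delta> \<in> pre_components \<gamma>2" using pre_components_Union d by blast
  have lab: "label \<delta> Y G2" if K: "K \<in> complement_components X \<gamma>" and Y: "Y \<in> complement_components X \<delta>" "Y \<inter> P = K \<inter> P"
    and G2: "G2 \<in> complement_components X \<gamma>2" "G2 \<subseteq> K" for K Y G2
  proof (rule inner_label[OF jc[OF \<gamma>2] cP[OF \<gamma>2] d2 J Y(1) G2(1)])
    show "G2 \<inter> P \<subseteq> Y" using G2(2) Y(2) by blast
    show "P - (Y \<union> \<delta>) \<noteq> {}" using opp_marked[OF \<gamma> K] Y(2) pre_component_P[OF d] by blast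
  qed
  have eq: "\<gamma>2 = \<gamma>"
  proof (rule ccontr)
    assume ne: "\<gamma>2 \<noteq> \<gamma>"
    have ne': "\<gamma> \<noteq> \<gamma>2" using ne by blast
    obtain q where q: "q \<in> topspace X - \<gamma>" using jordan_curve_proper[OF sphere jc[OF \<gamma>]] by blast
    obtain D where D: "D \<in> complement_components X \<gamma>" using complement_component_ex[OF q] by metis
    obtain K where K: "K \<in> complement_components X \<gamma>" "\<gamma>2 \<subseteq> K"
      using side_cases[OF sphere jc[OF \<gamma>] D jordan_curve_closedin(2)[OF sphere jc[OF \<gamma>2]] disj[OF \<gamma>2 \<gamma> ne]]
        D jordan_side(7)[OF sphere jc[OF \<gamma>] D] by blast
    obtain G2 where G2: "G2 \<in> complement_components X \<gamma>2" "G2 \<subseteq> K"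
      by (rule nested_side[OF sphere jc[OF \<gamma>] K(1) jc[OF \<gamma>2] K(2)], rule that)
    obtain Y where Y: "Y \<in> complement_components X \<delta>" "Y \<inter> P = K \<inter> P" 
      using isotopic_pre_component[OF \<gamma> iso K(1)] by metis
    have PY: "P - Y \<noteq> {}" using opp_marked[OF \<gamma> K(1)] Y(2) by blast
    have psub: "G2 \<inter> P \<subset> Y \<inter> P" using G2(2) Y(2) not_parallel[OF \<gamma> \<gamma>2 ne' K(1) G2(1)] by blast
    show False by (rule no_shrinking_label[OF \<gamma>2 d2 J Y(1) G2(1) lab[OF K(1) Y G2] PY psub])
  qed
  show "\<delta> \<in> pre_components \<gamma>" using d2 eq by simp
  show "\<exists>Y\<in>complement_components X \<delta>. Y \<inter> P = G \<inter> P \<and> label \<delta> Y G" if G: "G \<in> complement_components X \<gamma>"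
  proof -
    obtain Y where Y: "Y \<in> complement_components X \<delta>" "Y \<inter> P = G \<inter> P" 
      using isotopic_pre_component[OF \<gamma> iso G] by metis
    have "label \<delta> Y G" by (rule lab[OF G Y _ subset_refl]) (use G eq in simp)
    then show ?thesis using Y by blast
  qed
qed

text \<open>Let \<open>\<delta>\<close> lie on the side \<open>Z\<close> of \<open>\<delta>0\<close>, corresponding to the side \<open>K\<close> of \<open>\<gamma>\<close>. The component over the side
opposite to \<open>K\<close> that is adjacent to \<open>\<delta>\<close> avoids \<open>\<delta>0\<close>, so it lies in \<open>Z\<close>. Its marked points would be
both in \<open>K\<close> and in the opposite side, so there are none.\<close>

lemma other_component:
  assumes \<gamma>: "\<gamma> \<in> \<Gamma>" and d0: "\<delta>0 \<in> pre_components (\<Union>\<Gamma>)" "isotopic_rel X P \<gamma> \<delta>0"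
    and d: "\<delta> \<in> pre_components \<gamma>" "\<delta> \<noteq> \<delta>0"
  shows "jordan_curve X \<delta>" "null_homotopic_curve X P \<delta>" "inj_on f \<delta>" "f ` \<delta> = \<gamma>"
proof -
  note J0 = essential_label(1)[OF \<gamma> d0] and lab = essential_label(3)[OF \<gamma> d0]
  have d0': "\<delta>0 \<in> pre_components \<gamma>" by (rule essential_label(2)[OF \<gamma> d0])
  note dc = pre_component_connected[OF d(1)]
  have dis: "\<delta> \<inter> \<delta>0 = {}" using pre_component_eq[OF d(1) d0'] d(2) by blast
  obtain q where q: "q \<in> topspace X - \<gamma>" using jordan_curve_proper[OF sphere jc[OF \<gamma>]] by blast
  obtain D where D: "D \<in> complement_components X \<gamma>" using complement_component_ex[OF q] by metis
  note D' = jordan_side(7)[OF sphere jc[OF \<gamma>] D]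
  have "\<exists>K Z. K \<in> complement_components X \<gamma> \<and> Z \<in> complement_components X \<delta>0 \<and> Z \<inter> P = K \<inter> P \<and> \<delta> \<subseteq> Z"
  proof -
    obtain Y where Y: "Y \<in> complement_components X \<delta>0" "Y \<inter> P = D \<inter> P" using lab[OF D] by blast
    obtain Z where Z: "Z \<in> complement_components X \<delta>0" "Z \<inter> P = (topspace X - (D \<union> \<gamma>)) \<inter> P" using lab[OF D'] by blast
    have "Z \<noteq> Y" using Y(2) Z(2) side_marked[OF \<gamma> D] by blast
    then have "Z = topspace X - (Y \<union> \<delta>0)" using jordan_side(9)[OF sphere J0 Y(1) Z(1)] by blast
    then have "\<delta> \<subseteq> Y \<or> \<delta> \<subseteq> Z" using side_cases[OF sphere J0 Y(1) _ dis] dc by blast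
    then show ?thesis using Y Z D D' by blast
  qed
  then obtain K Z where K: "K \<in> complement_components X \<gamma>" and Z: "Z \<in> complement_components X \<delta>0" "Z \<inter> P = K \<inter> P"
    and dZ: "\<delta> \<subseteq> Z" by blast
  let ?K' = "topspace X - (K \<union> \<gamma>)"
  note K' = jordan_side(7)[OF sphere jc[OF \<gamma>] K]
  obtain V where V: "V \<in> pre_components ?K'" "\<delta> \<subseteq> X closure_of V"
    by (rule adjacent_component[OF jc[OF \<gamma>] cP[OF \<gamma>] K' d(1)], rule that)
  note Vc = pre_component_connected[OF V(1)]
  have Vd: "V \<inter> \<delta>0 = {}"
    using preim_disjoint[OF jordan_side(4)[OF sphere jc[OF \<gamma>] K']] Vc pre_component_connected[OF d0'] by blast
  obtain x where x: "x \<in> \<delta>" using dc by blast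
  then have "x \<in> X closure_of V" "x \<in> Z" using V(2) dZ by auto
  then obtain y where "y \<in> V" "y \<in> Z" using jordan_side(1)[OF sphere J0 Z(1)] unfolding in_closure_of by blast
  then have VZ: "V \<subseteq> Z" using side_absorbs[OF sphere J0 Z(1) _ Vd] Vc by blast
  have VP: "V \<inter> P = {}"
  proof (rule ccontr)
    assume "V \<inter> P \<noteq> {}"
    then obtain p where p: "p \<in> V" "p \<in> P" by blast
    then have "f p \<in> ?K'" using Vc by (auto simp: preim_def)
    then have "p \<notin> K" using fixP p by auto
    then show False using p VZ Z(2) by blast
  qed
  have "\<delta> \<inter> X closure_of V \<noteq> {}" using V(2) dc by blast
  note res = disc_pre_component[OF jc[OF \<gamma>] cP[OF \<gamma>] d(1) K' V(1) VP this]
  show "jordan_curve X \<delta>" "inj_on f \<delta>" "f ` \<delta> = \<gamma>" using res by auto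
  show "null_homotopic_curve X P \<delta>" unfolding null_homotopic_curve_def using res(2) VP by blast
qed

lemma null_not_isotopic:
  assumes \<gamma>: "\<gamma> \<in> \<Gamma>" and iso: "isotopic_rel X P \<gamma> \<delta>" and null: "null_homotopic_curve X P \<delta>" shows False
proof -
  have "\<gamma> \<subseteq> topspace X" using jc[OF \<gamma>] by (simp add: jordan_curve_def)
  then have iso': "isotopic_rel X P \<delta> \<gamma>" using isotopic_rel_sym[OF PX _ iso] by blast
  have dX: "\<delta> \<subseteq> topspace X" using isotopic_rel_jordan_curve[OF jc[OF \<gamma>] iso] by (simp add: jordan_curve_def)
  obtain V where V: "V \<in> complement_components X \<delta>" "V \<inter> P = {}" using null by (auto simp: null_homotopic_curve_def)
  obtain W where "W \<in> complement_components X \<gamma>" "W \<inter> P = V \<inter> P" by (rule isotopic_rel_sides[OF PX dX iso' V(1)], rule that)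
  then show False using V(2) side_marked[OF \<gamma>] by blast
qed

text \<open>By \<open>other_component\<close> a second one would be null-homotopic.\<close>

lemma essential_pre_component_unique:
  assumes \<gamma>: "\<gamma> \<in> \<Gamma>" and d: "\<delta> \<in> pre_components (\<Union>\<Gamma>)" "isotopic_rel X P \<gamma> \<delta>"
    and d2: "\<delta>2 \<in> pre_components (\<Union>\<Gamma>)" "isotopic_rel X P \<gamma> \<delta>2"
  shows "\<delta> = \<delta>2"
proof (rule ccontr)
  assume "\<delta> \<noteq> \<delta>2"
  then have "null_homotopic_curve X P \<delta>" using other_component(2)[OF \<gamma> d2 essential_label(2)[OF \<gamma> d]] by blast
  then show False using null_not_isotopic[OF \<gamma> d(2)] by blast
qed

lemma pre_component_cases:
  assumes d: "\<delta> \<in> pre_components (\<Union>\<Gamma>)"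
  shows "jordan_curve X \<delta>" "null_homotopic_curve X P \<delta> \<or> (\<exists>\<gamma>\<in>\<Gamma>. isotopic_rel X P \<gamma> \<delta>)"
proof -
  obtain \<gamma> where \<gamma>: "\<gamma> \<in> \<Gamma>" "\<delta> \<in> pre_components \<gamma>" using pre_components_Union d by blast
  obtain \<delta>0 where \<delta>0: "\<delta>0 \<in> pre_components (\<Union>\<Gamma>)" "isotopic_rel X P \<gamma> \<delta>0" using inv[OF \<gamma>(1)] by blast
  have "jordan_curve X \<delta> \<and> (null_homotopic_curve X P \<delta> \<or> (\<exists>\<gamma>\<in>\<Gamma>. isotopic_rel X P \<gamma> \<delta>))"
  proof (cases "\<delta> = \<delta>0")
    case True then show ?thesis using essential_label(1)[OF \<gamma>(1) \<delta>0] \<delta>0(2) \<gamma>(1) by blast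
  next
    case False then show ?thesis using other_component(1,2)[OF \<gamma>(1) \<delta>0 \<gamma>(2)] by blast
  qed
  then show "jordan_curve X \<delta>" "null_homotopic_curve X P \<delta> \<or> (\<exists>\<gamma>\<in>\<Gamma>. isotopic_rel X P \<gamma> \<delta>)" by blast+
qed

lemma curve_degree_injective:
  assumes "inj_on f \<delta>" "f ` \<delta> = \<gamma>" "\<gamma> \<noteq> {}" shows "curve_degree f \<delta> \<gamma> = 1"
proof -
  have one: "card {x \<in> \<delta>. f x = y} = 1" if y: "y \<in> \<gamma>" for y
  proof -
    obtain x where x: "x \<in> \<delta>" "f x = y" using y assms(2) by blast
    then have "{x \<in> \<delta>. f x = y} = {x}" using assms(1) by (auto dest: inj_onD)
    then show ?thesis by simp
  qed
  obtain y where "y \<in> \<gamma>" using assms(3) by blast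
  then show ?thesis unfolding curve_degree_def using one by (intro the_equality) force+
qed

text \<open>This is part (i) of the theorem, for a single curve.\<close>

lemma curve_dichotomy:
  assumes \<gamma>: "\<gamma> \<in> \<Gamma>"
  shows "\<exists>\<gamma>'\<in>pre_components \<gamma>. isotopic_rel X P \<gamma>' \<gamma> \<and>
    (\<forall>\<delta>\<in>pre_components \<gamma> - {\<gamma>'}. \<not> isotopic_rel X P \<delta> \<gamma> \<and> null_homotopic_curve X P \<delta> \<and> curve_degree f \<delta> \<gamma> = 1)"
proof -
  have sub: "\<gamma> \<subseteq> topspace X" using jc[OF \<gamma>] by (simp add: jordan_curve_def)
  obtain \<delta>0 where \<delta>0: "\<delta>0 \<in> pre_components (\<Union>\<Gamma>)" "isotopic_rel X P \<gamma> \<delta>0" using inv[OF \<gamma>] by blast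
  show ?thesis
  proof (intro bexI conjI ballI)
    show "\<delta>0 \<in> pre_components \<gamma>" by (rule essential_label(2)[OF \<gamma> \<delta>0])
    show "isotopic_rel X P \<delta>0 \<gamma>" by (rule isotopic_rel_sym[OF PX sub \<delta>0(2)])
    fix \<delta> assume "\<delta> \<in> pre_components \<gamma> - {\<delta>0}"
    then have d: "\<delta> \<in> pre_components \<gamma>" "\<delta> \<noteq> \<delta>0" by auto
    note o = other_component[OF \<gamma> \<delta>0 d]
    show "null_homotopic_curve X P \<delta>" by (fact o(2))
    show "curve_degree f \<delta> \<gamma> = 1"
      by (rule curve_degree_injective[OF o(3,4) jordan_curve_closedin(3)[OF sphere jc[OF \<gamma>]]])
    have dX: "\<delta> \<subseteq> topspace X" using o(1) by (simp add: jordan_curve_def)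
    show "\<not> isotopic_rel X P \<delta> \<gamma>"
      using null_not_isotopic[OF \<gamma> isotopic_rel_sym[OF PX dX] o(2)] by blast
  qed
qed

end

section \<open>Complements of finite families of Jordan curves\<close>

text \<open>Finitely many disjoint Jordan curves; below this is applied both to a multicurve and to the set of its
preimage curves.\<close>

locale curve_family =
  fixes X :: "'a topology" and \<J> :: "'a set set"
  assumes sph: "topological_sphere X" and fin: "finite \<J>" and jordan: "\<And>J. J \<in> \<J> \<Longrightarrow> jordan_curve X J"
    and disjoint: "\<And>J K. J \<in> \<J> \<Longrightarrow> K \<in> \<J> \<Longrightarrow> J \<noteq> K \<Longrightarrow> J \<inter> K = {}"
begin

lemma closed_Union: "\<K> \<subseteq> \<J> \<Longrightarrow> closedin X (\<Union>\<K>)"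
  using finite_subset[OF _ fin] jordan_curve_closedin(1)[OF sph jordan] by (intro closedin_Union) auto

text \<open>By \<open>joined_off_Union\<close>, points that no single curve separates are not separated by all curves
together.\<close>

lemma same_sides_joined:
  assumes K: "\<K> \<subseteq> \<J>" and zw: "z \<in> topspace X" "w \<in> topspace X"
    and same: "\<And>K. K \<in> \<K> \<Longrightarrow> \<exists>E\<in>complement_components X K. z \<in> E \<and> w \<in> E"
  shows "joined_off X (\<Union>\<K>) z w"
proof (rule joined_off_Union[OF sph finite_subset[OF K fin] _ _ zw])
  fix J assume J: "J \<in> \<K>"
  then have jJ: "jordan_curve X J" using jordan K by blast
  show "closedin X J" by (rule jordan_curve_closedin(1)[OF sph jJ])
  obtain E where E: "E \<in> complement_components X J" "z \<in> E" "w \<in> E" using same[OF J] by blast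
  note e = jordan_side[OF sph jJ E(1)]
  have "E \<subseteq> topspace X - J" using e(4,5) by blast
  then show "joined_off X J z w" using e(2) E unfolding joined_off_def by blast
next
  show "pairwise disjnt \<K>" using disjoint K by (simp add: pairwise_def disjnt_def) blast
qed

context
  fixes S assumes S: "S \<in> complement_components X (\<Union>\<J>)"
begin

lemmas comp = complement_component_props[OF sph closed_Union[OF subset_refl] S]

lemma comp_frontier: "X frontier_of S = X closure_of S - S"
  using comp(1) by (simp add: frontier_of_openin)

lemma comp_in_side:
  assumes J: "J \<in> \<J>"
  obtains E where "E \<in> complement_components X J" "S \<subseteq> E"
proof -
  note jJ = jordan[OF J]
  obtain q where q: "q \<in> topspace X - J" using jordan_curve_proper[OF sph jJ] by blast
  obtain D where D: "D \<in> complement_components X J" using complement_component_ex[OF q] by metis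
  have "S \<inter> J = {}" using comp(4) J by blast
  then show thesis using side_cases[OF sph jJ D comp(2)] D jordan_side(7)[OF sph jJ D] that by blast
qed

lemma closure_in_side:
  assumes "J \<in> \<J>" "E \<in> complement_components X J" "S \<subseteq> E" shows "X closure_of S \<subseteq> E \<union> J"
  using closure_of_mono[OF assms(3), of X] jordan_side(6)[OF sph jordan[OF assms(1)] assms(2)] by simp

lemma other_curve_in_side:
  assumes J: "J \<in> \<J>" and E: "E \<in> complement_components X J" "S \<subseteq> E" and K: "K \<in> \<J>" "K \<noteq> J" "K \<inter> X closure_of S \<noteq> {}"
  shows "K \<subseteq> E"
proof (rule side_absorbs[OF sph jordan[OF J] E(1) jordan_curve_closedin(2)[OF sph jordan[OF K(1)]] disjoint[OF K(1) J K(2)]])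
  show "K \<inter> (E \<union> J) \<noteq> {}" using closure_in_side[OF J E] K(3) by blast
qed

text \<open>Every other curve \<open>K\<close> has \<open>S\<close> and \<open>J\<close> on the same side, as \<open>J\<close> touches \<open>S\<close>. So a point close to \<open>y\<close> on the
side of \<open>J\<close> containing \<open>S\<close> is not separated from \<open>S\<close> by any curve.\<close>

lemma boundary_curve_nbhd:
  assumes J: "J \<in> \<J>" "J \<inter> X frontier_of S \<noteq> {}" and E: "E \<in> complement_components X J" "S \<subseteq> E" and y: "y \<in> J"
  obtains N where "openin X N" "y \<in> N" "N \<inter> E \<subseteq> S"
proof -
  have JS: "J \<inter> X closure_of S \<noteq> {}" using J(2) comp_frontier by blast
  have "\<exists>F. F \<in> complement_components X K \<and> S \<subseteq> F \<and> J \<subseteq> F" if K: "K \<in> \<J> - {J}" for K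
  proof -
    have KJ: "K \<in> \<J>" "J \<noteq> K" using K by auto
    obtain F where F: "F \<in> complement_components X K" "S \<subseteq> F" using comp_in_side[OF KJ(1)] by metis
    then show ?thesis using other_curve_in_side[OF KJ(1) F J(1) KJ(2) JS] by blast
  qed
  then obtain F where F: "\<And>K. K \<in> \<J> - {J} \<Longrightarrow> F K \<in> complement_components X K \<and> S \<subseteq> F K \<and> J \<subseteq> F K"
    by metis
  define N where "N = topspace X \<inter> \<Inter>(F ` (\<J> - {J}))"
  have oF: "openin X (F K)" if "K \<in> \<J> - {J}" for K
    using jordan_side(1)[OF sph jordan, of K "F K"] F[OF that] that by blast
  have "openin X ((\<Inter>K\<in>\<J> - {J}. F K) \<inter> topspace X)" by (rule openin_INT) (use fin oF in auto)
  then have oN: "openin X N" by (simp add: N_def Int_commute)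
  have "J \<subseteq> topspace X" using jordan[OF J(1)] by (simp add: jordan_curve_def)
  then have yN: "y \<in> N" using y F by (auto simp: N_def)
  obtain z where z: "z \<in> S" using comp(3) by blast
  have "N \<inter> E \<subseteq> S"
  proof
    fix w assume w: "w \<in> N \<inter> E"
    have zw: "z \<in> topspace X" "w \<in> topspace X" using z comp(4) w by (auto simp: N_def)
    have "joined_off X (\<Union>\<J>) z w"
    proof (rule same_sides_joined[OF subset_refl zw])
      fix K assume K: "K \<in> \<J>"
      show "\<exists>E\<in>complement_components X K. z \<in> E \<and> w \<in> E"
      proof (cases "K = J")
        case True then show ?thesis using E z w by blast
      next
        case False
        then have "K \<in> \<J> - {J}" using K by blast
        then show ?thesis using F[of K] z w unfolding N_def by blast
      qed
    qed
    then show "w \<in> S" using joined_off_component[OF S z] by blast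
  qed
  then show thesis using that oN yN by blast
qed

lemma boundary_curve_subset:
  assumes J: "J \<in> \<J>" "J \<inter> X frontier_of S \<noteq> {}"
  shows "J \<subseteq> X frontier_of S"
proof
  fix y assume y: "y \<in> J"
  obtain E where E: "E \<in> complement_components X J" "S \<subseteq> E" using comp_in_side[OF J(1)] by metis
  note e = jordan_side[OF sph jordan[OF J(1)] E(1)]
  obtain N where N: "openin X N" "y \<in> N" "N \<inter> E \<subseteq> S" by (rule boundary_curve_nbhd[OF J E y], rule that)
  have "y \<in> X closure_of S"
    unfolding in_closure_of
  proof (intro conjI allI impI)
    show "y \<in> topspace X" using y e(8) by blast
    fix M assume M: "y \<in> M \<and> openin X M"
    then have "openin X (M \<inter> N)" using N(1) by blast
    moreover have "y \<in> X closure_of E" using e(6) y by blast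
    ultimately obtain u where "u \<in> E" "u \<in> M \<inter> N" using M N(2) unfolding in_closure_of by (meson IntI)
    then show "\<exists>u. u \<in> S \<and> u \<in> M" using N(3) by blast
  qed
  moreover have "y \<notin> S" using comp(4) J(1) y by blast
  ultimately show "y \<in> X frontier_of S" using comp_frontier by blast
qed

lemma boundary_curves_eq: "boundary_curves X S = {J \<in> \<J>. J \<subseteq> X frontier_of S}"
proof -
  define \<B> where "\<B> = {J \<in> \<J>. J \<subseteq> X frontier_of S}"
  have un: "X frontier_of S = \<Union>\<B>"
    using comp(5) boundary_curve_subset unfolding \<B>_def by blast
  let ?Y = "subtopology X (\<Union>\<B>)"
  have 1: "J \<in> connected_components_of ?Y" if J: "J \<in> \<B>" for J
  proof (rule clopen_connected_is_component)
    have JJ: "J \<in> \<J>" using J by (simp add: \<B>_def)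
    note c = jordan_curve_closedin[OF sph jordan[OF JJ]]
    show "connectedin ?Y J" using c(2) J by (auto simp: connectedin_subtopology)
    show "J \<noteq> {}" by (fact c)
    show "closedin ?Y J" unfolding closedin_subtopology using c(1) J by (intro exI[of _ J]) auto
    have "closedin X (\<Union>(\<B> - {J}))" by (rule closed_Union) (auto simp: \<B>_def)
    moreover have "J = (topspace X - \<Union>(\<B> - {J})) \<inter> \<Union>\<B>"
    proof
      show "J \<subseteq> (topspace X - \<Union>(\<B> - {J})) \<inter> \<Union>\<B>"
        using J disjoint[OF JJ] closedin_subset[OF c(1)] unfolding \<B>_def by blast
      show "(topspace X - \<Union>(\<B> - {J})) \<inter> \<Union>\<B> \<subseteq> J" by blast
    qed
    ultimately show "openin ?Y J" unfolding openin_subtopology by blast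
  qed
  have 2: "C \<in> \<B>" if C: "C \<in> connected_components_of ?Y" for C
  proof -
    obtain x where x: "x \<in> C" using C nonempty_connected_components_of by blast
    then have "x \<in> topspace ?Y" using C connected_components_of_subset by blast
    then obtain J where J: "J \<in> \<B>" "x \<in> J" by auto
    then have "C = J" using pairwiseD[OF pairwise_disjoint_connected_components_of C 1[OF J(1)]] x by (auto simp: disjnt_def)
    then show ?thesis using J by simp
  qed
  have "boundary_curves X S = \<B>" unfolding boundary_curves_def un using 1 2 by blast
  then show ?thesis unfolding \<B>_def .
qed

lemma frontier_Union: "X frontier_of S = \<Union>(boundary_curves X S)"
  unfolding boundary_curves_eq using comp(5) boundary_curve_subset by blast

lemma boundary_curvesD: "J \<in> boundary_curves X S \<Longrightarrow> J \<in> \<J> \<and> J \<subseteq> X frontier_of S \<and> J \<noteq> {} \<and> J \<subseteq> X closure_of S"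
  unfolding boundary_curves_eq using jordan_curve_closedin(3)[OF sph jordan] comp_frontier by blast

lemma boundary_curves_nonempty:
  assumes "\<J> \<noteq> {}" shows "boundary_curves X S \<noteq> {}"
proof
  assume "boundary_curves X S = {}"
  then have "X frontier_of S = {}" using frontier_Union by simp
  then have "X closure_of S = S" using comp_frontier closure_of_subset[OF openin_subset[OF comp(1)]] by blast
  then have "closedin X S" by (metis closedin_closure_of)
  then have "S = topspace X" using topological_sphere_connected[OF sph] comp(1,3) by (auto simp: connected_space_clopen_in)
  moreover obtain J where J: "J \<in> \<J>" using assms by blast
  moreover have "J \<noteq> {}" "J \<subseteq> topspace X"
    using jordan_curve_closedin(3)[OF sph jordan[OF J]] jordan[OF J] by (auto simp: jordan_curve_def)
  ultimately show False using comp(4) by blast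
qed

text \<open>A point that is not separated from \<open>S\<close> by a boundary curve can be joined to \<open>S\<close> off the boundary of \<open>S\<close>.\<close>

lemma in_comp_if_boundary_sides:
  assumes p: "p \<in> topspace X" and same: "\<And>J. J \<in> boundary_curves X S \<Longrightarrow> \<exists>E\<in>complement_components X J. S \<subseteq> E \<and> p \<in> E"
  shows "p \<in> S"
proof -
  obtain z where z: "z \<in> S" using comp(3) by blast
  have zX: "z \<in> topspace X" using z comp(4) by blast
  have "joined_off X (\<Union>(boundary_curves X S)) z p"
  proof (rule same_sides_joined[OF _ zX p])
    show "boundary_curves X S \<subseteq> \<J>" using boundary_curvesD by blast
    fix J assume "J \<in> boundary_curves X S"
    then show "\<exists>E\<in>complement_components X J. z \<in> E \<and> p \<in> E" using same z by blast
  qed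
  then obtain C where C: "connectedin X C" "C \<inter> X frontier_of S = {}" "z \<in> C" "p \<in> C"
    unfolding joined_off_def frontier_Union by blast
  show ?thesis
  proof (rule ccontr)
    assume "p \<notin> S"
    then have "C \<inter> X frontier_of S \<noteq> {}" using C z by (intro connectedin_Int_frontier_of) blast+
    then show False using C by blast
  qed
qed

text \<open>Two boundary curves of \<open>S\<close> are unnested as seen from \<open>S\<close>.\<close>

lemma opposite_side_subset:
  assumes J: "J \<in> boundary_curves X S" and E: "E \<in> complement_components X J" "S \<subseteq> E"
    and K: "K \<in> boundary_curves X S" and F: "F \<in> complement_components X K" "S \<subseteq> F" and ne: "K \<noteq> J"
  shows "topspace X - (F \<union> K) \<subseteq> E"
proof -
  note j = boundary_curvesD[OF J] and k = boundary_curvesD[OF K]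
  have jJ: "J \<in> \<J>" "K \<in> \<J>" using j k by auto
  have KE: "K \<subseteq> E" by (rule other_curve_in_side[OF jJ(1) E jJ(2) ne]) (use k in blast)
  have JF: "J \<subseteq> F" by (rule other_curve_in_side[OF jJ(2) F jJ(1) ne[symmetric]]) (use j in blast)
  note f' = jordan_side[OF sph jordan[OF jJ(2)] jordan_side(7)[OF sph jordan[OF jJ(2)] F(1)]]
  obtain x where x: "x \<in> K" using k by blast
  then have "x \<in> X closure_of (topspace X - (F \<union> K))" "x \<in> E" using f'(6) KE by auto
  then obtain y where y: "y \<in> topspace X - (F \<union> K)" "y \<in> E"
    using jordan_side(1)[OF sph jordan[OF jJ(1)] E(1)] unfolding in_closure_of by meson
  show ?thesis
    by (rule side_absorbs[OF sph jordan[OF jJ(1)] E(1) f'(2)]) (use JF y in blast)+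
qed

text \<open>The Hausdorff property of small spheres, for a pair containing a boundary curve: \<open>r\<close> and the union of the boundary
curves other than \<open>r\<close> are separated in \<open>X\<close>, and neighbourhoods of these two sets contain every boundary
curve that they meet, so they are open in the quotient.\<close>

lemma small_sphere_separate:
  assumes r: "r \<in> small_sphere_points X S" and c: "c \<in> boundary_curves X S" and ne: "r \<noteq> c"
  obtains \<A> \<B> where "openin (small_sphere X S) \<A>" "openin (small_sphere X S) \<B>" "r \<in> \<A>" "c \<in> \<B>" "\<Union>\<A> \<inter> \<Union>\<B> = {}"
proof -
  note dis = pairwiseD[OF disjoint_small_sphere_points[OF comp(1)]]
  have bp: "boundary_curves X S \<subseteq> small_sphere_points X S" by (auto simp: small_sphere_points_def)
  define R where "R = \<Union>(boundary_curves X S - {r})"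
  have haus: "compact_space X" "Hausdorff_space X" using topological_sphere_compact_Hausdorff[OF sph] by auto
  have SX: "S \<subseteq> topspace X" using comp(4) by blast
  have "closedin X r"
  proof (cases "r \<in> boundary_curves X S")
    case True
    then show ?thesis using boundary_curvesD jordan_curve_closedin(1)[OF sph jordan] by blast
  next
    case False
    then obtain x where "x \<in> S" "r = {x}" using r by (auto simp: small_sphere_points_def)
    then show ?thesis using haus(2) SX by (simp add: closedin_Hausdorff_sing_eq subset_iff)
  qed
  moreover have "closedin X R" unfolding R_def by (rule closed_Union) (use boundary_curvesD in blast)
  moreover have "disjnt r R"
    unfolding R_def using dis[OF r] bp by (auto simp: disjnt_def)
  moreover have "normal_space X" using haus compact_Hausdorff_or_regular_imp_normal_space by blast
  ultimately obtain A B where AB: "openin X A" "openin X B" "r \<subseteq> A" "R \<subseteq> B" "disjnt A B"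
    unfolding normal_space_def by meson
  have dA: "A \<inter> B = {}" using AB(5) by (simp add: disjnt_def)
  define sat where "sat U = {q \<in> small_sphere_points X S. q \<subseteq> U}" for U
  have op: "openin (small_sphere X S) (sat U)" if U: "openin X U" and s: "\<And>J. J \<in> boundary_curves X S \<Longrightarrow> J \<inter> U \<noteq> {} \<Longrightarrow> J \<subseteq> U" for U
  proof -
    have "\<Union>(sat U) = U \<inter> X closure_of S"
    proof
      show "\<Union>(sat U) \<subseteq> U \<inter> X closure_of S"
        using Union_small_sphere_points[OF comp(1)] unfolding sat_def by blast
      show "U \<inter> X closure_of S \<subseteq> \<Union>(sat U)"
      proof
        fix x assume x: "x \<in> U \<inter> X closure_of S"
        then obtain q where q: "q \<in> small_sphere_points X S" "x \<in> q"
          using Union_small_sphere_points[OF comp(1)] by blast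
        have "q \<subseteq> U" using q x s[of q] by (auto simp: small_sphere_points_def)
        then show "x \<in> \<Union>(sat U)" using q unfolding sat_def by blast
      qed
    qed
    then show ?thesis unfolding openin_small_sphere[OF comp(1)]
      using U by (auto simp: sat_def openin_subtopology)
  qed
  have J: "J = r \<or> J \<subseteq> R" if "J \<in> boundary_curves X S" for J using that by (auto simp: R_def)
  show thesis
  proof (rule that)
    show "openin (small_sphere X S) (sat A)" by (rule op[OF AB(1)]) (use J AB(3,4) dA in blast)
    show "openin (small_sphere X S) (sat B)" by (rule op[OF AB(2)]) (use J AB(3,4) dA in blast)
    show "r \<in> sat A" using r AB(3) by (simp add: sat_def)
    have "c \<subseteq> R" using c ne by (auto simp: R_def)
    then show "c \<in> sat B" using c bp AB(4) by (auto simp: sat_def)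
    show "\<Union>(sat A) \<inter> \<Union>(sat B) = {}" using dA by (auto simp: sat_def)
  qed
qed

lemma small_sphere_singleton:
  assumes "q \<in> small_sphere_points X S" "x \<in> q" "x \<in> S" shows "q = {x}"
  using assms boundary_curvesD comp_frontier unfolding small_sphere_points_def by blast

end
end

section \<open>Lifts of complementary components\<close>

lemma openin_small_sphereE:
  assumes "openin X S" "openin (small_sphere X S) \<U>"
  obtains T where "openin X T" "\<Union>\<U> = T \<inter> X closure_of S" "\<U> \<subseteq> small_sphere_points X S"
proof -
  have u: "\<U> \<subseteq> small_sphere_points X S" "openin (subtopology X (X closure_of S)) (\<Union>\<U>)"
    using openin_small_sphere[OF assms(1)] assms(2) by auto
  show thesis using u(2)[unfolded openin_subtopology] by (elim exE conjE) (rule that[OF _ _ u(1)])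
qed

lemma closure_of_meets:
  assumes "x \<in> X closure_of S" "openin X U" "x \<in> U" obtains y where "y \<in> S" "y \<in> U"
  using assms unfolding in_closure_of by blast

lemma essential_isotopic:
  assumes P: "P \<subseteq> topspace X" and \<gamma>: "\<gamma> \<subseteq> topspace X" "\<delta> \<subseteq> topspace X"
    and iso: "isotopic_rel X P \<gamma> \<delta>" and ess: "essential_curve X P \<gamma>"
  shows "essential_curve X P \<delta>"
  unfolding essential_curve_def
proof
  fix U assume U: "U \<in> complement_components X \<delta>"
  obtain W where W: "W \<in> complement_components X \<gamma>" "W \<inter> P = U \<inter> P"
    by (rule isotopic_rel_sides[OF P \<gamma>(2) isotopic_rel_sym[OF P \<gamma>(1) iso] U], rule that)
  then show "\<exists>a\<in>U \<inter> P. \<exists>b\<in>U \<inter> P. a \<noteq> b" using ess unfolding essential_curve_def by metis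
qed

context invariant_multicurve
begin

text \<open>The preimage is compact, and its components are open in it.\<close>

lemma finite_pre_components: "finite (pre_components (\<Union>\<Gamma>))"
proof -
  let ?Y = "subtopology X (preim (\<Union>\<Gamma>))"
  let ?\<D> = "pre_components (\<Union>\<Gamma>)"
  have "closedin X (\<Union>\<Gamma>)" using fin\<Gamma> jordan_curve_closedin(1)[OF sphere jc] by (intro closedin_Union) auto
  then have "compact_space ?Y"
    using closedin_preim cpt closedin_compact_space compact_space_subtopology by blast
  moreover have "openin ?Y \<delta>" if d: "\<delta> \<in> ?\<D>" for \<delta>
    using d openin_pre_component pre_components_Union by blast
  moreover have un: "topspace ?Y \<subseteq> \<Union>?\<D>" unfolding pre_components_def Union_connected_components_of by simp
  ultimately obtain \<F> where F: "finite \<F>" "\<F> \<subseteq> ?\<D>" "topspace ?Y \<subseteq> \<Union>\<F>"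
    unfolding compact_space_alt by meson
  have "?\<D> \<subseteq> \<F>"
  proof
    fix \<delta> assume d: "\<delta> \<in> ?\<D>"
    then obtain x where x: "x \<in> \<delta>" "x \<in> preim (\<Union>\<Gamma>)" using pre_component_connected by blast
    then have "x \<in> topspace ?Y" using preim_sub by auto
    then obtain \<delta>' where "\<delta>' \<in> \<F>" "x \<in> \<delta>'" using F(3) by blast
    then show "\<delta> \<in> \<F>" using pre_component_eq[OF d, of \<delta>'] F(2) x by blast
  qed
  then show ?thesis using F(1) finite_subset by blast
qed

lemma curve_family_\<Gamma>: "curve_family X \<Gamma>"
  using sphere fin\<Gamma> jc disj by unfold_locales

lemma curve_family_preimage: "curve_family X (pre_components (\<Union>\<Gamma>))"
  using sphere finite_pre_components pre_component_cases(1) pre_component_eq by unfold_locales blast+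

lemma Union_pre_components: "\<Union>(pre_components (\<Union>\<Gamma>)) = preim (\<Union>\<Gamma>)"
  unfolding pre_components_def Union_connected_components_of using preim_sub by auto

text \<open>\<open>essential_label\<close> with the side of the preimage curve prescribed.\<close>

lemma essential_side:
  assumes \<gamma>: "\<gamma> \<in> \<Gamma>" and d: "\<delta> \<in> pre_components (\<Union>\<Gamma>)" and iso: "isotopic_rel X P \<gamma> \<delta>" and Y: "Y \<in> complement_components X \<delta>"
  obtains G where "G \<in> complement_components X \<gamma>" "Y \<inter> P = G \<inter> P" "label \<delta> Y G"
proof -
  note J = essential_label(1)[OF \<gamma> d iso] and lab = essential_label(3)[OF \<gamma> d iso]
  obtain q where q: "q \<in> topspace X - \<gamma>" using jordan_curve_proper[OF sphere jc[OF \<gamma>]] by blast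
  obtain D where D: "D \<in> complement_components X \<gamma>" using complement_component_ex[OF q] by metis
  note D' = jordan_side(7)[OF sphere jc[OF \<gamma>] D]
  obtain A where A: "A \<in> complement_components X \<delta>" "A \<inter> P = D \<inter> P" "label \<delta> A D" using lab[OF D] by blast
  obtain B where B: "B \<in> complement_components X \<delta>" "B \<inter> P = (topspace X - (D \<union> \<gamma>)) \<inter> P" "label \<delta> B (topspace X - (D \<union> \<gamma>))"
    using lab[OF D'] by blast
  have "B \<noteq> A" using A(2) B(2) side_marked[OF \<gamma> D] by blast
  then have "B = topspace X - (A \<union> \<delta>)" using jordan_side(9)[OF sphere J A(1) B(1)] by blast
  then have "Y = A \<or> Y = B" using jordan_side(9)[OF sphere J A(1) Y] by blast
  then show thesis using that A B D D' by blast
qed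

text \<open>Here \<open>h\<close> is the end of a collapsing homotopy, and \<open>S'\<close> is the component that it maps into \<open>S\<close>.\<close>

context
  fixes S S' h
  assumes S: "S \<in> complement_components X (\<Union>\<Gamma>)" and S': "S' \<in> complement_components X (preim (\<Union>\<Gamma>))"
    and h: "continuous_map X X h" and hP: "\<And>p. p \<in> P \<Longrightarrow> h p = p"
    and hcl: "h ` (X closure_of S') = X closure_of S" and hS: "h ` S' \<subseteq> S"
    and hb: "\<And>\<delta>. \<delta> \<in> boundary_curves X S' \<Longrightarrow> essential_curve X P \<delta> \<Longrightarrow>
      \<exists>\<gamma>\<in>boundary_curves X S. isotopic_rel X P \<delta> \<gamma> \<and> h ` \<delta> = \<gamma>"
    and hn: "\<And>\<delta>. \<delta> \<in> boundary_curves X S' \<Longrightarrow> \<not> essential_curve X P \<delta> \<Longrightarrow> \<exists>y. h ` \<delta> = {y}"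
    and ne: "\<Gamma> \<noteq> {}"
begin

interpretation G: curve_family X \<Gamma> by (rule curve_family_\<Gamma>)
interpretation D: curve_family X "pre_components (\<Union>\<Gamma>)" by (rule curve_family_preimage)

lemma S'D: "S' \<in> complement_components X (\<Union>(pre_components (\<Union>\<Gamma>)))"
  using S' by (simp add: Union_pre_components)

lemmas compS = G.comp[OF S] and compS' = D.comp[OF S'D]
lemmas bS = G.boundary_curvesD[OF S] and bS' = D.boundary_curvesD[OF S'D]

text \<open>As \<open>h\<close> maps the closure of \<open>S'\<close> onto that of \<open>S\<close> and \<open>S'\<close> into \<open>S\<close>, the curve \<open>\<gamma>\<close> is covered by the images of
the boundary curves of \<open>S'\<close>. Those of inessential curves are points, finitely many, so some essential
curve maps to \<open>\<gamma>\<close>.\<close>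

lemma boundary_curve_lift:
  assumes \<gamma>: "\<gamma> \<in> boundary_curves X S"
  obtains \<beta> where "\<beta> \<in> boundary_curves X S'" "isotopic_rel X P \<gamma> \<beta>" "h ` \<beta> = \<gamma>"
proof -
  let ?B = "boundary_curves X S'"
  have g: "\<gamma> \<in> \<Gamma>" "\<gamma> \<subseteq> X frontier_of S" using bS[OF \<gamma>] by auto
  have finB: "finite ?B" using bS' finite_subset[OF _ finite_pre_components] by blast
  have cl: "X closure_of S' = S' \<union> \<Union>?B"
    using D.frontier_Union[OF S'D] D.comp_frontier[OF S'D] closure_of_subset[OF openin_subset[OF compS'(1)]] by blast
  have gS: "\<gamma> \<inter> S = {}" "\<gamma> \<subseteq> X closure_of S" using g(2) G.comp_frontier[OF S] by blast+
  have sub: "\<gamma> \<subseteq> \<Union>((`) h ` ?B)"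
  proof
    fix y assume y: "y \<in> \<gamma>"
    then have "y \<in> h ` (S' \<union> \<Union>?B)" using gS(2) hcl cl by auto
    moreover have "y \<notin> h ` S'" using gS(1) hS y by blast
    ultimately show "y \<in> \<Union>((`) h ` ?B)" by blast
  qed
  have "\<exists>\<beta>\<in>?B. essential_curve X P \<beta> \<and> h ` \<beta> \<inter> \<gamma> \<noteq> {}"
  proof (rule ccontr)
    assume no: "\<not> ?thesis"
    let ?N = "{\<beta> \<in> ?B. \<not> essential_curve X P \<beta>}"
    have "\<gamma> \<subseteq> \<Union>((`) h ` ?N)"
    proof
      fix y assume y: "y \<in> \<gamma>"
      then obtain \<beta> where b: "\<beta> \<in> ?B" "y \<in> h ` \<beta>" using sub by blast
      then have "h ` \<beta> \<inter> \<gamma> \<noteq> {}" using y by blast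
      then have "\<not> essential_curve X P \<beta>" using no b(1) by meson
      then have "\<beta> \<in> ?N" using b(1) by simp
      then show "y \<in> \<Union>((`) h ` ?N)" using b(2) by (rule_tac UN_I)
    qed
    moreover have "finite (\<Union>((`) h ` ?N))"
    proof (rule finite_Union)
      show "finite ((`) h ` ?N)" using finB by simp
      fix M assume "M \<in> (`) h ` ?N"
      then obtain \<beta> where "\<beta> \<in> ?N" "M = h ` \<beta>" by blast
      then show "finite M" using hn[of \<beta>] by auto
    qed
    ultimately have "finite \<gamma>" by (rule finite_subset)
    then show False using jordan_curve_closedin(4)[OF sphere jc[OF g(1)]] by blast
  qed
  then obtain \<beta> where \<beta>: "\<beta> \<in> ?B" "essential_curve X P \<beta>" "h ` \<beta> \<inter> \<gamma> \<noteq> {}" by blast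
  then obtain \<gamma>0 where \<gamma>0: "\<gamma>0 \<in> boundary_curves X S" "isotopic_rel X P \<beta> \<gamma>0" "h ` \<beta> = \<gamma>0" using hb by blast
  have eq: "\<gamma>0 = \<gamma>" using disj[of \<gamma>0 \<gamma>] bS[OF \<gamma>0(1)] g(1) \<beta>(3) \<gamma>0(3) by blast
  have bX: "\<beta> \<subseteq> topspace X" using pre_component_cases(1) bS'[OF \<beta>(1)] by (auto simp: jordan_curve_def)
  have "isotopic_rel X P \<gamma> \<beta>" using isotopic_rel_sym[OF PX bX \<gamma>0(2)] eq by simp
  then show thesis using that[OF \<beta>(1)] \<gamma>0(3) eq by simp
qed

lemma image_connected: "connectedin X (f ` S')" "f ` S' \<inter> \<Union>\<Gamma> = {}"
  using connectedin_continuous_map_image[OF cont compS'(2)] compS'(4) by (auto simp: preim_def Union_pre_components)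

text \<open>Near the boundary curve \<open>\<beta>\<close> the set \<open>S'\<close> is on the side \<open>Y\<close>, so its image is on the side of \<open>\<gamma>\<close> matched with
\<open>Y\<close>; and the image does not meet \<open>\<gamma>\<close>.\<close>

lemma image_in_side:
  assumes \<gamma>: "\<gamma> \<in> \<Gamma>" and b: "\<beta> \<in> boundary_curves X S'" and iso: "isotopic_rel X P \<gamma> \<beta>"
    and Y: "Y \<in> complement_components X \<beta>" "S' \<subseteq> Y"
  obtains G where "G \<in> complement_components X \<gamma>" "Y \<inter> P = G \<inter> P" "f ` S' \<subseteq> G"
proof -
  have bD: "\<beta> \<in> pre_components (\<Union>\<Gamma>)" and bcl: "\<beta> \<subseteq> X closure_of S'" "\<beta> \<noteq> {}" using bS'[OF b] by auto
  note bg = essential_label(2)[OF \<gamma> bD iso] and J = essential_label(1)[OF \<gamma> bD iso]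
  obtain G where G: "G \<in> complement_components X \<gamma>" "Y \<inter> P = G \<inter> P" "label \<beta> Y G"
    by (rule essential_side[OF \<gamma> bD iso Y(1)], rule that)
  have "label \<beta> (topspace X - (Y \<union> \<beta>)) (topspace X - (G \<union> \<gamma>))"
    by (rule label_opp[OF jc[OF \<gamma>] cP[OF \<gamma>] bg J Y(1) G(1,3)])
  then obtain V where V: "V \<subseteq> topspace X - (Y \<union> \<beta>)"
      "\<forall>x\<in>\<beta>. \<exists>N. openin X N \<and> x \<in> N \<and> N \<inter> preim (topspace X - (G \<union> \<gamma>)) \<subseteq> V"
    unfolding label_def by blast
  obtain x where x: "x \<in> \<beta>" using bcl by blast
  obtain N where N: "openin X N" "x \<in> N" "N \<inter> preim (topspace X - (G \<union> \<gamma>)) \<subseteq> V" using V(2) x by blast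
  have "x \<in> X closure_of S'" using x bcl by blast
  then obtain y where y: "y \<in> S'" "y \<in> N" using N unfolding in_closure_of by blast
  have yX: "y \<in> topspace X" using y compS'(4) by blast
  have fy: "f y \<notin> \<gamma>" "f y \<in> topspace X" using image_connected(2) y \<gamma> f_in[OF yX] by blast+
  have "y \<in> Y" using y Y(2) by blast
  then have "y \<notin> preim (topspace X - (G \<union> \<gamma>))" using N(3) V(1) y by blast
  then have "f y \<in> G" using fy yX by (auto simp: preim_def)
  then have "f ` S' \<subseteq> G"
    using side_absorbs[OF sphere jc[OF \<gamma>] G(1) image_connected(1)] image_connected(2) \<gamma> y by blast
  then show thesis using that G by blast
qed

text \<open>All of \<open>P\<close> is on one side of a null-homotopic curve. This is the side of \<open>S'\<close>, because otherwise \<open>S'\<close> would lie in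
the unmarked side, and with it the far side of \<open>\<beta>\<close>, which contains marked points.\<close>

lemma null_boundary_curve_side:
  assumes J: "J \<in> boundary_curves X S'" "null_homotopic_curve X P J"
    and b: "\<beta> \<in> boundary_curves X S'" "\<gamma> \<in> \<Gamma>" "isotopic_rel X P \<gamma> \<beta>" and p: "p \<in> P"
  shows "\<exists>E\<in>complement_components X J. S' \<subseteq> E \<and> p \<in> E"
proof -
  have JD: "J \<in> pre_components (\<Union>\<Gamma>)" and bD: "\<beta> \<in> pre_components (\<Union>\<Gamma>)" using bS' J b by blast+
  have jJ: "jordan_curve X J" and jb: "jordan_curve X \<beta>" using pre_component_cases(1) JD bD by auto
  obtain E where E: "E \<in> complement_components X J" "S' \<subseteq> E" by (rule D.comp_in_side[OF S'D JD], rule that)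
  obtain Y where Y: "Y \<in> complement_components X \<beta>" "S' \<subseteq> Y" by (rule D.comp_in_side[OF S'D bD], rule that)
  have "\<beta> \<noteq> J" using null_not_isotopic[OF b(2,3)] J(2) by blast
  then have sub: "topspace X - (Y \<union> \<beta>) \<subseteq> E" by (rule D.opposite_side_subset[OF S'D J(1) E b(1) Y])
  obtain H where "H \<in> complement_components X \<gamma>" "(topspace X - (Y \<union> \<beta>)) \<inter> P = H \<inter> P"
    using essential_side[OF b(2) bD b(3) jordan_side(7)[OF sphere jb Y(1)]] by metis
  then have "E \<inter> P \<noteq> {}" using sub side_marked[OF b(2)] by blast
  moreover obtain U where U: "U \<in> complement_components X J" "U \<inter> P = {}" using J(2) by (auto simp: null_homotopic_curve_def)
  ultimately have "U = topspace X - (E \<union> J)" using jordan_side(9)[OF sphere jJ E(1) U(1)] by blast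
  then have "p \<in> E" using U(2) p PX pre_component_P[OF JD] by blast
  then show ?thesis using E by blast
qed

text \<open>Only the essential boundary curves of \<open>S'\<close> can separate a marked point from \<open>S'\<close>.\<close>

lemma marked_point_in_lift:
  assumes p: "p \<in> P" and b: "\<beta>0 \<in> boundary_curves X S'" "\<gamma>0 \<in> \<Gamma>" "isotopic_rel X P \<gamma>0 \<beta>0"
    and side: "\<And>\<gamma> \<beta> Y. \<gamma> \<in> boundary_curves X S \<Longrightarrow> \<beta> \<in> boundary_curves X S' \<Longrightarrow> isotopic_rel X P \<gamma> \<beta> \<Longrightarrow>
      Y \<in> complement_components X \<beta> \<Longrightarrow> S' \<subseteq> Y \<Longrightarrow> p \<in> Y"
  shows "p \<in> S'"
proof (rule D.in_comp_if_boundary_sides[OF S'D])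
  show "p \<in> topspace X" using p PX by blast
  fix J assume J: "J \<in> boundary_curves X S'"
  have JD: "J \<in> pre_components (\<Union>\<Gamma>)" using bS' J by blast
  have JX: "J \<subseteq> topspace X" using pre_component_cases(1)[OF JD] by (simp add: jordan_curve_def)
  show "\<exists>E\<in>complement_components X J. S' \<subseteq> E \<and> p \<in> E"
  proof (cases "essential_curve X P J")
    case True
    then obtain \<gamma> where \<gamma>: "\<gamma> \<in> boundary_curves X S" "isotopic_rel X P J \<gamma>" using hb[OF J] by blast
    then have iso: "isotopic_rel X P \<gamma> J" using isotopic_rel_sym[OF PX JX] by blast
    obtain E where E: "E \<in> complement_components X J" "S' \<subseteq> E" by (rule D.comp_in_side[OF S'D JD], rule that)
    then show ?thesis using side[OF \<gamma>(1) J iso E] by blast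
  next
    case False
    have "null_homotopic_curve X P J"
    proof (rule ccontr)
      assume "\<not> null_homotopic_curve X P J"
      then obtain \<gamma> where \<gamma>: "\<gamma> \<in> \<Gamma>" "isotopic_rel X P \<gamma> J" using pre_component_cases(2)[OF JD] by blast
      have "\<gamma> \<subseteq> topspace X" using jc[OF \<gamma>(1)] by (simp add: jordan_curve_def)
      moreover have "essential_curve X P \<gamma>" using mult \<gamma>(1) by (simp add: multicurve_def)
      ultimately show False using essential_isotopic[OF PX _ JX \<gamma>(2)] False by blast
    qed
    then show ?thesis by (rule null_boundary_curve_side[OF J _ b p])
  qed
qed

text \<open>\<open>S\<close> and \<open>S'\<close> are on corresponding sides of \<open>\<gamma>\<close> and \<open>\<beta>\<close>. Suppose not. If \<open>\<gamma>\<close> is the only boundary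
curve of \<open>S\<close>, then all marked points of \<open>Y\<close> are in \<open>S'\<close>, and they are fixed by \<open>h\<close>, which maps \<open>S'\<close> to \<open>S\<close>. If there is another
boundary curve \<open>\<gamma>2\<close>, let \<open>G2'\<close> be the side of \<open>\<gamma>2\<close> corresponding to the far side of \<open>\<beta>2\<close> from \<open>S'\<close>. This far side
lies in \<open>Y\<close>, so the marked points of \<open>G2'\<close> are in \<open>G\<close>, which is the far side of \<open>\<gamma>\<close> from \<open>S\<close> and so lies in the
side \<open>K2\<close> of \<open>\<gamma>2\<close> that contains \<open>S\<close>. Hence \<open>K2 = G2'\<close>, and \<open>G\<close> and \<open>G2'\<close> have the same marked points, although
\<open>\<gamma>\<close> and \<open>\<gamma>2\<close> are not isotopic.\<close>

lemma comp_in_matching_side: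
  assumes \<gamma>: "\<gamma> \<in> boundary_curves X S" and b: "\<beta> \<in> boundary_curves X S'" and iso: "isotopic_rel X P \<gamma> \<beta>"
    and Y: "Y \<in> complement_components X \<beta>" "S' \<subseteq> Y" and G: "G \<in> complement_components X \<gamma>" "Y \<inter> P = G \<inter> P"
  shows "S \<subseteq> G"
proof (rule ccontr)
  assume nS: "\<not> S \<subseteq> G"
  have g: "\<gamma> \<in> \<Gamma>" using bS[OF \<gamma>] by blast
  have bD: "\<beta> \<in> pre_components (\<Union>\<Gamma>)" using bS' b by blast
  note jg = jc[OF g]
  obtain K where K: "K \<in> complement_components X \<gamma>" "S \<subseteq> K" by (rule G.comp_in_side[OF S g], rule that)
  then have KG: "K = topspace X - (G \<union> \<gamma>)" using jordan_side(9)[OF sphere jg G(1) K(1)] nS by blast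
  have GK: "G = topspace X - (K \<union> \<gamma>)" using jordan_side(10)[OF sphere jg G(1)] KG by simp
  show False
  proof (cases "boundary_curves X S = {\<gamma>}")
    case True
    obtain p where p: "p \<in> G" "p \<in> P" using side_marked[OF g G(1)] by blast
    have "p \<in> S'"
    proof (rule marked_point_in_lift[OF p(2) b g iso])
      fix \<gamma>1 \<beta>1 Y1
      assume a: "\<gamma>1 \<in> boundary_curves X S" "\<beta>1 \<in> boundary_curves X S'" "isotopic_rel X P \<gamma>1 \<beta>1"
        "Y1 \<in> complement_components X \<beta>1" "S' \<subseteq> Y1"
      then have "\<gamma>1 = \<gamma>" using True by blast
      then have "\<beta>1 = \<beta>" using essential_pre_component_unique[OF g _ _ bD iso] a bS' by blast
      then have "Y1 = Y" using complement_components_disjoint[of Y1 X \<beta> Y] a Y compS'(3) by blast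
      then show "p \<in> Y1" using p G(2) by blast
    qed
    then have "h p \<in> S" using hS by blast
    then show False using hP[OF p(2)] p(1) K(2) KG by auto
  next
    case False
    then obtain \<gamma>2 where \<gamma>2: "\<gamma>2 \<in> boundary_curves X S" "\<gamma>2 \<noteq> \<gamma>" using \<gamma> by blast
    have g2: "\<gamma>2 \<in> \<Gamma>" using bS[OF \<gamma>2(1)] by blast
    obtain \<beta>2 where b2: "\<beta>2 \<in> boundary_curves X S'" "isotopic_rel X P \<gamma>2 \<beta>2" using boundary_curve_lift[OF \<gamma>2(1)] by metis
    have b2D: "\<beta>2 \<in> pre_components (\<Union>\<Gamma>)" using bS' b2 by blast
    note jg2 = jc[OF g2]
    have "\<beta>2 \<noteq> \<beta>"
    proof
      assume "\<beta>2 = \<beta>"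
      then have "isotopic_rel X P \<gamma> \<gamma>2"
        using isotopic_rel_trans[OF iso] isotopic_rel_sym[OF PX _ b2(2)] jg2 by (simp add: jordan_curve_def)
      then show False using not_isotopic[OF g g2] \<gamma>2(2) by blast
    qed
    obtain Y2 where Y2: "Y2 \<in> complement_components X \<beta>2" "S' \<subseteq> Y2" by (rule D.comp_in_side[OF S'D b2D], rule that)
    have YY: "topspace X - (Y2 \<union> \<beta>2) \<subseteq> Y" by (rule D.opposite_side_subset[OF S'D b Y b2(1) Y2 \<open>\<beta>2 \<noteq> \<beta>\<close>])
    obtain G2 where G2: "G2 \<in> complement_components X \<gamma>2" "Y2 \<inter> P = G2 \<inter> P"
      using essential_side[OF g2 b2D b2(2) Y2(1)] by metis
    define G2' where "G2' = topspace X - (G2 \<union> \<gamma>2)"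
    have G2'c: "G2' \<in> complement_components X \<gamma>2" unfolding G2'_def by (rule jordan_side(7)[OF sphere jg2 G2(1)])
    have G2'G: "G2' \<inter> P \<subseteq> G"
    proof
      fix p assume p: "p \<in> G2' \<inter> P"
      then have "p \<notin> Y2" using G2(2) by (auto simp: G2'_def)
      then have "p \<in> topspace X - (Y2 \<union> \<beta>2)" using p PX pre_component_P[OF b2D] by blast
      then show "p \<in> G" using YY p G(2) by blast
    qed
    obtain K2 where K2: "K2 \<in> complement_components X \<gamma>2" "S \<subseteq> K2" by (rule G.comp_in_side[OF S g2], rule that)
    have "topspace X - (K \<union> \<gamma>) \<subseteq> K2" by (rule G.opposite_side_subset[OF S \<gamma>2(1) K2 \<gamma> K \<gamma>2(2)[symmetric]])
    then have GK2: "G \<subseteq> K2" using GK by simp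
    have G2'P: "G2' \<inter> P \<noteq> {}" by (rule side_marked[OF g2 G2'c])
    have "K2 \<noteq> G2" using G2'G GK2 G2'P unfolding G2'_def by blast
    then have "K2 = G2'" using jordan_side(9)[OF sphere jg2 G2(1) K2(1)] unfolding G2'_def by blast
    then have "G \<inter> P = G2' \<inter> P" using G2'G GK2 by blast
    then show False using not_parallel[OF g g2 \<gamma>2(2)[symmetric] G(1) G2'c] by blast
  qed
qed

lemma preimage_boundary_curve:
  assumes \<gamma>: "\<gamma> \<in> boundary_curves X S" and b: "\<beta> \<in> boundary_curves X S'" "isotopic_rel X P \<gamma> \<beta>"
  shows "f ` \<beta> \<subseteq> \<gamma>"
proof -
  have "\<beta> \<in> pre_components \<gamma>" using essential_label(2)[of \<gamma> \<beta>] bS[OF \<gamma>] bS'[OF b(1)] b(2) by blast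
  then show ?thesis using pre_component_connected by (auto simp: preim_def)
qed

text \<open>The image of \<open>S'\<close> is a component of the complement of \<open>\<Gamma>\<close>, because \<open>f\<close> is open and closed. Close to a
boundary curve it is on the same side as \<open>S\<close>, by \<open>comp_in_matching_side\<close>, hence it meets \<open>S\<close>.\<close>

lemma image_lift: "f ` S' = S"
proof -
  obtain \<gamma> where \<gamma>: "\<gamma> \<in> boundary_curves X S" using G.boundary_curves_nonempty[OF S ne] by blast
  have g: "\<gamma> \<in> \<Gamma>" "\<gamma> \<inter> X frontier_of S \<noteq> {}" using bS[OF \<gamma>] by blast+
  obtain \<beta> where b: "\<beta> \<in> boundary_curves X S'" "isotopic_rel X P \<gamma> \<beta>" using boundary_curve_lift[OF \<gamma>] by metis
  have bD: "\<beta> \<in> pre_components (\<Union>\<Gamma>)" and bcl: "\<beta> \<subseteq> X closure_of S'" "\<beta> \<noteq> {}" using bS'[OF b(1)] by auto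
  obtain Y where Y: "Y \<in> complement_components X \<beta>" "S' \<subseteq> Y" by (rule D.comp_in_side[OF S'D bD], rule that)
  obtain G where G: "G \<in> complement_components X \<gamma>" "Y \<inter> P = G \<inter> P" "f ` S' \<subseteq> G"
    by (rule image_in_side[OF g(1) b Y], rule that)
  have SG: "S \<subseteq> G" by (rule comp_in_matching_side[OF \<gamma> b Y G(1,2)])
  obtain x where x: "x \<in> \<beta>" using bcl by blast
  then have fx: "f x \<in> \<gamma>" using preimage_boundary_curve[OF \<gamma> b] by blast
  have xcl: "x \<in> X closure_of S'" using x bcl by blast
  obtain N where N: "openin X N" "f x \<in> N" "N \<inter> G \<subseteq> S" by (rule G.boundary_curve_nbhd[OF S g G(1) SG fx], rule that)
  have "openin X (preim N)" by (rule openin_preim[OF N(1)])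
  moreover have "x \<in> preim N" using N(2) xcl closure_of_subset_topspace[of X S'] by (auto simp: preim_def)
  ultimately obtain y where y: "y \<in> S'" "y \<in> preim N" using xcl unfolding in_closure_of by blast
  then have fy: "f y \<in> S" using N(3) G(3) by (auto simp: preim_def)
  have sub: "f ` S' \<subseteq> S"
  proof (rule complement_component_maximal[OF S image_connected(1)])
    show "f ` S' \<subseteq> topspace X - \<Union>\<Gamma>" using image_connected connectedin_subset_topspace by blast
    show "f ` S' \<inter> S \<noteq> {}" using y fy by blast
  qed
  have "S \<subseteq> f ` S'"
  proof (rule ccontr)
    assume "\<not> S \<subseteq> f ` S'"
    then have "S \<inter> X frontier_of (f ` S') \<noteq> {}" using compS(2) y fy by (intro connectedin_Int_frontier_of) blast+
    moreover have o: "openin X (f ` S')" using opn compS'(1) by (simp add: open_map_def)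
    ultimately obtain z where z: "z \<in> S" "z \<in> X closure_of (f ` S')" "z \<notin> f ` S'" by (auto simp: frontier_of_openin)
    have "compactin X (X closure_of S')" by (simp add: closedin_compact_space cpt)
    then have "closedin X (f ` (X closure_of S'))" using image_compactin[OF _ cont] haus compactin_imp_closedin by blast
    moreover have "f ` S' \<subseteq> f ` (X closure_of S')" using closure_of_subset[OF openin_subset[OF compS'(1)]] by blast
    ultimately have "X closure_of (f ` S') \<subseteq> f ` (X closure_of S')" by (rule closure_of_minimal[rotated])
    then obtain u where u: "u \<in> X closure_of S'" "z = f u" using z(2) by blast
    have "f u \<notin> \<Union>\<Gamma>" using z(1) u(2) compS(4) by blast
    then have "u \<notin> preim (\<Union>\<Gamma>)" by (simp add: preim_def)
    moreover have "X frontier_of S' \<subseteq> preim (\<Union>\<Gamma>)" using compS'(5) by (simp add: Union_pre_components)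
    ultimately have "u \<in> S'" using u(1) D.comp_frontier[OF S'D] by blast
    then show False using z(3) u(2) by blast
  qed
  then show ?thesis using sub by blast
qed

text \<open>For each essential boundary curve of \<open>S'\<close>, \<open>p\<close> is on the side of \<open>S'\<close> by \<open>comp_in_matching_side\<close>, so
\<open>marked_point_in_lift\<close> applies.\<close>

lemma marked_point_lift:
  assumes p: "p \<in> S" "p \<in> P"
  shows "p \<in> S'"
proof -
  obtain \<gamma>0 where \<gamma>0: "\<gamma>0 \<in> boundary_curves X S" using G.boundary_curves_nonempty[OF S ne] by blast
  obtain \<beta>0 where b0: "\<beta>0 \<in> boundary_curves X S'" "isotopic_rel X P \<gamma>0 \<beta>0" using boundary_curve_lift[OF \<gamma>0] by metis
  have g0: "\<gamma>0 \<in> \<Gamma>" using bS[OF \<gamma>0] by blast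
  show ?thesis
  proof (rule marked_point_in_lift[OF p(2) b0(1) g0 b0(2)])
    fix \<gamma> \<beta> Y assume a: "\<gamma> \<in> boundary_curves X S" "\<beta> \<in> boundary_curves X S'" "isotopic_rel X P \<gamma> \<beta>"
      and Y: "Y \<in> complement_components X \<beta>" "S' \<subseteq> Y"
    have g: "\<gamma> \<in> \<Gamma>" using bS[OF a(1)] by blast
    obtain G where G: "G \<in> complement_components X \<gamma>" "Y \<inter> P = G \<inter> P" 
      using image_in_side[OF g a(2,3) Y] by metis
    have "S \<subseteq> G" by (rule comp_in_matching_side[OF a Y G])
    then show "p \<in> Y" using p G(2) by blast
  qed
qed

text \<open>The value is determined by continuity: points of \<open>S'\<close> close to \<open>\<beta>\<close> are mapped by \<open>h\<close> to points close to
\<open>\<gamma>\<close>, and \<open>i\<close> maps these back.\<close>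

lemma small_sphere_map_boundary:
  assumes i: "continuous_map (small_sphere X S) (small_sphere X S') i" and ih: "\<And>x. x \<in> S' \<Longrightarrow> i {h x} = {x}"
    and \<gamma>: "\<gamma> \<in> boundary_curves X S" and b: "\<beta> \<in> boundary_curves X S'" "h ` \<beta> = \<gamma>"
  shows "i \<gamma> = \<beta>"
proof (rule ccontr)
  assume ne: "i \<gamma> \<noteq> \<beta>"
  note tS = topspace_small_sphere[OF compS(1)] and tS' = topspace_small_sphere[OF compS'(1)]
  have gp: "\<gamma> \<in> topspace (small_sphere X S)" using \<gamma> tS by (simp add: small_sphere_points_def)
  then have "i \<gamma> \<in> small_sphere_points X S'" using continuous_map_image_subset_topspace[OF i] tS' by blast
  then obtain \<A> \<B> where AB: "openin (small_sphere X S') \<A>" "openin (small_sphere X S') \<B>" "i \<gamma> \<in> \<A>" "\<beta> \<in> \<B>" "\<Union>\<A> \<inter> \<Union>\<B> = {}"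
    using D.small_sphere_separate[OF S'D _ b(1) ne] by metis
  define \<U> where "\<U> = {q \<in> topspace (small_sphere X S). i q \<in> \<A>}"
  have oU: "openin (small_sphere X S) \<U>" unfolding \<U>_def by (rule openin_continuous_map_preimage[OF i AB(1)])
  obtain T where T: "openin X T" "\<Union>\<U> = T \<inter> X closure_of S" and Us: "\<U> \<subseteq> small_sphere_points X S"
    by (rule openin_small_sphereE[OF compS(1) oU], rule that)
  obtain T' where T': "openin X T'" "\<Union>\<B> = T' \<inter> X closure_of S'"
    by (rule openin_small_sphereE[OF compS'(1) AB(2)], rule that)
  obtain x where x: "x \<in> \<beta>" using bS'[OF b(1)] by blast
  have xcl: "x \<in> X closure_of S'" using bS'[OF b(1)] x by blast
  have xX: "x \<in> topspace X" using xcl closure_of_subset_topspace by fastforce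
  have "\<gamma> \<in> \<U>" using gp AB(3) by (simp add: \<U>_def)
  then have "h x \<in> \<Union>\<U>" using x b(2) by blast
  then have "h x \<in> T" unfolding T(2) by simp
  moreover have "x \<in> \<Union>\<B>" using x AB(4) by blast
  then have "x \<in> T'" unfolding T'(2) by simp
  ultimately have xU: "x \<in> {u \<in> topspace X. h u \<in> T} \<inter> T'" using xX by simp
  have oT: "openin X ({u \<in> topspace X. h u \<in> T} \<inter> T')"
    by (rule openin_Int[OF openin_continuous_map_preimage[OF h T(1)] T'(1)])
  obtain y where "y \<in> S'" "y \<in> {u \<in> topspace X. h u \<in> T} \<inter> T'" by (rule closure_of_meets[OF xcl oT xU], rule that)
  then have y: "y \<in> S'" "h y \<in> T" "y \<in> T'" by simp_all
  have hy: "h y \<in> S" using y hS by blast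
  then have "h y \<in> X closure_of S" using closure_of_subset[OF openin_subset[OF compS(1)]] by blast
  then have "h y \<in> \<Union>\<U>" unfolding T(2) using y(2) by simp
  then obtain q where q: "q \<in> \<U>" "h y \<in> q" by blast
  have "q = {h y}" by (rule G.small_sphere_singleton[OF S _ q(2) hy]) (use Us q(1) in blast)
  then have "i {h y} \<in> \<A>" using q(1) by (simp add: \<U>_def)
  then have "{y} \<in> \<A>" using ih[OF y(1)] by simp
  moreover have "y \<in> X closure_of S'" using y closure_of_subset[OF openin_subset[OF compS'(1)]] by blast
  then have "y \<in> \<Union>\<B>" unfolding T'(2) using y(3) by simp
  ultimately show False using AB(5) by blast
qed

text \<open>Again by continuity: points close to \<open>\<beta>\<close> are mapped by \<open>f\<close> to points close to \<open>\<gamma>\<close>.\<close>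

lemma small_sphere_image_boundary:
  assumes F: "continuous_map (small_sphere X S') (small_sphere X S) F" and Ff: "\<And>x. x \<in> S' \<Longrightarrow> F {x} = {f x}"
    and \<gamma>: "\<gamma> \<in> boundary_curves X S" and b: "\<beta> \<in> boundary_curves X S'" "isotopic_rel X P \<gamma> \<beta>"
  shows "F \<beta> = \<gamma>"
proof (rule ccontr)
  assume ne: "F \<beta> \<noteq> \<gamma>"
  note tS = topspace_small_sphere[OF compS(1)] and tS' = topspace_small_sphere[OF compS'(1)]
  have bp: "\<beta> \<in> topspace (small_sphere X S')" using b tS' by (simp add: small_sphere_points_def)
  then have "F \<beta> \<in> small_sphere_points X S" using continuous_map_image_subset_topspace[OF F] tS by blast
  then obtain \<A> \<B> where AB: "openin (small_sphere X S) \<A>" "openin (small_sphere X S) \<B>" "F \<beta> \<in> \<A>" "\<gamma> \<in> \<B>" "\<Union>\<A> \<inter> \<Union>\<B> = {}"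
    using G.small_sphere_separate[OF S _ \<gamma> ne] by metis
  define \<U> where "\<U> = {q \<in> topspace (small_sphere X S'). F q \<in> \<A>}"
  have oU: "openin (small_sphere X S') \<U>" unfolding \<U>_def by (rule openin_continuous_map_preimage[OF F AB(1)])
  obtain T where T: "openin X T" "\<Union>\<U> = T \<inter> X closure_of S'" and Us: "\<U> \<subseteq> small_sphere_points X S'"
    by (rule openin_small_sphereE[OF compS'(1) oU], rule that)
  obtain T' where T': "openin X T'" "\<Union>\<B> = T' \<inter> X closure_of S"
    by (rule openin_small_sphereE[OF compS(1) AB(2)], rule that)
  obtain x where x: "x \<in> \<beta>" using bS'[OF b(1)] by blast
  have xcl: "x \<in> X closure_of S'" using bS'[OF b(1)] x by blast
  have xX: "x \<in> topspace X" using xcl closure_of_subset_topspace by fastforce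
  have "\<beta> \<in> \<U>" using bp AB(3) by (simp add: \<U>_def)
  then have "x \<in> \<Union>\<U>" using x by blast
  then have "x \<in> T" unfolding T(2) by simp
  have "f x \<in> \<gamma>" using preimage_boundary_curve[OF \<gamma> b] x by blast
  then have "f x \<in> \<Union>\<B>" using AB(4) by blast
  then have "f x \<in> T'" unfolding T'(2) by simp
  then have xU: "x \<in> preim T' \<inter> T" using \<open>x \<in> T\<close> xX by (simp add: preim_def)
  have oT: "openin X (preim T' \<inter> T)" by (rule openin_Int[OF openin_preim[OF T'(1)] T(1)])
  obtain y where "y \<in> S'" "y \<in> preim T' \<inter> T" by (rule closure_of_meets[OF xcl oT xU], rule that)
  then have y: "y \<in> S'" "y \<in> preim T'" "y \<in> T" by simp_all
  have "y \<in> X closure_of S'" using y closure_of_subset[OF openin_subset[OF compS'(1)]] by blast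
  then have "y \<in> \<Union>\<U>" unfolding T(2) using y(3) by simp
  then obtain q where q: "q \<in> \<U>" "y \<in> q" by blast
  have "q = {y}" by (rule D.small_sphere_singleton[OF S'D _ q(2) y(1)]) (use Us q(1) in blast)
  then have "F {y} \<in> \<A>" using q(1) by (simp add: \<U>_def)
  then have "{f y} \<in> \<A>" using Ff[OF y(1)] by simp
  moreover have "f y \<in> S" using image_lift y(1) by blast
  then have "f y \<in> X closure_of S" using closure_of_subset[OF openin_subset[OF compS(1)]] by blast
  then have "f y \<in> \<Union>\<B>" unfolding T'(2) using y(2) by (simp add: preim_def)
  ultimately show False using AB(5) by blast
qed

text \<open>Part (ii) of the theorem for one small sphere, where \<open>F\<close> is the extension of \<open>f\<close> and \<open>i\<close> the one of the
inverse of \<open>h\<close>.\<close>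

lemma small_sphere_fixed:
  assumes i: "homeomorphic_map (small_sphere X S) (small_sphere X S') i" and ih: "\<And>x. x \<in> S' \<Longrightarrow> i {h x} = {x}"
    and F: "continuous_map (small_sphere X S') (small_sphere X S) F" and Ff: "\<And>x. x \<in> S' \<Longrightarrow> F {x} = {f x}"
  shows "(\<lambda>q. F (i q)) ` topspace (small_sphere X S) = topspace (small_sphere X S)"
    "q \<in> marked_points X P S \<Longrightarrow> F (i q) = q"
proof -
  note tS = topspace_small_sphere[OF compS(1)] and tS' = topspace_small_sphere[OF compS'(1)]
  have ci: "continuous_map (small_sphere X S) (small_sphere X S') i" using i by (rule homeomorphic_imp_continuous_map)
  have fix_b: "F (i \<gamma>) = \<gamma> \<and> (\<exists>\<beta>\<in>boundary_curves X S'. F \<beta> = \<gamma>)" if \<gamma>: "\<gamma> \<in> boundary_curves X S" for \<gamma>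
  proof -
    obtain \<beta> where b: "\<beta> \<in> boundary_curves X S'" "isotopic_rel X P \<gamma> \<beta>" "h ` \<beta> = \<gamma>" by (rule boundary_curve_lift[OF \<gamma>], rule that)
    show ?thesis
      using small_sphere_map_boundary[OF ci ih \<gamma> b(1,3)] small_sphere_image_boundary[OF F Ff \<gamma> b(1,2)] b(1) by auto
  qed
  have onto': "F ` topspace (small_sphere X S') = topspace (small_sphere X S)"
  proof
    show "F ` topspace (small_sphere X S') \<subseteq> topspace (small_sphere X S)"
      by (rule continuous_map_image_subset_topspace[OF F])
    show "topspace (small_sphere X S) \<subseteq> F ` topspace (small_sphere X S')"
    proof
      fix q assume "q \<in> topspace (small_sphere X S)"
      then consider y where "y \<in> S" "q = {y}" | "q \<in> boundary_curves X S" unfolding tS small_sphere_points_def by blast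
      then show "q \<in> F ` topspace (small_sphere X S')"
      proof cases
        case 1
        then obtain x where x: "x \<in> S'" "y = f x" using image_lift by blast
        then have "q = F {x}" using Ff 1 by simp
        moreover have "{x} \<in> topspace (small_sphere X S')" using x unfolding tS' small_sphere_points_def by blast
        ultimately show ?thesis by blast
      next
        case 2
        then obtain \<beta> where "\<beta> \<in> boundary_curves X S'" "F \<beta> = q" using fix_b by blast
        then show ?thesis unfolding tS' small_sphere_points_def by blast
      qed
    qed
  qed
  have "i ` topspace (small_sphere X S) = topspace (small_sphere X S')" using i by (rule homeomorphic_imp_surjective_map)
  then show "(\<lambda>q. F (i q)) ` topspace (small_sphere X S) = topspace (small_sphere X S)"
    using onto' by (metis image_image)
  assume "q \<in> marked_points X P S"
  then consider p where "p \<in> S" "p \<in> P" "q = {p}" | "q \<in> boundary_curves X S" unfolding marked_points_def by blast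
  then show "F (i q) = q"
  proof cases
    case 1
    then have p: "p \<in> S'" using marked_point_lift by blast
    then have "i {p} = {p}" using ih[OF p] hP[OF 1(2)] by simp
    then show ?thesis using Ff[OF p] fixP[OF 1(2)] 1(3) by simp
  next
    case 2 then show ?thesis using fix_b by blast
  qed
qed

end
end

section \<open>The map on small spheres\<close>

context fixed_branch_map
begin
lemma preimage_curves_eq: "preimage_curves X f \<Delta> = pre_components (\<Union>\<Delta>)"
  by (simp add: preimage_curves_def pre_components_def preim_def)
end

context invariant_multicurve
begin

lemma map_on_small_spheres_fixed:
  assumes F: "map_on_small_spheres X P f \<Gamma> F" and ne: "\<Gamma> \<noteq> {}" and S: "S \<in> complement_components X (\<Union>\<Gamma>)"
  shows "F ` small_sphere_in X S = small_sphere_in X S" "\<And>q. q \<in> marked_points X P S \<Longrightarrow> F (S, q) = (S, q)"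
proof -
  obtain lift H where CH: "collapsing_homotopy X P f \<Gamma> lift H"
    and all: "\<forall>S\<in>complement_components X (\<Union>\<Gamma>).
          let S' = lift S in
          \<exists>i f_star. homeomorphic_map (small_sphere X S) (small_sphere X S') i \<and>
                 (\<forall>x\<in>S'. i {H (x, 1)} = {x}) \<and>
                 continuous_map (small_sphere X S') (small_sphere X (f ` S')) f_star \<and>
                 (\<forall>x\<in>S'. f_star {x} = {f x}) \<and>
                 (\<forall>q\<in>topspace (small_sphere X S). F (S, q) = (f ` S', f_star (i q)))"
    using F unfolding map_on_small_spheres_def by (elim exE conjE) (rule that)
  define S' where "S' = lift S"
  define h where "h = (\<lambda>x. H (x, 1))"
  obtain i f_star where i: "homeomorphic_map (small_sphere X S) (small_sphere X S') i" "\<forall>x\<in>S'. i {H (x, 1)} = {x}"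
    and fs: "continuous_map (small_sphere X S') (small_sphere X (f ` S')) f_star" "\<forall>x\<in>S'. f_star {x} = {f x}"
    and FS: "\<forall>q\<in>topspace (small_sphere X S). F (S, q) = (f ` S', f_star (i q))"
    using bspec[OF all S] unfolding Let_def S'_def[symmetric] by (elim exE conjE) (rule that)
  have cH: "continuous_map (prod_topology X (top_of_set {0..1})) X H" and HP: "\<forall>p\<in>P. \<forall>t\<in>{0..1}. H (p, t) = p"
    by (fact conjunct1[OF CH[unfolded collapsing_homotopy_def]],
        fact conjunct1[OF conjunct2[OF CH[unfolded collapsing_homotopy_def]]])
  have C: "S' \<in> complement_components X (\<Union>(preimage_curves X f \<Gamma>)) \<and>
        homotopic_subsets (subtopology X (topspace X - P)) (S' - P) (S - P) \<and>
        h ` (X closure_of S') = X closure_of S \<and> h ` S' \<subseteq> S \<and>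
        homeomorphic_map (subtopology X S') (subtopology X (h ` S')) h \<and>
        (\<forall>\<delta>\<in>boundary_curves X S'.
           if essential_curve X P \<delta>
           then \<exists>\<gamma>\<in>boundary_curves X S. isotopic_rel X P \<delta> \<gamma> \<and>
                  homeomorphic_map (subtopology X \<delta>) (subtopology X \<gamma>) h
           else \<exists>y. h ` \<delta> = {y})"
    using bspec[OF conjunct2[OF conjunct2[OF conjunct2[OF conjunct2[OF CH[unfolded collapsing_homotopy_def]]]]] S]
    unfolding Let_def S'_def h_def .
  have S'c: "S' \<in> complement_components X (preim (\<Union>\<Gamma>))"
    using conjunct1[OF C] by (simp add: preimage_curves_eq Union_pre_components)
  have ch: "continuous_map X X h"
  proof -
    have "continuous_map X (prod_topology X (top_of_set {0..1})) (\<lambda>x. (x, 1::real))"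
      by (intro continuous_map_pairedI) auto
    then show ?thesis using continuous_map_compose[OF _ cH] by (simp add: h_def o_def)
  qed
  have hP: "h p = p" if "p \<in> P" for p using HP that by (simp add: h_def)
  have hcl: "h ` (X closure_of S') = X closure_of S" and hS: "h ` S' \<subseteq> S" using C by simp_all
  have Cb: "\<forall>\<delta>\<in>boundary_curves X S'.
           if essential_curve X P \<delta>
           then \<exists>\<gamma>\<in>boundary_curves X S. isotopic_rel X P \<delta> \<gamma> \<and>
                  homeomorphic_map (subtopology X \<delta>) (subtopology X \<gamma>) h
           else \<exists>y. h ` \<delta> = {y}" using C by (elim conjE)
  have cb: "\<delta> \<subseteq> topspace X" if "\<delta> \<in> boundary_curves X T" for \<delta> T
    using connected_components_of_subset[OF that[unfolded boundary_curves_def]] by simp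
  have hb: "\<exists>\<gamma>\<in>boundary_curves X S. isotopic_rel X P \<delta> \<gamma> \<and> h ` \<delta> = \<gamma>"
    if d: "\<delta> \<in> boundary_curves X S'" "essential_curve X P \<delta>" for \<delta>
  proof -
    obtain \<gamma> where \<gamma>: "\<gamma> \<in> boundary_curves X S" "isotopic_rel X P \<delta> \<gamma>"
      and hm: "homeomorphic_map (subtopology X \<delta>) (subtopology X \<gamma>) h" using bspec[OF Cb d(1)] d(2) by auto
    have "h ` \<delta> = \<gamma>" using homeomorphic_imp_surjective_map[OF hm] cb[OF d(1)] cb[OF \<gamma>(1)] by (simp add: Int_absorb1)
    then show ?thesis using \<gamma> by blast
  qed
  have hn: "\<exists>y. h ` \<delta> = {y}" if "\<delta> \<in> boundary_curves X S'" "\<not> essential_curve X P \<delta>" for \<delta>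
    using bspec[OF Cb that(1)] that(2) by simp
  have ih: "i {h x} = {x}" if "x \<in> S'" for x using i(2) that by (simp add: h_def)
  have fS: "f ` S' = S" by (rule image_lift[OF S S'c ch hP hcl hS hb hn ne])
  have cf: "continuous_map (small_sphere X S') (small_sphere X S) f_star" using fs(1) fS by simp
  have ff: "f_star {x} = {f x}" if "x \<in> S'" for x using fs(2) that by blast
  have fixed: "(\<lambda>q. f_star (i q)) ` topspace (small_sphere X S) = topspace (small_sphere X S)"
    by (rule small_sphere_fixed(1)[OF S S'c ch hP hcl hS hb hn ne i(1) ih cf ff])
  have marked: "f_star (i q) = q" if "q \<in> marked_points X P S" for q
    by (rule small_sphere_fixed(2)[OF S S'c ch hP hcl hS hb hn ne i(1) ih cf ff that])
  have "F ` small_sphere_in X S = Pair S ` (\<lambda>q. f_star (i q)) ` topspace (small_sphere X S)"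
    unfolding small_sphere_in_def image_image using FS fS by (intro image_cong) auto
  then show "F ` small_sphere_in X S = small_sphere_in X S" unfolding fixed small_sphere_in_def .
  fix q assume q: "q \<in> marked_points X P S"
  have "openin X S" by (rule curve_family.comp(1)[OF curve_family_\<Gamma> S])
  then have "q \<in> topspace (small_sphere X S)"
    using q by (auto simp: topspace_small_sphere small_sphere_points_def marked_points_def)
  then show "F (S, q) = (S, q)" using FS fS marked[OF q] by simp
qed

end

theorem theorem3p28:
  fixes X :: "'a topology" and \<A> :: "'a chart set" and f :: "'a \<Rightarrow> 'a" and \<Gamma> :: "'a set set"
  assumes "oriented_sphere X \<A>"
    and "critically_fixed_Thurston_map X \<A> f"
    and "multicurve X (postcritical_set X \<A> f) \<Gamma>"
    and "completely_invariant X (postcritical_set X \<A> f) f \<Gamma>"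
    and "\<Gamma> \<noteq> {}"
  shows "(\<forall>\<gamma>\<in>\<Gamma>. \<exists>\<gamma>'\<in>preimage_curves X f {\<gamma>}.
            isotopic_rel X (critical_points X \<A> f) \<gamma>' \<gamma> \<and>
            (\<forall>\<delta>'\<in>preimage_curves X f {\<gamma>} - {\<gamma>'}.
               \<not> isotopic_rel X (critical_points X \<A> f) \<delta>' \<gamma> \<and>
               null_homotopic_curve X (postcritical_set X \<A> f) \<delta>' \<and>
               curve_degree f \<delta>' \<gamma> = 1)) \<and>
         (\<forall>F. map_on_small_spheres X (postcritical_set X \<A> f) f \<Gamma> F \<longrightarrow>
            (\<forall>S\<in>complement_components X (\<Union>\<Gamma>).
               F ` small_sphere_in X S = small_sphere_in X S \<and>
               (\<forall>q\<in>marked_points X (postcritical_set X \<A> f) S. F (S, q) = (S, q))))"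
proof -
  define P where "P = critical_points X \<A> f"
  have sph: "topological_sphere X" using assms(1) by (simp add: oriented_sphere_def topological_sphere_def)
  have bc: "branched_covering X \<A> f" and fixP: "\<forall>c\<in>critical_points X \<A> f. f c = c"
    using assms(2) by (auto simp: critically_fixed_Thurston_map_def)
  have PP: "postcritical_set X \<A> f = P" unfolding P_def by (rule postcritical_eq_critical[OF fixP])
  interpret fixed_branch_map X f P
  proof
    show "topological_sphere X" by (fact sph)
    show "continuous_map X X f" "f ` topspace X = topspace X" using bc by (auto simp: branched_covering_def)
    show "open_map X X f" by (rule branched_covering_open_map[OF bc])
    show "P \<subseteq> topspace X" by (auto simp: P_def critical_points_def)
    show "f p = p" if "p \<in> P" for p using that fixP by (simp add: P_def)
    show "\<exists>U. openin X U \<and> x \<in> U \<and> inj_on f U" if "x \<in> topspace X" "x \<notin> P" for x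
      using noncritical_locally_injective[OF sph bc that[unfolded P_def]] by metis
  qed
  interpret invariant_multicurve X f P \<Gamma>
  proof
    show "finite P" unfolding P_def by (rule critical_points_finite[OF sph bc])
    show "multicurve X P \<Gamma>" using assms(3) by (simp add: PP)
    show "\<exists>\<delta>\<in>pre_components (\<Union>\<Gamma>). isotopic_rel X P \<gamma> \<delta>" if "\<gamma> \<in> \<Gamma>" for \<gamma>
      using assms(4) that unfolding PP completely_invariant_def preimage_curves_eq by blast
  qed
  show ?thesis
    unfolding PP P_def[symmetric] preimage_curves_eq
  proof (intro conjI ballI allI impI)
    fix \<gamma> assume "\<gamma> \<in> \<Gamma>"
    then show "\<exists>\<gamma>'\<in>pre_components (\<Union>{\<gamma>}). isotopic_rel X P \<gamma>' \<gamma> \<and>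
        (\<forall>\<delta>'\<in>pre_components (\<Union>{\<gamma>}) - {\<gamma>'}. \<not> isotopic_rel X P \<delta>' \<gamma> \<and>
           null_homotopic_curve X P \<delta>' \<and> curve_degree f \<delta>' \<gamma> = 1)"
      using curve_dichotomy by simp
  next
    fix F S assume "map_on_small_spheres X P f \<Gamma> F" "S \<in> complement_components X (\<Union>\<Gamma>)"
    note fixed = map_on_small_spheres_fixed[OF this(1) assms(5) this(2)]
    show "F ` small_sphere_in X S = small_sphere_in X S" by (fact fixed(1))
    show "F (S, q) = (S, q)" if "q \<in> marked_points X P S" for q using that by (rule fixed(2))
  qed
qed

end
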